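(* Let $\widetilde M^2(4\epsilon)$ be a complete and simply connected complex space form of complex dimension $2$ and constant holomorphic sectional curvature $4\epsilon$ ($\epsilon\in\mathbb R$), and let $M$ be a Hamiltonian stationary Lagrangian (immersed) surface in $\widetilde M^2(4\epsilon)$ with nowhere-zero mean curvature vector $H$. Suppose that the Gaussian curvature $K$ of $M$ is constant and that the length of $\operatorname{grad}|H|$ is a positive constant. Then $K=\epsilon=0$ (so that the ambient space is $\mathbb C^2$). Moreover, the immersion is locally congruent to an open subset of the surface parametrized by $$F_\kappa(x,y)=\left(\int_0^x e^{i\kappa t^2}\,dt,\ \int_0^y e^{-i\kappa t^2}\,dt\right)\in\mathbb C^2,\qquad (x,y)\in\mathbb R^2\setminus\{(0,0)\},$$ where $\kappa=|\operatorname{grad}|H||$. Conversely, for every real $\kappa>0$, the map $F_\kappa:\mathbb R^2\setminus\{(0,0)\}\to\mathbb C^2$ satisfies all the assumptions above: it is a Hamiltonian stationary Lagrangian immersion into $\mathbb C^2$ with nowhere-zero mean curvature vector $H$, its Gaussian curvature is constant, and the length of $\operatorname{grad}|H|$ is a positive constant.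
   Context: Let $\widetilde M^n$ be a Kähler manifold of complex dimension $n$ with complex structure $J$ and Kähler metric $\langle\cdot,\cdot\rangle$. An $n$-dimensional (immersed) submanifold $M$ is Lagrangian if $\langle X,JY\rangle=0$ for all tangent vector fields $X,Y$ on $M$. Let $g$ be the induced metric on $M$; gradients, divergences and lengths of tangent fields on $M$ are taken with respect to $g$. With $\nabla,\widetilde\nabla$ the Levi-Civita connections of $M$ and $\widetilde M^n$, the second fundamental form is $h(X,Y)=\widetilde\nabla_XY-\nabla_XY$, and the mean curvature vector field is $H=\frac1n\operatorname{tr}_g h$ (here $n=2$); the function $|H|$ is its length. A normal vector field $\xi$ on a Lagrangian submanifold $M$ is a Hamiltonian variation vector field if $\xi=J\operatorname{grad}f$ for some compactly supported smooth function $f$ on $M$. A Lagrangian submanifold is Hamiltonian stationary if the first variation of volume vanishes for every Hamiltonian variation; by a known result of Oh this is equivalent to $\operatorname{div}(JH)=0$ on $M$ (note that $JH$ is tangent to $M$). The complex space form $\widetilde M^2(4\epsilon)$ is $\mathbb C^2$ with its standard flat Kähler metric and $J$ equal to multiplication by $i$ when $\epsilon=0$; otherwise it is complex projective plane ($\epsilon>0$) or complex hyperbolic plane ($\epsilon<0$), with the metric of constant holomorphic sectional curvature $4\epsilon$. "Locally congruent" means: every point of $M$ has a neighborhood which, in suitable local coordinates $(x,y)$ taking values in an open subset of $\mathbb R^2\setminus\{(0,0)\}$, has immersion equal to $F_\kappa(x,y)$ after composing with a holomorphic isometry of $\mathbb C^2$ (a map $Z\mapsto WZ+Z_0$ with $W$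 unitary and $Z_0\in\mathbb C^2$). *)

theory Defs
  imports "HOL-Analysis.Analysis"
begin

section \<open>Smooth maps and surfaces\<close>

text \<open>\<open>Ck_on k f S\<close>: on the open set \<open>S\<close> of a finite-dimensional space, \<open>f\<close> is of class
  \<open>C\<^sup>k\<close>; the derivative is handled through all its directional values.\<close>

primrec Ck_on :: "nat \<Rightarrow> ('a::real_normed_vector \<Rightarrow> 'b::real_normed_vector) \<Rightarrow> 'a set \<Rightarrow> bool" where
  "Ck_on 0 f S \<longleftrightarrow> continuous_on S f"
| "Ck_on (Suc k) f S \<longleftrightarrow>
     (\<forall>x\<in>S. f differentiable (at x)) \<and> (\<forall>v. Ck_on k (\<lambda>x. frechet_derivative f (at x) v) S)"

definition smooth_on :: "'a::real_normed_vector set \<Rightarrow> ('a \<Rightarrow> 'b::real_normed_vector) \<Rightarrow> bool" where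
  "smooth_on S f \<longleftrightarrow> open S \<and> (\<forall>k. Ck_on k f S)"

text \<open>A chart is a pair of a domain and a coordinate map; outside the domain the
  coordinate map is irrelevant.\<close>

type_synonym ('p, 'e) chart = "'p set \<times> ('p \<Rightarrow> 'e)"

abbreviation chart_inv :: "('p, 'e) chart \<Rightarrow> 'e \<Rightarrow> 'p" where
  "chart_inv c \<equiv> inv_into (fst c) (snd c)"

text \<open>A nonempty smooth surface without boundary: a subset \<open>S\<close> (with the subspace topology) of
  a Hausdorff second countable space, with a smooth atlas \<open>A\<close>, not required to be maximal.
  Connectedness is not required.\<close>

definition smooth_surface ::
    "'m::{t2_space,second_countable_topology} set \<Rightarrow> ('m, real \<times> real) chart set \<Rightarrow> bool" where
  "smooth_surface S A \<longleftrightarrow>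
     S \<noteq> {} \<and> (\<Union>c\<in>A. fst c) = S \<and>
     (\<forall>c\<in>A. openin (top_of_set S) (fst c) \<and> open (snd c ` fst c) \<and>
            homeomorphism (fst c) (snd c ` fst c) (snd c) (chart_inv c)) \<and>
     (\<forall>c\<in>A. \<forall>d\<in>A. smooth_on (snd c ` (fst c \<inter> fst d)) (snd d \<circ> chart_inv c))"

definition compactly_supported_smooth ::
    "'m::{t2_space,second_countable_topology} set \<Rightarrow> ('m, real \<times> real) chart set \<Rightarrow> ('m \<Rightarrow> real) \<Rightarrow> bool" where
  "compactly_supported_smooth S A u \<longleftrightarrow>
     (\<forall>c\<in>A. smooth_on (snd c ` fst c) (u \<circ> chart_inv c)) \<and>
     (\<exists>C. compact C \<and> C \<subseteq> S \<and> (\<forall>p\<in>S - C. u p = 0))"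

section \<open>Riemannian geometry in coordinates\<close>

type_synonym 'e metric = "'e \<Rightarrow> 'e \<Rightarrow> 'e \<Rightarrow> real"

abbreviation D :: "('a::real_normed_vector \<Rightarrow> 'b::real_normed_vector) \<Rightarrow> 'a \<Rightarrow> 'a \<Rightarrow> 'b" where
  "D f x \<equiv> frechet_derivative f (at x)"

text \<open>The vector representing a linear form with respect to an inner product.\<close>

definition riesz :: "('e \<Rightarrow> 'e \<Rightarrow> real) \<Rightarrow> ('e \<Rightarrow> real) \<Rightarrow> 'e" where
  "riesz b \<alpha> = (THE z. \<forall>w. b z w = \<alpha> w)"

definition gradient :: "'e::euclidean_space metric \<Rightarrow> ('e \<Rightarrow> real) \<Rightarrow> 'e \<Rightarrow> 'e" where
  "gradient g u x = riesz (g x) (D u x)"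

definition metric_norm :: "'e metric \<Rightarrow> 'e \<Rightarrow> 'e \<Rightarrow> real" where
  "metric_norm g x v = sqrt (g x v v)"

text \<open>The trace \<open>g\<^sup>i\<^sup>j B\<^sub>i\<^sub>j\<close>: the vectors dual to the coordinate forms
  have components \<open>g\<^sup>i\<^sup>j\<close>.\<close>

definition metric_trace ::
    "('e::euclidean_space \<Rightarrow> 'e \<Rightarrow> real) \<Rightarrow> ('e \<Rightarrow> 'e \<Rightarrow> 'f::real_vector) \<Rightarrow> 'f" where
  "metric_trace b B = (\<Sum>i\<in>Basis. B (riesz b (\<lambda>w. i \<bullet> w)) i)"

text \<open>Levi-Civita connection: \<open>\<nabla>\<^sub>u v = christoffel g x u v\<close> for constant coordinate
  fields \<open>u\<close>, \<open>v\<close>, by the Koszul formula.\<close>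

definition christoffel :: "'e::euclidean_space metric \<Rightarrow> 'e \<Rightarrow> 'e \<Rightarrow> 'e \<Rightarrow> 'e" where
  "christoffel g x u v = riesz (g x)
     (\<lambda>w. (D (\<lambda>y. g y v w) x u + D (\<lambda>y. g y u w) x v - D (\<lambda>y. g y u v) x w) / 2)"

text \<open>\<open>R(u,v)w = \<nabla>\<^sub>u \<nabla>\<^sub>v w - \<nabla>\<^sub>v \<nabla>\<^sub>u w\<close>
  for constant coordinate fields.\<close>

definition curvature_tensor :: "'e::euclidean_space metric \<Rightarrow> 'e \<Rightarrow> 'e \<Rightarrow> 'e \<Rightarrow> 'e \<Rightarrow> 'e" where
  "curvature_tensor g x u v w =
     D (\<lambda>y. christoffel g y v w) x u + christoffel g x u (christoffel g x v w)
   - D (\<lambda>y. christoffel g y u w) x v - christoffel g x v (christoffel g x u w)"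

definition gram :: "(real \<times> real) metric \<Rightarrow> real \<times> real \<Rightarrow> real" where
  "gram g x = g x (1,0) (1,0) * g x (0,1) (0,1) - (g x (1,0) (0,1))\<^sup>2"

definition gaussian_curvature :: "(real \<times> real) metric \<Rightarrow> real \<times> real \<Rightarrow> real" where
  "gaussian_curvature g x = g x (curvature_tensor g x (1,0) (0,1) (0,1)) (1,0) / gram g x"

text \<open>Immersions \<open>f\<close> in coordinates on both sides; \<open>G\<close> is the ambient metric in the
  ambient chart.\<close>

definition induced_metric ::
    "'f::euclidean_space metric \<Rightarrow> ('e::euclidean_space \<Rightarrow> 'f) \<Rightarrow> 'e metric" where
  "induced_metric G f x u v = G (f x) (D f x u) (D f x v)"

text \<open>\<open>h(u,v)\<close>, the ambient minus the intrinsic covariant derivative, for constant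
  coordinate fields \<open>u\<close>, \<open>v\<close>; the first two summands are the ambient derivative of
  \<open>D f v\<close> along \<open>f\<close> in direction \<open>u\<close>.\<close>

definition second_fundamental_form ::
    "'f::euclidean_space metric \<Rightarrow> ('e::euclidean_space \<Rightarrow> 'f) \<Rightarrow> 'e \<Rightarrow> 'e \<Rightarrow> 'e \<Rightarrow> 'f" where
  "second_fundamental_form G f x u v =
     D (\<lambda>y. D f y v) x u + christoffel G (f x) (D f x u) (D f x v)
   - D f x (christoffel (induced_metric G f) x u v)"

definition mean_curvature ::
    "'f::euclidean_space metric \<Rightarrow> ('e::euclidean_space \<Rightarrow> 'f) \<Rightarrow> 'e \<Rightarrow> 'f" where
  "mean_curvature G f x =
     (1 / real DIM('e)) *\<^sub>R metric_trace (induced_metric G f x) (second_fundamental_form G f x)"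

definition mean_curvature_length ::
    "'f::euclidean_space metric \<Rightarrow> ('e::euclidean_space \<Rightarrow> 'f) \<Rightarrow> 'e \<Rightarrow> real" where
  "mean_curvature_length G f x = metric_norm G (f x) (mean_curvature G f x)"

definition grad_mean_curvature_length ::
    "'f::euclidean_space metric \<Rightarrow> ('e::euclidean_space \<Rightarrow> 'f) \<Rightarrow> 'e \<Rightarrow> real" where
  "grad_mean_curvature_length G f x =
     metric_norm (induced_metric G f) x
       (gradient (induced_metric G f) (mean_curvature_length G f) x)"

section \<open>The complex space forms of complex dimension 2\<close>

definition herm :: "complex^'n \<Rightarrow> complex^'n \<Rightarrow> complex" where
  "herm a b = (\<Sum>k\<in>UNIV. a $ k * cnj (b $ k))"

text \<open>The complex structure in every (holomorphic) ambient chart.\<close>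

abbreviation J :: "complex^'n \<Rightarrow> complex^'n" where
  "J v \<equiv> \<i> *s v"

text \<open>Points: \<open>Affine w\<close> for the plane and for the unit ball model of the complex hyperbolic
  plane; \<open>Projective L\<close> for a complex line \<open>L\<close> through the origin of three-dimensional
  complex space, as a point of the complex projective plane.\<close>

datatype csf_point = Affine "complex^2" | Projective "(complex^3) set"

fun affine_coord :: "csf_point \<Rightarrow> complex^2" where
  "affine_coord (Affine w) = w"
| "affine_coord (Projective L) = 0"

definition complex_line :: "complex^'n \<Rightarrow> (complex^'n) set" where
  "complex_line v = range (\<lambda>c. c *s v)"

text \<open>Domain of the affine chart \<open>v\<^sub>j \<noteq> 0\<close>, and the representative with \<open>v\<^sub>j = 1\<close>.\<close>

definition cp2_domain :: "3 \<Rightarrow> csf_point set" where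
  "cp2_domain j = {Projective (complex_line v) | v. v $ j \<noteq> 0}"

fun cp2_representative :: "3 \<Rightarrow> csf_point \<Rightarrow> complex^3" where
  "cp2_representative j (Projective L) = (THE v. v \<in> L \<and> v $ j = 1)"
| "cp2_representative j (Affine w) = 0"

definition cp2_charts :: "(csf_point, complex^2) chart set" where
  "cp2_charts =
     {(cp2_domain 1, \<lambda>q. let v = cp2_representative 1 q in vector [v $ 2, v $ 3]),
      (cp2_domain 2, \<lambda>q. let v = cp2_representative 2 q in vector [v $ 1, v $ 3]),
      (cp2_domain 3, \<lambda>q. let v = cp2_representative 3 q in vector [v $ 1, v $ 2])}"

text \<open>The holomorphic atlas of the complete simply connected complex space form of constant
  holomorphic sectional curvature \<open>4 \<epsilon>\<close>.\<close>

definition csf_charts :: "real \<Rightarrow> (csf_point, complex^2) chart set" where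
  "csf_charts \<epsilon> =
     (if \<epsilon> = 0 then {(range Affine, affine_coord)}
      else if \<epsilon> < 0 then {(Affine ` {w. norm w < 1}, affine_coord)}
      else cp2_charts)"

text \<open>Its metric, given by the same formula in all charts of the atlas: the flat metric, or
  \<open>1 / \<bar>\<epsilon>\<bar>\<close> times the Fubini--Study (\<open>sgn \<epsilon> = 1\<close>) respectively Bergman
  (\<open>sgn \<epsilon> = -1\<close>) metric of holomorphic sectional curvature \<open>4\<close> respectively \<open>-4\<close>.\<close>

definition csf_metric :: "real \<Rightarrow> (complex^2) metric" where
  "csf_metric \<epsilon> w a b =
     (if \<epsilon> = 0 then Re (herm a b)
      else Re ((1 + of_real (sgn \<epsilon>) * herm w w) * herm a b
               - of_real (sgn \<epsilon>) * herm a w * herm w b)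
           / (\<bar>\<epsilon>\<bar> * (1 + sgn \<epsilon> * (norm w)\<^sup>2)\<^sup>2))"

section \<open>Hamiltonian stationary Lagrangian surfaces\<close>

text \<open>A map in the charts \<open>c\<close> of the surface and \<open>d\<close> of the ambient space; meaningful on
  \<open>snd c ` (fst c \<inter> F -` fst d)\<close>.\<close>

definition local_rep :: "('m, 'e) chart \<Rightarrow> ('p, 'f) chart \<Rightarrow> ('m \<Rightarrow> 'p) \<Rightarrow> 'e \<Rightarrow> 'f" where
  "local_rep c d F = (\<lambda>x. snd d (F (chart_inv c x)))"

text \<open>\<open>P\<close> holds at every point of the surface, in all charts around the point and its image.
  It is used for properties \<open>P\<close> that do not depend on the charts.\<close>

definition everywhere :: "real \<Rightarrow> ('m, real \<times> real) chart set \<Rightarrow> ('m \<Rightarrow> csf_point) \<Rightarrow>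
    ((real \<times> real \<Rightarrow> complex^2) \<Rightarrow> real \<times> real \<Rightarrow> bool) \<Rightarrow> bool" where
  "everywhere \<epsilon> A F P \<longleftrightarrow>
     (\<forall>c\<in>A. \<forall>d\<in>csf_charts \<epsilon>. \<forall>p\<in>fst c. F p \<in> fst d \<longrightarrow> P (local_rep c d F) (snd c p))"

definition smooth_into_csf ::
    "real \<Rightarrow> 'm set \<Rightarrow> ('m, real \<times> real) chart set \<Rightarrow> ('m \<Rightarrow> csf_point) \<Rightarrow> bool" where
  "smooth_into_csf \<epsilon> S A F \<longleftrightarrow>
     F ` S \<subseteq> (\<Union>d\<in>csf_charts \<epsilon>. fst d) \<and>
     (\<forall>c\<in>A. \<forall>d\<in>csf_charts \<epsilon>. smooth_on (snd c ` (fst c \<inter> F -` fst d)) (local_rep c d F))"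

definition lagrangian_immersion ::
    "real \<Rightarrow> 'm set \<Rightarrow> ('m, real \<times> real) chart set \<Rightarrow> ('m \<Rightarrow> csf_point) \<Rightarrow> bool" where
  "lagrangian_immersion \<epsilon> S A F \<longleftrightarrow>
     smooth_into_csf \<epsilon> S A F \<and>
     everywhere \<epsilon> A F (\<lambda>f x. inj (D f x)) \<and>
     everywhere \<epsilon> A F (\<lambda>f x. \<forall>u v. csf_metric \<epsilon> (f x) (D f x u) (J (D f x v)) = 0)"

text \<open>\<open>a\<close> is the area of the region \<open>C\<close> under the map \<open>F\<close>, computed by cutting \<open>C\<close> into
  finitely many Borel pieces, each contained with its image in a chart. For compact \<open>C\<close> and
  smooth \<open>F\<close>, such a partition exists and \<open>a\<close> does not depend on it.\<close>

definition has_area :: "real \<Rightarrow> ('m, real \<times> real) chart set \<Rightarrow> ('m \<Rightarrow> csf_point) \<Rightarrow>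
    'm set \<Rightarrow> real \<Rightarrow> bool" where
  "has_area \<epsilon> A F C a \<longleftrightarrow>
     (\<exists>(N::nat) B c d.
        disjoint_family_on B {..<N} \<and> (\<Union>i<N. B i) = C \<and>
        (\<forall>i<N. c i \<in> A \<and> d i \<in> csf_charts \<epsilon> \<and> B i \<subseteq> fst (c i) \<inter> F -` fst (d i) \<and>
               snd (c i) ` B i \<in> sets borel) \<and>
        a = (\<Sum>i<N. LINT x:snd (c i) ` B i|lborel.
               sqrt (gram (induced_metric (csf_metric \<epsilon>) (local_rep (c i) (d i) F)) x)))"

text \<open>Smooth variations of \<open>F\<close>, with parameter \<open>t\<close> in \<open>(-\<delta>, \<delta>)\<close>, fixed outside the
  compact set \<open>C\<close>.\<close>

definition variation :: "real \<Rightarrow> 'm::{t2_space,second_countable_topology} set \<Rightarrow>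
    ('m, real \<times> real) chart set \<Rightarrow> ('m \<Rightarrow> csf_point) \<Rightarrow>
    'm set \<Rightarrow> real \<Rightarrow> (real \<Rightarrow> 'm \<Rightarrow> csf_point) \<Rightarrow> bool" where
  "variation \<epsilon> S A F C \<delta> \<Phi> \<longleftrightarrow>
     \<delta> > 0 \<and> compact C \<and> C \<subseteq> S \<and>
     (\<forall>p\<in>S. \<Phi> 0 p = F p) \<and>
     (\<forall>t. \<bar>t\<bar> < \<delta> \<longrightarrow> (\<forall>p\<in>S - C. \<Phi> t p = F p)) \<and>
     (\<forall>t. \<bar>t\<bar> < \<delta> \<longrightarrow> \<Phi> t ` S \<subseteq> (\<Union>d\<in>csf_charts \<epsilon>. fst d)) \<and>
     (\<forall>c\<in>A. \<forall>d\<in>csf_charts \<epsilon>.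
        smooth_on {(t, x). \<bar>t\<bar> < \<delta> \<and> x \<in> snd c ` fst c \<and> \<Phi> t (chart_inv c x) \<in> fst d}
                  (\<lambda>(t, x). local_rep c d (\<Phi> t) x))"

text \<open>The variation vector field at \<open>t = 0\<close> is \<open>J grad u\<close> for a compactly supported smooth
  function \<open>u\<close> on the surface.\<close>

definition hamiltonian_variation :: "real \<Rightarrow> 'm::{t2_space,second_countable_topology} set \<Rightarrow>
    ('m, real \<times> real) chart set \<Rightarrow> ('m \<Rightarrow> csf_point) \<Rightarrow>
    'm set \<Rightarrow> real \<Rightarrow> (real \<Rightarrow> 'm \<Rightarrow> csf_point) \<Rightarrow> bool" where
  "hamiltonian_variation \<epsilon> S A F C \<delta> \<Phi> \<longleftrightarrow>
     variation \<epsilon> S A F C \<delta> \<Phi> \<and>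
     (\<exists>u. compactly_supported_smooth S A u \<and>
        (\<forall>c\<in>A. \<forall>d\<in>csf_charts \<epsilon>. \<forall>p\<in>fst c. F p \<in> fst d \<longrightarrow>
           vector_derivative (\<lambda>t. snd d (\<Phi> t p)) (at 0) =
             (let f = local_rep c d F; x = snd c p in
              J (D f x (gradient (induced_metric (csf_metric \<epsilon>) f) (u \<circ> chart_inv c) x)))))"

text \<open>Total volume may be infinite; its first variation is that of the area of the compact
  set outside of which the variation is trivial.\<close>

definition hamiltonian_stationary_lagrangian_surface ::
    "real \<Rightarrow> 'm::{t2_space,second_countable_topology} set \<Rightarrow> ('m, real \<times> real) chart set \<Rightarrow>
     ('m \<Rightarrow> csf_point) \<Rightarrow> bool" where
  "hamiltonian_stationary_lagrangian_surface \<epsilon> S A F \<longleftrightarrow>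
     smooth_surface S A \<and> lagrangian_immersion \<epsilon> S A F \<and>
     (\<forall>C \<delta> \<Phi> a. hamiltonian_variation \<epsilon> S A F C \<delta> \<Phi> \<and>
        (\<forall>t. \<bar>t\<bar> < \<delta> \<longrightarrow> has_area \<epsilon> A (\<Phi> t) C (a t)) \<longrightarrow>
        (a has_real_derivative 0) (at 0))"

section \<open>The model surface\<close>

abbreviation punctured_plane :: "(real \<times> real) set" where
  "punctured_plane \<equiv> UNIV - {(0, 0)}"

text \<open>The integrals are oriented, so negative upper limits are covered.\<close>

definition F_map :: "real \<Rightarrow> real \<times> real \<Rightarrow> complex^2" where
  "F_map \<kappa> = (\<lambda>(x, y). vector
     [LBINT t=ereal 0..ereal x. exp (\<i> * complex_of_real (\<kappa> * t\<^sup>2)),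
      LBINT t=ereal 0..ereal y. exp (- \<i> * complex_of_real (\<kappa> * t\<^sup>2))])"

definition unitary :: "complex^'n^'n \<Rightarrow> bool" where
  "unitary W \<longleftrightarrow> (\<chi> i j. cnj (W $ j $ i)) ** W = mat 1"

text \<open>\<open>(N, \<phi>)\<close> being an admissible chart is expressed by adding it to the atlas.\<close>

definition locally_congruent_to_model :: "'m::{t2_space,second_countable_topology} set \<Rightarrow>
    ('m, real \<times> real) chart set \<Rightarrow> ('m \<Rightarrow> csf_point) \<Rightarrow> real \<Rightarrow> bool" where
  "locally_congruent_to_model S A F \<kappa> \<longleftrightarrow>
     (\<forall>p\<in>S. \<exists>N \<phi> W Z\<^sub>0. p \<in> N \<and> smooth_surface S (insert (N, \<phi>) A) \<and>
        \<phi> ` N \<subseteq> punctured_plane \<and> unitary W \<and>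
        (\<forall>q\<in>N. \<exists>Z. F q = Affine Z \<and> W *v Z + Z\<^sub>0 = F_map \<kappa> (\<phi> q)))"

end

theory Submission
  imports Defs
begin

text \<open>The mean curvature form \<open>\<alpha> = \<langle>H, J \<cdot>\<rangle>\<close> is closed by the Codazzi equation, and it is
  coclosed because the first variation of area along \<open>J grad u\<close> is \<open>-2 \<integral> \<alpha>(grad u)\<close>. Local
  potentials of \<open>\<alpha>\<close> and of its Hodge dual are therefore isothermal coordinates, in which the induced
  metric is \<open>\<bar>dz\<bar>\<^sup>2 / \<bar>H\<bar>\<^sup>2\<close>. With \<open>q = \<bar>H\<bar>\<^sup>2 / (2 \<kappa>)\<close> the hypotheses become
  \<open>\<bar>grad q\<bar> = 1\<close> and \<open>\<Delta> q = K / \<kappa> + 1 / q\<close> in the flat plane, which forces \<open>K = 0\<close> and makes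
  \<open>q\<close> the distance to a point. A complex square root about this point yields coordinates with flat
  induced metric and \<open>\<alpha> = \<kappa> (x dx - y dy)\<close>. There the Gauss and Codazzi equations leave no choice
  for the second fundamental form, give \<open>\<epsilon> = 0\<close>, and the frame equations integrate to
  \<open>F_map \<kappa>\<close> up to a unitary motion.\<close>

section \<open>Calculus of smooth maps\<close>

text \<open>A Lagrangian tangent frame is a complex basis of the ambient tangent space. Expanded in
  it, the covariant second derivatives of the immersion have complex coefficients whose real parts
  are the Christoffel symbols of the surface and whose imaginary parts are its second fundamental
  form, so the complex integrability conditions contain Gauss and Codazzi together, for all
  \<epsilon>. The conditions on \<open>q\<close> come from the metric \<open>|dz|^2 / k\<close> with
  \<open>k = |H|^2 = 2 \<kappa> q\<close>: the length of grad |H| is half the Euclidean length of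
  grad k, and the curvature satisfies \<open>2 K k = k Lap k - |grad k|^2\<close> with the flat
  Laplacian \<open>Lap\<close>. In the final coordinates two unknown functions remain, which form a
  holomorphic \<open>w\<close> with \<open>|w|^2 - \<kappa> Re (z w) = \<epsilon> / 2\<close>;
  taking the Laplacian gives \<open>w' = 0\<close>, and then \<open>w = 0\<close> and
  \<open>\<epsilon> = 0\<close>. Stationarity is given only through actual variations of the whole
  surface, so variations supported in one chart must be constructed and shown to be smooth and
  Hamiltonian in every other pair of charts before the coclosedness of \<alpha> can be
  extracted.\<close>

lemma D_eqI: "(f has_derivative f') (at x) \<Longrightarrow> D f x = f'"
  by (simp add: frechet_derivative_at[symmetric])

lemma has_derivative_D: "f differentiable (at x) \<Longrightarrow> (f has_derivative D f x) (at x)"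
  by (simp add: frechet_derivative_works)

lemma has_derivative_cong_open:
  assumes "open S" "x \<in> S" "\<And>y. y \<in> S \<Longrightarrow> f y = g y"
  shows "(f has_derivative f') (at x) \<longleftrightarrow> (g has_derivative f') (at x)"
  using assms has_derivative_transform_within_open[of f f' x UNIV S g]
    has_derivative_transform_within_open[of g f' x UNIV S f] by auto

text \<open>\<open>frechet_derivative\<close> is a choice that depends on the map only through its
  \<open>has_derivative\<close> facts, so no differentiability has to be assumed.\<close>

lemma D_cong_open:
  assumes "open S" "x \<in> S" "\<And>y. y \<in> S \<Longrightarrow> f y = g y"
  shows "D f x = D g x"
  unfolding frechet_derivative_def using has_derivative_cong_open[OF assms] by simp

lemma differentiable_cong_open:
  assumes "open S" "x \<in> S" "\<And>y. y \<in> S \<Longrightarrow> f y = g y"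
  shows "f differentiable (at x) \<longleftrightarrow> g differentiable (at x)"
  unfolding differentiable_def using has_derivative_cong_open[OF assms] by simp

lemma Ck_on_cong:
  assumes "open S" "\<And>y. y \<in> S \<Longrightarrow> f y = g y"
  shows "Ck_on k f S \<longleftrightarrow> Ck_on k g S"
  using assms(2)
proof (induction k arbitrary: f g)
  case 0
  then show ?case by (simp cong: continuous_on_cong)
next
  case (Suc k)
  have "f differentiable (at x) \<longleftrightarrow> g differentiable (at x)" if "x \<in> S" for x
    using differentiable_cong_open[OF assms(1) that Suc.prems] .
  moreover have "Ck_on k (\<lambda>x. D f x v) S \<longleftrightarrow> Ck_on k (\<lambda>x. D g x v) S" for v
    by (rule Suc.IH) (simp add: D_cong_open[OF assms(1) _ Suc.prems])
  ultimately show ?case by simp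
qed

lemma Ck_on_subset: "Ck_on k f S \<Longrightarrow> T \<subseteq> S \<Longrightarrow> Ck_on k f T"
  by (induction k arbitrary: f) (auto intro: continuous_on_subset)

lemma Ck_on_Suc_imp: "Ck_on (Suc k) f S \<Longrightarrow> Ck_on k f S"
proof (induction k arbitrary: f)
  case 0
  then show ?case
    by (auto intro!: continuous_at_imp_continuous_on differentiable_imp_continuous_within)
next
  case (Suc k)
  then show ?case by (metis Ck_on.simps(2))
qed

lemma Ck_on_SucI:
  assumes "open S" "\<And>x. x \<in> S \<Longrightarrow> (f has_derivative f' x) (at x)" "\<And>v. Ck_on k (\<lambda>x. f' x v) S"
  shows "Ck_on (Suc k) f S"
proof -
  have "Ck_on k (\<lambda>x. D f x v) S" for v
    using assms(3)[of v] by (subst Ck_on_cong[OF assms(1)]) (auto dest!: assms(2) D_eqI)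
  moreover have "f differentiable (at x)" if "x \<in> S" for x
    using assms(2)[OF that] by (auto simp: differentiable_def)
  ultimately show ?thesis by simp
qed

lemma Ck_on_local:
  assumes "\<And>x. x \<in> S \<Longrightarrow> \<exists>T. open T \<and> x \<in> T \<and> Ck_on k f T"
  shows "Ck_on k f S"
  using assms
proof (induction k arbitrary: f)
  case 0
  then show ?case
    by (metis Ck_on.simps(1) continuous_at_imp_continuous_on continuous_on_eq_continuous_at)
next
  case (Suc k)
  have "Ck_on k (\<lambda>x. D f x v) S" for v
  proof (rule Suc.IH)
    fix x assume "x \<in> S"
    then obtain T where "open T" "x \<in> T" "Ck_on (Suc k) f T" using Suc.prems by blast
    then show "\<exists>T. open T \<and> x \<in> T \<and> Ck_on k (\<lambda>x. D f x v) T" by auto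
  qed
  moreover have "f differentiable (at x)" if "x \<in> S" for x
    using Suc.prems[OF that] by auto
  ultimately show ?case by simp
qed

lemma Ck_on_const: "Ck_on k (\<lambda>x. c) S"
proof (induction k arbitrary: c)
  case (Suc k)
  have "D (\<lambda>x. c) x v = 0" for x and v :: 'a by (simp add: frechet_derivative_const)
  then show ?case using Suc[of 0] by simp
qed auto

lemma Ck_on_linear:
  assumes "bounded_linear T" "Ck_on k f S" "open S"
  shows "Ck_on k (\<lambda>x. T (f x)) S"
  using assms(2)
proof (induction k arbitrary: f)
  case 0
  then show ?case
    using linear_continuous_on[OF assms(1)] continuous_on_compose2 by (metis Ck_on.simps(1) subset_UNIV)
next
  case (Suc k)
  have *: "((\<lambda>x. T (f x)) has_derivative (\<lambda>v. T (D f x v))) (at x)" if "x \<in> S" for x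
    using Suc.prems that by (auto intro!: bounded_linear.has_derivative[OF assms(1)] has_derivative_D)
  have "Ck_on k (\<lambda>x. T (D f x v)) S" for v using Suc.IH Suc.prems by auto
  then show ?case using * by (intro Ck_on_SucI[OF assms(3)]) auto
qed

lemma Ck_on_id: "Ck_on k (\<lambda>x. x) S"
proof (cases k)
  case (Suc m)
  have "D (\<lambda>x. x) x v = v" for x v :: 'a by (simp add: frechet_derivative_ident)
  then show ?thesis using Suc by (simp add: Ck_on_const)
qed auto

lemma Ck_on_add:
  assumes "open S" "Ck_on k f S" "Ck_on k g S"
  shows "Ck_on k (\<lambda>x. f x + g x) S"
  using assms(2,3)
proof (induction k arbitrary: f g)
  case 0
  then show ?case by (auto intro: continuous_intros)
next
  case (Suc k)
  have *: "((\<lambda>x. f x + g x) has_derivative (\<lambda>v. D f x v + D g x v)) (at x)" if "x \<in> S" for x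
    using Suc.prems that by (auto intro!: has_derivative_add has_derivative_D)
  have "Ck_on k (\<lambda>x. D f x v + D g x v) S" for v using Suc.IH Suc.prems by auto
  then show ?case using * by (intro Ck_on_SucI[OF assms(1)]) auto
qed

lemma Ck_on_bilinear:
  assumes "bounded_bilinear B" "open S" "Ck_on k f S" "Ck_on k g S"
  shows "Ck_on k (\<lambda>x. B (f x) (g x)) S"
  using assms(3,4)
proof (induction k arbitrary: f g)
  case 0
  then show ?case using bounded_bilinear.continuous_on[OF assms(1)] by auto
next
  case (Suc k)
  have *: "((\<lambda>x. B (f x) (g x)) has_derivative (\<lambda>v. B (f x) (D g x v) + B (D f x v) (g x))) (at x)"
    if "x \<in> S" for x
    using Suc.prems that by (auto intro!: bounded_bilinear.FDERIV[OF assms(1)] has_derivative_D)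
  have "Ck_on k (\<lambda>x. B (f x) (D g x v) + B (D f x v) (g x)) S" for v
    using Suc.IH Suc.prems Ck_on_Suc_imp[OF Suc.prems(1)] Ck_on_Suc_imp[OF Suc.prems(2)]
    by (intro Ck_on_add[OF assms(2)] Suc.IH) auto
  then show ?case using * by (intro Ck_on_SucI[OF assms(2)]) auto
qed

lemma Ck_on_sum:
  assumes "open S" "\<And>i. i \<in> I \<Longrightarrow> Ck_on k (f i) S"
  shows "Ck_on k (\<lambda>x. \<Sum>i\<in>I. f i x) S"
  using assms(2)
  by (induction I rule: infinite_finite_induct) (auto intro: Ck_on_const Ck_on_add[OF assms(1)])

text \<open>\<open>Ck_on\<close> controls derivatives in fixed directions, while in the chain rule
  the direction \<open>D f x v\<close> moves with \<open>x\<close>. Expanding it in an orthonormal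
  basis leaves products of its components with \<open>D g (f x) b\<close> for fixed
  \<open>b\<close>, to which the induction hypothesis applies; hence the Euclidean middle
  space.\<close>

lemma Ck_on_compose:
  fixes f :: "'a::real_normed_vector \<Rightarrow> 'b::euclidean_space"
  assumes "open S" "open T" "f ` S \<subseteq> T" "Ck_on k f S" "Ck_on k g T"
  shows "Ck_on k (\<lambda>x. g (f x)) S"
  using assms(4,5)
proof (induction k arbitrary: g)
  case 0
  then show ?case using assms(3) continuous_on_compose2 by auto
next
  case (Suc k)
  have *: "((\<lambda>x. g (f x)) has_derivative (\<lambda>v. D g (f x) (D f x v))) (at x)" if "x \<in> S" for x
    by (rule has_derivative_compose; rule has_derivative_D) (use Suc.prems that assms(3) in auto)
  have **: "D g (f x) (D f x v) = (\<Sum>b\<in>Basis. (D f x v \<bullet> b) *\<^sub>R D g (f x) b)" if "x \<in> S" for x v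
  proof -
    have "linear (D g (f x))"
      using Suc.prems that assms(3) by (intro linear_frechet_derivative) auto
    then have "(\<Sum>b\<in>Basis. (D f x v \<bullet> b) *\<^sub>R D g (f x) b) = D g (f x) (\<Sum>b\<in>Basis. (D f x v \<bullet> b) *\<^sub>R b)"
      by (simp add: linear_sum linear_scale)
    then show ?thesis by (simp only: euclidean_representation)
  qed
  have "Ck_on k (\<lambda>x. (\<Sum>b\<in>Basis. (D f x v \<bullet> b) *\<^sub>R D g (f x) b)) S" for v
  proof (intro Ck_on_sum assms(1))
    fix b :: 'b assume "b \<in> Basis"
    have "Ck_on k (\<lambda>x. D f x v \<bullet> b) S"
      using Suc.prems by (intro Ck_on_linear[OF bounded_linear_inner_left] assms(1)) auto
    moreover have "Ck_on k (\<lambda>x. D g (f x) b) S"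
      using Suc.prems Ck_on_Suc_imp[OF Suc.prems(1)] by (intro Suc.IH) auto
    ultimately show "Ck_on k (\<lambda>x. (D f x v \<bullet> b) *\<^sub>R D g (f x) b) S"
      by (rule Ck_on_bilinear[OF bounded_bilinear_scaleR assms(1)])
  qed
  moreover have "((\<lambda>x. g (f x)) has_derivative (\<lambda>v. \<Sum>b\<in>Basis. (D f x v \<bullet> b) *\<^sub>R D g (f x) b)) (at x)"
    if "x \<in> S" for x using *[OF that] **[OF that] by simp
  ultimately show ?case by (intro Ck_on_SucI[OF assms(1)])
qed

text \<open>The derivative of the reciprocal is a polynomial in the reciprocal and the derivative of
  \<open>f\<close>, so order \<open>k\<close> for the reciprocal itself yields order
  \<open>k + 1\<close>.\<close>

lemma Ck_on_inverse:
  fixes f :: "'a::real_normed_vector \<Rightarrow> 'b::real_normed_field"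
  assumes "open S" "\<And>x. x \<in> S \<Longrightarrow> f x \<noteq> 0" "Ck_on k f S"
  shows "Ck_on k (\<lambda>x. inverse (f x)) S"
  using assms(3)
proof (induction k)
  case 0
  then show ?case using assms by (auto intro: continuous_intros)
next
  case (Suc k)
  have *: "((\<lambda>x. inverse (f x)) has_derivative (\<lambda>v. - (inverse (f x) * D f x v * inverse (f x)))) (at x)"
    if "x \<in> S" for x
    by (intro Deriv.has_derivative_inverse has_derivative_D) (use Suc.prems that assms(2) in auto)
  have "Ck_on k (\<lambda>x. - (inverse (f x) * D f x v * inverse (f x))) S" for v
    using Suc Ck_on_Suc_imp[OF Suc.prems]
    by (intro Ck_on_linear[OF bounded_linear_minus[OF bounded_linear_ident]]
        Ck_on_bilinear[OF bounded_bilinear_mult] assms(1)) auto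
  then show ?case using * by (intro Ck_on_SucI[OF assms(1)]) auto
qed

text \<open>Covers \<open>exp\<close> and \<open>sqrt\<close>: the derivative of \<open>\<phi>\<close> is a smooth expression in
  \<open>\<phi>\<close> and the argument.\<close>

lemma Ck_on_field_compose:
  fixes f :: "'a::real_normed_vector \<Rightarrow> 'b::real_normed_field"
  assumes "open S" "Ck_on k f S"
    "\<And>x. x \<in> S \<Longrightarrow> (\<phi> has_field_derivative \<psi> (f x)) (at (f x))"
    "\<And>j. Ck_on j f S \<Longrightarrow> Ck_on j (\<lambda>x. \<phi> (f x)) S \<Longrightarrow> Ck_on j (\<lambda>x. \<psi> (f x)) S"
  shows "Ck_on k (\<lambda>x. \<phi> (f x)) S"
  using assms(2)
proof (induction k)
  case 0
  have "continuous_on S (\<lambda>x. \<phi> (f x))"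
  proof (rule continuous_at_imp_continuous_on, rule ballI)
    fix x assume "x \<in> S"
    then have "isCont f x" using 0 assms(1) by (simp add: continuous_on_eq_continuous_at)
    then show "isCont (\<lambda>x. \<phi> (f x)) x"
      using assms(3)[OF \<open>x \<in> S\<close>] DERIV_isCont isCont_o2 by blast
  qed
  then show ?case by simp
next
  case (Suc k)
  have *: "((\<lambda>x. \<phi> (f x)) has_derivative (\<lambda>v. \<psi> (f x) * D f x v)) (at x)"
    if "x \<in> S" for x
    using Suc.prems that has_derivative_compose[of f "D f x" x UNIV \<phi> "(*) (\<psi> (f x))"] assms(3)[OF that]
    by (auto simp: has_field_derivative_def intro: has_derivative_D)
  have "Ck_on k (\<lambda>x. \<psi> (f x) * D f x v) S" for v
    using Suc Ck_on_Suc_imp[OF Suc.prems]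
    by (intro Ck_on_bilinear[OF bounded_bilinear_mult] assms) auto
  then show ?case using * by (intro Ck_on_SucI[OF assms(1)]) auto
qed

section \<open>Closure properties of smooth maps\<close>

named_theorems smooth_intros

lemma smooth_on_open: "smooth_on S f \<Longrightarrow> open S"
  by (simp add: smooth_on_def)

lemma smooth_on_differentiable: "smooth_on S f \<Longrightarrow> x \<in> S \<Longrightarrow> f differentiable (at x)"
  unfolding smooth_on_def by (metis Ck_on.simps(2))

lemma smooth_on_has_derivative: "smooth_on S f \<Longrightarrow> x \<in> S \<Longrightarrow> (f has_derivative D f x) (at x)"
  using smooth_on_differentiable has_derivative_D by blast

lemma smooth_on_continuous_on: "smooth_on S f \<Longrightarrow> continuous_on S f"
  unfolding smooth_on_def by (metis Ck_on.simps(1))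

lemma smooth_on_D [smooth_intros]: "smooth_on S f \<Longrightarrow> smooth_on S (\<lambda>x. D f x v)"
  unfolding smooth_on_def by (metis Ck_on.simps(2))

lemma smooth_on_cong:
  assumes "\<And>y. y \<in> S \<Longrightarrow> f y = g y"
  shows "smooth_on S f \<longleftrightarrow> smooth_on S g"
  using Ck_on_cong assms unfolding smooth_on_def by blast

lemma smooth_on_subset: "smooth_on S f \<Longrightarrow> open T \<Longrightarrow> T \<subseteq> S \<Longrightarrow> smooth_on T f"
  unfolding smooth_on_def using Ck_on_subset by blast

lemma smooth_on_local:
  assumes "\<And>x. x \<in> S \<Longrightarrow> \<exists>T. x \<in> T \<and> T \<subseteq> S \<and> smooth_on T f"
  shows "smooth_on S f"
  unfolding smooth_on_def
proof (intro conjI allI)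
  show "open S" using assms smooth_on_open by (meson openI open_subopen)
  show "Ck_on k f S" for k
    by (rule Ck_on_local) (meson assms smooth_on_def)
qed

lemma smooth_on_const [smooth_intros]: "open S \<Longrightarrow> smooth_on S (\<lambda>x. c)"
  by (simp add: smooth_on_def Ck_on_const)

lemma smooth_on_id [smooth_intros]: "open S \<Longrightarrow> smooth_on S (\<lambda>x. x)"
  by (simp add: smooth_on_def Ck_on_id)

lemma smooth_on_linear: "bounded_linear T \<Longrightarrow> smooth_on S f \<Longrightarrow> smooth_on S (\<lambda>x. T (f x))"
  by (simp add: smooth_on_def Ck_on_linear)

lemma smooth_on_bilinear:
  "bounded_bilinear B \<Longrightarrow> smooth_on S f \<Longrightarrow> smooth_on S g \<Longrightarrow> smooth_on S (\<lambda>x. B (f x) (g x))"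
  by (simp add: smooth_on_def Ck_on_bilinear)

lemma smooth_on_add [smooth_intros]:
  "smooth_on S f \<Longrightarrow> smooth_on S g \<Longrightarrow> smooth_on S (\<lambda>x. f x + g x)"
  by (simp add: smooth_on_def Ck_on_add)

lemma smooth_on_minus [smooth_intros]: "smooth_on S f \<Longrightarrow> smooth_on S (\<lambda>x. - f x)"
  by (rule smooth_on_linear[OF bounded_linear_minus[OF bounded_linear_ident]])

lemma smooth_on_diff [smooth_intros]:
  "smooth_on S f \<Longrightarrow> smooth_on S g \<Longrightarrow> smooth_on S (\<lambda>x. f x - g x)"
  using smooth_on_add[of S f "\<lambda>x. - g x"] smooth_on_minus[of S g] by simp

lemma smooth_on_compose:
  fixes f :: "'a::real_normed_vector \<Rightarrow> 'b::euclidean_space"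
  assumes "smooth_on T g" "smooth_on S f" "f ` S \<subseteq> T"
  shows "smooth_on S (\<lambda>x. g (f x))"
  using assms Ck_on_compose[of S T f] unfolding smooth_on_def by blast

lemma smooth_on_inverse [smooth_intros]:
  fixes f :: "'a::real_normed_vector \<Rightarrow> 'b::real_normed_field"
  shows "smooth_on S f \<Longrightarrow> (\<And>x. x \<in> S \<Longrightarrow> f x \<noteq> 0) \<Longrightarrow> smooth_on S (\<lambda>x. inverse (f x))"
  by (simp add: smooth_on_def Ck_on_inverse)

lemmas smooth_on_mult [smooth_intros] = smooth_on_bilinear[OF bounded_bilinear_mult]
lemmas smooth_on_scaleR [smooth_intros] = smooth_on_bilinear[OF bounded_bilinear_scaleR]
lemmas smooth_on_inner [smooth_intros] = smooth_on_bilinear[OF bounded_bilinear_inner]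
lemmas smooth_on_Re [smooth_intros] = smooth_on_linear[OF bounded_linear_Re]
lemmas smooth_on_Im [smooth_intros] = smooth_on_linear[OF bounded_linear_Im]
lemmas smooth_on_of_real [smooth_intros] = smooth_on_linear[OF bounded_linear_of_real]
lemmas smooth_on_fst [smooth_intros] = smooth_on_linear[OF bounded_linear_fst]
lemmas smooth_on_snd [smooth_intros] = smooth_on_linear[OF bounded_linear_snd]
lemmas smooth_on_vec_nth [smooth_intros] = smooth_on_linear[OF bounded_linear_vec_nth]

lemma smooth_on_divide [smooth_intros]:
  fixes f :: "'a::real_normed_vector \<Rightarrow> 'b::real_normed_field"
  shows "smooth_on S f \<Longrightarrow> smooth_on S g \<Longrightarrow> (\<And>x. x \<in> S \<Longrightarrow> g x \<noteq> 0) \<Longrightarrow> smooth_on S (\<lambda>x. f x / g x)"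
  unfolding divide_inverse by (intro smooth_intros)

lemma smooth_on_power [smooth_intros]:
  fixes f :: "'a::real_normed_vector \<Rightarrow> 'b::real_normed_field"
  shows "smooth_on S f \<Longrightarrow> smooth_on S (\<lambda>x. f x ^ n)"
  by (induction n) (auto intro: smooth_intros smooth_on_open)

lemma smooth_on_sqrt [smooth_intros]:
  assumes "smooth_on S f" "\<And>x. x \<in> S \<Longrightarrow> f x > 0"
  shows "smooth_on S (\<lambda>x. sqrt (f x))"
proof -
  have S: "open S" using assms(1) smooth_on_open by blast
  have "Ck_on k (\<lambda>x. sqrt (f x)) S" for k
  proof (rule Ck_on_field_compose[where f = f and \<phi> = sqrt and \<psi> = "\<lambda>y. inverse (sqrt y) / 2", OF S])
    show "Ck_on k f S" using assms(1) by (simp add: smooth_on_def)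
    show "(sqrt has_real_derivative inverse (sqrt (f x)) / 2) (at (f x))" if "x \<in> S" for x
      using assms(2)[OF that] by (rule DERIV_real_sqrt)
    show "Ck_on j (\<lambda>x. inverse (sqrt (f x)) / 2) S" if "Ck_on j (\<lambda>x. sqrt (f x)) S" for j
      using assms(2) unfolding divide_inverse
      by (intro Ck_on_bilinear[OF bounded_bilinear_mult S] Ck_on_inverse Ck_on_const that S)
         force+
  qed
  then show ?thesis using S by (simp add: smooth_on_def)
qed

lemma smooth_on_exp [smooth_intros]:
  fixes f :: "'a::real_normed_vector \<Rightarrow> 'b::{banach,real_normed_field}"
  assumes "smooth_on S f"
  shows "smooth_on S (\<lambda>x. exp (f x))"
proof -
  have S: "open S" using assms(1) smooth_on_open by blast
  have "Ck_on k (\<lambda>x. exp (f x)) S" for k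
    using assms by - (rule Ck_on_field_compose[where f = f and \<phi> = exp and \<psi> = exp, OF S],
      simp_all add: smooth_on_def DERIV_exp)
  then show ?thesis using S by (simp add: smooth_on_def)
qed

lemma smooth_on_Pair [smooth_intros]:
  fixes f :: "'a::real_normed_vector \<Rightarrow> 'b::real_normed_vector" and g :: "'a \<Rightarrow> 'c::real_normed_vector"
  assumes "smooth_on S f" "smooth_on S g"
  shows "smooth_on S (\<lambda>x. (f x, g x))"
proof -
  have 1: "bounded_linear (\<lambda>y. (y, 0::'c))" for y :: 'b
    by (intro bounded_linear_Pair bounded_linear_ident bounded_linear_zero)
  have 2: "bounded_linear (\<lambda>y. (0::'b, y))" for y :: 'c
    by (intro bounded_linear_Pair bounded_linear_ident bounded_linear_zero)
  have "smooth_on S (\<lambda>x. (f x, 0) + (0, g x))"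
    by (intro smooth_on_add smooth_on_linear[OF 1] smooth_on_linear[OF 2] assms)
  then show ?thesis by simp
qed

lemma bounded_bilinear_vscale: "bounded_bilinear ((*s) :: complex \<Rightarrow> complex^'n \<Rightarrow> complex^'n)"
proof -
  have "bilinear ((*s) :: complex \<Rightarrow> complex^'n \<Rightarrow> complex^'n)"
    by (auto simp: bilinear_def linear_iff vec_eq_iff algebra_simps)
  then show ?thesis by (simp add: bilinear_conv_bounded_bilinear)
qed

lemmas smooth_on_vscale [smooth_intros] = smooth_on_bilinear[OF bounded_bilinear_vscale]

lemma smooth_on_vector2 [smooth_intros]:
  fixes a b :: "'a::real_normed_vector \<Rightarrow> complex"
  assumes "smooth_on S a" "smooth_on S b"
  shows "smooth_on S (\<lambda>x. vector [a x, b x] :: complex^2)"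
proof -
  have "smooth_on S (\<lambda>x. a x *s (vector [1, 0] :: complex^2) + b x *s vector [0, 1])"
    by (intro smooth_intros assms smooth_on_open[OF assms(1)])
  moreover have "a x *s (vector [1, 0] :: complex^2) + b x *s vector [0, 1] = vector [a x, b x]" for x
    by (simp add: vec_eq_iff forall_2)
  ultimately show ?thesis by simp
qed

section \<open>Chain rule and symmetry of second derivatives\<close>

lemma D_compose:
  assumes "smooth_on T g" "f differentiable (at x)" "f x \<in> T"
  shows "D (\<lambda>x. g (f x)) x v = D g (f x) (D f x v)"
  by (metis D_eqI assms has_derivative_D has_derivative_compose smooth_on_has_derivative)

lemma linear_D: "smooth_on S f \<Longrightarrow> x \<in> S \<Longrightarrow> linear (D f x)"
  using smooth_on_differentiable linear_frechet_derivative by blast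

text \<open>Two mean value theorems, in direction \<open>u\<close> for the difference along
  \<open>h v\<close> and then in direction \<open>v\<close>. The left-hand side is symmetric in
  \<open>u\<close> and \<open>v\<close>; comparing both orders gives the symmetry of mixed
  derivatives in the limit.\<close>

lemma mixed_difference_mvt:
  fixes f :: "'a::real_normed_vector \<Rightarrow> real"
  assumes f: "smooth_on S f" and h: "h > 0"
    and S: "\<And>s t. 0 \<le> s \<Longrightarrow> s \<le> h \<Longrightarrow> 0 \<le> t \<Longrightarrow> t \<le> h \<Longrightarrow> x + s *\<^sub>R u + t *\<^sub>R v \<in> S"
  obtains s t where "0 \<le> s" "s \<le> h" "0 \<le> t" "t \<le> h"
    "f (x + h *\<^sub>R u + h *\<^sub>R v) - f (x + h *\<^sub>R u) - (f (x + h *\<^sub>R v) - f x)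
       = h * h * D (\<lambda>y. D f y u) (x + s *\<^sub>R u + t *\<^sub>R v) v"
proof -
  have du: "((\<lambda>s. g (x + s *\<^sub>R u + t *\<^sub>R v)) has_real_derivative D g (x + s *\<^sub>R u + t *\<^sub>R v) u) (at s)"
    if "smooth_on S g" "0 \<le> s" "s \<le> h" "0 \<le> t" "t \<le> h" for g :: "'a \<Rightarrow> real" and s t
  proof -
    have "((\<lambda>s. x + s *\<^sub>R u + t *\<^sub>R v) has_derivative (\<lambda>r. r *\<^sub>R u)) (at s)"
      by (auto intro!: derivative_eq_intros)
    from has_derivative_compose[OF this smooth_on_has_derivative[OF that(1) S[OF that(2-)]]]
    show ?thesis unfolding has_field_derivative_def
      using linear_D[OF that(1) S[OF that(2-)]] by (simp add: linear_scale mult.commute[of _ "D _ _ _"])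
  qed
  have dv: "((\<lambda>t. g (x + s *\<^sub>R u + t *\<^sub>R v)) has_real_derivative D g (x + s *\<^sub>R u + t *\<^sub>R v) v) (at t)"
    if "smooth_on S g" "0 \<le> s" "s \<le> h" "0 \<le> t" "t \<le> h" for g :: "'a \<Rightarrow> real" and s t
  proof -
    have "((\<lambda>t. x + s *\<^sub>R u + t *\<^sub>R v) has_derivative (\<lambda>r. r *\<^sub>R v)) (at t)"
      by (auto intro!: derivative_eq_intros)
    from has_derivative_compose[OF this smooth_on_has_derivative[OF that(1) S[OF that(2-)]]]
    show ?thesis unfolding has_field_derivative_def
      using linear_D[OF that(1) S[OF that(2-)]] by (simp add: linear_scale mult.commute[of _ "D _ _ _"])
  qed
  have d0: "((\<lambda>s. f (x + s *\<^sub>R u)) has_real_derivative D f (x + s *\<^sub>R u) u) (at s)"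
    if "0 \<le> s" "s \<le> h" for s
    using du[OF f, of s 0] that h by simp
  define G where "G s = f (x + s *\<^sub>R u + h *\<^sub>R v) - f (x + s *\<^sub>R u + 0 *\<^sub>R v)" for s
  have "\<exists>z>0. z < h \<and> G h - G 0 = (h - 0) *
      (D f (x + z *\<^sub>R u + h *\<^sub>R v) u - D f (x + z *\<^sub>R u + 0 *\<^sub>R v) u)"
    unfolding G_def using h by (intro MVT2) (auto intro!: derivative_intros du d0 f)
  then obtain s where s: "0 < s" "s < h"
    "G h - G 0 = h * (D f (x + s *\<^sub>R u + h *\<^sub>R v) u - D f (x + s *\<^sub>R u + 0 *\<^sub>R v) u)" by auto
  have "\<exists>z>0. z < h \<and> D f (x + s *\<^sub>R u + h *\<^sub>R v) u - D f (x + s *\<^sub>R u + 0 *\<^sub>R v) u = (h - 0) *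
      D (\<lambda>y. D f y u) (x + s *\<^sub>R u + z *\<^sub>R v) v"
    using h s by (intro MVT2 dv smooth_on_D f) auto
  then obtain t where "0 < t" "t < h"
    "D f (x + s *\<^sub>R u + h *\<^sub>R v) u - D f (x + s *\<^sub>R u + 0 *\<^sub>R v) u = h * D (\<lambda>y. D f y u) (x + s *\<^sub>R u + t *\<^sub>R v) v"
    by auto
  with s show ?thesis using that[of s t] by (auto simp: G_def)
qed

lemma D_D_commute_real:
  fixes f :: "'a::real_normed_vector \<Rightarrow> real"
  assumes f: "smooth_on S f" and x: "x \<in> S"
  shows "D (\<lambda>y. D f y u) x v = D (\<lambda>y. D f y v) x u"
proof (rule ccontr)
  define a where "a y = D (\<lambda>y. D f y u) y v" for y
  define b where "b y = D (\<lambda>y. D f y v) y u" for y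
  assume "\<not> ?thesis"
  then have e: "\<bar>a x - b x\<bar> / 2 > 0" (is "?e > 0") by (simp add: a_def b_def)
  have "continuous_on S a" "continuous_on S b"
    unfolding a_def b_def by (intro smooth_on_continuous_on smooth_intros f)+
  moreover note S = smooth_on_open[OF f]
  ultimately have "isCont a x" "isCont b x"
    using x by (auto simp: continuous_on_eq_continuous_at)
  then obtain d1 d2 where d1: "d1 > 0" "\<And>y. dist y x < d1 \<Longrightarrow> dist (a y) (a x) < ?e"
    and d2: "d2 > 0" "\<And>y. dist y x < d2 \<Longrightarrow> dist (b y) (b x) < ?e"
    using e unfolding continuous_at_eps_delta by metis
  obtain d3 where d3: "d3 > 0" "\<And>y. dist y x < d3 \<Longrightarrow> y \<in> S"
    using S x by (auto simp: open_dist)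
  define d where "d = min d1 (min d2 d3)"
  have d: "d > 0" using d1 d2 d3 by (simp add: d_def)
  \<comment> \<open>The parallelogram with sides \<open>h u\<close> and \<open>h v\<close> then
    stays within distance \<open>d\<close> of \<open>x\<close>; the summand 1 keeps the denominator
    positive when both vectors vanish.\<close>
  define h where "h = d / (norm u + norm v + 1) / 2"
  have n: "norm u + norm v + 1 > 0" by (simp add: add_nonneg_pos)
  have h: "h > 0" using d n by (simp add: h_def)
  have near: "dist (x + s *\<^sub>R u + t *\<^sub>R v) x < d" if "0 \<le> s" "s \<le> h" "0 \<le> t" "t \<le> h" for s t
  proof -
    have "dist (x + s *\<^sub>R u + t *\<^sub>R v) x \<le> s * norm u + t * norm v"
      using that norm_triangle_ineq[of "s *\<^sub>R u" "t *\<^sub>R v"] by (simp add: dist_norm)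
    also have "\<dots> \<le> h * norm u + h * norm v" using that by (intro add_mono mult_right_mono) auto
    also have "\<dots> < 2 * (h * (norm u + norm v + 1))" using h by (simp add: algebra_simps add_nonneg_pos)
    also have "\<dots> = d" using n unfolding h_def by (simp add: nonzero_divide_eq_eq)
    finally show ?thesis .
  qed
  obtain s t where st: "0 \<le> s" "s \<le> h" "0 \<le> t" "t \<le> h"
    "f (x + h *\<^sub>R u + h *\<^sub>R v) - f (x + h *\<^sub>R u) - (f (x + h *\<^sub>R v) - f x) = h * h * a (x + s *\<^sub>R u + t *\<^sub>R v)"
    unfolding a_def using mixed_difference_mvt[OF f h, of x u v] near d3 d_def by auto
  have "x + s *\<^sub>R v + t *\<^sub>R u \<in> S" if "0 \<le> s" "s \<le> h" "0 \<le> t" "t \<le> h" for s t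
    using near[of t s] that d3 d_def by (simp add: add.commute add.left_commute)
  then obtain s' t' where st': "0 \<le> s'" "s' \<le> h" "0 \<le> t'" "t' \<le> h"
    "f (x + h *\<^sub>R v + h *\<^sub>R u) - f (x + h *\<^sub>R v) - (f (x + h *\<^sub>R u) - f x) = h * h * b (x + s' *\<^sub>R v + t' *\<^sub>R u)"
    unfolding b_def using mixed_difference_mvt[OF f h, of x v u] by metis
  have "a (x + s *\<^sub>R u + t *\<^sub>R v) = b (x + t' *\<^sub>R u + s' *\<^sub>R v)"
    using st(5) st'(5) h by (simp add: algebra_simps)
  moreover have "dist (a (x + s *\<^sub>R u + t *\<^sub>R v)) (a x) < ?e" "dist (b (x + t' *\<^sub>R u + s' *\<^sub>R v)) (b x) < ?e"
    using near[OF st(1-4)] near[of t' s'] st' d1 d2 by (auto simp: d_def)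
  ultimately show False unfolding dist_real_def by (smt (verit) field_sum_of_halves)
qed

lemma D_D_commute:
  fixes f :: "'a::real_normed_vector \<Rightarrow> 'b::euclidean_space"
  assumes f: "smooth_on S f" and x: "x \<in> S"
  shows "D (\<lambda>y. D f y u) x v = D (\<lambda>y. D f y v) x u"
proof (rule euclidean_eqI)
  fix b :: 'b
  have *: "D (\<lambda>y. D f y u) x v \<bullet> b = D (\<lambda>y. D (\<lambda>y. f y \<bullet> b) y u) x v" for u v
  proof -
    have 1: "D (\<lambda>y. f y \<bullet> b) y u = D f y u \<bullet> b" if "y \<in> S" for y
      by (simp add: D_eqI[OF has_derivative_inner_left[OF smooth_on_has_derivative[OF f that]]])
    have "D (\<lambda>y. D (\<lambda>y. f y \<bullet> b) y u) x v = D (\<lambda>y. D f y u \<bullet> b) x v"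
      by (rule fun_cong[OF D_cong_open[OF smooth_on_open[OF f] x 1]])
    also have "\<dots> = D (\<lambda>y. D f y u) x v \<bullet> b"
      by (simp add: D_eqI[OF has_derivative_inner_left[OF smooth_on_has_derivative[OF smooth_on_D[OF f] x]]])
    finally show ?thesis by simp
  qed
  have "smooth_on S (\<lambda>y. f y \<bullet> b)"
    by (rule smooth_on_linear[OF bounded_linear_inner_left f])
  from D_D_commute_real[OF this x, of u v]
  show "D (\<lambda>y. D f y u) x v \<bullet> b = D (\<lambda>y. D f y v) x u \<bullet> b"
    by (simp only: *)
qed

section \<open>The Hermitian metric of the complex space forms\<close>

lemma herm_2: "herm a b = a $ 1 * cnj (b $ 1) + a $ 2 * cnj (b $ 2)" for a b :: "complex^2"
  by (simp add: herm_def sum_2)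

lemma herm_linear [simp]:
  "herm (a + a') b = herm a b + herm a' b" "herm a (b + b') = herm a b + herm a b'"
  "herm (a - a') b = herm a b - herm a' b" "herm a (b - b') = herm a b - herm a b'"
  "herm (- a) b = - herm a b" "herm a (- b) = - herm a b"
  "herm (c *s a) b = c * herm a b" "herm a (c *s b) = cnj c * herm a b"
  "herm (r *\<^sub>R a) b = of_real r * herm a b" "herm a (r *\<^sub>R b) = of_real r * herm a b"
  "herm 0 b = 0" "herm a 0 = 0"
  by (simp_all add: herm_def sum.distrib sum_subtractf sum_negf sum_distrib_left algebra_simps)
     (simp_all add: scaleR_conv_of_real mult.left_commute sum_distrib_left)

lemma cnj_herm: "cnj (herm a b) = herm b a"
  by (simp add: herm_def mult.commute)

lemma herm_self: "herm w w = of_real ((norm w)\<^sup>2)"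
proof -
  have "herm w w = (\<Sum>k\<in>UNIV. of_real ((cmod (w $ k))\<^sup>2))"
    unfolding herm_def by (simp add: complex_norm_square[symmetric] flip: of_real_power)
  then show ?thesis
    by (simp add: norm_vec_def L2_set_def sum_nonneg)
qed

lemma bounded_bilinear_herm: "bounded_bilinear (herm :: complex^'n \<Rightarrow> complex^'n \<Rightarrow> complex)"
proof -
  have "bilinear (herm :: complex^'n \<Rightarrow> complex^'n \<Rightarrow> complex)"
    by (auto simp: bilinear_def linear_iff scaleR_conv_of_real[where 'a = complex])
  then show ?thesis by (simp add: bilinear_conv_bounded_bilinear)
qed

lemmas smooth_on_herm [smooth_intros] = smooth_on_bilinear[OF bounded_bilinear_herm]
lemmas has_derivative_herm = bounded_bilinear.FDERIV[OF bounded_bilinear_herm]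
lemmas has_derivative_vscale = bounded_bilinear.FDERIV[OF bounded_bilinear_vscale]

definition csf_weight :: "real \<Rightarrow> real" where
  "csf_weight \<epsilon> = (if \<epsilon> = 0 then 1 else 1 / \<bar>\<epsilon>\<bar>)"

text \<open>All of the coordinate space for \<open>\<epsilon> \<ge> 0\<close> and the unit ball for
  \<open>\<epsilon> < 0\<close>: the region where the metric formula is regular.\<close>

definition csf_domain :: "real \<Rightarrow> (complex^2) set" where
  "csf_domain \<epsilon> = {w. 1 + sgn \<epsilon> * (norm w)\<^sup>2 > 0}"

definition csf_inv :: "real \<Rightarrow> complex^2 \<Rightarrow> complex" where
  "csf_inv \<epsilon> w = inverse (1 + of_real (sgn \<epsilon>) * herm w w)"

text \<open>For \<open>\<epsilon> = 0\<close> this is the flat Hermitian form, so that the formula covers all three cases.\<close>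

definition csf_herm :: "real \<Rightarrow> complex^2 \<Rightarrow> complex^2 \<Rightarrow> complex^2 \<Rightarrow> complex" where
  "csf_herm \<epsilon> w a b = of_real (csf_weight \<epsilon>) *
     (herm a b * csf_inv \<epsilon> w - of_real (sgn \<epsilon>) * herm a w * herm w b * (csf_inv \<epsilon> w)\<^sup>2)"

lemma csf_inv_real: "csf_inv \<epsilon> w = of_real (inverse (1 + sgn \<epsilon> * (norm w)\<^sup>2))"
  by (simp add: csf_inv_def herm_self)

lemma csf_domain_nonzero: "w \<in> csf_domain \<epsilon> \<Longrightarrow> 1 + of_real (sgn \<epsilon>) * herm w w \<noteq> 0"
proof -
  assume "w \<in> csf_domain \<epsilon>"
  moreover have "1 + of_real (sgn \<epsilon>) * herm w w = of_real (1 + sgn \<epsilon> * (norm w)\<^sup>2)"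
    by (simp add: herm_self)
  ultimately show ?thesis unfolding csf_domain_def by (simp del: of_real_add of_real_mult)
qed

lemma open_csf_domain: "open (csf_domain \<epsilon>)"
  unfolding csf_domain_def by (intro open_Collect_less continuous_intros)

lemma csf_metric_eq: "w \<in> csf_domain \<epsilon> \<Longrightarrow> csf_metric \<epsilon> w a b = Re (csf_herm \<epsilon> w a b)"
proof (cases "\<epsilon> = 0")
  case False
  assume w: "w \<in> csf_domain \<epsilon>"
  define N where "N = 1 + sgn \<epsilon> * (norm w)\<^sup>2"
  have N: "N > 0" using w by (simp add: csf_domain_def N_def)
  have Nc: "1 + of_real (sgn \<epsilon>) * herm w w = complex_of_real N" by (simp add: N_def herm_self)
  have "csf_herm \<epsilon> w a b = ((1 + of_real (sgn \<epsilon>) * herm w w) * herm a b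
               - of_real (sgn \<epsilon>) * herm a w * herm w b) * of_real (1 / (\<bar>\<epsilon>\<bar> * N\<^sup>2))"
    using N False unfolding csf_herm_def csf_inv_def Nc csf_weight_def
    by (simp add: field_simps power2_eq_square)
  then show ?thesis using False by (simp add: csf_metric_def N_def[symmetric])
qed (simp add: csf_metric_def csf_herm_def csf_weight_def csf_inv_def)

lemma csf_herm_linear [simp]:
  "csf_herm \<epsilon> w (a + a') b = csf_herm \<epsilon> w a b + csf_herm \<epsilon> w a' b"
  "csf_herm \<epsilon> w a (b + b') = csf_herm \<epsilon> w a b + csf_herm \<epsilon> w a b'"
  "csf_herm \<epsilon> w (a - a') b = csf_herm \<epsilon> w a b - csf_herm \<epsilon> w a' b"
  "csf_herm \<epsilon> w a (b - b') = csf_herm \<epsilon> w a b - csf_herm \<epsilon> w a b'"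
  "csf_herm \<epsilon> w (- a) b = - csf_herm \<epsilon> w a b" "csf_herm \<epsilon> w a (- b) = - csf_herm \<epsilon> w a b"
  "csf_herm \<epsilon> w (c *s a) b = c * csf_herm \<epsilon> w a b"
  "csf_herm \<epsilon> w a (c *s b) = cnj c * csf_herm \<epsilon> w a b"
  "csf_herm \<epsilon> w (r *\<^sub>R a) b = of_real r * csf_herm \<epsilon> w a b"
  "csf_herm \<epsilon> w a (r *\<^sub>R b) = of_real r * csf_herm \<epsilon> w a b"
  "csf_herm \<epsilon> w 0 b = 0" "csf_herm \<epsilon> w a 0 = 0"
  by (simp_all add: csf_herm_def algebra_simps)

lemma cnj_csf_herm: "cnj (csf_herm \<epsilon> w a b) = csf_herm \<epsilon> w b a"
  by (simp add: csf_herm_def cnj_herm csf_inv_real mult.commute)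

text \<open>After clearing denominators the claim is
  \<open>|a|^2 (1 + s |w|^2) - s |herm a w|^2 > 0\<close> with \<open>s = sgn \<epsilon>\<close>.
  For \<open>s \<ge> 0\<close> it is Cauchy-Schwarz with \<open>|a|^2\<close> to spare; for
  \<open>s < 0\<close> the second term has the favourable sign and the domain makes the first one
  positive.\<close>

lemma csf_herm_pos:
  assumes "w \<in> csf_domain \<epsilon>" "a \<noteq> 0"
  shows "Re (csf_herm \<epsilon> w a a) > 0"
proof -
  define N where "N = 1 + sgn \<epsilon> * (norm w)\<^sup>2"
  have N: "N > 0" using assms by (simp add: csf_domain_def N_def)
  have a: "(norm a)\<^sup>2 > 0" using assms by simp
  have haw: "herm a w * herm w a = of_real ((cmod (herm a w))\<^sup>2)"
    by (metis cnj_herm complex_norm_square)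
  \<comment> \<open>Lagrange's identity in dimension 2: the defect in Cauchy-Schwarz is the squared
    modulus of a determinant.\<close>
  have "herm a a * herm w w - herm a w * herm w a
      = (a $ 1 * w $ 2 - a $ 2 * w $ 1) * cnj (a $ 1 * w $ 2 - a $ 2 * w $ 1)"
    by (simp add: herm_2 algebra_simps)
  then have "complex_of_real ((norm a)\<^sup>2 * (norm w)\<^sup>2 - (cmod (herm a w))\<^sup>2)
      = of_real ((cmod (a $ 1 * w $ 2 - a $ 2 * w $ 1))\<^sup>2)"
    unfolding haw herm_self by (simp only: complex_norm_square of_real_mult of_real_diff)
  then have cs: "(norm a)\<^sup>2 * (norm w)\<^sup>2 - (cmod (herm a w))\<^sup>2 \<ge> 0"
    using of_real_eq_iff by (metis zero_le_power2)
  have "csf_herm \<epsilon> w a a = of_real (csf_weight \<epsilon>) * (of_real ((norm a)\<^sup>2) * of_real (inverse N)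
      - of_real (sgn \<epsilon>) * (herm a w * herm w a) * (of_real (inverse N))\<^sup>2)"
    unfolding csf_herm_def csf_inv_real N_def herm_self[of a] by (simp add: mult.assoc)
  also have "\<dots> = of_real (csf_weight \<epsilon> * ((norm a)\<^sup>2 * inverse N
      - sgn \<epsilon> * (cmod (herm a w))\<^sup>2 * (inverse N)\<^sup>2))"
    unfolding haw by simp
  finally have "Re (csf_herm \<epsilon> w a a) = csf_weight \<epsilon> * ((norm a)\<^sup>2 * inverse N
      - sgn \<epsilon> * (cmod (herm a w))\<^sup>2 * (inverse N)\<^sup>2)" by (simp only: Re_complex_of_real)
  also have "(norm a)\<^sup>2 * inverse N - sgn \<epsilon> * (cmod (herm a w))\<^sup>2 * (inverse N)\<^sup>2
      = ((norm a)\<^sup>2 * N - sgn \<epsilon> * (cmod (herm a w))\<^sup>2) / N\<^sup>2"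
    using N by (simp add: field_simps power2_eq_square)
  finally have e: "Re (csf_herm \<epsilon> w a a) = csf_weight \<epsilon> * (((norm a)\<^sup>2 * N - sgn \<epsilon> * (cmod (herm a w))\<^sup>2) / N\<^sup>2)" .
  have "(norm a)\<^sup>2 * N - sgn \<epsilon> * (cmod (herm a w))\<^sup>2 > 0"
  proof (cases "\<epsilon> \<ge> 0")
    case True
    then have "sgn \<epsilon> * ((norm a)\<^sup>2 * (norm w)\<^sup>2 - (cmod (herm a w))\<^sup>2) \<ge> 0"
      using cs by (intro mult_nonneg_nonneg) (simp_all add: sgn_if)
    with a have "(norm a)\<^sup>2 + sgn \<epsilon> * ((norm a)\<^sup>2 * (norm w)\<^sup>2 - (cmod (herm a w))\<^sup>2) > 0"
      by (rule add_pos_nonneg)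
    then show ?thesis by (simp add: N_def algebra_simps)
  next
    case False
    then have "(norm a)\<^sup>2 * N > 0" using a N by simp
    then show ?thesis using False by (simp add: add_pos_nonneg)
  qed
  then show ?thesis unfolding e using N by (simp add: csf_weight_def)
qed

section \<open>The Levi-Civita connection of the space forms\<close>

lemma riesz_eqI:
  fixes b :: "'e::real_vector \<Rightarrow> 'e \<Rightarrow> real"
  assumes "\<And>w. b z w = \<alpha> w" "\<And>z z' w. b (z - z') w = b z w - b z' w" "\<And>z. b z z = 0 \<Longrightarrow> z = 0"
  shows "riesz b \<alpha> = z"
  unfolding riesz_def
proof (rule the_equality)
  fix z' assume "\<forall>w. b z' w = \<alpha> w"
  then have "b (z' - z) (z' - z) = 0" using assms(1,2) by simp
  then show "z' = z" using assms(3) by fastforce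
qed (use assms in blast)

text \<open>The Christoffel symbols of the space form, see \<open>christoffel_csf_metric\<close>.
  They are complex bilinear because the metric is Kaehler and the coordinates are
  holomorphic.\<close>

definition csf_gamma :: "real \<Rightarrow> complex^2 \<Rightarrow> complex^2 \<Rightarrow> complex^2 \<Rightarrow> complex^2" where
  "csf_gamma \<epsilon> w a b = (- of_real (sgn \<epsilon>) * csf_inv \<epsilon> w) *s (herm a w *s b + herm b w *s a)"

lemma csf_gamma_commute: "csf_gamma \<epsilon> w a b = csf_gamma \<epsilon> w b a"
  by (simp add: csf_gamma_def add.commute)

lemma csf_gamma_linear [simp]:
  "csf_gamma \<epsilon> w (a + a') b = csf_gamma \<epsilon> w a b + csf_gamma \<epsilon> w a' b"
  "csf_gamma \<epsilon> w a (b + b') = csf_gamma \<epsilon> w a b + csf_gamma \<epsilon> w a b'"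
  "csf_gamma \<epsilon> w (c *s a) b = c *s csf_gamma \<epsilon> w a b"
  "csf_gamma \<epsilon> w a (c *s b) = c *s csf_gamma \<epsilon> w a b"
  "csf_gamma \<epsilon> w (r *\<^sub>R a) b = r *\<^sub>R csf_gamma \<epsilon> w a b"
  "csf_gamma \<epsilon> w a (r *\<^sub>R b) = r *\<^sub>R csf_gamma \<epsilon> w a b"
  by (simp_all add: csf_gamma_def vec_eq_iff algebra_simps scaleR_conv_of_real[where 'a = complex])

lemma has_derivative_csf_inv:
  assumes "w x \<in> csf_domain \<epsilon>" "(w has_derivative w') (at x)"
  shows "((\<lambda>x. csf_inv \<epsilon> (w x)) has_derivative
    (\<lambda>v. - of_real (sgn \<epsilon>) * (herm (w x) (w' v) + herm (w' v) (w x)) * (csf_inv \<epsilon> (w x))\<^sup>2)) (at x)"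
proof -
  have "((\<lambda>x. 1 + of_real (sgn \<epsilon>) * herm (w x) (w x)) has_derivative
      (\<lambda>v. of_real (sgn \<epsilon>) * (herm (w x) (w' v) + herm (w' v) (w x)))) (at x)"
    by (auto intro!: derivative_eq_intros has_derivative_herm assms(2))
  from Deriv.has_derivative_inverse[OF csf_domain_nonzero[OF assms(1)] this]
  show ?thesis unfolding csf_inv_def
    by (rule has_derivative_eq_rhs) (simp add: fun_eq_iff power2_eq_square algebra_simps)
qed

text \<open>Metric compatibility for the whole Hermitian form: derivatives are replaced by covariant
  ones. The real part concerns the metric and the imaginary part the Kaehler form, so both are
  handled at once.\<close>

lemma has_derivative_csf_herm:
  assumes "w x \<in> csf_domain \<epsilon>" "(w has_derivative w') (at x)"
    "(a has_derivative a') (at x)" "(b has_derivative b') (at x)"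
  shows "((\<lambda>x. csf_herm \<epsilon> (w x) (a x) (b x)) has_derivative
    (\<lambda>v. csf_herm \<epsilon> (w x) (a' v + csf_gamma \<epsilon> (w x) (w' v) (a x)) (b x)
        + csf_herm \<epsilon> (w x) (a x) (b' v + csf_gamma \<epsilon> (w x) (w' v) (b x)))) (at x)"
proof -
  note i = has_derivative_csf_inv[OF assms(1,2)]
  have "((\<lambda>x. csf_herm \<epsilon> (w x) (a x) (b x)) has_derivative
    (\<lambda>v. of_real (csf_weight \<epsilon>) *
     (herm (a x) (b x) * (- of_real (sgn \<epsilon>) * (herm (w x) (w' v) + herm (w' v) (w x)) * (csf_inv \<epsilon> (w x))\<^sup>2)
      + (herm (a x) (b' v) + herm (a' v) (b x)) * csf_inv \<epsilon> (w x)
      - of_real (sgn \<epsilon>) * ((herm (a x) (w x) * herm (w x) (b x)) *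
          (2 * csf_inv \<epsilon> (w x) * (- of_real (sgn \<epsilon>) * (herm (w x) (w' v) + herm (w' v) (w x)) * (csf_inv \<epsilon> (w x))\<^sup>2))
        + (herm (a x) (w x) * (herm (w x) (b' v) + herm (w' v) (b x))
           + (herm (a x) (w' v) + herm (a' v) (w x)) * herm (w x) (b x)) * (csf_inv \<epsilon> (w x))\<^sup>2)))) (at x)"
    unfolding csf_herm_def power2_eq_square
    by (rule derivative_eq_intros has_derivative_herm assms i refl)+ (simp add: fun_eq_iff power2_eq_square algebra_simps)
  then show ?thesis
    by (rule has_derivative_eq_rhs)
       (simp add: fun_eq_iff csf_herm_def csf_gamma_def csf_inv_real cnj_herm
          power2_eq_square power3_eq_cube algebra_simps)
qed

lemma smooth_on_csf_inv [smooth_intros]: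
  assumes "smooth_on S w" "w ` S \<subseteq> csf_domain \<epsilon>"
  shows "smooth_on S (\<lambda>x. csf_inv \<epsilon> (w x))"
  unfolding csf_inv_def
  by (intro smooth_intros assms smooth_on_open[OF assms(1)]) (use assms csf_domain_nonzero in blast)

lemma smooth_on_csf_herm [smooth_intros]:
  assumes "smooth_on S w" "smooth_on S a" "smooth_on S b" "w ` S \<subseteq> csf_domain \<epsilon>"
  shows "smooth_on S (\<lambda>x. csf_herm \<epsilon> (w x) (a x) (b x))"
  unfolding csf_herm_def by (intro smooth_intros assms smooth_on_open[OF assms(1)])

lemma smooth_on_csf_gamma [smooth_intros]:
  assumes "smooth_on S w" "smooth_on S a" "smooth_on S b" "w ` S \<subseteq> csf_domain \<epsilon>"
  shows "smooth_on S (\<lambda>x. csf_gamma \<epsilon> (w x) (a x) (b x))"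
  unfolding csf_gamma_def by (intro smooth_intros assms smooth_on_open[OF assms(1)])

lemma D_csf_metric:
  assumes "w \<in> csf_domain \<epsilon>"
  shows "D (\<lambda>y. csf_metric \<epsilon> y a b) w v
    = Re (csf_herm \<epsilon> w (csf_gamma \<epsilon> w v a) b) + Re (csf_herm \<epsilon> w a (csf_gamma \<epsilon> w v b))"
proof -
  have "D (\<lambda>y. csf_metric \<epsilon> y a b) w = D (\<lambda>y. Re (csf_herm \<epsilon> y a b)) w"
    by (rule D_cong_open[OF open_csf_domain assms]) (rule csf_metric_eq)
  also have "\<dots> = (\<lambda>v. Re (csf_herm \<epsilon> w (0 + csf_gamma \<epsilon> w v a) b + csf_herm \<epsilon> w a (0 + csf_gamma \<epsilon> w v b)))"
    by (rule D_eqI, rule bounded_linear.has_derivative[OF bounded_linear_Re],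
        rule has_derivative_csf_herm[where w = "\<lambda>y. y" and a = "\<lambda>y. a" and b = "\<lambda>y. b"])
       (auto intro: assms derivative_intros)
  finally show ?thesis by simp
qed

text \<open>By \<open>D_csf_metric\<close> the three terms of the Koszul formula are products with
  \<open>csf_gamma\<close>; its symmetry cancels all of them except twice the wanted
  product.\<close>

lemma christoffel_csf_metric:
  assumes "w \<in> csf_domain \<epsilon>"
  shows "christoffel (csf_metric \<epsilon>) w a b = csf_gamma \<epsilon> w a b"
  unfolding christoffel_def
proof (rule riesz_eqI)
  have *: "Re (csf_herm \<epsilon> w c d) = Re (csf_herm \<epsilon> w d c)" for c d
    by (metis cnj_csf_herm complex_cnj cnj.simps(1))
  show "csf_metric \<epsilon> w (csf_gamma \<epsilon> w a b) c
    = (D (\<lambda>y. csf_metric \<epsilon> y b c) w a + D (\<lambda>y. csf_metric \<epsilon> y a c) w b - D (\<lambda>y. csf_metric \<epsilon> y a b) w c) / 2" for c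
    using assms *[of b "csf_gamma \<epsilon> w a c"] *[of a "csf_gamma \<epsilon> w b c"]
    by (simp add: D_csf_metric csf_metric_eq csf_gamma_commute[of _ _ c] csf_gamma_commute[of _ _ b a])
  show "csf_metric \<epsilon> w (z - z') c = csf_metric \<epsilon> w z c - csf_metric \<epsilon> w z' c" for z z' c
    using assms by (simp add: csf_metric_eq)
  show "z = 0" if "csf_metric \<epsilon> w z z = 0" for z
    using csf_herm_pos[OF assms, of z] that assms by (auto simp: csf_metric_eq)
qed

section \<open>Complex frames in dimension 2 and rules for computing derivatives\<close>

definition det2 :: "complex^2 \<Rightarrow> complex^2 \<Rightarrow> complex" where
  "det2 a b = a $ 1 * b $ 2 - a $ 2 * b $ 1"

lemma cramer2:
  assumes "det2 a b \<noteq> 0"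
  shows "v = (det2 v b / det2 a b) *s a + (det2 a v / det2 a b) *s b"
proof -
  have "det2 a b *s v = det2 v b *s a + det2 a v *s b"
    by (simp add: vec_eq_iff forall_2 det2_def algebra_simps)
  then have "inverse (det2 a b) *s (det2 a b *s v) = inverse (det2 a b) *s (det2 v b *s a + det2 a v *s b)"
    by simp
  then show ?thesis using assms by (simp add: divide_inverse mult.commute vector_add_ldistrib)
qed

lemma det2_combination [simp]:
  "det2 (x *s a + y *s b) b = x * det2 a b" "det2 a (x *s a + y *s b) = y * det2 a b"
  by (simp_all add: det2_def algebra_simps)

lemma smooth_on_det2 [smooth_intros]:
  "smooth_on S a \<Longrightarrow> smooth_on S b \<Longrightarrow> smooth_on S (\<lambda>x. det2 (a x) (b x))"
  unfolding det2_def by (intro smooth_intros)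

lemma D_linear:
  "bounded_linear T \<Longrightarrow> smooth_on S f \<Longrightarrow> x \<in> S \<Longrightarrow> D (\<lambda>x. T (f x)) x v = T (D f x v)"
  by (simp add: D_eqI[OF bounded_linear.has_derivative[OF _ smooth_on_has_derivative]])

lemma D_bilinear:
  "bounded_bilinear B \<Longrightarrow> smooth_on S f \<Longrightarrow> smooth_on S g \<Longrightarrow> x \<in> S \<Longrightarrow>
     D (\<lambda>x. B (f x) (g x)) x v = B (f x) (D g x v) + B (D f x v) (g x)"
  by (simp add: D_eqI[OF bounded_bilinear.FDERIV[OF _ smooth_on_has_derivative smooth_on_has_derivative]])

lemma D_const: "D (\<lambda>x. c) x v = 0"
  by (simp add: frechet_derivative_const)

lemma D_add:
  "smooth_on S f \<Longrightarrow> smooth_on S g \<Longrightarrow> x \<in> S \<Longrightarrow> D (\<lambda>x. f x + g x) x v = D f x v + D g x v"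
  by (simp add: D_eqI[OF has_derivative_add[OF smooth_on_has_derivative smooth_on_has_derivative]])

lemma D_diff:
  "smooth_on S f \<Longrightarrow> smooth_on S g \<Longrightarrow> x \<in> S \<Longrightarrow> D (\<lambda>x. f x - g x) x v = D f x v - D g x v"
  by (simp add: D_eqI[OF has_derivative_diff[OF smooth_on_has_derivative smooth_on_has_derivative]])

lemmas D_vscale = D_bilinear[OF bounded_bilinear_vscale]
lemmas D_mult = D_bilinear[OF bounded_bilinear_mult]
lemmas D_scaleR = D_bilinear[OF bounded_bilinear_scaleR]
lemmas D_herm = D_bilinear[OF bounded_bilinear_herm]
lemmas D_Re = D_linear[OF bounded_linear_Re]
lemmas D_Im = D_linear[OF bounded_linear_Im]

lemma D_power2:
  fixes f :: "'a::real_normed_vector \<Rightarrow> 'b::real_normed_field"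
  shows "smooth_on S f \<Longrightarrow> x \<in> S \<Longrightarrow> D (\<lambda>x. (f x)\<^sup>2) x v = 2 * f x * D f x v"
  unfolding power2_eq_square using D_mult[of S f f x v] by (simp add: algebra_simps)

abbreviation d1 :: "(real \<times> real \<Rightarrow> 'b::real_normed_vector) \<Rightarrow> real \<times> real \<Rightarrow> 'b" where
  "d1 f \<equiv> (\<lambda>x. D f x (1, 0))"

abbreviation d2 :: "(real \<times> real \<Rightarrow> 'b::real_normed_vector) \<Rightarrow> real \<times> real \<Rightarrow> 'b" where
  "d2 f \<equiv> (\<lambda>x. D f x (0, 1))"

lemma D_split:
  assumes "smooth_on U f" "x \<in> U"
  shows "D f x v = fst v *\<^sub>R d1 f x + snd v *\<^sub>R d2 f x"
proof -
  have "D f x (fst v *\<^sub>R (1, 0) + snd v *\<^sub>R (0, 1)) = fst v *\<^sub>R d1 f x + snd v *\<^sub>R d2 f x"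
    by (simp only: linear_add[OF linear_D[OF assms]] linear_scale[OF linear_D[OF assms]])
  then show ?thesis by simp
qed

lemma D_cong_on: "open S \<Longrightarrow> (\<And>y. y \<in> S \<Longrightarrow> f y = g y) \<Longrightarrow> x \<in> S \<Longrightarrow> D f x v = D g x v"
  by (simp add: D_cong_open[of S x f g])

section \<open>Structure equations of a Lagrangian immersion\<close>

text \<open>The ambient covariant derivative along \<open>f\<close> of the image of the constant
  field \<open>v\<close>. Unlike \<open>second_fundamental_form\<close> it keeps the tangential
  part.\<close>

definition hess :: "real \<Rightarrow> (real \<times> real \<Rightarrow> complex^2) \<Rightarrow> real \<times> real \<Rightarrow>
    real \<times> real \<Rightarrow> real \<times> real \<Rightarrow> complex^2" where
  "hess \<epsilon> f x u v = D (\<lambda>y. D f y v) x u + csf_gamma \<epsilon> (f x) (D f x u) (D f x v)"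

locale lagrangian_patch =
  fixes \<epsilon> :: real and U :: "(real \<times> real) set" and f :: "real \<times> real \<Rightarrow> complex^2"
  assumes smooth: "smooth_on U f"
    and domain: "f ` U \<subseteq> csf_domain \<epsilon>"
    and immersion: "x \<in> U \<Longrightarrow> inj (D f x)"
    and lagrangian: "x \<in> U \<Longrightarrow> csf_metric \<epsilon> (f x) (D f x u) (J (D f x v)) = 0"
begin

abbreviation "f1 \<equiv> d1 f"
abbreviation "f2 \<equiv> d2 f"

definition "coeff1 v x = det2 v (f2 x) / det2 (f1 x) (f2 x)"
definition "coeff2 v x = det2 (f1 x) v / det2 (f1 x) (f2 x)"

text \<open>Coefficients of the covariant second derivatives in the complex frame \<open>f1\<close>,
  \<open>f2\<close>. Since \<open>J\<close> maps tangent vectors to normal ones, the real parts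
  belong to the connection of the surface and the imaginary parts to its second fundamental
  form.\<close>

definition "A1 x = coeff1 (hess \<epsilon> f x (1,0) (1,0)) x"
definition "A2 x = coeff2 (hess \<epsilon> f x (1,0) (1,0)) x"
definition "B1 x = coeff1 (hess \<epsilon> f x (1,0) (0,1)) x"
definition "B2 x = coeff2 (hess \<epsilon> f x (1,0) (0,1)) x"
definition "C1 x = coeff1 (hess \<epsilon> f x (0,1) (0,1)) x"
definition "C2 x = coeff2 (hess \<epsilon> f x (0,1) (0,1)) x"

text \<open>The ambient Christoffel term of the frame vectors \<open>f_i\<close>, \<open>f_j\<close>
  is \<open>- (\<eta>_i f_j + \<eta>_j f_i)\<close>, so these two functions translate between
  covariant and ordinary second derivatives.\<close>

definition "\<eta>1 x = of_real (sgn \<epsilon>) * csf_inv \<epsilon> (f x) * herm (f1 x) (f x)"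
definition "\<eta>2 x = of_real (sgn \<epsilon>) * csf_inv \<epsilon> (f x) * herm (f2 x) (f x)"

definition "g11 x = Re (csf_herm \<epsilon> (f x) (f1 x) (f1 x))"
definition "g12 x = Re (csf_herm \<epsilon> (f x) (f1 x) (f2 x))"
definition "g22 x = Re (csf_herm \<epsilon> (f x) (f2 x) (f2 x))"

lemma open_U: "open U"
  using smooth smooth_on_open by blast

lemma in_domain: "x \<in> U \<Longrightarrow> f x \<in> csf_domain \<epsilon>"
  using domain by blast

text \<open>The imaginary part of the Hermitian product of \<open>a\<close> and \<open>b\<close> is
  the metric product of \<open>a\<close> and \<open>J b\<close>; Lagrangian therefore means that
  tangent vectors have real Hermitian products.\<close>

lemma csf_herm_tangent:
  assumes "x \<in> U"
  shows "Im (csf_herm \<epsilon> (f x) (D f x u) (D f x v)) = 0"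
  using lagrangian[OF assms, of u v] in_domain[OF assms] by (simp add: csf_metric_eq)

lemma herm_frame:
  assumes "x \<in> U"
  shows "csf_herm \<epsilon> (f x) (f1 x) (f1 x) = of_real (g11 x)"
    "csf_herm \<epsilon> (f x) (f1 x) (f2 x) = of_real (g12 x)"
    "csf_herm \<epsilon> (f x) (f2 x) (f1 x) = of_real (g12 x)"
    "csf_herm \<epsilon> (f x) (f2 x) (f2 x) = of_real (g22 x)"
proof -
  show 2: "csf_herm \<epsilon> (f x) (f1 x) (f2 x) = of_real (g12 x)"
    using csf_herm_tangent[OF assms] by (simp add: complex_eq_iff g12_def)
  show "csf_herm \<epsilon> (f x) (f2 x) (f1 x) = of_real (g12 x)"
    using 2 by (metis cnj_csf_herm complex_cnj_complex_of_real)
qed (use csf_herm_tangent[OF assms] in \<open>simp_all add: complex_eq_iff g11_def g22_def\<close>)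

lemma frame_independent:
  assumes x: "x \<in> U" and r: "a *\<^sub>R f1 x + b *\<^sub>R f2 x = 0"
  shows "a = 0 \<and> b = 0"
proof -
  have "D f x (a, b) = D f x (0, 0)"
    using r by (simp add: D_split[OF smooth x, of "(a, b)"] D_split[OF smooth x, of "(0, 0)"])
  then show ?thesis using immersion[OF x] by (simp add: inj_eq)
qed

lemma g11_pos: "x \<in> U \<Longrightarrow> g11 x > 0"
  unfolding g11_def by (rule csf_herm_pos[OF in_domain]) (use frame_independent[of x 1 0] in auto)

lemma gram_pos:
  assumes x: "x \<in> U"
  shows "g11 x * g22 x - (g12 x)\<^sup>2 > 0"
proof -
  \<comment> \<open>This vector is orthogonal to \<open>f1\<close>, and its squared length is
    \<open>g11\<close> times the Gram determinant.\<close>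
  let ?v = "(- g12 x) *\<^sub>R f1 x + g11 x *\<^sub>R f2 x"
  have "?v \<noteq> 0" using frame_independent[OF x, of "- g12 x" "g11 x"] g11_pos[OF x] by force
  then have "Re (csf_herm \<epsilon> (f x) ?v ?v) > 0" using csf_herm_pos[OF in_domain[OF x]] by blast
  also have "csf_herm \<epsilon> (f x) ?v ?v = of_real (g11 x * (g11 x * g22 x - (g12 x)\<^sup>2))"
    by (simp add: herm_frame[OF x] power2_eq_square algebra_simps)
  finally show ?thesis using g11_pos[OF x] by (simp only: Re_complex_of_real zero_less_mult_pos)
qed

text \<open>In a complex dependence \<open>f2 = c f1\<close> the factor \<open>c\<close> would be
  real, because the Hermitian products with \<open>f1\<close> are real, contradicting the immersion
  property. Here the Lagrangian condition turns a real frame into a complex one.\<close>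

lemma det_nonzero:
  assumes x: "x \<in> U"
  shows "det2 (f1 x) (f2 x) \<noteq> 0"
proof
  assume d: "det2 (f1 x) (f2 x) = 0"
  have n: "f1 x \<noteq> 0" using frame_independent[OF x, of 1 0] by auto
  obtain c where c: "f2 x = c *s f1 x"
  proof (cases "f1 x $ 1 = 0")
    case True
    then have "f1 x $ 2 \<noteq> 0" using n by (simp add: vec_eq_iff forall_2)
    then have "f2 x = (f2 x $ 2 / f1 x $ 2) *s f1 x"
      using d True by (simp add: vec_eq_iff forall_2 det2_def)
    then show ?thesis using that by blast
  next
    case False
    then have "f2 x = (f2 x $ 1 / f1 x $ 1) *s f1 x"
      using d by (simp add: vec_eq_iff forall_2 det2_def field_simps)
    then show ?thesis using that by blast
  qed
  have "c * of_real (g11 x) = of_real (g12 x)"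
    using herm_frame(1)[OF x] herm_frame(3)[OF x] unfolding c by simp
  then have "Im c = 0" using g11_pos[OF x] by (auto simp: complex_eq_iff)
  then have "f2 x = Re c *\<^sub>R f1 x"
    unfolding c by (simp add: vec_eq_iff complex_eq_iff)
  then show False using frame_independent[OF x, of "Re c" "-1"] by simp
qed

lemma smooth_hess: "smooth_on U (\<lambda>x. hess \<epsilon> f x u v)"
  unfolding hess_def by (intro smooth_intros smooth domain)

lemma smooth_coeffs [simp]:
  "smooth_on U f1" "smooth_on U f2"
  "smooth_on U A1" "smooth_on U A2" "smooth_on U B1" "smooth_on U B2" "smooth_on U C1" "smooth_on U C2"
  "smooth_on U \<eta>1" "smooth_on U \<eta>2" "smooth_on U g11" "smooth_on U g12" "smooth_on U g22"
  unfolding A1_def A2_def B1_def B2_def C1_def C2_def \<eta>1_def \<eta>2_def g11_def g12_def g22_def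
    coeff1_def coeff2_def
  by (intro smooth_intros smooth smooth_hess domain open_U det_nonzero; assumption)+

lemma coeff_decompose: "x \<in> U \<Longrightarrow> v = coeff1 v x *s f1 x + coeff2 v x *s f2 x"
  unfolding coeff1_def coeff2_def using cramer2 det_nonzero by blast

lemma complex_frame_independent:
  assumes "x \<in> U" "X *s f1 x + Y *s f2 x = 0"
  shows "X = 0 \<and> Y = 0"
  using det2_combination[where a = "f1 x" and b = "f2 x" and x = X and y = Y] det_nonzero[OF assms(1)] assms(2)
  by (simp add: det2_def)

lemma hess_frame:
  assumes "x \<in> U"
  shows "hess \<epsilon> f x (1,0) (1,0) = A1 x *s f1 x + A2 x *s f2 x"
    "hess \<epsilon> f x (1,0) (0,1) = B1 x *s f1 x + B2 x *s f2 x"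
    "hess \<epsilon> f x (0,1) (0,1) = C1 x *s f1 x + C2 x *s f2 x"
  unfolding A1_def A2_def B1_def B2_def C1_def C2_def by (rule coeff_decompose[OF assms])+

lemma hess_commute: "x \<in> U \<Longrightarrow> hess \<epsilon> f x u v = hess \<epsilon> f x v u"
  unfolding hess_def by (simp only: D_D_commute[OF smooth, of x u v] csf_gamma_commute[of _ _ "D f x u"])

lemma gamma_frame:
  "csf_gamma \<epsilon> (f x) (f1 x) (f1 x) = - (2 * \<eta>1 x) *s f1 x"
  "csf_gamma \<epsilon> (f x) (f1 x) (f2 x) = - (\<eta>1 x *s f2 x + \<eta>2 x *s f1 x)"
  "csf_gamma \<epsilon> (f x) (f2 x) (f2 x) = - (2 * \<eta>2 x) *s f2 x"
  by (simp_all add: csf_gamma_def \<eta>1_def \<eta>2_def vec_eq_iff algebra_simps)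

lemma second_derivatives:
  assumes "x \<in> U"
  shows "d1 f1 x = (A1 x + 2 * \<eta>1 x) *s f1 x + A2 x *s f2 x"
    "d1 f2 x = (B1 x + \<eta>2 x) *s f1 x + (B2 x + \<eta>1 x) *s f2 x"
    "d2 f1 x = (B1 x + \<eta>2 x) *s f1 x + (B2 x + \<eta>1 x) *s f2 x"
    "d2 f2 x = C1 x *s f1 x + (C2 x + 2 * \<eta>2 x) *s f2 x"
proof -
  show *: "d1 f2 x = (B1 x + \<eta>2 x) *s f1 x + (B2 x + \<eta>1 x) *s f2 x"
    using hess_frame(2)[OF assms] unfolding hess_def gamma_frame
    by (simp add: vec_eq_iff algebra_simps)
  show "d2 f1 x = (B1 x + \<eta>2 x) *s f1 x + (B2 x + \<eta>1 x) *s f2 x"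
    using * D_D_commute[OF smooth assms, of "(1,0)" "(0,1)"] by simp
qed (use hess_frame[OF assms] in \<open>simp_all add: hess_def gamma_frame vec_eq_iff algebra_simps\<close>)

lemma D_metric_herm:
  assumes x: "x \<in> U"
  shows "D (\<lambda>x. csf_herm \<epsilon> (f x) (D f x u) (D f x v)) x w
    = csf_herm \<epsilon> (f x) (hess \<epsilon> f x w u) (D f x v) + csf_herm \<epsilon> (f x) (D f x u) (hess \<epsilon> f x w v)"
  unfolding hess_def
  by (subst D_eqI[OF has_derivative_csf_herm]) (auto intro!: smooth_on_has_derivative[of U] smooth smooth_on_D in_domain x)

text \<open>The real part of \<open>D_metric_herm\<close> gives the derivatives of the metric. The
  imaginary part of the product of \<open>f1\<close> and \<open>f2\<close> vanishes identically, and
  its derivative is the last identity, from which \<open>T_symmetric\<close> follows.\<close>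

lemma D_metric:
  assumes x: "x \<in> U"
  shows "D g11 x w = 2 * Re (csf_herm \<epsilon> (f x) (hess \<epsilon> f x w (1,0)) (f1 x))"
    "D g22 x w = 2 * Re (csf_herm \<epsilon> (f x) (hess \<epsilon> f x w (0,1)) (f2 x))"
    "D g12 x w = Re (csf_herm \<epsilon> (f x) (hess \<epsilon> f x w (1,0)) (f2 x))
               + Re (csf_herm \<epsilon> (f x) (hess \<epsilon> f x w (0,1)) (f1 x))"
    "Im (csf_herm \<epsilon> (f x) (hess \<epsilon> f x w (1,0)) (f2 x)) = Im (csf_herm \<epsilon> (f x) (hess \<epsilon> f x w (0,1)) (f1 x))"
proof -
  have *: "Re (csf_herm \<epsilon> y a b) = Re (csf_herm \<epsilon> y b a)" "Im (csf_herm \<epsilon> y a b) = - Im (csf_herm \<epsilon> y b a)" for y a b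
    by (metis cnj_csf_herm cnj.sel)+
  have s: "smooth_on U (\<lambda>x. csf_herm \<epsilon> (f x) (D f x u) (D f x v))" for u v
    by (intro smooth_intros smooth domain)
  have re: "D (\<lambda>x. Re (csf_herm \<epsilon> (f x) (D f x u) (D f x v))) x w
    = Re (csf_herm \<epsilon> (f x) (hess \<epsilon> f x w u) (D f x v)) + Re (csf_herm \<epsilon> (f x) (D f x u) (hess \<epsilon> f x w v))" for u v
    by (simp add: D_Re[OF s x] D_metric_herm[OF x])
  show "D g11 x w = 2 * Re (csf_herm \<epsilon> (f x) (hess \<epsilon> f x w (1,0)) (f1 x))"
    "D g22 x w = 2 * Re (csf_herm \<epsilon> (f x) (hess \<epsilon> f x w (0,1)) (f2 x))"
    "D g12 x w = Re (csf_herm \<epsilon> (f x) (hess \<epsilon> f x w (1,0)) (f2 x))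
               + Re (csf_herm \<epsilon> (f x) (hess \<epsilon> f x w (0,1)) (f1 x))"
    unfolding g11_def[abs_def] g12_def[abs_def] g22_def[abs_def] re
    using *(1)[of "f x" "f1 x"] *(1)[of "f x" "f2 x"] by simp_all
  have "D (\<lambda>x. Im (csf_herm \<epsilon> (f x) (D f x (1,0)) (D f x (0,1)))) x w = D (\<lambda>x. 0) x w"
    by (rule D_cong_on[OF open_U _ x]) (rule csf_herm_tangent)
  then show "Im (csf_herm \<epsilon> (f x) (hess \<epsilon> f x w (1,0)) (f2 x)) = Im (csf_herm \<epsilon> (f x) (hess \<epsilon> f x w (0,1)) (f1 x))"
    by (simp add: D_Im[OF s x] D_metric_herm[OF x] D_const *(2)[of "f x" "f1 x"])
qed

lemma D_metric_frame:
  assumes x: "x \<in> U"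
  shows "d1 g11 x = 2 * (Re (A1 x) * g11 x + Re (A2 x) * g12 x)"
    "d2 g11 x = 2 * (Re (B1 x) * g11 x + Re (B2 x) * g12 x)"
    "d1 g22 x = 2 * (Re (B1 x) * g12 x + Re (B2 x) * g22 x)"
    "d2 g22 x = 2 * (Re (C1 x) * g12 x + Re (C2 x) * g22 x)"
    "d1 g12 x = Re (A1 x) * g12 x + Re (A2 x) * g22 x + Re (B1 x) * g11 x + Re (B2 x) * g12 x"
    "d2 g12 x = Re (B1 x) * g12 x + Re (B2 x) * g22 x + Re (C1 x) * g11 x + Re (C2 x) * g12 x"
  unfolding D_metric[OF x] hess_commute[OF x, of "(0,1)" "(1,0)"] hess_frame[OF x]
  by (simp_all add: herm_frame[OF x])

text \<open>Total symmetry of the cubic form \<open>\<langle>h(X, Y), J Z\<rangle>\<close> of a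
  Lagrangian immersion, in the two index combinations that the symmetry of the Hessian leaves
  open.\<close>

lemma T_symmetric:
  assumes x: "x \<in> U"
  shows "Im (A1 x) * g12 x + Im (A2 x) * g22 x = Im (B1 x) * g11 x + Im (B2 x) * g12 x"
    "Im (B1 x) * g12 x + Im (B2 x) * g22 x = Im (C1 x) * g11 x + Im (C2 x) * g12 x"
  using D_metric(4)[OF x, of "(1,0)"] D_metric(4)[OF x, of "(0,1)"]
  unfolding hess_commute[OF x, of "(0,1)" "(1,0)"] hess_frame[OF x]
  by (simp_all add: herm_frame[OF x])

text \<open>Here the ambient curvature enters: differentiating \<eta> reproduces the Hermitian
  metric with the factor \<epsilon>, besides terms that are quadratic in \<eta> and the frame
  coefficients.\<close>

lemma D_eta:
  assumes x: "x \<in> U"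
  shows "d1 \<eta>1 x = A1 x * \<eta>1 x + A2 x * \<eta>2 x + \<eta>1 x * \<eta>1 x + \<epsilon> * g11 x"
    "d2 \<eta>1 x = B1 x * \<eta>1 x + B2 x * \<eta>2 x + \<eta>1 x * \<eta>2 x + \<epsilon> * g12 x"
    "d1 \<eta>2 x = B1 x * \<eta>1 x + B2 x * \<eta>2 x + \<eta>1 x * \<eta>2 x + \<epsilon> * g12 x"
    "d2 \<eta>2 x = C1 x * \<eta>1 x + C2 x * \<eta>2 x + \<eta>2 x * \<eta>2 x + \<epsilon> * g22 x"
proof -
  have w: "of_real \<epsilon> * of_real (csf_weight \<epsilon>) = complex_of_real (sgn \<epsilon>)"
    by (simp add: csf_weight_def sgn_if flip: of_real_mult)
  have e: "\<epsilon> * csf_herm \<epsilon> (f x) a b = of_real (sgn \<epsilon>) * (herm a b * csf_inv \<epsilon> (f x)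
      - of_real (sgn \<epsilon>) * herm a (f x) * herm (f x) b * (csf_inv \<epsilon> (f x))\<^sup>2)" for a b
    unfolding csf_herm_def mult.assoc[symmetric] w by simp
  have s: "smooth_on U (\<lambda>x. herm (D f x u) (f x))" for u by (intro smooth_intros smooth)
  have i: "smooth_on U (\<lambda>x. csf_inv \<epsilon> (f x))" by (intro smooth_intros smooth domain)
  have d: "D (\<lambda>x. of_real (sgn \<epsilon>) * csf_inv \<epsilon> (f x) * herm (D f x u) (f x)) x v
    = of_real (sgn \<epsilon>) * csf_inv \<epsilon> (f x) * (herm (D f x u) (D f x v) + herm (D (\<lambda>y. D f y u) x v) (f x))
     - of_real (sgn \<epsilon>) * of_real (sgn \<epsilon>) * (herm (f x) (D f x v) + herm (D f x v) (f x)) * (csf_inv \<epsilon> (f x))\<^sup>2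
       * herm (D f x u) (f x)" for u v
    using D_herm[OF smooth_on_D[OF smooth, of u] smooth x, of v]
    by (simp add: mult.assoc D_mult[OF smooth_on_const[OF open_U] smooth_on_mult[OF i s] x] D_const
        D_mult[OF i s x] D_eqI[OF has_derivative_csf_inv[OF in_domain[OF x] smooth_on_has_derivative[OF smooth x]]])
       (simp add: algebra_simps)
  show "d1 \<eta>1 x = A1 x * \<eta>1 x + A2 x * \<eta>2 x + \<eta>1 x * \<eta>1 x + \<epsilon> * g11 x"
    "d2 \<eta>1 x = B1 x * \<eta>1 x + B2 x * \<eta>2 x + \<eta>1 x * \<eta>2 x + \<epsilon> * g12 x"
    "d1 \<eta>2 x = B1 x * \<eta>1 x + B2 x * \<eta>2 x + \<eta>1 x * \<eta>2 x + \<epsilon> * g12 x"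
    "d2 \<eta>2 x = C1 x * \<eta>1 x + C2 x * \<eta>2 x + \<eta>2 x * \<eta>2 x + \<epsilon> * g22 x"
    unfolding \<eta>1_def[abs_def] \<eta>2_def[abs_def] d second_derivatives[OF x]
    using e[of "f1 x" "f1 x"] e[of "f1 x" "f2 x"] e[of "f2 x" "f1 x"] e[of "f2 x" "f2 x"]
    by (simp_all add: herm_frame[OF x] \<eta>1_def \<eta>2_def power2_eq_square algebra_simps)
qed

text \<open>Third derivatives of \<open>f\<close> commute: the two expressions for
  \<open>d2 (d1 f1)\<close> and those for \<open>d2 (d1 f2)\<close> are compared coefficientwise in
  the complex frame. The \<eta> terms cancel up to \<epsilon> times the metric. Real parts carry the
  Gauss equation, imaginary parts the Codazzi equation.\<close>

lemma integrability:
  assumes x: "x \<in> U"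
  shows "d1 B1 x - d2 A1 x + B2 x * B1 x - A2 x * C1 x = \<epsilon> * g12 x"
    "d1 B2 x - d2 A2 x + B1 x * A2 x + B2 x * B2 x - A1 x * B2 x - A2 x * C2 x = - (\<epsilon> * g11 x)"
    "d1 C1 x - d2 B1 x + C1 x * A1 x + C2 x * B1 x - B1 x * B1 x - B2 x * C1 x = \<epsilon> * g22 x"
    "d1 C2 x - d2 B2 x + C1 x * A2 x - B1 x * B2 x = - (\<epsilon> * g12 x)"
proof -
  note cong = D_cong_on[OF open_U _ x]
  note rules = D_add[of U, OF _ _ x] D_vscale[of U, OF _ _ x] D_mult[of U, OF _ _ x] D_const
  note sm = smooth_on_add smooth_on_vscale smooth_on_mult smooth_on_const[OF open_U]
  have comm: "D (\<lambda>y. D (\<lambda>z. D f z u) y v) x w = D (\<lambda>y. D (\<lambda>z. D f z u) y w) x v" for u v w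
    by (rule D_D_commute[OF smooth_on_D[OF smooth] x])
  have "D (\<lambda>y. (A1 y + 2 * \<eta>1 y) *s f1 y + A2 y *s f2 y) x (0,1)
      = D (\<lambda>y. (B1 y + \<eta>2 y) *s f1 y + (B2 y + \<eta>1 y) *s f2 y) x (1,0)"
    using comm[of "(1,0)" "(0,1)" "(1,0)"]
    by (simp only: cong[OF second_derivatives(1), symmetric] cong[OF second_derivatives(3), symmetric])
  then have e1: "(d2 A1 x + 2 * d2 \<eta>1 x) *s f1 x + (A1 x + 2 * \<eta>1 x) *s d2 f1 x + d2 A2 x *s f2 x + A2 x *s d2 f2 x
    = (d1 B1 x + d1 \<eta>2 x) *s f1 x + (B1 x + \<eta>2 x) *s d1 f1 x + (d1 B2 x + d1 \<eta>1 x) *s f2 x + (B2 x + \<eta>1 x) *s d1 f2 x"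
    by (simp add: rules sm algebra_simps)
  have "D (\<lambda>y. (B1 y + \<eta>2 y) *s f1 y + (B2 y + \<eta>1 y) *s f2 y) x (0,1)
      = D (\<lambda>y. C1 y *s f1 y + (C2 y + 2 * \<eta>2 y) *s f2 y) x (1,0)"
    using comm[of "(0,1)" "(0,1)" "(1,0)"]
    by (simp only: cong[OF second_derivatives(2), symmetric] cong[OF second_derivatives(4), symmetric])
  then have e2: "(d2 B1 x + d2 \<eta>2 x) *s f1 x + (B1 x + \<eta>2 x) *s d2 f1 x + (d2 B2 x + d2 \<eta>1 x) *s f2 x + (B2 x + \<eta>1 x) *s d2 f2 x
    = d1 C1 x *s f1 x + C1 x *s d1 f1 x + (d1 C2 x + 2 * d1 \<eta>2 x) *s f2 x + (C2 x + 2 * \<eta>2 x) *s d1 f2 x"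
    by (simp add: rules sm algebra_simps)
  have "(d1 B1 x - d2 A1 x + B2 x * B1 x - A2 x * C1 x - \<epsilon> * g12 x) *s f1 x
      + (d1 B2 x - d2 A2 x + B1 x * A2 x + B2 x * B2 x - A1 x * B2 x - A2 x * C2 x + \<epsilon> * g11 x) *s f2 x = 0"
    using e1 unfolding second_derivatives[OF x] D_eta[OF x]
    by (simp add: vec_eq_iff algebra_simps)
  from complex_frame_independent[OF x this]
  show "d1 B1 x - d2 A1 x + B2 x * B1 x - A2 x * C1 x = \<epsilon> * g12 x"
    "d1 B2 x - d2 A2 x + B1 x * A2 x + B2 x * B2 x - A1 x * B2 x - A2 x * C2 x = - (\<epsilon> * g11 x)"
    by (simp_all add: eq_neg_iff_add_eq_0)
  have "(d1 C1 x - d2 B1 x + C1 x * A1 x + C2 x * B1 x - B1 x * B1 x - B2 x * C1 x - \<epsilon> * g22 x) *s f1 x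
      + (d1 C2 x - d2 B2 x + C1 x * A2 x - B1 x * B2 x + \<epsilon> * g12 x) *s f2 x = 0"
    using e2 unfolding second_derivatives[OF x] D_eta[OF x]
    by (simp add: vec_eq_iff algebra_simps)
  from complex_frame_independent[OF x this]
  show "d1 C1 x - d2 B1 x + C1 x * A1 x + C2 x * B1 x - B1 x * B1 x - B2 x * C1 x = \<epsilon> * g22 x"
    "d1 C2 x - d2 B2 x + C1 x * A2 x - B1 x * B2 x = - (\<epsilon> * g12 x)"
    by (simp_all add: eq_neg_iff_add_eq_0)
qed

end

section \<open>Curvatures of a Lagrangian immersion\<close>

context lagrangian_patch
begin

definition "\<Delta> x = g11 x * g22 x - (g12 x)\<^sup>2"

text \<open>Half the trace of the imaginary coefficients over one upper and one lower index. That
  this metric-free expression is \<open>\<langle>H, J v\<rangle>\<close> rests on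
  \<open>T_symmetric\<close> and is stated in \<open>alpha_mean_curvature\<close>.\<close>

definition "\<alpha>1 x = Im (A1 x + B2 x) / 2"
definition "\<alpha>2 x = Im (B1 x + C2 x) / 2"

text \<open>The vector dual to \<alpha>; the mean curvature vector is \<open>J\<close> applied to
  its image under \<open>D f x\<close>.\<close>

definition "a1 x = (g22 x * \<alpha>1 x - g12 x * \<alpha>2 x) / \<Delta> x"
definition "a2 x = (g11 x * \<alpha>2 x - g12 x * \<alpha>1 x) / \<Delta> x"

definition "h2 x = (g22 x * (\<alpha>1 x)\<^sup>2 - 2 * g12 x * \<alpha>1 x * \<alpha>2 x + g11 x * (\<alpha>2 x)\<^sup>2) / \<Delta> x"

lemma Delta_pos: "x \<in> U \<Longrightarrow> \<Delta> x > 0"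
  unfolding \<Delta>_def by (rule gram_pos)

lemma smooth_alpha [simp]: "smooth_on U \<alpha>1" "smooth_on U \<alpha>2" "smooth_on U \<Delta>" "smooth_on U h2"
proof -
  show "smooth_on U \<alpha>1" "smooth_on U \<alpha>2" "smooth_on U \<Delta>"
    unfolding \<alpha>1_def \<alpha>2_def \<Delta>_def by (intro smooth_intros smooth_coeffs open_U; simp)+
  then show "smooth_on U h2" unfolding h2_def
    using Delta_pos by (intro smooth_intros smooth_coeffs open_U) force+
qed

text \<open>The trace of the integrability conditions: in the sum of the first and the fourth the
  products cancel, as in the trace of a commutator, and so do the terms with \<epsilon>.\<close>

lemma alpha_closed:
  assumes x: "x \<in> U"
  shows "d2 \<alpha>1 x = d1 \<alpha>2 x"
proof -
  have s: "smooth_on U (\<lambda>x. Im (A1 x + B2 x))" "smooth_on U (\<lambda>x. Im (B1 x + C2 x))"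
    "smooth_on U (\<lambda>x. A1 x + B2 x)" "smooth_on U (\<lambda>x. B1 x + C2 x)"
    by (intro smooth_intros smooth_coeffs)+
  have *: "D (\<lambda>x. g x / 2) x v = D g x v / 2" if "smooth_on U g" for g :: "_ \<Rightarrow> real" and v
    using D_linear[OF bounded_linear_mult_left that x, of "1/2" v] by simp
  have "(d1 B1 x - d2 A1 x + B2 x * B1 x - A2 x * C1 x) + (d1 C2 x - d2 B2 x + C1 x * A2 x - B1 x * B2 x) = 0"
    by (simp only: integrability(1)[OF x] integrability(4)[OF x]) simp
  then have "d1 B1 x + d1 C2 x = d2 A1 x + d2 B2 x"
    by (simp add: algebra_simps)
  then show ?thesis
    unfolding \<alpha>1_def[abs_def] \<alpha>2_def[abs_def]
    by (simp only: *[OF s(1)] *[OF s(2)] D_Im[OF s(3) x] D_Im[OF s(4) x]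
        D_add[OF smooth_coeffs(3) smooth_coeffs(6) x] D_add[OF smooth_coeffs(5) smooth_coeffs(8) x])
qed

section \<open>Induced metric, second fundamental form and mean curvature in the frame\<close>

abbreviation "G \<equiv> induced_metric (csf_metric \<epsilon>) f"

lemma induced_metric_eq:
  assumes x: "x \<in> U"
  shows "G x u v = fst u * fst v * g11 x + (fst u * snd v + snd u * fst v) * g12 x + snd u * snd v * g22 x"
  unfolding induced_metric_def csf_metric_eq[OF in_domain[OF x]] D_split[OF smooth x, of u] D_split[OF smooth x, of v]
  by (simp add: herm_frame[OF x] algebra_simps)

lemma gram_eq: "x \<in> U \<Longrightarrow> gram G x = \<Delta> x"
  by (simp add: gram_def induced_metric_eq \<Delta>_def)

lemma induced_metric_definite:
  assumes x: "x \<in> U" and z: "G x z z = 0"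
  shows "z = 0"
proof -
  have "D f x z = 0"
    using z csf_herm_pos[OF in_domain[OF x], of "D f x z"]
    unfolding induced_metric_def csf_metric_eq[OF in_domain[OF x]] by fastforce
  moreover have "D f x 0 = 0" using linear_D[OF smooth x] by (rule linear_0)
  ultimately show ?thesis using immersion[OF x] by (metis injD)
qed

lemma riesz_induced_metricI:
  assumes x: "x \<in> U" and "\<And>w. G x z w = \<alpha> w"
  shows "riesz (G x) \<alpha> = z"
  by (rule riesz_eqI)
     (use assms induced_metric_definite[OF x] in \<open>auto simp: induced_metric_eq[OF x] algebra_simps\<close>)

lemma riesz_induced_metric:
  assumes x: "x \<in> U" and "\<And>w. \<alpha> w = fst w * p + snd w * q"
  shows "riesz (G x) \<alpha> = ((g22 x * p - g12 x * q) / \<Delta> x, (g11 x * q - g12 x * p) / \<Delta> x)"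
proof (rule riesz_induced_metricI[OF x])
  fix w
  have d: "\<Delta> x \<noteq> 0" using Delta_pos[OF x] by simp
  have 1: "((g22 x * p - g12 x * q) / \<Delta> x) * g11 x + ((g11 x * q - g12 x * p) / \<Delta> x) * g12 x = p"
    using d by (simp add: field_simps) (simp add: \<Delta>_def power2_eq_square algebra_simps)
  have 2: "((g22 x * p - g12 x * q) / \<Delta> x) * g12 x + ((g11 x * q - g12 x * p) / \<Delta> x) * g22 x = q"
    using d by (simp add: field_simps) (simp add: \<Delta>_def power2_eq_square algebra_simps)
  have "G x (r, s) w = fst w * (r * g11 x + s * g12 x) + snd w * (r * g12 x + s * g22 x)" for r s
    by (simp add: induced_metric_eq[OF x] algebra_simps)
  then show "G x ((g22 x * p - g12 x * q) / \<Delta> x, (g11 x * q - g12 x * p) / \<Delta> x) w = \<alpha> w"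
    unfolding assms(2) using 1 2 by simp
qed

definition "Gamma1 x u v = fst u * fst v * Re (A1 x) + (fst u * snd v + snd u * fst v) * Re (B1 x) + snd u * snd v * Re (C1 x)"
definition "Gamma2 x u v = fst u * fst v * Re (A2 x) + (fst u * snd v + snd u * fst v) * Re (B2 x) + snd u * snd v * Re (C2 x)"
definition "T1 x u v = fst u * fst v * Im (A1 x) + (fst u * snd v + snd u * fst v) * Im (B1 x) + snd u * snd v * Im (C1 x)"
definition "T2 x u v = fst u * fst v * Im (A2 x) + (fst u * snd v + snd u * fst v) * Im (B2 x) + snd u * snd v * Im (C2 x)"

lemma D_induced_metric:
  assumes x: "x \<in> U"
  shows "D (\<lambda>y. G y u v) x w = fst u * fst v * D g11 x w + (fst u * snd v + snd u * fst v) * D g12 x w + snd u * snd v * D g22 x w"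
proof -
  have "D (\<lambda>y. G y u v) x w
    = D (\<lambda>y. fst u * fst v * g11 y + (fst u * snd v + snd u * fst v) * g12 y + snd u * snd v * g22 y) x w"
    by (rule D_cong_on[OF open_U _ x]) (rule induced_metric_eq)
  then show ?thesis
    by (simp add: D_add[of U, OF _ _ x] D_mult[of U, OF _ _ x] D_const smooth_on_add smooth_on_mult smooth_on_const open_U)
qed

text \<open>The real parts of the frame coefficients are symmetric and differentiate the metric
  correctly by \<open>D_metric_frame\<close>; these are the two properties behind the Koszul
  formula.\<close>

lemma christoffel_induced_metric:
  assumes x: "x \<in> U"
  shows "christoffel G x u v = (Gamma1 x u v, Gamma2 x u v)"
  unfolding christoffel_def
proof (rule riesz_induced_metricI[OF x])
  fix w
  note s = D_split[OF smooth_coeffs(11) x, unfolded real_scaleR_def D_metric_frame[OF x]]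
    D_split[OF smooth_coeffs(12) x, unfolded real_scaleR_def D_metric_frame[OF x]]
    D_split[OF smooth_coeffs(13) x, unfolded real_scaleR_def D_metric_frame[OF x]]
  show "G x (Gamma1 x u v, Gamma2 x u v) w
      = (D (\<lambda>y. G y v w) x u + D (\<lambda>y. G y u w) x v - D (\<lambda>y. G y u v) x w) / 2"
    unfolding D_induced_metric[OF x] s induced_metric_eq[OF x] Gamma1_def Gamma2_def fst_conv snd_conv
    by (simp add: algebra_simps)
qed

lemma hess_split:
  assumes x: "x \<in> U"
  shows "hess \<epsilon> f x u v = (fst u * fst v) *\<^sub>R hess \<epsilon> f x (1,0) (1,0)
    + (fst u * snd v + snd u * fst v) *\<^sub>R hess \<epsilon> f x (1,0) (0,1) + (snd u * snd v) *\<^sub>R hess \<epsilon> f x (0,1) (0,1)"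
proof -
  have "D (\<lambda>y. D f y v) x u = D (\<lambda>y. fst v *\<^sub>R f1 y + snd v *\<^sub>R f2 y) x u"
    by (rule D_cong_on[OF open_U _ x]) (rule D_split[OF smooth])
  also have "\<dots> = fst v *\<^sub>R D f1 x u + snd v *\<^sub>R D f2 x u"
    by (simp add: D_add[of U, OF _ _ x] D_scaleR[of U, OF _ _ x] D_const smooth_on_scaleR smooth_on_const open_U)
  finally show ?thesis
    using D_D_commute[OF smooth x, of "(1,0)" "(0,1)"] D_split[OF smooth_coeffs(1) x, of u]
      D_split[OF smooth_coeffs(2) x, of u] D_split[OF smooth x, of u] D_split[OF smooth x, of v]
    by (simp add: hess_def csf_gamma_commute[of _ _ "f2 x" "f1 x"] algebra_simps)
qed

lemma D_pair: "x \<in> U \<Longrightarrow> D f x (p, q) = p *\<^sub>R f1 x + q *\<^sub>R f2 x"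
  using D_split[OF smooth, of x "(p, q)"] by simp

lemma hess_decompose:
  assumes x: "x \<in> U"
  shows "hess \<epsilon> f x u v = D f x (Gamma1 x u v, Gamma2 x u v) + J (D f x (T1 x u v, T2 x u v))"
  unfolding hess_split[OF x, of u v] hess_frame[OF x] D_pair[OF x, of "Gamma1 x u v"] D_pair[OF x, of "T1 x u v"]
  by (simp add: vec_eq_iff forall_2 complex_eq_iff Gamma1_def Gamma2_def T1_def T2_def algebra_simps)

lemma second_fundamental_form_eq:
  assumes x: "x \<in> U"
  shows "second_fundamental_form (csf_metric \<epsilon>) f x u v = J (D f x (T1 x u v, T2 x u v))"
  using hess_decompose[OF x, of u v]
  unfolding second_fundamental_form_def christoffel_induced_metric[OF x]
    christoffel_csf_metric[OF in_domain[OF x]] hess_def by simp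

lemma tangent_normal_unique:
  assumes x: "x \<in> U" and "D f x s + J (D f x t) = D f x s' + J (D f x t')"
  shows "s = s' \<and> t = t'"
proof -
  have "Complex (fst s - fst s') (fst t - fst t') *s f1 x + Complex (snd s - snd s') (snd t - snd t') *s f2 x = 0"
    using assms(2) unfolding D_split[OF smooth x, of s] D_split[OF smooth x, of s']
      D_split[OF smooth x, of t] D_split[OF smooth x, of t']
    by (simp add: vec_eq_iff forall_2 complex_eq_iff algebra_simps)
  from complex_frame_independent[OF x this] show ?thesis
    by (simp add: complex_eq_iff prod_eq_iff)
qed

text \<open>Any splitting of the Hessian into tangential and normal parts reveals the second
  fundamental form; after a change of coordinates this avoids computing Christoffel symbols
  anew.\<close>

lemma second_fundamental_form_unique:
  assumes x: "x \<in> U" and "hess \<epsilon> f x u v = D f x s + J (D f x t)"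
  shows "second_fundamental_form (csf_metric \<epsilon>) f x u v = J (D f x t)"
  using tangent_normal_unique[OF x, of "(Gamma1 x u v, Gamma2 x u v)" "(T1 x u v, T2 x u v)" s t]
    hess_decompose[OF x, of u v] assms(2) second_fundamental_form_eq[OF x] by simp

lemma second_fundamental_form_frame:
  assumes x: "x \<in> U"
  shows "second_fundamental_form (csf_metric \<epsilon>) f x u v = J (T1 x u v *\<^sub>R f1 x + T2 x u v *\<^sub>R f2 x)"
  unfolding second_fundamental_form_eq[OF x] D_pair[OF x, of "T1 x u v"] ..

abbreviation "II \<equiv> second_fundamental_form (csf_metric \<epsilon>) f"
abbreviation "H \<equiv> mean_curvature (csf_metric \<epsilon>) f"

lemma II_split:
  assumes x: "x \<in> U"
  shows "II x u v = (fst u * fst v) *\<^sub>R II x (1,0) (1,0)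
    + (fst u * snd v + snd u * fst v) *\<^sub>R II x (1,0) (0,1) + (snd u * snd v) *\<^sub>R II x (0,1) (0,1)"
  unfolding second_fundamental_form_frame[OF x]
  by (simp add: T1_def T2_def vec_eq_iff algebra_simps scaleR_conv_of_real[where 'a = complex])

lemma mean_curvature_II:
  assumes x: "x \<in> U"
  shows "H x = (1 / (2 * \<Delta> x)) *\<^sub>R (g22 x *\<^sub>R II x (1,0) (1,0) - (2 * g12 x) *\<^sub>R II x (1,0) (0,1)
     + g11 x *\<^sub>R II x (0,1) (0,1))"
proof -
  have b: "(Basis :: (real \<times> real) set) = {(1,0), (0,1)}"
    by (auto simp: Basis_prod_def)
  have r1: "riesz (G x) (\<lambda>w. (1,0) \<bullet> w) = (g22 x / \<Delta> x, - g12 x / \<Delta> x)"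
    using riesz_induced_metric[OF x, of "\<lambda>w. (1,0) \<bullet> w" 1 0] by (simp add: inner_prod_def)
  have r2: "riesz (G x) (\<lambda>w. (0,1) \<bullet> w) = (- g12 x / \<Delta> x, g11 x / \<Delta> x)"
    using riesz_induced_metric[OF x, of "\<lambda>w. (0,1) \<bullet> w" 0 1] by (simp add: inner_prod_def)
  show ?thesis
    using II_split[OF x, of "(g22 x / \<Delta> x, - g12 x / \<Delta> x)" "(1,0)"]
      II_split[OF x, of "(- g12 x / \<Delta> x, g11 x / \<Delta> x)" "(0,1)"]
    by (simp add: mean_curvature_def metric_trace_def b r1 r2)
       (simp add: vec_eq_iff complex_eq_iff algebra_simps)
qed

text \<open>The metric trace runs over the two arguments of the second fundamental form, whereas
  \<alpha> is a trace over one argument and the value; \<open>T_symmetric\<close> exchanges the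
  two.\<close>

lemma mean_curvature_eq:
  assumes x: "x \<in> U"
  shows "H x = J (D f x (a1 x, a2 x))"
proof -
  have d: "\<Delta> x \<noteq> 0" using Delta_pos[OF x] by simp
  have D: "\<Delta> x = g11 x * g22 x - g12 x * g12 x" by (simp add: \<Delta>_def power2_eq_square)
  note t = T_symmetric[OF x]
  have 1: "g22 x * Im (A1 x) - 2 * g12 x * Im (B1 x) + g11 x * Im (C1 x) = 2 * (\<Delta> x * a1 x)"
  proof -
    have "2 * (\<Delta> x * a1 x) = g22 x * (Im (A1 x) + Im (B2 x)) - g12 x * (Im (B1 x) + Im (C2 x))"
      using d by (simp add: a1_def \<alpha>1_def \<alpha>2_def)
    then show ?thesis using t by (simp add: algebra_simps)
  qed
  have 2: "g22 x * Im (A2 x) - 2 * g12 x * Im (B2 x) + g11 x * Im (C2 x) = 2 * (\<Delta> x * a2 x)"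
  proof -
    have "2 * (\<Delta> x * a2 x) = g11 x * (Im (B1 x) + Im (C2 x)) - g12 x * (Im (A1 x) + Im (B2 x))"
      using d by (simp add: a2_def \<alpha>1_def \<alpha>2_def)
    then show ?thesis using t by (simp add: algebra_simps)
  qed
  have "g22 x *\<^sub>R II x (1,0) (1,0) - (2 * g12 x) *\<^sub>R II x (1,0) (0,1) + g11 x *\<^sub>R II x (0,1) (0,1)
     = J (D f x (g22 x * Im (A1 x) - 2 * g12 x * Im (B1 x) + g11 x * Im (C1 x),
                 g22 x * Im (A2 x) - 2 * g12 x * Im (B2 x) + g11 x * Im (C2 x)))"
    unfolding second_fundamental_form_frame[OF x] D_pair[OF x, of "g22 x * _ - _ + _"]
    by (simp add: T1_def T2_def vec_eq_iff algebra_simps scaleR_conv_of_real[where 'a = complex])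
  also have "\<dots> = (2 * \<Delta> x) *\<^sub>R J (D f x (a1 x, a2 x))"
    unfolding 1 2 D_pair[OF x, of "2 * (_ * _)"] D_pair[OF x, of "a1 x"]
    by (simp add: vec_eq_iff algebra_simps scaleR_conv_of_real[where 'a = complex])
  finally have "H x = (1 / (2 * \<Delta> x)) *\<^sub>R ((2 * \<Delta> x) *\<^sub>R J (D f x (a1 x, a2 x)))"
    unfolding mean_curvature_II[OF x] by (rule arg_cong)
  then show ?thesis using d by (simp del: scaleR_left_diff_distrib)
qed

lemma lower_a:
  assumes x: "x \<in> U"
  shows "g11 x * a1 x + g12 x * a2 x = \<alpha>1 x" "g12 x * a1 x + g22 x * a2 x = \<alpha>2 x"
proof -
  have d: "\<Delta> x \<noteq> 0" using Delta_pos[OF x] by simp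
  show "g11 x * a1 x + g12 x * a2 x = \<alpha>1 x" "g12 x * a1 x + g22 x * a2 x = \<alpha>2 x"
    unfolding a1_def a2_def using d
    by (simp_all add: field_simps) (simp_all add: \<Delta>_def power2_eq_square algebra_simps)
qed

lemma alpha_mean_curvature:
  assumes x: "x \<in> U"
  shows "Re (csf_herm \<epsilon> (f x) (H x) (J (D f x v))) = fst v * \<alpha>1 x + snd v * \<alpha>2 x"
proof -
  have "csf_herm \<epsilon> (f x) (H x) (J (D f x v)) = csf_herm \<epsilon> (f x) (D f x (a1 x, a2 x)) (D f x v)"
    by (simp add: mean_curvature_eq[OF x])
  then have "Re (csf_herm \<epsilon> (f x) (H x) (J (D f x v))) = fst v * (g11 x * a1 x + g12 x * a2 x) + snd v * (g12 x * a1 x + g22 x * a2 x)"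
    unfolding D_split[OF smooth x, of v] D_pair[OF x, of "a1 x"]
    by (simp add: herm_frame[OF x] algebra_simps)
  then show ?thesis by (simp add: lower_a[OF x])
qed

lemma mean_curvature_norm:
  assumes x: "x \<in> U"
  shows "Re (csf_herm \<epsilon> (f x) (H x) (H x)) = h2 x"
proof -
  have "Re (csf_herm \<epsilon> (f x) (H x) (H x)) = a1 x * \<alpha>1 x + a2 x * \<alpha>2 x"
    using alpha_mean_curvature[OF x, of "(a1 x, a2 x)"] mean_curvature_eq[OF x] by simp
  also have "\<dots> = h2 x"
    by (simp add: a1_def a2_def h2_def power2_eq_square algebra_simps add_divide_distrib diff_divide_distrib)
  finally show ?thesis .
qed

lemma mean_curvature_length_eq: "x \<in> U \<Longrightarrow> mean_curvature_length (csf_metric \<epsilon>) f x = sqrt (h2 x)"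
  by (simp add: mean_curvature_length_def metric_norm_def csf_metric_eq in_domain mean_curvature_norm)

lemma h2_pos: "x \<in> U \<Longrightarrow> H x \<noteq> 0 \<Longrightarrow> h2 x > 0"
  using csf_herm_pos[OF in_domain] mean_curvature_norm by metis

section \<open>Gradients and the Gauss equation\<close>

lemma gradient_eq:
  assumes x: "x \<in> U" and u: "u differentiable (at x)"
  shows "gradient G u x = ((g22 x * d1 u x - g12 x * d2 u x) / \<Delta> x, (g11 x * d2 u x - g12 x * d1 u x) / \<Delta> x)"
  unfolding gradient_def
proof (rule riesz_induced_metric[OF x])
  fix w
  have l: "linear (D u x)" using u by (rule linear_frechet_derivative)
  have "D u x (fst w *\<^sub>R (1, 0) + snd w *\<^sub>R (0, 1)) = fst w * d1 u x + snd w * d2 u x"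
    by (simp only: linear_add[OF l] linear_scale[OF l] real_scaleR_def)
  then show "D u x w = fst w * d1 u x + snd w * d2 u x" by simp
qed

lemma grad_norm_eq:
  assumes x: "x \<in> U" and u: "u differentiable (at x)"
  shows "(metric_norm G x (gradient G u x))\<^sup>2
    = (g22 x * (d1 u x)\<^sup>2 - 2 * g12 x * d1 u x * d2 u x + g11 x * (d2 u x)\<^sup>2) / \<Delta> x"
proof -
  have d: "\<Delta> x \<noteq> 0" using Delta_pos[OF x] by simp
  define p q where "p = d1 u x" and "q = d2 u x"
  let ?z = "((g22 x * p - g12 x * q) / \<Delta> x, (g11 x * q - g12 x * p) / \<Delta> x)"
  have "G x z z = Re (csf_herm \<epsilon> (f x) (D f x z) (D f x z))" for z
    by (simp add: induced_metric_def csf_metric_eq in_domain x)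
  then have nn: "G x z z \<ge> 0" for z
    using csf_herm_pos[OF in_domain[OF x], of "D f x z"] by (cases "D f x z = 0") (simp_all add: less_imp_le)
  have a: "(g22 x * p - g12 x * q) / \<Delta> x * g11 x + (g11 x * q - g12 x * p) / \<Delta> x * g12 x = p"
    using d by (simp add: field_simps) (simp add: \<Delta>_def power2_eq_square algebra_simps)
  have b: "(g22 x * p - g12 x * q) / \<Delta> x * g12 x + (g11 x * q - g12 x * p) / \<Delta> x * g22 x = q"
    using d by (simp add: field_simps) (simp add: \<Delta>_def power2_eq_square algebra_simps)
  have e: "G x (r, s) (r, s) = r * (r * g11 x + s * g12 x) + s * (r * g12 x + s * g22 x)" for r s
    by (simp add: induced_metric_eq[OF x] algebra_simps)
  have "(metric_norm G x (gradient G u x))\<^sup>2 = G x ?z ?z"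
    using nn[of ?z] by (simp add: metric_norm_def gradient_eq[OF x u] p_def q_def)
  also have "\<dots> = (g22 x * p - g12 x * q) / \<Delta> x * p + (g11 x * q - g12 x * p) / \<Delta> x * q"
    unfolding e a b ..
  also have "\<dots> = (g22 x * p\<^sup>2 - 2 * g12 x * p * q + g11 x * q\<^sup>2) / \<Delta> x"
    by (simp add: power2_eq_square algebra_simps add_divide_distrib diff_divide_distrib)
  finally show ?thesis by (simp add: p_def q_def)
qed

lemma gaussian_curvature_christoffel:
  assumes x: "x \<in> U"
  shows "gaussian_curvature G x * \<Delta> x =
    (Re (d1 C1 x) - Re (d2 B1 x) + (Re (C1 x) * Re (A1 x) + Re (C2 x) * Re (B1 x)) - (Re (B1 x) * Re (B1 x) + Re (B2 x) * Re (C1 x))) * g11 x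
    + (Re (d1 C2 x) - Re (d2 B2 x) + Re (C1 x) * Re (A2 x) - Re (B1 x) * Re (B2 x)) * g12 x" (is "_ = ?R1 * _ + ?R2 * _")
proof -
  have D: "D (\<lambda>y. christoffel G y u v) x w
      = (fst u * fst v * Re (D A1 x w) + (fst u * snd v + snd u * fst v) * Re (D B1 x w) + snd u * snd v * Re (D C1 x w),
         fst u * fst v * Re (D A2 x w) + (fst u * snd v + snd u * fst v) * Re (D B2 x w) + snd u * snd v * Re (D C2 x w))" for u v w
  proof -
    have r: "((\<lambda>y. Re (g y)) has_derivative (\<lambda>v. Re (D g x v))) (at x)" if "smooth_on U g" for g
      by (rule bounded_linear.has_derivative[OF bounded_linear_Re smooth_on_has_derivative[OF that x]])
    have "((\<lambda>y. (Gamma1 y u v, Gamma2 y u v)) has_derivative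
        (\<lambda>w. (fst u * fst v * Re (D A1 x w) + (fst u * snd v + snd u * fst v) * Re (D B1 x w) + snd u * snd v * Re (D C1 x w),
         fst u * fst v * Re (D A2 x w) + (fst u * snd v + snd u * fst v) * Re (D B2 x w) + snd u * snd v * Re (D C2 x w)))) (at x)"
      unfolding Gamma1_def Gamma2_def
      by (intro has_derivative_Pair has_derivative_add has_derivative_mult_right r smooth_coeffs)
    then have "D (\<lambda>y. (Gamma1 y u v, Gamma2 y u v)) x w
       = (fst u * fst v * Re (D A1 x w) + (fst u * snd v + snd u * fst v) * Re (D B1 x w) + snd u * snd v * Re (D C1 x w),
         fst u * fst v * Re (D A2 x w) + (fst u * snd v + snd u * fst v) * Re (D B2 x w) + snd u * snd v * Re (D C2 x w))"
      by (simp add: D_eqI)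
    moreover have "D (\<lambda>y. christoffel G y u v) x w = D (\<lambda>y. (Gamma1 y u v, Gamma2 y u v)) x w"
      by (rule D_cong_on[OF open_U _ x]) (rule christoffel_induced_metric)
    ultimately show ?thesis by simp
  qed
  have "curvature_tensor G x (1,0) (0,1) (0,1) = (?R1, ?R2)"
    unfolding curvature_tensor_def D christoffel_induced_metric[OF x] Gamma1_def Gamma2_def
    by (simp add: algebra_simps)
  then show ?thesis
    using Delta_pos[OF x] by (simp add: gaussian_curvature_def gram_eq[OF x] induced_metric_eq[OF x])
qed

lemma gauss_equation:
  assumes x: "x \<in> U"
  shows "gaussian_curvature G x * \<Delta> x = \<epsilon> * \<Delta> x
    + Re (csf_herm \<epsilon> (f x) (II x (1,0) (1,0)) (II x (0,1) (0,1)))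
    - Re (csf_herm \<epsilon> (f x) (II x (1,0) (0,1)) (II x (1,0) (0,1)))"
proof -
  define R1 where "R1 = \<epsilon> * g22 x + Im (C1 x) * Im (A1 x) + Im (C2 x) * Im (B1 x) - Im (B1 x) * Im (B1 x) - Im (B2 x) * Im (C1 x)"
  define R2 where "R2 = - \<epsilon> * g12 x + Im (C1 x) * Im (A2 x) - Im (B1 x) * Im (B2 x)"
  have i3: "Re (d1 C1 x) - Re (d2 B1 x) + (Re (C1 x) * Re (A1 x) + Re (C2 x) * Re (B1 x)) - (Re (B1 x) * Re (B1 x) + Re (B2 x) * Re (C1 x)) = R1"
    using arg_cong[OF integrability(3)[OF x], of Re] by (simp add: R1_def algebra_simps)
  have i4: "Re (d1 C2 x) - Re (d2 B2 x) + Re (C1 x) * Re (A2 x) - Re (B1 x) * Re (B2 x) = R2"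
    using arg_cong[OF integrability(4)[OF x], of Re] by (simp add: R2_def algebra_simps)
  have K: "gaussian_curvature G x * \<Delta> x = R1 * g11 x + R2 * g12 x"
    unfolding gaussian_curvature_christoffel[OF x] i3 i4 ..
  have S: "Re (csf_herm \<epsilon> (f x) (J (p *\<^sub>R f1 x + q *\<^sub>R f2 x)) (J (r *\<^sub>R f1 x + s *\<^sub>R f2 x)))
    = p * r * g11 x + (p * s + q * r) * g12 x + q * s * g22 x" for p q r s
    by (simp add: herm_frame[OF x] algebra_simps)
  \<comment> \<open>The symmetry relations, with the factors that turn the quadratic terms of
    \<open>R1\<close> and \<open>R2\<close> into inner products of the second fundamental
    form.\<close>
  have "Im (C2 x) * (Im (A1 x) * g12 x + Im (A2 x) * g22 x) = Im (C2 x) * (Im (B1 x) * g11 x + Im (B2 x) * g12 x)"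
    "Im (B2 x) * (Im (B1 x) * g12 x + Im (B2 x) * g22 x) = Im (B2 x) * (Im (C1 x) * g11 x + Im (C2 x) * g12 x)"
    using T_symmetric[OF x] by simp_all
  then show ?thesis
    unfolding K second_fundamental_form_frame[OF x] S
    by (simp add: T1_def T2_def R1_def R2_def \<Delta>_def power2_eq_square algebra_simps)
qed

end

section \<open>Potentials and local inverses in the plane\<close>

lemma smooth_on_partial_derivatives:
  fixes q :: "real \<times> real \<Rightarrow> real"
  assumes "smooth_on S q" "(x, y) \<in> S"
  shows "((\<lambda>x. q (x, y)) has_real_derivative d1 q (x, y)) (at x)"
    "((\<lambda>y. q (x, y)) has_real_derivative d2 q (x, y)) (at y)"
proof -
  note q = smooth_on_has_derivative[OF assms]
  note l = linear_D[OF assms]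
  have "((\<lambda>x. (x, y)) has_derivative (\<lambda>h. (h, 0))) (at x)" by (auto intro!: derivative_eq_intros)
  from has_derivative_compose[OF this q] have "((\<lambda>x. q (x, y)) has_derivative (\<lambda>h. D q (x, y) (h, 0))) (at x)" .
  moreover have "(\<lambda>h. D q (x, y) (h, 0)) = (\<lambda>h. d1 q (x, y) * h)"
  proof
    fix h show "D q (x, y) (h, 0) = d1 q (x, y) * h"
      using linear_scale[OF l, of h "(1,0)"] by (simp add: mult.commute)
  qed
  ultimately show "((\<lambda>x. q (x, y)) has_real_derivative d1 q (x, y)) (at x)"
    by (simp only: has_field_derivative_def)
  have "((\<lambda>y. (x, y)) has_derivative (\<lambda>h. (0, h))) (at y)" by (auto intro!: derivative_eq_intros)
  from has_derivative_compose[OF this q] have "((\<lambda>y. q (x, y)) has_derivative (\<lambda>h. D q (x, y) (0, h))) (at y)" .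
  moreover have "(\<lambda>h. D q (x, y) (0, h)) = (\<lambda>h. d2 q (x, y) * h)"
  proof
    fix h show "D q (x, y) (0, h) = d2 q (x, y) * h"
      using linear_scale[OF l, of h "(0,1)"] by (simp add: mult.commute)
  qed
  ultimately show "((\<lambda>y. q (x, y)) has_real_derivative d2 q (x, y)) (at y)"
    by (simp only: has_field_derivative_def)
qed

text \<open>Serves maps given by integrals, where only the partial derivatives are visibly
  smooth.\<close>

lemma smooth_on_from_partials:
  fixes \<phi> :: "real \<times> real \<Rightarrow> 'b::real_normed_vector"
  assumes "smooth_on S p" "smooth_on S q"
    "\<And>x. x \<in> S \<Longrightarrow> (\<phi> has_derivative (\<lambda>v. fst v *\<^sub>R p x + snd v *\<^sub>R q x)) (at x)"
  shows "smooth_on S \<phi>"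
proof -
  have S: "open S" using assms(1) by (rule smooth_on_open)
  have "Ck_on k \<phi> S" for k
  proof (cases k)
    case 0
    have "isCont \<phi> x" if "x \<in> S" for x using has_derivative_continuous[OF assms(3)[OF that]] .
    then show ?thesis using 0 by (simp add: continuous_at_imp_continuous_on)
  next
    case (Suc m)
    have "smooth_on S (\<lambda>x. fst v *\<^sub>R p x + snd v *\<^sub>R q x)" for v :: "real \<times> real"
      by (intro smooth_intros assms S)
    then show ?thesis unfolding Suc
      by (intro Ck_on_SucI[OF S assms(3)]) (simp_all add: smooth_on_def)
  qed
  then show ?thesis using S by (simp add: smooth_on_def)
qed

lemma open_contains_rectangle:
  fixes S :: "(real \<times> real) set"
  assumes "open S" "(a, b) \<in> S"
  obtains r where "r > 0" "{a - r..a + r} \<times> {b - r..b + r} \<subseteq> S"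
proof -
  obtain A B where AB: "open A" "open B" "a \<in> A" "b \<in> B" "A \<times> B \<subseteq> S"
    using open_prod_elim[OF assms] by (metis mem_Sigma_iff)
  obtain r1 where r1: "r1 > 0" "cball a r1 \<subseteq> A" using AB open_contains_cball by blast
  obtain r2 where r2: "r2 > 0" "cball b r2 \<subseteq> B" using AB open_contains_cball by blast
  let ?r = "min r1 r2"
  have "{a - ?r..a + ?r} \<subseteq> A" using r1 by (force simp: dist_real_def)
  moreover have "{b - ?r..b + ?r} \<subseteq> B" using r2 by (force simp: dist_real_def)
  ultimately show ?thesis using that[of ?r] r1 r2 AB by (meson Sigma_mono min_less_iff_conj subset_trans)
qed

text \<open>The Poincare lemma on a rectangle: integrate \<open>p\<close> along the bottom edge,
  then \<open>q\<close> upwards. For the derivative in \<open>x\<close>, differentiation under the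
  integral and closedness turn \<open>d1 q\<close> into \<open>d2 p\<close>, whose integral is
  \<open>p (x, y) - p (x, b0)\<close>. The base point is a corner, so that all integrals run over
  ordered intervals.\<close>

lemma closed_form_potential:
  fixes p q :: "real \<times> real \<Rightarrow> real"
  assumes p: "smooth_on S p" and q: "smooth_on S q"
    and closed: "\<forall>x\<in>S. d2 p x = d1 q x" and x0: "x0 \<in> S"
  obtains B \<phi> where "open B" "convex B" "x0 \<in> B" "B \<subseteq> S" "smooth_on B \<phi>"
    "\<And>x v. x \<in> B \<Longrightarrow> D \<phi> x v = fst v * p x + snd v * q x"
proof -
  obtain a b where ab: "x0 = (a, b)" by fastforce
  obtain r where r: "r > 0" "{a - r..a + r} \<times> {b - r..b + r} \<subseteq> S"
    using open_contains_rectangle smooth_on_open[OF p] x0 ab by metis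
  define a0 a1 b0 b1 where "a0 = a - r" and "a1 = a + r" and "b0 = b - r" and "b1 = b + r"
  define X Y where "X = {a0..a1}" and "Y = {b0..b1}"
  have XY: "X \<times> Y \<subseteq> S" and b0Y: "b0 \<in> Y" using r by (auto simp: X_def Y_def a0_def a1_def b0_def b1_def)
  have cont: "continuous_on T (\<lambda>z. g (u z, v z))"
    if "smooth_on S g" "continuous_on T u" "continuous_on T v" "\<And>z. z \<in> T \<Longrightarrow> u z \<in> X \<and> v z \<in> Y"
    for T :: "'c::topological_space set" and g :: "real \<times> real \<Rightarrow> real" and u v
    by (rule continuous_on_compose2[OF smooth_on_continuous_on[OF that(1)] continuous_on_Pair[OF that(2,3)]])
       (use that(4) XY in auto)
  define \<phi> where "\<phi> x y = integral {a0..x} (\<lambda>t. p (t, b0)) + integral {b0..y} (\<lambda>t. q (x, t))" for x y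
  have dy: "((\<lambda>y. \<phi> x y) has_derivative blinfun_apply (blinfun_mult_right (q (x, y)))) (at y within Y)"
    if "x \<in> X" "y \<in> Y" for x y
  proof -
    have "continuous_on {b0..b1} (\<lambda>t. q (x, t))"
      using that by (intro cont q continuous_intros) (auto simp: Y_def)
    from integral_has_real_derivative[OF this] have
      "((\<lambda>y. integral {b0..y} (\<lambda>t. q (x, t))) has_real_derivative q (x, y)) (at y within Y)"
      using that by (simp add: Y_def)
    then have "((\<lambda>y. \<phi> x y) has_real_derivative q (x, y)) (at y within Y)"
      unfolding \<phi>_def by (auto intro!: derivative_eq_intros)
    then show ?thesis by (simp add: has_field_derivative_def)
  qed
  have dx: "((\<lambda>x. \<phi> x y) has_real_derivative p (x, y)) (at x within X)"
    if xy: "x \<in> X" "y \<in> Y" for x y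
  proof -
    have sub: "{b0..y} \<subseteq> Y" "b0 \<le> y" using xy by (auto simp: Y_def)
    have "continuous_on {a0..a1} (\<lambda>t. p (t, b0))"
      using b0Y by (intro cont p continuous_intros) (auto simp: X_def)
    from integral_has_real_derivative[OF this]
    have 1: "((\<lambda>x. integral {a0..x} (\<lambda>t. p (t, b0))) has_real_derivative p (x, b0)) (at x within X)"
      using xy by (simp add: X_def)
    have "((\<lambda>x. integral (cbox b0 y) (\<lambda>t. q (x, t))) has_field_derivative
        integral (cbox b0 y) (\<lambda>t. d1 q (x, t))) (at x within X)"
    proof (rule leibniz_rule_field_derivative)
      show "((\<lambda>x. q (x, t)) has_real_derivative d1 q (x, t)) (at x within X)" if "x \<in> X" "t \<in> cbox b0 y" for x t
        by (rule has_field_derivative_at_within[OF smooth_on_partial_derivatives(1)[OF q]])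
            (use that sub XY in auto)
      show "(\<lambda>t. q (x, t)) integrable_on cbox b0 y" if "x \<in> X" for x
        using that sub by (intro integrable_continuous cont q continuous_intros) auto
      show "continuous_on (X \<times> cbox b0 y) (\<lambda>(x, t). d1 q (x, t))"
        unfolding split_beta using sub by (intro cont smooth_on_D q continuous_intros) auto
      show "convex X" by (simp add: X_def)
    qed (use xy in auto)
    moreover have "((\<lambda>t. d1 q (x, t)) has_integral p (x, y) - p (x, b0)) {b0..y}"
    proof (rule fundamental_theorem_of_calculus[OF sub(2)])
      fix t assume t: "t \<in> {b0..y}"
      then have tS: "(x, t) \<in> S" using sub XY xy by auto
      have "((\<lambda>t. p (x, t)) has_real_derivative d1 q (x, t)) (at t)"
        using smooth_on_partial_derivatives(2)[OF p tS] bspec[OF closed tS] by simp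
      then show "((\<lambda>t. p (x, t)) has_vector_derivative d1 q (x, t)) (at t within {b0..y})"
        by (simp add: has_real_derivative_iff_has_vector_derivative[symmetric] has_field_derivative_at_within)
    qed
    ultimately have "((\<lambda>x. integral {b0..y} (\<lambda>t. q (x, t))) has_real_derivative p (x, y) - p (x, b0)) (at x within X)"
      by (simp add: integral_unique)
    from DERIV_add[OF 1 this] show ?thesis unfolding \<phi>_def by simp
  qed
  \<comment> \<open>In the interior, derivatives within the closed rectangle become full
    derivatives.\<close>
  define B where "B = {a0<..<a1} \<times> {b0<..<b1}"
  have B: "open B" "convex B" "B \<subseteq> X \<times> Y" "x0 \<in> B"
    using r by (auto simp: B_def X_def Y_def ab a0_def a1_def b0_def b1_def open_Times convex_Times)
  have D: "((\<lambda>z. \<phi> (fst z) (snd z)) has_derivative (\<lambda>v. fst v *\<^sub>R p z + snd v *\<^sub>R q z)) (at z)" if "z \<in> B" for z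
  proof -
    obtain x y where z: "z = (x, y)" by fastforce
    have xy: "x \<in> X" "y \<in> Y" using B(3) that z by auto
    have "((\<lambda>(x, y). \<phi> x y) has_derivative (\<lambda>(tx, ty). p (x, y) * tx + blinfun_mult_right (q (x, y)) ty))
        (at (x, y) within X \<times> Y)"
    proof (rule has_derivative_partialsI)
      show "((\<lambda>x. \<phi> x y) has_derivative (*) (p (x, y))) (at x within X)"
        using dx[OF xy] by (simp add: has_field_derivative_def)
      have "continuous_on (X \<times> Y) (\<lambda>(x, y). blinfun_mult_right (q (x, y)))"
        unfolding split_beta by (intro bounded_linear.continuous_on[OF bounded_linear_blinfun_mult_right] cont q continuous_intros) auto
      then show "continuous (at (x, y) within X \<times> Y) (\<lambda>(x, y). blinfun_mult_right (q (x, y)))"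
        using xy unfolding continuous_on_eq_continuous_within by blast
    qed (use xy dy in \<open>auto simp: Y_def\<close>)
    moreover have "at (x, y) within X \<times> Y = at (x, y)"
      using B that z by (intro at_within_interior) (meson interior_maximal subsetD)
    ultimately show ?thesis unfolding z
      by (simp add: case_prod_beta' mult.commute)
  qed
  show ?thesis
  proof (rule that[OF B(1,2) B(4)])
    show "B \<subseteq> S" using B XY by blast
    show "smooth_on B (\<lambda>z. \<phi> (fst z) (snd z))"
      using \<open>B \<subseteq> S\<close> B(1) by (intro smooth_on_from_partials[OF _ _ D] smooth_on_subset[OF p] smooth_on_subset[OF q]) auto
    show "D (\<lambda>z. \<phi> (fst z) (snd z)) x v = fst v * p x + snd v * q x" if "x \<in> B" for x v
      by (simp add: D_eqI[OF D[OF that]])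
  qed
qed

section \<open>Local inverses of smooth planar maps\<close>

definition jacdet :: "(real \<times> real \<Rightarrow> real \<times> real) \<Rightarrow> real \<times> real \<Rightarrow> real" where
  "jacdet \<Psi> x = fst (d1 \<Psi> x) * snd (d2 \<Psi> x) - snd (d1 \<Psi> x) * fst (d2 \<Psi> x)"

lemma jacdet_solve:
  assumes "smooth_on U \<Psi>" "x \<in> U" "jacdet \<Psi> x \<noteq> 0" "D \<Psi> x v = w"
  shows "v = ((snd (d2 \<Psi> x) * fst w - fst (d2 \<Psi> x) * snd w) / jacdet \<Psi> x,
              (fst (d1 \<Psi> x) * snd w - snd (d1 \<Psi> x) * fst w) / jacdet \<Psi> x)"
proof -
  obtain p q where v: "v = (p, q)" by fastforce
  have w: "fst w = p * fst (d1 \<Psi> x) + q * fst (d2 \<Psi> x)" "snd w = p * snd (d1 \<Psi> x) + q * snd (d2 \<Psi> x)"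
    using assms(4) D_split[OF assms(1,2), of v] v by auto
  have "p * jacdet \<Psi> x = snd (d2 \<Psi> x) * fst w - fst (d2 \<Psi> x) * snd w"
    "q * jacdet \<Psi> x = fst (d1 \<Psi> x) * snd w - snd (d1 \<Psi> x) * fst w"
    unfolding w jacdet_def by (simp_all add: algebra_simps)
  then show ?thesis using assms(3) v by (simp add: eq_divide_eq)
qed

lemma inj_D_planar:
  assumes "smooth_on U \<Psi>" "x \<in> U" "jacdet \<Psi> x \<noteq> 0"
  shows "inj (D \<Psi> x)"
  by (rule injI) (metis jacdet_solve[OF assms])

text \<open>The inverse function theorem yields a differentiable inverse. By Cramer's rule its
  derivative is a smooth function of \<open>\<Theta> y\<close>, so each order of regularity of
  \<Theta> gives the next one.\<close>

lemma local_inverse: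
  assumes \<Psi>: "smooth_on U \<Psi>" and jac: "\<forall>x\<in>U. jacdet \<Psi> x \<noteq> 0" and x0: "x0 \<in> U"
  obtains U' V \<Theta> where "open U'" "x0 \<in> U'" "U' \<subseteq> U" "open V" "homeomorphism U' V \<Psi> \<Theta>"
    "smooth_on V \<Theta>" "\<And>y w. y \<in> V \<Longrightarrow> D \<Psi> (\<Theta> y) (D \<Theta> y w) = w"
proof -
  note nz = bspec[OF jac]
  define f' where "f' x = Blinfun (D \<Psi> x)" for x
  have bl: "bounded_linear (D \<Psi> x)" if "x \<in> U" for x
    using smooth_on_has_derivative[OF \<Psi> that] by (rule has_derivative_bounded_linear)
  have f': "blinfun_apply (f' x) = D \<Psi> x" if "x \<in> U" for x
    unfolding f'_def by (rule bounded_linear_Blinfun_apply[OF bl[OF that]])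
  have derf: "(\<Psi> has_derivative blinfun_apply (f' x)) (at x)" if "x \<in> U" for x
    using smooth_on_has_derivative[OF \<Psi> that] f'[OF that] by simp
  have contf: "continuous_on U f'"
  proof (rule continuous_on_blinfun_componentwise)
    fix i :: "real \<times> real"
    have "continuous_on U (\<lambda>x. D \<Psi> x i)" by (intro smooth_on_continuous_on smooth_on_D \<Psi>)
    then show "continuous_on U (\<lambda>x. blinfun_apply (f' x) i)"
      by (rule continuous_on_eq) (simp add: f')
  qed
  \<comment> \<open>Cramer's rule at \<open>x0\<close>, as the bounded left inverse of the
    derivative that the inverse function theorem asks for.\<close>
  define inv0 :: "real \<times> real \<Rightarrow> real \<times> real" where
    "inv0 w = ((snd (d2 \<Psi> x0) * fst w - fst (d2 \<Psi> x0) * snd w) / jacdet \<Psi> x0,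
              (fst (d1 \<Psi> x0) * snd w - snd (d1 \<Psi> x0) * fst w) / jacdet \<Psi> x0)" for w
  have "linear inv0"
    by (rule linearI) (simp_all add: inv0_def prod_eq_iff algebra_simps add_divide_distrib diff_divide_distrib)
  then have bi: "bounded_linear inv0" by (rule linear_conv_bounded_linear[THEN iffD1])
  have "inv0 (D \<Psi> x0 v) = v" for v
    unfolding inv0_def using jacdet_solve[OF \<Psi> x0 nz[OF x0] refl, of v] by simp
  then have invf: "Blinfun inv0 o\<^sub>L f' x0 = id_blinfun"
    by (intro blinfun_eqI) (simp add: bounded_linear_Blinfun_apply[OF bi] f'[OF x0])
  obtain U' V \<Theta> g' where *: "open U'" "U' \<subseteq> U" "x0 \<in> U'" "open V" "homeomorphism U' V \<Psi> \<Theta>"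
    "\<And>y. y \<in> V \<Longrightarrow> (\<Theta> has_derivative (g' y)) (at y)"
    using inverse_function_theorem[OF smooth_on_open[OF \<Psi>] derf contf x0 invf] by metis
  have \<Theta>V: "\<Theta> y \<in> U'" "\<Psi> (\<Theta> y) = y" if "y \<in> V" for y
    using *(5) that by (auto simp: homeomorphism_def)
  have inv: "D \<Psi> (\<Theta> y) (g' y w) = w" if y: "y \<in> V" for y w
  proof -
    have "((\<lambda>y. \<Psi> (\<Theta> y)) has_derivative (\<lambda>w. D \<Psi> (\<Theta> y) (g' y w))) (at y)"
      using \<Theta>V[OF y] *(2) by (intro has_derivative_compose[OF *(6)[OF y]] smooth_on_has_derivative[OF \<Psi>]) auto
    moreover have "((\<lambda>y. y) has_derivative (\<lambda>w. w)) (at y)" by (rule has_derivative_ident)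
    then have "((\<lambda>y. \<Psi> (\<Theta> y)) has_derivative (\<lambda>w. w)) (at y)"
      using has_derivative_cong_open[OF *(4) y, of "\<lambda>y. \<Psi> (\<Theta> y)" "\<lambda>y. y"] \<Theta>V(2) by blast
    ultimately show ?thesis using has_derivative_unique by metis
  qed
  define M where "M w x = ((snd (d2 \<Psi> x) * fst w - fst (d2 \<Psi> x) * snd w) / jacdet \<Psi> x,
              (fst (d1 \<Psi> x) * snd w - snd (d1 \<Psi> x) * fst w) / jacdet \<Psi> x)" for w x
  have g': "g' y w = M w (\<Theta> y)" if "y \<in> V" for y w
    unfolding M_def using \<Theta>V(1)[OF that] *(2) by (intro jacdet_solve[OF \<Psi> _ nz inv[OF that]]) auto
  have M: "smooth_on U' (M w)" for w
    unfolding M_def jacdet_def using nz[unfolded jacdet_def] *(2)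
    by (intro smooth_intros *(1) smooth_on_subset[OF \<Psi>]) auto
  have "Ck_on k \<Theta> V" for k
  proof (induction k)
    case 0
    then show ?case using *(5) by (simp add: homeomorphism_def)
  next
    case (Suc k)
    show ?case
    proof (rule Ck_on_SucI[OF *(4) *(6)])
      fix w
      have "Ck_on k (\<lambda>y. M w (\<Theta> y)) V"
        using M[of w] \<Theta>V(1) by (intro Ck_on_compose[OF *(4) *(1) _ Suc]) (auto simp: smooth_on_def)
      then show "Ck_on k (\<lambda>y. g' y w) V"
        using Ck_on_cong[OF *(4), of "\<lambda>y. g' y w" "\<lambda>y. M w (\<Theta> y)"] g' by simp
    qed
  qed
  then have "smooth_on V \<Theta>" using *(4) by (simp add: smooth_on_def)
  moreover have "D \<Psi> (\<Theta> y) (D \<Theta> y w) = w" if "y \<in> V" for y w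
    using inv[OF that] D_eqI[OF *(6)[OF that]] by simp
  ultimately show ?thesis using that * by blast
qed

section \<open>Change of coordinates\<close>

text \<open>The same surface in other coordinates. The quantities of a patch are coordinate
  formulas, so their transformation laws have to be proved; \<open>Q\<close> is the patch of the
  composed map.\<close>

locale patch_change = lagrangian_patch +
  fixes V :: "(real \<times> real) set" and \<Theta> :: "real \<times> real \<Rightarrow> real \<times> real"
  assumes smooth_change: "smooth_on V \<Theta>" and range_change: "y \<in> V \<Longrightarrow> \<Theta> y \<in> U"
    and jacdet_nonzero: "y \<in> V \<Longrightarrow> jacdet \<Theta> y \<noteq> 0"
begin

abbreviation "f' \<equiv> (\<lambda>y. f (\<Theta> y))"

lemma D_change: "y \<in> V \<Longrightarrow> D f' y v = D f (\<Theta> y) (D \<Theta> y v)"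
  by (rule D_compose[OF smooth smooth_on_differentiable[OF smooth_change] range_change])

sublocale Q: lagrangian_patch \<epsilon> V f'
proof
  show "smooth_on V f'"
    by (rule smooth_on_compose[OF smooth smooth_change]) (use range_change in auto)
  show "f' ` V \<subseteq> csf_domain \<epsilon>" by (intro image_subsetI in_domain range_change)
  show "inj (D f' y)" if "y \<in> V" for y
  proof -
    have "D f' y = D f (\<Theta> y) \<circ> D \<Theta> y" using D_change[OF that] by auto
    then show ?thesis
      using immersion[OF range_change[OF that]] inj_D_planar[OF smooth_change that jacdet_nonzero[OF that]]
      by (simp add: inj_compose)
  qed
  show "csf_metric \<epsilon> (f' y) (D f' y u) (J (D f' y v)) = 0" if "y \<in> V" for y u v
    using lagrangian[OF range_change[OF that]] D_change[OF that] by simp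
qed

text \<open>The second derivative of the coordinate change contributes a tangential term only, so
  the normal part transforms as a tensor.\<close>

lemma hess_change:
  assumes y: "y \<in> V"
  shows "hess \<epsilon> f' y u v = hess \<epsilon> f (\<Theta> y) (D \<Theta> y u) (D \<Theta> y v) + D f (\<Theta> y) (D (\<lambda>y. D \<Theta> y v) y u)"
proof -
  note x = range_change[OF y]
  have hd: "((\<lambda>y. F (\<Theta> y)) has_derivative (\<lambda>u. D F (\<Theta> y) (D \<Theta> y u))) (at y)" if "smooth_on U F" for F :: "_ \<Rightarrow> complex^2"
    by (rule has_derivative_compose[OF smooth_on_has_derivative[OF smooth_change y] smooth_on_has_derivative[OF that x]])
  have dv: "((\<lambda>y. D \<Theta> y v) has_derivative D (\<lambda>y. D \<Theta> y v) y) (at y)"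
    by (rule smooth_on_has_derivative[OF smooth_on_D[OF smooth_change] y])
  have "D (\<lambda>y. D f' y v) y u = D (\<lambda>y. fst (D \<Theta> y v) *\<^sub>R f1 (\<Theta> y) + snd (D \<Theta> y v) *\<^sub>R f2 (\<Theta> y)) y u"
    by (rule D_cong_on[OF Q.open_U _ y]) (simp only: D_change D_split[OF smooth range_change, of _ "D \<Theta> _ v"])
  also have "\<dots> = fst (D \<Theta> y v) *\<^sub>R D f1 (\<Theta> y) (D \<Theta> y u) + fst (D (\<lambda>y. D \<Theta> y v) y u) *\<^sub>R f1 (\<Theta> y)
     + (snd (D \<Theta> y v) *\<^sub>R D f2 (\<Theta> y) (D \<Theta> y u) + snd (D (\<lambda>y. D \<Theta> y v) y u) *\<^sub>R f2 (\<Theta> y))"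
    by (subst D_eqI[OF has_derivative_add[OF
          bounded_bilinear.FDERIV[OF bounded_bilinear_scaleR bounded_linear.has_derivative[OF bounded_linear_fst dv] hd[OF smooth_coeffs(1)]]
          bounded_bilinear.FDERIV[OF bounded_bilinear_scaleR bounded_linear.has_derivative[OF bounded_linear_snd dv] hd[OF smooth_coeffs(2)]]]]) simp
  finally have 1: "D (\<lambda>y. D f' y v) y u = \<dots>" .
  have "D (\<lambda>x. fst w *\<^sub>R f1 x + snd w *\<^sub>R f2 x) (\<Theta> y) z = fst w *\<^sub>R D f1 (\<Theta> y) z + snd w *\<^sub>R D f2 (\<Theta> y) z" for w z
    by (simp add: D_add[of U, OF _ _ x] D_scaleR[of U, OF _ _ x] D_const smooth_on_scaleR smooth_on_const open_U)
  moreover have "D (\<lambda>x. D f x w) (\<Theta> y) z = D (\<lambda>x. fst w *\<^sub>R f1 x + snd w *\<^sub>R f2 x) (\<Theta> y) z" for w z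
    by (rule D_cong_on[OF open_U _ x]) (rule D_split[OF smooth])
  ultimately have 2: "D (\<lambda>x. D f x w) (\<Theta> y) z = fst w *\<^sub>R D f1 (\<Theta> y) z + snd w *\<^sub>R D f2 (\<Theta> y) z" for w z
    by (rule trans[rotated])
  show ?thesis
    unfolding hess_def 1 2[of "D \<Theta> y v"] D_change[OF y] D_split[OF smooth x, of "D (\<lambda>y. D \<Theta> y v) y u"]
    by (simp add: algebra_simps)
qed

lemma II_change:
  assumes y: "y \<in> V"
  shows "Q.II y u v = II (\<Theta> y) (D \<Theta> y u) (D \<Theta> y v)"
proof -
  note x = range_change[OF y]
  define s where "s = D (\<lambda>y. D \<Theta> y v) y u"
  define X where "X = (Gamma1 (\<Theta> y) (D \<Theta> y u) (D \<Theta> y v), Gamma2 (\<Theta> y) (D \<Theta> y u) (D \<Theta> y v))"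
  define Z where "Z = (T1 (\<Theta> y) (D \<Theta> y u) (D \<Theta> y v), T2 (\<Theta> y) (D \<Theta> y u) (D \<Theta> y v))"
  \<comment> \<open>Both parts of the Hessian must be written with tangent vectors of the new
    coordinates, that is, with preimages under \<open>D \<Theta> y\<close>.\<close>
  have surj: "\<exists>w'. D \<Theta> y w' = w" for w
  proof -
    have "linear (D \<Theta> y)" by (rule linear_D[OF smooth_change y])
    then have "surj (D \<Theta> y)"
      using linear_injective_imp_surjective inj_D_planar[OF smooth_change y jacdet_nonzero[OF y]] by blast
    then show ?thesis by (metis surjD)
  qed
  obtain s' where s': "D \<Theta> y s' = X + s" using surj by blast
  obtain t' where t': "D \<Theta> y t' = Z" using surj by blast
  have "D f (\<Theta> y) (X + s) = D f (\<Theta> y) X + D f (\<Theta> y) s"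
    by (rule linear_add[OF linear_D[OF smooth x]])
  then have "hess \<epsilon> f' y u v = D f' y s' + J (D f' y t')"
    unfolding hess_change[OF y] hess_decompose[OF x, of "D \<Theta> y u"] D_change[OF y] s' t'
    unfolding s_def[symmetric] X_def[symmetric] Z_def[symmetric] by simp
  then have "Q.II y u v = J (D f' y t')" by (rule Q.second_fundamental_form_unique[OF y])
  then show ?thesis
    unfolding second_fundamental_form_eq[OF x] Z_def[symmetric] D_change[OF y] t' .
qed

definition "p11 y = fst (d1 \<Theta> y)"
definition "p12 y = snd (d1 \<Theta> y)"
definition "p21 y = fst (d2 \<Theta> y)"
definition "p22 y = snd (d2 \<Theta> y)"

lemma jac_eq: "jacdet \<Theta> y = p11 y * p22 y - p12 y * p21 y"
  by (simp add: jacdet_def p11_def p12_def p21_def p22_def)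

lemma f'_partials:
  assumes "y \<in> V"
  shows "Q.f1 y = p11 y *\<^sub>R f1 (\<Theta> y) + p12 y *\<^sub>R f2 (\<Theta> y)"
    "Q.f2 y = p21 y *\<^sub>R f1 (\<Theta> y) + p22 y *\<^sub>R f2 (\<Theta> y)"
  using D_change[OF assms] D_split[OF smooth range_change[OF assms], of "d1 \<Theta> y"]
    D_split[OF smooth range_change[OF assms], of "d2 \<Theta> y"]
  by (simp_all add: p11_def p12_def p21_def p22_def)

lemma g_change:
  assumes y: "y \<in> V"
  shows "Q.g11 y = (p11 y)\<^sup>2 * g11 (\<Theta> y) + 2 * p11 y * p12 y * g12 (\<Theta> y) + (p12 y)\<^sup>2 * g22 (\<Theta> y)"
    "Q.g12 y = p11 y * p21 y * g11 (\<Theta> y) + (p11 y * p22 y + p12 y * p21 y) * g12 (\<Theta> y) + p12 y * p22 y * g22 (\<Theta> y)"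
    "Q.g22 y = (p21 y)\<^sup>2 * g11 (\<Theta> y) + 2 * p21 y * p22 y * g12 (\<Theta> y) + (p22 y)\<^sup>2 * g22 (\<Theta> y)"
  unfolding Q.g11_def Q.g12_def Q.g22_def f'_partials[OF y]
  by (simp_all add: herm_frame[OF range_change[OF y]] power2_eq_square algebra_simps)

lemma Delta_change:
  assumes y: "y \<in> V"
  shows "Q.\<Delta> y = (jacdet \<Theta> y)\<^sup>2 * \<Delta> (\<Theta> y)"
  unfolding Q.\<Delta>_def \<Delta>_def g_change[OF y] jac_eq by (simp add: power2_eq_square algebra_simps)

lemma II_change_frame:
  assumes y: "y \<in> V"
  defines "X \<equiv> II (\<Theta> y) (1,0) (1,0)" and "Y \<equiv> II (\<Theta> y) (1,0) (0,1)" and "Z \<equiv> II (\<Theta> y) (0,1) (0,1)"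
  shows "Q.II y (1,0) (1,0) = (p11 y)\<^sup>2 *\<^sub>R X + (2 * p11 y * p12 y) *\<^sub>R Y + (p12 y)\<^sup>2 *\<^sub>R Z"
    "Q.II y (1,0) (0,1) = (p11 y * p21 y) *\<^sub>R X + (p11 y * p22 y + p12 y * p21 y) *\<^sub>R Y + (p12 y * p22 y) *\<^sub>R Z"
    "Q.II y (0,1) (0,1) = (p21 y)\<^sup>2 *\<^sub>R X + (2 * p21 y * p22 y) *\<^sub>R Y + (p22 y)\<^sup>2 *\<^sub>R Z"
  unfolding II_change[OF y] X_def Y_def Z_def
  using II_split[OF range_change[OF y], of "d1 \<Theta> y" "d1 \<Theta> y"]
    II_split[OF range_change[OF y], of "d1 \<Theta> y" "d2 \<Theta> y"] II_split[OF range_change[OF y], of "d2 \<Theta> y" "d2 \<Theta> y"]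
  by (simp_all add: p11_def p12_def p21_def p22_def power2_eq_square mult.commute)

lemma H_change:
  assumes y: "y \<in> V"
  shows "Q.H y = H (\<Theta> y)"
proof -
  note x = range_change[OF y]
  have j: "jacdet \<Theta> y \<noteq> 0" by (rule jacdet_nonzero[OF y])
  have "Q.g22 y *\<^sub>R Q.II y (1,0) (1,0) - (2 * Q.g12 y) *\<^sub>R Q.II y (1,0) (0,1) + Q.g11 y *\<^sub>R Q.II y (0,1) (0,1)
    = (jacdet \<Theta> y)\<^sup>2 *\<^sub>R (g22 (\<Theta> y) *\<^sub>R II (\<Theta> y) (1,0) (1,0) - (2 * g12 (\<Theta> y)) *\<^sub>R II (\<Theta> y) (1,0) (0,1)
      + g11 (\<Theta> y) *\<^sub>R II (\<Theta> y) (0,1) (0,1))"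
    unfolding II_change_frame[OF y] g_change[OF y] jac_eq
    by (simp add: vec_eq_iff complex_eq_iff power2_eq_square algebra_simps)
  then show ?thesis
    unfolding Q.mean_curvature_II[OF y] mean_curvature_II[OF x] Delta_change[OF y] using j Delta_pos[OF x]
    by (simp add: power2_eq_square)
qed

lemma alpha_change:
  assumes y: "y \<in> V"
  shows "Q.\<alpha>1 y = p11 y * \<alpha>1 (\<Theta> y) + p12 y * \<alpha>2 (\<Theta> y)" "Q.\<alpha>2 y = p21 y * \<alpha>1 (\<Theta> y) + p22 y * \<alpha>2 (\<Theta> y)"
proof -
  have "Re (csf_herm \<epsilon> (f' y) (Q.H y) (J (D f' y v))) = fst (D \<Theta> y v) * \<alpha>1 (\<Theta> y) + snd (D \<Theta> y v) * \<alpha>2 (\<Theta> y)" for v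
    unfolding H_change[OF y] D_change[OF y] by (rule alpha_mean_curvature[OF range_change[OF y]])
  then have "fst v * Q.\<alpha>1 y + snd v * Q.\<alpha>2 y = fst (D \<Theta> y v) * \<alpha>1 (\<Theta> y) + snd (D \<Theta> y v) * \<alpha>2 (\<Theta> y)" for v
    unfolding Q.alpha_mean_curvature[OF y] .
  from this[of "(1,0)"] this[of "(0,1)"]
  show "Q.\<alpha>1 y = p11 y * \<alpha>1 (\<Theta> y) + p12 y * \<alpha>2 (\<Theta> y)" "Q.\<alpha>2 y = p21 y * \<alpha>1 (\<Theta> y) + p22 y * \<alpha>2 (\<Theta> y)"
    by (simp_all add: p11_def p12_def p21_def p22_def)
qed

text \<open>Deduced from the Gauss equation in both coordinate systems: the determinant of the
  second fundamental form and the Gram determinant scale by the same squared Jacobian.\<close>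

lemma gaussian_curvature_change:
  assumes y: "y \<in> V"
  shows "gaussian_curvature Q.G y = gaussian_curvature G (\<Theta> y)"
proof -
  note x = range_change[OF y]
  define S where "S a b = Re (csf_herm \<epsilon> (f (\<Theta> y)) a b)" for a b
  have S: "S (a + b) c = S a c + S b c" "S c (a + b) = S c a + S c b" "S (r *\<^sub>R a) c = r * S a c" "S c (r *\<^sub>R a) = r * S c a"
    "S a b = S b a" for a b c r
    by (simp_all add: S_def) (metis cnj_csf_herm cnj.sel(1))
  let ?X = "II (\<Theta> y) (1,0) (1,0)" and ?Y = "II (\<Theta> y) (1,0) (0,1)" and ?Z = "II (\<Theta> y) (0,1) (0,1)"
  have e1: "S (Q.II y (1,0) (1,0)) (Q.II y (0,1) (0,1)) - S (Q.II y (1,0) (0,1)) (Q.II y (1,0) (0,1))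
    = (jacdet \<Theta> y)\<^sup>2 * (S ?X ?Z - S ?Y ?Y)"
    unfolding II_change_frame[OF y] S(1-4) jac_eq S(5)[of ?Y ?X] S(5)[of ?Z ?X] S(5)[of ?Z ?Y]
    by (simp add: power2_eq_square algebra_simps)
  have e2: "gaussian_curvature Q.G y * Q.\<Delta> y = \<epsilon> * Q.\<Delta> y
      + S (Q.II y (1,0) (1,0)) (Q.II y (0,1) (0,1)) - S (Q.II y (1,0) (0,1)) (Q.II y (1,0) (0,1))"
    unfolding S_def by (rule Q.gauss_equation[OF y])
  have e3: "gaussian_curvature G (\<Theta> y) * \<Delta> (\<Theta> y) = \<epsilon> * \<Delta> (\<Theta> y) + S ?X ?Z - S ?Y ?Y"
    unfolding S_def by (rule gauss_equation[OF x])
  have "gaussian_curvature Q.G y * Q.\<Delta> y = \<epsilon> * Q.\<Delta> y + (jacdet \<Theta> y)\<^sup>2 * (S ?X ?Z - S ?Y ?Y)"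
    using e1 e2 by linarith
  also have "\<dots> = (jacdet \<Theta> y)\<^sup>2 * (\<epsilon> * \<Delta> (\<Theta> y) + S ?X ?Z - S ?Y ?Y)"
    unfolding Delta_change[OF y] by (simp add: algebra_simps)
  finally have "gaussian_curvature Q.G y * Q.\<Delta> y = (jacdet \<Theta> y)\<^sup>2 * (gaussian_curvature G (\<Theta> y) * \<Delta> (\<Theta> y))"
    unfolding e3 .
  then have "gaussian_curvature Q.G y * Q.\<Delta> y = gaussian_curvature G (\<Theta> y) * Q.\<Delta> y"
    unfolding Delta_change[OF y] by (simp add: algebra_simps)
  then show ?thesis using Q.Delta_pos[OF y] by simp
qed

text \<open>Both sides are the squared length of the gradient of \<open>u\<close>; numerator and
  denominator pick up the squared Jacobian.\<close>

lemma cometric_change: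
  assumes y: "y \<in> V" and u: "smooth_on U u"
  shows "(Q.g22 y * (d1 (\<lambda>y. u (\<Theta> y)) y)\<^sup>2 - 2 * Q.g12 y * d1 (\<lambda>y. u (\<Theta> y)) y * d2 (\<lambda>y. u (\<Theta> y)) y
      + Q.g11 y * (d2 (\<lambda>y. u (\<Theta> y)) y)\<^sup>2) / Q.\<Delta> y
    = (g22 (\<Theta> y) * (d1 u (\<Theta> y))\<^sup>2 - 2 * g12 (\<Theta> y) * d1 u (\<Theta> y) * d2 u (\<Theta> y) + g11 (\<Theta> y) * (d2 u (\<Theta> y))\<^sup>2) / \<Delta> (\<Theta> y)"
proof -
  note x = range_change[OF y]
  have D: "D (\<lambda>y. u (\<Theta> y)) y v = fst (D \<Theta> y v) * d1 u (\<Theta> y) + snd (D \<Theta> y v) * d2 u (\<Theta> y)" for v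
    using D_compose[OF u smooth_on_differentiable[OF smooth_change y] x, of v] D_split[OF u x, of "D \<Theta> y v"] by simp
  have "Q.g22 y * (d1 (\<lambda>y. u (\<Theta> y)) y)\<^sup>2 - 2 * Q.g12 y * d1 (\<lambda>y. u (\<Theta> y)) y * d2 (\<lambda>y. u (\<Theta> y)) y
      + Q.g11 y * (d2 (\<lambda>y. u (\<Theta> y)) y)\<^sup>2
    = (jacdet \<Theta> y)\<^sup>2 * (g22 (\<Theta> y) * (d1 u (\<Theta> y))\<^sup>2 - 2 * g12 (\<Theta> y) * d1 u (\<Theta> y) * d2 u (\<Theta> y) + g11 (\<Theta> y) * (d2 u (\<Theta> y))\<^sup>2)"
    unfolding D[of "(1,0)"] D[of "(0,1)"] g_change[OF y] jac_eq p11_def[symmetric] p12_def[symmetric] p21_def[symmetric] p22_def[symmetric]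
    by (simp add: power2_eq_square algebra_simps)
  then show ?thesis
    unfolding Delta_change[OF y] using jacdet_nonzero[OF y] by simp
qed

end

section \<open>The eikonal equation in isothermal coordinates\<close>

lemma zero_derivative_constant:
  fixes F :: "real \<times> real \<Rightarrow> 'b::real_normed_vector"
  assumes "smooth_on V F" "convex V" "\<And>x. x \<in> V \<Longrightarrow> d1 F x = 0" "\<And>x. x \<in> V \<Longrightarrow> d2 F x = 0"
  obtains c where "\<And>x. x \<in> V \<Longrightarrow> F x = c"
proof -
  have "(F has_derivative (\<lambda>h. 0)) (at x within V)" if "x \<in> V" for x
  proof -
    have "D F x = (\<lambda>h. 0)"
    proof
      fix h show "D F x h = 0"
        using D_split[OF assms(1) that, of h] assms(3,4)[OF that] by simp
    qed
    then show ?thesis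
      using smooth_on_has_derivative[OF assms(1) that] by (simp add: has_derivative_at_withinI)
  qed
  from has_derivative_zero_constant[OF assms(2) this] show ?thesis using that by blast
qed

text \<open>Differentiating the eikonal equation puts the gradient into the kernel of the Hessian. A
  symmetric 2 by 2 matrix that annihilates a unit vector is its trace \<open>m\<close> times the
  projection onto the orthogonal direction.\<close>

lemma eikonal_hessian:
  fixes q :: "real \<times> real \<Rightarrow> real"
  assumes q: "smooth_on V q" and eik: "\<And>x. x \<in> V \<Longrightarrow> (d1 q x)\<^sup>2 + (d2 q x)\<^sup>2 = 1" and x: "x \<in> V"
  defines "m \<equiv> d1 (d1 q) x + d2 (d2 q) x"
  shows "d1 (d1 q) x = m * (d2 q x)\<^sup>2" "d2 (d2 q) x = m * (d1 q x)\<^sup>2"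
    "d1 (d2 q) x = - m * d1 q x * d2 q x" "d2 (d1 q) x = d1 (d2 q) x"
proof -
  have V: "open V" using q by (rule smooth_on_open)
  have sq: "smooth_on V (d1 q)" "smooth_on V (d2 q)" using q by (auto intro: smooth_on_D)
  show c: "d2 (d1 q) x = d1 (d2 q) x" by (rule D_D_commute[OF q x])
  have "D (\<lambda>x. (d1 q x)\<^sup>2 + (d2 q x)\<^sup>2) x v = 0" for v
    using D_cong_on[OF V eik x, of "\<lambda>x. x" v] by (simp add: D_const)
  then have "2 * d1 q x * D (d1 q) x v + 2 * d2 q x * D (d2 q) x v = 0" for v
    using sq by (simp add: D_add[OF smooth_on_power smooth_on_power x] D_power2[OF _ x])
  from this[of "(1,0)"] this[of "(0,1)"]
  have e: "d1 q x * d1 (d1 q) x + d2 q x * d1 (d2 q) x = 0" "d1 q x * d1 (d2 q) x + d2 q x * d2 (d2 q) x = 0"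
    using c by simp_all
  have n: "(d1 q x)\<^sup>2 + (d2 q x)\<^sup>2 = 1" by (rule eik[OF x])
  have "a = (a + d) * s\<^sup>2 \<and> d = (a + d) * r\<^sup>2 \<and> b = - (a + d) * r * s"
    if "r * a + s * b = 0" "r * b + s * d = 0" "r\<^sup>2 + s\<^sup>2 = 1" for a b d r s :: real
  proof -
    have 1: "r\<^sup>2 * a - s\<^sup>2 * d = 0"
    proof -
      have "r\<^sup>2 * a - s\<^sup>2 * d = r * (r * a + s * b) - s * (r * b + s * d)"
        by (simp add: power2_eq_square algebra_simps)
      then show ?thesis using that by simp
    qed
    have "a = a * (r\<^sup>2 + s\<^sup>2)" "d = d * (r\<^sup>2 + s\<^sup>2)" using that by simp_all
    then have 2: "a = (a + d) * s\<^sup>2" "d = (a + d) * r\<^sup>2" using 1 by (simp_all add: algebra_simps)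
    have "b = b * (r\<^sup>2 + s\<^sup>2)" using that by simp
    also have "\<dots> = r * (r * b + s * d) + s * (r * a + s * b) - (a + d) * r * s"
      by (simp add: power2_eq_square algebra_simps)
    finally have "b = - ((a + d) * r * s)" using that by simp
    then have "b = - (a + d) * r * s" by (simp only: mult_minus_left)
    then show ?thesis using 2 by blast
  qed
  from this[OF e n] show "d1 (d1 q) x = m * (d2 q x)\<^sup>2" "d2 (d2 q) x = m * (d1 q x)\<^sup>2"
    "d1 (d2 q) x = - m * d1 q x * d2 q x" unfolding m_def by simp_all
qed

text \<open>Along the gradient lines the Laplacian \<open>m\<close> satisfies the Riccati equation \<open>m' + m\<^sup>2 = 0\<close>,
  which is compatible with \<open>m = b + 1 / q\<close>, \<open>q' = 1\<close> only for \<open>b = 0\<close>.\<close>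

lemma eikonal_distance:
  fixes q :: "real \<times> real \<Rightarrow> real"
  assumes q: "smooth_on V q" and V: "convex V" "V \<noteq> {}" and pos: "\<And>x. x \<in> V \<Longrightarrow> q x > 0"
    and eik: "\<And>x. x \<in> V \<Longrightarrow> (d1 q x)\<^sup>2 + (d2 q x)\<^sup>2 = 1"
    and lap: "\<And>x. x \<in> V \<Longrightarrow> d1 (d1 q) x + d2 (d2 q) x = b + 1 / q x"
  shows "b = 0 \<and> (\<exists>c. \<forall>x\<in>V. q x = norm (x - c))"
proof -
  have oV: "open V" using q by (rule smooth_on_open)
  define m where "m x = b + 1 / q x" for x
  have sq [simp]: "smooth_on V (d1 q)" "smooth_on V (d2 q)" "smooth_on V q" using q by (auto intro: smooth_on_D)
  have sm [simp]: "smooth_on V m"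
    unfolding m_def using pos by (intro smooth_intros oV q) force
  have h: "d1 (d1 q) x = m x * (d2 q x)\<^sup>2" "d2 (d2 q) x = m x * (d1 q x)\<^sup>2"
    "d1 (d2 q) x = - m x * d1 q x * d2 q x" "d2 (d1 q) x = - m x * d1 q x * d2 q x" if "x \<in> V" for x
    using eikonal_hessian[OF q eik that] lap[OF that] by (simp_all add: m_def)
  have mm: "D m x v = - D q x v / (q x)\<^sup>2" if "x \<in> V" for x v
  proof -
    have "(m has_derivative (\<lambda>v. - D q x v / (q x)\<^sup>2)) (at x)"
      unfolding m_def using pos[OF that]
      by (auto intro!: derivative_eq_intros smooth_on_has_derivative[OF q that] simp: power2_eq_square divide_inverse)
    then show ?thesis by (simp add: D_eqI)
  qed
  \<comment> \<open>The equality of mixed third derivatives, computed from the Hessian formula, says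
    that each component of the gradient times \<open>m^2 - 1 / q^2\<close> vanishes, and one of the
    components is nonzero.\<close>
  have m2: "(m x)\<^sup>2 = 1 / (q x)\<^sup>2" if x: "x \<in> V" for x
  proof -
    let ?r = "d1 q x" and ?s = "d2 q x"
    have 1: "D (\<lambda>x. m x * (d2 q x)\<^sup>2) x v = m x * (2 * d2 q x * D (d2 q) x v) + D m x v * (d2 q x)\<^sup>2" for v
      by (simp add: D_mult[of V, OF _ _ x] D_power2[of V, OF _ x] smooth_on_power)
    have 2: "D (\<lambda>x. m x * (d1 q x)\<^sup>2) x v = m x * (2 * d1 q x * D (d1 q) x v) + D m x v * (d1 q x)\<^sup>2" for v
      by (simp add: D_mult[of V, OF _ _ x] D_power2[of V, OF _ x] smooth_on_power)
    have 3: "D (\<lambda>x. - m x * d1 q x * d2 q x) x v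
      = - m x * d1 q x * D (d2 q) x v + (- m x * D (d1 q) x v - D m x v * d1 q x) * d2 q x" for v
      using D_diff[OF smooth_on_const[OF oV, of 0] smooth_on_mult[OF smooth_on_mult[OF sm sq(1)] sq(2)] x, of v]
      by (simp add: D_const D_mult[of V, OF _ _ x] smooth_on_mult algebra_simps)
    have "d2 (\<lambda>x. m x * (d2 q x)\<^sup>2) x = d1 (\<lambda>x. - m x * d1 q x * d2 q x) x"
      using D_D_commute[OF sq(1) x, of "(1,0)" "(0,1)"] D_cong_on[OF oV h(1) x, of "\<lambda>x. x" "(0,1)"] D_cong_on[OF oV h(4) x, of "\<lambda>x. x" "(1,0)"]
      by simp
    then have A: "?s * ((m x)\<^sup>2 * (?r\<^sup>2 + ?s\<^sup>2) - (?r\<^sup>2 + ?s\<^sup>2) / (q x)\<^sup>2) = 0"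
      unfolding 1 3 h[OF x] mm[OF x] by (simp add: power2_eq_square algebra_simps add_divide_distrib)
    have "d1 (\<lambda>x. m x * (d1 q x)\<^sup>2) x = d2 (\<lambda>x. - m x * d1 q x * d2 q x) x"
      using D_D_commute[OF sq(2) x, of "(1,0)" "(0,1)"] D_cong_on[OF oV h(2) x, of "\<lambda>x. x" "(1,0)"] D_cong_on[OF oV h(3) x, of "\<lambda>x. x" "(0,1)"]
      by simp
    then have B: "?r * ((m x)\<^sup>2 * (?r\<^sup>2 + ?s\<^sup>2) - (?r\<^sup>2 + ?s\<^sup>2) / (q x)\<^sup>2) = 0"
      unfolding 2 3 h[OF x] mm[OF x] by (simp add: power2_eq_square algebra_simps add_divide_distrib)
    have "?r \<noteq> 0 \<or> ?s \<noteq> 0" using eik[OF x] by auto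
    then show ?thesis using A B unfolding eik[OF x] by auto
  qed
  have b0: "b = 0"
  proof (rule ccontr)
    assume b: "b \<noteq> 0"
    \<comment> \<open>From \<open>(b + 1 / q)^2 = 1 / q^2\<close> a nonzero \<open>b\<close>
      determines \<open>q\<close>, which is then constant and violates the eikonal equation.\<close>
    have c: "q x = - 2 / b" if x: "x \<in> V" for x
    proof -
      have "b * (b + 2 / q x) = 0" using m2[OF x] pos[OF x] unfolding m_def by (simp add: power2_eq_square algebra_simps)
      then have "b + 2 / q x = 0" using b by simp
      then show ?thesis using b pos[OF x] by (simp add: field_simps)
    qed
    obtain x where x: "x \<in> V" using V by blast
    have "D q x v = 0" for v using D_cong_on[OF oV c x, of "\<lambda>x. x" v] by (simp add: D_const)
    then show False using eik[OF x] by simp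
  qed
  have qm: "q x * m x = 1" if "x \<in> V" for x using pos[OF that] b0 by (simp add: m_def)
  \<comment> \<open>The field \<open>q grad q\<close> has the identity as derivative, so it equals
    \<open>x - c\<close> for a constant \<open>c\<close>; its length is \<open>q\<close>.\<close>
  have dq: "d1 (\<lambda>x. q x * d1 q x) x = 1" "d2 (\<lambda>x. q x * d1 q x) x = 0"
    "d1 (\<lambda>x. q x * d2 q x) x = 0" "d2 (\<lambda>x. q x * d2 q x) x = 1" if x: "x \<in> V" for x
  proof -
    have 1: "m x * (q x * y) = y" for y
    proof -
      have "m x * (q x * y) = (q x * m x) * y" by (simp only: ac_simps)
      then show ?thesis using qm[OF x] by simp
    qed
    show "d1 (\<lambda>x. q x * d1 q x) x = 1" "d2 (\<lambda>x. q x * d1 q x) x = 0"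
      "d1 (\<lambda>x. q x * d2 q x) x = 0" "d2 (\<lambda>x. q x * d2 q x) x = 1"
      using eik[OF x]
      by (simp_all add: D_mult[of V, OF _ _ x] h[OF x] power2_eq_square mult.assoc mult.left_commute add.commute 1)
  qed
  have lin: "D (fst :: real \<times> real \<Rightarrow> real) x v = fst v" "D (snd :: real \<times> real \<Rightarrow> real) x v = snd v" for x v
    by (simp_all add: D_eqI[OF bounded_linear_imp_has_derivative] bounded_linear_fst bounded_linear_snd)
  have sl: "smooth_on V (fst :: real \<times> real \<Rightarrow> real)" "smooth_on V (snd :: real \<times> real \<Rightarrow> real)"
    using smooth_on_fst[OF smooth_on_id[OF oV]] smooth_on_snd[OF smooth_on_id[OF oV]] by simp_all
  have s1: "smooth_on V (\<lambda>x. fst x - q x * d1 q x)" and s2: "smooth_on V (\<lambda>x. snd x - q x * d2 q x)"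
    by (intro smooth_on_diff smooth_on_mult sl sq)+
  obtain c1 where c1: "\<And>x. x \<in> V \<Longrightarrow> fst x - q x * d1 q x = c1"
    by (rule zero_derivative_constant[OF s1 V(1)])
       (simp_all add: D_diff[OF sl(1) smooth_on_mult] dq lin)
  obtain c2 where c2: "\<And>x. x \<in> V \<Longrightarrow> snd x - q x * d2 q x = c2"
    by (rule zero_derivative_constant[OF s2 V(1)])
       (simp_all add: D_diff[OF sl(2) smooth_on_mult] dq lin)
  have "q x = norm (x - (c1, c2))" if x: "x \<in> V" for x
  proof -
    have "fst x - c1 = q x * d1 q x" "snd x - c2 = q x * d2 q x" using c1[OF x] c2[OF x] by simp_all
    then have "(fst x - c1)\<^sup>2 + (snd x - c2)\<^sup>2 = (q x)\<^sup>2 * ((d1 q x)\<^sup>2 + (d2 q x)\<^sup>2)"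
      by (simp add: power_mult_distrib algebra_simps)
    then show ?thesis using eik[OF x] pos[OF x] by (simp add: norm_prod_def)
  qed
  then show ?thesis using b0 by blast
qed

context lagrangian_patch
begin

text \<open>The classical formula that \<open>K\<close> is \<open>k / 2\<close> times the Laplacian
  of \<open>log k\<close> for the metric \<open>|dz|^2 / k\<close>, multiplied out.
  \<open>D_metric_frame\<close> determines all Christoffel symbols of such a metric.\<close>

lemma conformal_curvature:
  assumes g: "\<And>x. x \<in> U \<Longrightarrow> g11 x = 1 / k x" "\<And>x. x \<in> U \<Longrightarrow> g22 x = 1 / k x" "\<And>x. x \<in> U \<Longrightarrow> g12 x = 0"
    and k: "smooth_on U k" "\<And>x. x \<in> U \<Longrightarrow> k x > 0" and x: "x \<in> U"
  shows "2 * gaussian_curvature G x * k x = k x * (d1 (d1 k) x + d2 (d2 k) x) - ((d1 k x)\<^sup>2 + (d2 k x)\<^sup>2)"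
proof -
  have dk: "D (\<lambda>x. 1 / k x) x v = - D k x v / (k x)\<^sup>2" if "x \<in> U" for x v
  proof -
    have "((\<lambda>x. 1 / k x) has_derivative (\<lambda>v. - D k x v / (k x)\<^sup>2)) (at x)"
      using k(2)[OF that]
      by (auto intro!: derivative_eq_intros smooth_on_has_derivative[OF k(1) that] simp: power2_eq_square divide_inverse)
    then show ?thesis by (simp add: D_eqI)
  qed
  have dg: "D g11 x v = - D k x v / (k x)\<^sup>2" "D g22 x v = - D k x v / (k x)\<^sup>2" "D g12 x v = 0" if "x \<in> U" for x v
    using D_cong_on[OF open_U g(1) that, of "\<lambda>x. x" v] D_cong_on[OF open_U g(2) that, of "\<lambda>x. x" v] D_cong_on[OF open_U g(3) that, of "\<lambda>x. x" v] dk[OF that]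
    by (simp_all add: D_const)
  have p: "Re (A1 x) = - d1 k x / (2 * k x)" "Re (B1 x) = - d2 k x / (2 * k x)" "Re (B2 x) = - d1 k x / (2 * k x)"
    "Re (C2 x) = - d2 k x / (2 * k x)" "Re (A2 x) = d2 k x / (2 * k x)" "Re (C1 x) = d1 k x / (2 * k x)" if "x \<in> U" for x
  proof -
    have z: "k x \<noteq> 0" using k(2)[OF that] by simp
    note m = D_metric_frame[OF that, unfolded dg[OF that] g(1)[OF that] g(2)[OF that] g(3)[OF that]]
    show 1: "Re (A1 x) = - d1 k x / (2 * k x)" "Re (B1 x) = - d2 k x / (2 * k x)" "Re (B2 x) = - d1 k x / (2 * k x)"
      "Re (C2 x) = - d2 k x / (2 * k x)"
      using m(1-4) z by (simp_all add: field_simps power2_eq_square)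
    have "Re (A2 x) + Re (B1 x) = 0" "Re (C1 x) + Re (B2 x) = 0"
      using m(5,6) z by (simp_all add: field_simps)
    then show "Re (A2 x) = d2 k x / (2 * k x)" "Re (C1 x) = d1 k x / (2 * k x)" using 1 by simp_all
  qed
  have z: "k x \<noteq> 0" using k(2)[OF x] by simp
  have s: "smooth_on U (d1 k)" "smooth_on U (d2 k)" using k(1) by (auto intro: smooth_on_D)
  have q: "D (\<lambda>x. F x / (2 * k x)) x v = D F x v / (2 * k x) - F x * D k x v / (2 * (k x)\<^sup>2)" if "smooth_on U F" for F :: "_ \<Rightarrow> real" and v
  proof -
    have "((\<lambda>x. F x / (2 * k x)) has_derivative (\<lambda>v. D F x v / (2 * k x) - F x * D k x v / (2 * (k x)\<^sup>2))) (at x)"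
      using z by (auto intro!: derivative_eq_intros smooth_on_has_derivative[OF k(1) x] smooth_on_has_derivative[OF that x] ext
          simp: power2_eq_square divide_simps)
    then show ?thesis by (simp add: D_eqI)
  qed
  have c1: "Re (d1 C1 x) = d1 (d1 k) x / (2 * k x) - (d1 k x)\<^sup>2 / (2 * (k x)\<^sup>2)"
    using D_cong_on[OF open_U p(6) x, of "\<lambda>x. x" "(1,0)"] unfolding q[OF s(1)] D_Re[OF smooth_coeffs(7) x]
    by (simp add: power2_eq_square)
  have "d2 (\<lambda>x. - d2 k x / (2 * k x)) x = - (d2 (\<lambda>x. d2 k x / (2 * k x)) x)"
  proof -
    have "smooth_on U (\<lambda>x. d2 k x / (2 * k x))" using less_imp_neq[OF k(2), symmetric] by (intro smooth_intros s k(1) open_U) simp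
    from D_linear[OF bounded_linear_minus[OF bounded_linear_ident] this x, of "(0,1)"] show ?thesis by simp
  qed
  then have b1: "Re (d2 B1 x) = - (d2 (d2 k) x / (2 * k x) - (d2 k x)\<^sup>2 / (2 * (k x)\<^sup>2))"
    using D_cong_on[OF open_U p(2) x, of "\<lambda>x. x" "(0,1)"] unfolding q[OF s(2)] D_Re[OF smooth_coeffs(5) x]
    by (simp add: power2_eq_square)
  have "\<Delta> x = 1 / (k x)\<^sup>2" by (simp add: \<Delta>_def g[OF x] power2_eq_square)
  then have "gaussian_curvature G x * (1 / (k x)\<^sup>2) = (d1 (d1 k) x / (2 * k x) - (d1 k x)\<^sup>2 / (2 * (k x)\<^sup>2)
      + (d2 (d2 k) x / (2 * k x) - (d2 k x)\<^sup>2 / (2 * (k x)\<^sup>2))) * (1 / k x)"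
    using gaussian_curvature_christoffel[OF x] unfolding c1 b1 p[OF x] g[OF x] by (simp add: algebra_simps)
  then have "2 * (k x * k x) * (2 * gaussian_curvature G x * k x
      - (k x * (d1 (d1 k) x + d2 (d2 k) x) - ((d1 k x)\<^sup>2 + (d2 k x)\<^sup>2))) = 0"
    using z by (simp add: field_simps power2_eq_square)
  then show ?thesis using z by simp
qed

end

section \<open>Flat coordinates and the model surface\<close>

text \<open>With \<open>w = u + i v\<close> and \<open>z = x + i y\<close>, \<open>w\<close> is
  holomorphic and the hypothesis reads \<open>|w|^2 - \<kappa> Re (z w) = c\<close>. The second term
  is harmonic, so the Laplacian of the left-hand side is \<open>4 |w'|^2\<close> and
  \<open>w'\<close> vanishes; the first derivatives of the identity then reduce to
  \<open>\<kappa> w = 0\<close>.\<close>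

lemma cauchy_riemann_quadratic:
  fixes u v :: "real \<times> real \<Rightarrow> real"
  assumes u: "smooth_on U u" and v: "smooth_on U v" and \<kappa>: "\<kappa> \<noteq> 0"
    and cr: "\<And>x. x \<in> U \<Longrightarrow> d1 u x = d2 v x" "\<And>x. x \<in> U \<Longrightarrow> d1 v x = - d2 u x"
    and quad: "\<And>x. x \<in> U \<Longrightarrow> (u x)\<^sup>2 + (v x)\<^sup>2 - \<kappa> * fst x * u x + \<kappa> * snd x * v x = c"
    and x: "x \<in> U"
  shows "u x = 0 \<and> v x = 0"
proof -
  have oU: "open U" using u by (rule smooth_on_open)
  define s t where "s = d1 u" and "t = d2 u"
  have dv: "d1 v x = - t x" "d2 v x = s x" if "x \<in> U" for x using cr[OF that] by (simp_all add: s_def t_def)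
  have du: "d1 u x = s x" "d2 u x = t x" for x by (simp_all add: s_def t_def)
  have st [simp]: "smooth_on U s" "smooth_on U t" unfolding s_def t_def using u by (auto intro: smooth_on_D)
  note hd = smooth_on_has_derivative
  have F: "2 * u x * D u x w + 2 * v x * D v x w - \<kappa> * (fst w * u x + fst x * D u x w) + \<kappa> * (snd w * v x + snd x * D v x w) = 0"
    if x: "x \<in> U" for x w
  proof -
    have hF: "((\<lambda>x. (u x)\<^sup>2 + (v x)\<^sup>2 - \<kappa> * fst x * u x + \<kappa> * snd x * v x) has_derivative
      (\<lambda>w. 2 * u x * D u x w + 2 * v x * D v x w - \<kappa> * (fst w * u x + fst x * D u x w) + \<kappa> * (snd w * v x + snd x * D v x w))) (at x)"
      by (auto intro!: derivative_eq_intros hd[OF u x] hd[OF v x] ext simp: algebra_simps)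
    have "D (\<lambda>x. (u x)\<^sup>2 + (v x)\<^sup>2 - \<kappa> * fst x * u x + \<kappa> * snd x * v x) x w = 0"
      using D_cong_on[OF oU quad x, of "\<lambda>x. x" w] by (simp add: D_const)
    then show ?thesis unfolding D_eqI[OF hF] .
  qed
  have F1: "2 * u x * s x - 2 * v x * t x - \<kappa> * u x - \<kappa> * fst x * s x - \<kappa> * snd x * t x = 0" if "x \<in> U" for x
    using F[OF that, of "(1,0)"] by (simp add: du dv[OF that] algebra_simps)
  have F2: "2 * u x * t x + 2 * v x * s x - \<kappa> * fst x * t x + \<kappa> * v x + \<kappa> * snd x * s x = 0" if "x \<in> U" for x
    using F[OF that, of "(0,1)"] by (simp add: du dv[OF that] algebra_simps)
  have h1: "d2 s x = d1 t x" unfolding s_def t_def by (rule D_D_commute[OF u x])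
  have h2: "d2 t x = - d1 s x"
  proof -
    have "d2 (d1 v) x = d1 (d2 v) x" by (rule D_D_commute[OF v x])
    moreover have "d2 (d1 v) x = - d2 t x"
      using D_cong_on[OF oU dv(1) x, of "\<lambda>x. x" "(0,1)"] D_linear[OF bounded_linear_minus[OF bounded_linear_ident] st(2) x, of "(0,1)"] by simp
    moreover have "d1 (d2 v) x = d1 s x" by (rule D_cong_on[OF oU dv(2) x])
    ultimately show ?thesis by simp
  qed
  have "d1 (\<lambda>x. 2 * u x * s x - 2 * v x * t x - \<kappa> * u x - \<kappa> * fst x * s x - \<kappa> * snd x * t x) x = 0"
    using D_cong_on[OF oU F1 x, of "\<lambda>x. x" "(1,0)"] by (simp add: D_const)
  moreover have "((\<lambda>x. 2 * u x * s x - 2 * v x * t x - \<kappa> * u x - \<kappa> * fst x * s x - \<kappa> * snd x * t x) has_derivative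
    (\<lambda>w. 2 * D u x w * s x + 2 * u x * D s x w - 2 * D v x w * t x - 2 * v x * D t x w - \<kappa> * D u x w
      - \<kappa> * fst w * s x - \<kappa> * fst x * D s x w - \<kappa> * snd w * t x - \<kappa> * snd x * D t x w)) (at x)"
    by (auto intro!: derivative_eq_intros hd[OF u x] hd[OF v x] hd[OF st(1) x] hd[OF st(2) x] ext simp: algebra_simps)
  ultimately have L1: "2 * s x * s x + 2 * u x * d1 s x + 2 * t x * t x - 2 * v x * d1 t x - \<kappa> * s x
      - \<kappa> * s x - \<kappa> * fst x * d1 s x - \<kappa> * snd x * d1 t x = 0"
    by (simp add: D_eqI du dv[OF x])
  have "d2 (\<lambda>x. 2 * u x * t x + 2 * v x * s x - \<kappa> * fst x * t x + \<kappa> * v x + \<kappa> * snd x * s x) x = 0"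
    using D_cong_on[OF oU F2 x, of "\<lambda>x. x" "(0,1)"] by (simp add: D_const)
  moreover have "((\<lambda>x. 2 * u x * t x + 2 * v x * s x - \<kappa> * fst x * t x + \<kappa> * v x + \<kappa> * snd x * s x) has_derivative
    (\<lambda>w. 2 * D u x w * t x + 2 * u x * D t x w + 2 * D v x w * s x + 2 * v x * D s x w
      - \<kappa> * fst w * t x - \<kappa> * fst x * D t x w + \<kappa> * D v x w + \<kappa> * snd w * s x + \<kappa> * snd x * D s x w)) (at x)"
    by (auto intro!: derivative_eq_intros hd[OF u x] hd[OF v x] hd[OF st(1) x] hd[OF st(2) x] ext simp: algebra_simps)
  ultimately have L2: "2 * t x * t x + 2 * u x * d2 t x + 2 * s x * s x + 2 * v x * d2 s x
      - \<kappa> * fst x * d2 t x + \<kappa> * s x + \<kappa> * s x + \<kappa> * snd x * d2 s x = 0"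
    by (simp add: D_eqI du dv[OF x])
  \<comment> \<open>The sum is the Laplacian of the quadratic identity; all second derivatives of
    \<open>u\<close> and \<open>v\<close> cancel by harmonicity.\<close>
  have "4 * ((s x)\<^sup>2 + (t x)\<^sup>2) = (2 * s x * s x + 2 * u x * d1 s x + 2 * t x * t x - 2 * v x * d1 t x - \<kappa> * s x
      - \<kappa> * s x - \<kappa> * fst x * d1 s x - \<kappa> * snd x * d1 t x)
      + (2 * t x * t x + 2 * u x * d2 t x + 2 * s x * s x + 2 * v x * d2 s x
      - \<kappa> * fst x * d2 t x + \<kappa> * s x + \<kappa> * s x + \<kappa> * snd x * d2 s x)"
    unfolding h1 h2 power2_eq_square by (simp add: algebra_simps)
  also have "\<dots> = 0" unfolding L1 L2 by simp
  finally have "(s x)\<^sup>2 + (t x)\<^sup>2 = 0" by (metis mult_eq_0_iff zero_neq_numeral)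
  then have "s x = 0" "t x = 0" by simp_all
  then show ?thesis using F1[OF x] F2[OF x] \<kappa> by simp
qed

section \<open>The model map and unitary motions\<close>

lemma F_map_has_derivative:
  "(F_map \<kappa> has_derivative (\<lambda>v. vector [fst v *\<^sub>R exp (\<i> * complex_of_real (\<kappa> * (fst z)\<^sup>2)),
      snd v *\<^sub>R exp (- \<i> * complex_of_real (\<kappa> * (snd z)\<^sup>2))])) (at z)"
proof -
  have d: "((\<lambda>x. LBINT t=ereal 0..ereal x. E t) has_vector_derivative E x) (at x)"
    if E: "continuous_on UNIV E" for E :: "real \<Rightarrow> complex" and x
  proof -
    \<comment> \<open>The fundamental theorem speaks of a closed interval containing the base point
      0; this one has \<open>x\<close> in its interior.\<close>
    define a b where "a = min x 0 - 1" and "b = max x 0 + 1"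
    have "((\<lambda>u. LBINT t=ereal 0..ereal u. E t) has_vector_derivative E x) (at x within {a..b})"
      by (rule interval_integral_FTC2) (auto simp: a_def b_def intro: continuous_on_subset[OF E])
    moreover have "at x within {a..b} = at x"
      by (rule at_within_interior) (auto simp: a_def b_def)
    ultimately show ?thesis by simp
  qed
  have c: "continuous_on UNIV (\<lambda>t. exp (\<i> * complex_of_real (\<kappa> * t\<^sup>2)))"
    "continuous_on UNIV (\<lambda>t. exp (- \<i> * complex_of_real (\<kappa> * t\<^sup>2)))"
    by (intro continuous_intros)+
  have 1: "((\<lambda>z::real \<times> real. LBINT t=ereal 0..ereal (fst z). exp (\<i> * complex_of_real (\<kappa> * t\<^sup>2))) has_derivative
      (\<lambda>v. fst v *\<^sub>R exp (\<i> * complex_of_real (\<kappa> * (fst z)\<^sup>2)))) (at z)"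
    using has_derivative_compose[OF bounded_linear_imp_has_derivative[OF bounded_linear_fst]
        d[OF c(1), of "fst z", unfolded has_vector_derivative_def]] by simp
  have 2: "((\<lambda>z::real \<times> real. LBINT t=ereal 0..ereal (snd z). exp (- \<i> * complex_of_real (\<kappa> * t\<^sup>2))) has_derivative
      (\<lambda>v. snd v *\<^sub>R exp (- \<i> * complex_of_real (\<kappa> * (snd z)\<^sup>2)))) (at z)"
    using has_derivative_compose[OF bounded_linear_imp_has_derivative[OF bounded_linear_snd]
        d[OF c(2), of "snd z", unfolded has_vector_derivative_def]] by simp
  have v: "vector [a, b] = a *s (vector [1, 0] :: complex^2) + b *s vector [0, 1]" for a b
    by (simp add: vec_eq_iff forall_2)
  have "((\<lambda>z::real\<times>real. (LBINT t=ereal 0..ereal (fst z). exp (\<i> * complex_of_real (\<kappa> * t\<^sup>2))) *s (vector [1, 0] :: complex^2)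
      + (LBINT t=ereal 0..ereal (snd z). exp (- \<i> * complex_of_real (\<kappa> * t\<^sup>2))) *s vector [0, 1]) has_derivative
     (\<lambda>w. ((fst w *\<^sub>R exp (\<i> * complex_of_real (\<kappa> * (fst z)\<^sup>2))) *s vector [1, 0])
       + ((snd w *\<^sub>R exp (- \<i> * complex_of_real (\<kappa> * (snd z)\<^sup>2))) *s vector [0, 1]))) (at z)"
    by (rule has_derivative_eq_rhs[OF has_derivative_add[OF
          has_derivative_vscale[OF 1 has_derivative_const] has_derivative_vscale[OF 2 has_derivative_const]]]) simp
  then show ?thesis unfolding F_map_def case_prod_beta' v[symmetric] .
qed

lemma smooth_F_map: "smooth_on UNIV (F_map \<kappa>)"
proof (rule smooth_on_from_partials)
  let ?p = "\<lambda>z::real\<times>real. vector [exp (\<i> * complex_of_real (\<kappa> * (fst z)\<^sup>2)), 0] :: complex^2"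
  let ?q = "\<lambda>z::real\<times>real. vector [0, exp (- \<i> * complex_of_real (\<kappa> * (snd z)\<^sup>2))] :: complex^2"
  show "smooth_on UNIV ?p" "smooth_on UNIV ?q"
    by (intro smooth_intros open_UNIV)+
  show "(F_map \<kappa> has_derivative (\<lambda>v. fst v *\<^sub>R ?p z + snd v *\<^sub>R ?q z)) (at z)" for z
    by (rule has_derivative_eq_rhs[OF F_map_has_derivative]) (simp add: fun_eq_iff vec_eq_iff forall_2)
qed

lemma D_F_map: "D (F_map \<kappa>) z v = vector [fst v *\<^sub>R exp (\<i> * complex_of_real (\<kappa> * (fst z)\<^sup>2)),
      snd v *\<^sub>R exp (- \<i> * complex_of_real (\<kappa> * (snd z)\<^sup>2))]"
  by (simp add: D_eqI[OF F_map_has_derivative])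

lemma csf_herm_flat: "csf_herm 0 w a b = herm a b"
  by (simp add: csf_herm_def csf_weight_def csf_inv_def)

text \<open>The rows of \<open>W\<close> are the conjugates of the two vectors. Orthonormality says
  that \<open>W\<close> times its adjoint is the identity, and for square matrices the other order
  follows.\<close>

lemma unitary_of_orthonormal:
  assumes "herm c1 c1 = 1" "herm c2 c2 = 1" "herm c1 c2 = 0"
  obtains W :: "complex^2^2" where "unitary W" "\<And>v. W *v v = vector [herm v c1, herm v c2]"
proof -
  define W :: "complex^2^2" where "W = (\<chi> j i. cnj ((if j = 1 then c1 else c2) $ i))"
  have h: "herm c2 c1 = 0" using assms(3) by (metis cnj_herm complex_cnj_zero)
  have "W ** (\<chi> i j. cnj (W $ j $ i)) = mat 1"
    using assms h
    by (simp add: vec_eq_iff forall_2 matrix_matrix_mult_def mat_def sum_2 W_def herm_2 mult.commute)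
  then have "unitary W" unfolding unitary_def using matrix_left_right_inverse by blast
  moreover have "W *v v = vector [herm v c1, herm v c2]" for v
    by (simp add: vec_eq_iff forall_2 matrix_vector_mult_def sum_2 W_def herm_2 mult.commute)
  ultimately show ?thesis using that by blast
qed

context lagrangian_patch
begin

text \<open>A constant metric kills the real parts of all coefficients, and the given \<alpha>
  together with \<open>T_symmetric\<close> leaves two free functions \<open>u\<close>,
  \<open>v\<close>. Codazzi gives the Cauchy-Riemann equations, Gauss a quadratic relation with
  right-hand side \<open>\<epsilon> / 2\<close>; \<open>cauchy_riemann_quadratic\<close> then forces
  \<open>u\<close>, \<open>v\<close> and \<epsilon> to vanish.\<close>

lemma flat_model:
  assumes U: "convex U" "U \<noteq> {}" and \<kappa>: "\<kappa> > 0"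
    and g: "\<And>x. x \<in> U \<Longrightarrow> g11 x = 1" "\<And>x. x \<in> U \<Longrightarrow> g22 x = 1" "\<And>x. x \<in> U \<Longrightarrow> g12 x = 0"
    and \<alpha>: "\<And>x. x \<in> U \<Longrightarrow> \<alpha>1 x = \<kappa> * fst x" "\<And>x. x \<in> U \<Longrightarrow> \<alpha>2 x = - \<kappa> * snd x"
  shows "\<epsilon> = 0 \<and> (\<exists>W Z0. unitary W \<and> (\<forall>x\<in>U. W *v f x + Z0 = F_map \<kappa> x))"
proof -
  have dg: "D g11 x v = 0" "D g22 x v = 0" "D g12 x v = 0" if "x \<in> U" for x v
    using D_cong_on[OF open_U g(1) that, of "\<lambda>x. x" v] D_cong_on[OF open_U g(2) that, of "\<lambda>x. x" v] D_cong_on[OF open_U g(3) that, of "\<lambda>x. x" v]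
    by (simp_all add: D_const)
  have re: "Re (A1 x) = 0" "Re (A2 x) = 0" "Re (B1 x) = 0" "Re (B2 x) = 0" "Re (C1 x) = 0" "Re (C2 x) = 0" if "x \<in> U" for x
    using D_metric_frame[OF that, unfolded dg[OF that] g(1)[OF that] g(2)[OF that] g(3)[OF that]] by simp_all
  define u v where "u x = Im (B2 x)" and "v x = Im (B1 x)" for x
  have im: "Im (B2 x) = u x" "Im (B1 x) = v x" "Im (C1 x) = u x" "Im (A2 x) = v x"
    "Im (A1 x) = 2 * \<kappa> * fst x - u x" "Im (C2 x) = - 2 * \<kappa> * snd x - v x" if "x \<in> U" for x
    using T_symmetric[OF that] \<alpha>[OF that] by (simp_all add: u_def v_def g[OF that] \<alpha>1_def \<alpha>2_def)
  have su: "smooth_on U u" and sv: "smooth_on U v"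
    unfolding u_def v_def by (intro smooth_intros smooth_coeffs)+
  have cr: "d1 v x = - d2 u x" "d1 u x = d2 v x" if x: "x \<in> U" for x
  proof -
    have i: "D F x w = D (\<lambda>x. Im (E x)) x w" if "smooth_on U E" "\<And>x. x \<in> U \<Longrightarrow> Im (E x) = F x" for F E w
      using D_cong_on[OF open_U _ x, of "\<lambda>x. Im (E x)" F w] that(2) by simp
    have ImD: "Im (D E x w) = D F x w" if "smooth_on U E" "\<And>x. x \<in> U \<Longrightarrow> Im (E x) = F x" for F E w
      using i[OF that] D_Im[OF that(1) x] by simp
    have A1: "Im (d2 A1 x) = - d2 u x"
    proof -
      have "((\<lambda>x. 2 * \<kappa> * fst x - u x) has_derivative (\<lambda>w. 2 * \<kappa> * fst w - D u x w)) (at x)"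
        by (auto intro!: derivative_eq_intros smooth_on_has_derivative[OF su x])
      then show ?thesis using ImD[OF smooth_coeffs(3) im(5), of "(0,1)"] by (simp add: D_eqI)
    qed
    have "Im (d1 B1 x) - Im (d2 A1 x) = 0"
      using arg_cong[OF integrability(1)[OF x], of Im] by (simp add: re[OF x] g[OF x])
    then show "d1 v x = - d2 u x" using A1 ImD[OF smooth_coeffs(5) im(2)] by simp
    have "Im (d1 B2 x) - Im (d2 A2 x) = 0"
      using arg_cong[OF integrability(2)[OF x], of Im] by (simp add: re[OF x])
    then show "d1 u x = d2 v x" using ImD[OF smooth_coeffs(6) im(1)] ImD[OF smooth_coeffs(4) im(4)] by simp
  qed
  have quad: "(u x)\<^sup>2 + (v x)\<^sup>2 - \<kappa> * fst x * u x + \<kappa> * snd x * v x = \<epsilon> / 2" if x: "x \<in> U" for x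
  proof -
    have ReD: "Re (D E x w) = 0" if "smooth_on U E" "\<And>x. x \<in> U \<Longrightarrow> Re (E x) = 0" for E w
      using D_cong_on[OF open_U _ x, of "\<lambda>x. Re (E x)" "\<lambda>x. 0" w] that D_Re[OF that(1) x] by (simp add: D_const)
    show ?thesis
      using arg_cong[OF integrability(2)[OF x], of Re] ReD[OF smooth_coeffs(6) re(4)] ReD[OF smooth_coeffs(4) re(2)]
      by (simp add: re[OF x] im[OF x] g[OF x] power2_eq_square algebra_simps)
  qed
  have uv: "u x = 0" "v x = 0" if "x \<in> U" for x
  proof -
    have "u x = 0 \<and> v x = 0"
      by (rule cauchy_riemann_quadratic[OF su sv _ _ _ _ that, of \<kappa> "\<epsilon> / 2"]) (use cr quad \<kappa> in auto)
    then show "u x = 0" "v x = 0" by simp_all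
  qed
  obtain z0 where z0: "z0 \<in> U" using U by blast
  have \<epsilon>: "\<epsilon> = 0" using quad[OF z0] uv[OF z0] by simp
  have eta: "\<eta>1 x = 0" "\<eta>2 x = 0" for x unfolding \<eta>1_def \<eta>2_def by (simp_all add: \<epsilon>)
  have co: "A1 x = \<i> * of_real (2 * \<kappa> * fst x)" "A2 x = 0" "B1 x = 0" "B2 x = 0" "C1 x = 0"
    "C2 x = - \<i> * of_real (2 * \<kappa> * snd x)" if "x \<in> U" for x
    using re[OF that] im[OF that] uv[OF that] by (simp_all add: complex_eq_iff)
  have sd: "d1 f1 x = (\<i> * of_real (2 * \<kappa> * fst x)) *s f1 x" "d1 f2 x = 0" "d2 f1 x = 0"
    "d2 f2 x = (- \<i> * of_real (2 * \<kappa> * snd x)) *s f2 x" if "x \<in> U" for x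
    using second_derivatives[OF that] by (simp_all add: eta co[OF that])
  \<comment> \<open>Integrating factors of the remaining equations
    \<open>d1 f1 = 2 i \<kappa> x f1\<close> and \<open>d2 f2 = - 2 i \<kappa> y f2\<close>, whose
    mixed companions vanish. They are the conjugates of the integrands of
    \<open>F_map\<close>.\<close>
  define e1 e2 where "e1 z = exp (- \<i> * complex_of_real (\<kappa> * (fst z)\<^sup>2))"
    and "e2 z = exp (\<i> * complex_of_real (\<kappa> * (snd z)\<^sup>2))" for z :: "real \<times> real"
  have se: "smooth_on U e1" "smooth_on U e2"
    unfolding e1_def e2_def by (intro smooth_intros open_U)+
  have d: "(e1 has_derivative (\<lambda>v. - \<i> * of_real (2 * \<kappa> * fst z * fst v) * e1 z)) (at z)"
    "(e2 has_derivative (\<lambda>v. \<i> * of_real (2 * \<kappa> * snd z * snd v) * e2 z)) (at z)" for z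
  proof -
    have a: "((\<lambda>z. c * complex_of_real (\<kappa> * (T z)\<^sup>2)) has_derivative (\<lambda>v. c * of_real (2 * \<kappa> * T z * T v))) (at z)"
      if "bounded_linear T" for T :: "real \<times> real \<Rightarrow> real" and c
      by (auto intro!: derivative_eq_intros bounded_linear.has_derivative[OF that] ext simp: algebra_simps)
    show "(e1 has_derivative (\<lambda>v. - \<i> * of_real (2 * \<kappa> * fst z * fst v) * e1 z)) (at z)"
      unfolding e1_def using has_derivative_compose[OF a[OF bounded_linear_fst] DERIV_exp[unfolded has_field_derivative_def], of "- \<i>"]
      by (rule has_derivative_eq_rhs) (simp add: fun_eq_iff mult_ac)
    show "(e2 has_derivative (\<lambda>v. \<i> * of_real (2 * \<kappa> * snd z * snd v) * e2 z)) (at z)"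
      unfolding e2_def using has_derivative_compose[OF a[OF bounded_linear_snd] DERIV_exp[unfolded has_field_derivative_def], of "\<i>"]
      by (rule has_derivative_eq_rhs) (simp add: fun_eq_iff mult_ac)
  qed
  have De: "D e1 z v = - \<i> * of_real (2 * \<kappa> * fst z * fst v) * e1 z" "D e2 z v = \<i> * of_real (2 * \<kappa> * snd z * snd v) * e2 z" for z v
    using D_eqI[OF d(1)] D_eqI[OF d(2)] by simp_all
  have s1: "smooth_on U (\<lambda>x. e1 x *s f1 x)" and s2: "smooth_on U (\<lambda>x. e2 x *s f2 x)"
    by (intro smooth_intros se smooth_coeffs)+
  obtain c1 where c1: "\<And>x. x \<in> U \<Longrightarrow> e1 x *s f1 x = c1"
    by (rule zero_derivative_constant[OF s1 U(1)])
       (simp_all add: D_vscale[OF se(1) smooth_coeffs(1)] De sd mult_ac)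
  obtain c2 where c2: "\<And>x. x \<in> U \<Longrightarrow> e2 x *s f2 x = c2"
    by (rule zero_derivative_constant[OF s2 U(1)])
       (simp_all add: D_vscale[OF se(2) smooth_coeffs(2)] De sd mult_ac)
  have ee: "exp (\<i> * complex_of_real (\<kappa> * (fst x)\<^sup>2)) * e1 x = 1" "exp (- \<i> * complex_of_real (\<kappa> * (snd x)\<^sup>2)) * e2 x = 1" for x
    unfolding e1_def e2_def exp_add[symmetric] by simp_all
  have f12: "f1 x = exp (\<i> * complex_of_real (\<kappa> * (fst x)\<^sup>2)) *s c1" "f2 x = exp (- \<i> * complex_of_real (\<kappa> * (snd x)\<^sup>2)) *s c2"
    if "x \<in> U" for x
    using c1[OF that] c2[OF that] ee[of x] by (metis vector_smult_assoc vector_smult_lid)+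
  have ce: "e1 x * cnj (e1 x) = 1" "e2 x * cnj (e2 x) = 1" for x
    unfolding e1_def e2_def exp_cnj exp_add[symmetric] by (simp_all add: exp_add[symmetric])
  have hz: "herm (f1 z0) (f1 z0) = 1" "herm (f2 z0) (f2 z0) = 1" "herm (f1 z0) (f2 z0) = 0"
    using herm_frame[OF z0] g[OF z0] by (simp_all add: \<epsilon> csf_herm_flat)
  have "herm c1 c1 = 1" "herm c2 c2 = 1" "herm c1 c2 = 0"
    using hz ce[of z0] unfolding c1[OF z0, symmetric] c2[OF z0, symmetric] by (simp_all add: mult.commute)
  then obtain W :: "complex^2^2" where W: "unitary W" "\<And>v. W *v v = vector [herm v c1, herm v c2]"
    and on: "herm c1 c1 = 1" "herm c2 c2 = 1" "herm c1 c2 = 0" "herm c2 c1 = 0"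
    using unitary_of_orthonormal by (metis cnj_herm complex_cnj_zero)
  have bW: "bounded_linear (\<lambda>v. W *v v)"
  proof -
    have "linear (\<lambda>v::complex^2. W *v v)"
      by (rule linearI) (simp_all add: W(2) vec_eq_iff forall_2 scaleR_conv_of_real[where 'a = complex])
    then show ?thesis by (rule linear_conv_bounded_linear[THEN iffD1])
  qed
  have sW: "smooth_on U (\<lambda>x. W *v f x)" by (rule smooth_on_linear[OF bW smooth])
  have sF: "smooth_on U (F_map \<kappa>)" by (rule smooth_on_subset[OF smooth_F_map open_U]) simp
  \<comment> \<open>\<open>W\<close> maps the orthonormal constants \<open>c1\<close>,
    \<open>c2\<close> to the standard basis, so both terms have the same derivative.\<close>
  define R where "R x = F_map \<kappa> x - W *v f x" for x
  have sR: "smooth_on U R" unfolding R_def by (rule smooth_on_diff[OF sF sW])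
  have dR: "D R x v = D (F_map \<kappa>) x v - W *v D f x v" if "x \<in> U" for x v
    unfolding R_def by (simp add: D_diff[OF sF sW that] D_linear[OF bW smooth that])
  have "d1 R x = 0" "d2 R x = 0" if "x \<in> U" for x
    by (simp_all add: dR[OF that] D_F_map f12[OF that] W(2) on vec_eq_iff forall_2 scaleR_conv_of_real)
  then obtain Z0 where Z0: "\<And>x. x \<in> U \<Longrightarrow> R x = Z0"
    using zero_derivative_constant[OF sR U(1)] by blast
  have "W *v f x + Z0 = F_map \<kappa> x" if "x \<in> U" for x using Z0[OF that, symmetric] by (simp add: R_def)
  then show ?thesis using \<epsilon> W(1) by blast
qed

end

section \<open>Isothermal coordinates, the complex square root and the local classification\<close>

context lagrangian_patch
begin

lemma smooth_a [simp]:
  "smooth_on U a1" "smooth_on U a2" "smooth_on U (\<lambda>x. sqrt (\<Delta> x))"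
proof -
  have nz: "\<Delta> x \<noteq> 0" if "x \<in> U" for x using Delta_pos[OF that] by simp
  show "smooth_on U a1" "smooth_on U a2"
    unfolding a1_def a2_def by (intro smooth_intros smooth_coeffs smooth_alpha nz; assumption)+
  show "smooth_on U (\<lambda>x. sqrt (\<Delta> x))"
    by (intro smooth_intros smooth_alpha Delta_pos)
qed

lemma h2_eq: "h2 x = a1 x * \<alpha>1 x + a2 x * \<alpha>2 x"
  by (simp add: a1_def a2_def h2_def power2_eq_square algebra_simps add_divide_distrib diff_divide_distrib)

end

text \<open>The hypotheses on one patch, in terms of the squared length \<open>h2\<close> of the
  mean curvature vector: as \<open>grad h2 = 2 |H| grad |H|\<close>, the gradient condition becomes
  free of square roots of \<open>h2\<close>. The last assumption is the coordinate form of a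
  vanishing divergence of \<open>J H\<close>.\<close>

locale constant_patch = lagrangian_patch +
  fixes K \<kappa> :: real
  assumes kappa_pos: "\<kappa> > 0" and nonzero_H: "x \<in> U \<Longrightarrow> h2 x > 0"
    and constant_curvature: "x \<in> U \<Longrightarrow> gaussian_curvature G x = K"
    and constant_gradient: "x \<in> U \<Longrightarrow>
      (g22 x * (d1 h2 x)\<^sup>2 - 2 * g12 x * d1 h2 x * d2 h2 x + g11 x * (d2 h2 x)\<^sup>2) / \<Delta> x = 4 * \<kappa>\<^sup>2 * h2 x"
    and coclosed: "x \<in> U \<Longrightarrow> d1 (\<lambda>x. sqrt (\<Delta> x) * a1 x) x + d2 (\<lambda>x. sqrt (\<Delta> x) * a2 x) x = 0"
begin

text \<open>The mean curvature form and its Hodge dual are closed; their potentials are the coordinates.\<close>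

lemma harmonic_coordinates:
  assumes x0: "x0 \<in> U"
  obtains U' \<Psi> V \<Theta> where "open U'" "x0 \<in> U'" "U' \<subseteq> U" "open V" "homeomorphism U' V \<Psi> \<Theta>"
    "smooth_on U' \<Psi>" "smooth_on V \<Theta>"
    "\<And>y. y \<in> V \<Longrightarrow> d1 \<Theta> y = (a1 (\<Theta> y) / h2 (\<Theta> y), a2 (\<Theta> y) / h2 (\<Theta> y))"
    "\<And>y. y \<in> V \<Longrightarrow> d2 \<Theta> y = (- \<alpha>2 (\<Theta> y) / (sqrt (\<Delta> (\<Theta> y)) * h2 (\<Theta> y)), \<alpha>1 (\<Theta> y) / (sqrt (\<Delta> (\<Theta> y)) * h2 (\<Theta> y)))"
proof -
  obtain B \<phi> where B: "open B" "x0 \<in> B" "B \<subseteq> U" "smooth_on B \<phi>"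
    and \<phi>: "\<And>x v. x \<in> B \<Longrightarrow> D \<phi> x v = fst v * \<alpha>1 x + snd v * \<alpha>2 x"
    using closed_form_potential[OF smooth_alpha(1,2) ballI[OF alpha_closed] x0] by metis
  \<comment> \<open>The Hodge dual of \<alpha>; it is closed exactly when the vector field with
    components \<open>a1\<close>, \<open>a2\<close> is divergence free.\<close>
  define p q where "p x = - (sqrt (\<Delta> x) * a2 x)" and "q x = sqrt (\<Delta> x) * a1 x" for x
  have spq: "smooth_on B p" "smooth_on B q"
    unfolding p_def q_def by (rule smooth_on_subset[OF _ B(1,3)], intro smooth_intros smooth_a)+
  have closed: "d2 p x = d1 q x" if x: "x \<in> B" for x
  proof -
    have "smooth_on U (\<lambda>x. sqrt (\<Delta> x) * a2 x)" by (intro smooth_intros smooth_a)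
    moreover have xU: "x \<in> U" using x B(3) by blast
    ultimately have "d2 (\<lambda>x. - (sqrt (\<Delta> x) * a2 x)) x = - d2 (\<lambda>x. sqrt (\<Delta> x) * a2 x) x"
      by (rule D_linear[OF bounded_linear_minus[OF bounded_linear_ident]])
    then show ?thesis using coclosed[OF xU] unfolding p_def q_def by linarith
  qed
  obtain B' \<psi> where B': "open B'" "x0 \<in> B'" "B' \<subseteq> B" "smooth_on B' \<psi>"
    and \<psi>: "\<And>x v. x \<in> B' \<Longrightarrow> D \<psi> x v = fst v * p x + snd v * q x"
    using closed_form_potential[OF spq ballI[OF closed] B(2)] by metis
  define \<Psi> where "\<Psi> x = (\<phi> x, \<psi> x)" for x
  have s\<phi>: "smooth_on B' \<phi>" by (rule smooth_on_subset[OF B(4) B'(1,3)])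
  have s\<Psi>: "smooth_on B' \<Psi>" unfolding \<Psi>_def by (intro smooth_intros s\<phi> B'(4))
  have D\<Psi>: "D \<Psi> x v = (fst v * \<alpha>1 x + snd v * \<alpha>2 x, fst v * p x + snd v * q x)" if x: "x \<in> B'" for x v
  proof -
    have "(\<Psi> has_derivative (\<lambda>v. (D \<phi> x v, D \<psi> x v))) (at x)"
      unfolding \<Psi>_def by (intro has_derivative_Pair smooth_on_has_derivative[OF s\<phi> x] smooth_on_has_derivative[OF B'(4) x])
    then show ?thesis using \<phi>[of x v] \<psi>[OF x, of v] x B'(3) by (auto simp: D_eqI)
  qed
  \<comment> \<open>The wedge product of \<alpha> with its dual is the squared length of \<alpha>
    times the area form, hence nonzero.\<close>
  have J: "jacdet \<Psi> x = sqrt (\<Delta> x) * h2 x" if "x \<in> B'" for x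
    by (simp add: jacdet_def D\<Psi>[OF that] p_def q_def h2_eq algebra_simps)
  have pos: "sqrt (\<Delta> x) > 0" "h2 x > 0" if "x \<in> B'" for x
  proof -
    have "x \<in> U" using that B'(3) B(3) by blast
    then show "sqrt (\<Delta> x) > 0" "h2 x > 0" by (simp_all add: Delta_pos nonzero_H)
  qed
  have nz: "jacdet \<Psi> x \<noteq> 0" if "x \<in> B'" for x using J[OF that] pos[OF that] by simp
  obtain U' V \<Theta> where *: "open U'" "x0 \<in> U'" "U' \<subseteq> B'" "open V" "homeomorphism U' V \<Psi> \<Theta>" "smooth_on V \<Theta>"
    "\<And>y w. y \<in> V \<Longrightarrow> D \<Psi> (\<Theta> y) (D \<Theta> y w) = w"
    using local_inverse[OF s\<Psi> _ B'(2)] nz by metis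
  have \<Theta>: "\<Theta> y \<in> B'" if "y \<in> V" for y using *(3,5) that by (auto simp: homeomorphism_def)
  show ?thesis
  proof (rule that[OF *(1,2) _ *(4,5) _ *(6)])
    show "U' \<subseteq> U" using *(3) B' B by blast
    show "smooth_on U' \<Psi>" by (rule smooth_on_subset[OF s\<Psi> *(1,3)])
    fix y assume y: "y \<in> V"
    note p = pos[OF \<Theta>[OF y]]
    show "d1 \<Theta> y = (a1 (\<Theta> y) / h2 (\<Theta> y), a2 (\<Theta> y) / h2 (\<Theta> y))"
      using jacdet_solve[OF s\<Psi> \<Theta>[OF y] nz[OF \<Theta>[OF y]] *(7)[OF y, of "(1,0)"]] p
      by (simp add: J[OF \<Theta>[OF y]] D\<Psi>[OF \<Theta>[OF y]] p_def q_def)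
    show "d2 \<Theta> y = (- \<alpha>2 (\<Theta> y) / (sqrt (\<Delta> (\<Theta> y)) * h2 (\<Theta> y)), \<alpha>1 (\<Theta> y) / (sqrt (\<Delta> (\<Theta> y)) * h2 (\<Theta> y)))"
      using jacdet_solve[OF s\<Psi> \<Theta>[OF y] nz[OF \<Theta>[OF y]] *(7)[OF y, of "(0,1)"]]
      by (simp add: J[OF \<Theta>[OF y]] D\<Psi>[OF \<Theta>[OF y]])
  qed
qed

end

text \<open>In complex notation \<open>z \<mapsto> c + \<kappa> z^2 / 2\<close>. The squared modulus
  \<open>\<kappa>^2 |z|^2\<close> of its derivative is \<open>2 \<kappa>\<close> times the distance
  of the image from \<open>c\<close>, which is \<open>|H|^2\<close> there; hence
  \<open>|dy|^2 / |H|^2\<close> pulls back to the flat metric.\<close>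

definition complex_square :: "real \<Rightarrow> real \<times> real \<Rightarrow> real \<times> real \<Rightarrow> real \<times> real" where
  "complex_square \<kappa> c z = c + (\<kappa> / 2 * ((fst z)\<^sup>2 - (snd z)\<^sup>2), \<kappa> * fst z * snd z)"

lemma complex_square_has_derivative:
  "(complex_square \<kappa> c has_derivative
     (\<lambda>v. (\<kappa> * (fst z * fst v - snd z * snd v), \<kappa> * (fst v * snd z + fst z * snd v)))) (at z)"
  unfolding complex_square_def
  by (auto intro!: derivative_eq_intros ext simp: algebra_simps)

lemma smooth_complex_square: "open S \<Longrightarrow> smooth_on S (complex_square \<kappa> c)"
  unfolding complex_square_def by (intro smooth_intros smooth_on_fst smooth_on_snd smooth_on_id; assumption)

lemma D_complex_square:
  "d1 (complex_square \<kappa> c) z = (\<kappa> * fst z, \<kappa> * snd z)" "d2 (complex_square \<kappa> c) z = (- \<kappa> * snd z, \<kappa> * fst z)"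
  by (simp_all add: D_eqI[OF complex_square_has_derivative])

lemma norm_complex_square: "norm (complex_square \<kappa> c z - c) = \<bar>\<kappa>\<bar> / 2 * ((fst z)\<^sup>2 + (snd z)\<^sup>2)"
proof -
  have 2: "complex_square \<kappa> c z - c = (\<kappa> / 2 * ((fst z)\<^sup>2 - (snd z)\<^sup>2), \<kappa> * fst z * snd z)"
    by (simp add: complex_square_def)
  have 1: "(\<kappa> / 2 * ((fst z)\<^sup>2 - (snd z)\<^sup>2))\<^sup>2 + (\<kappa> * fst z * snd z)\<^sup>2 = (\<kappa> / 2 * ((fst z)\<^sup>2 + (snd z)\<^sup>2))\<^sup>2"
    by (simp add: power2_eq_square algebra_simps)
  show ?thesis unfolding 2 norm_Pair real_norm_def power2_abs 1 real_sqrt_abs by (simp add: abs_mult)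
qed

lemma complex_square_surj:
  assumes "\<kappa> > 0"
  shows "\<exists>z. complex_square \<kappa> c z = y"
proof -
  define w where "w = csqrt (Complex (2 * (fst y - fst c) / \<kappa>) (2 * (snd y - snd c) / \<kappa>))"
  have "w\<^sup>2 = Complex (2 * (fst y - fst c) / \<kappa>) (2 * (snd y - snd c) / \<kappa>)" by (simp add: w_def)
  from arg_cong[OF this, of Re] arg_cong[OF this, of Im]
  have "(Re w)\<^sup>2 - (Im w)\<^sup>2 = 2 * (fst y - fst c) / \<kappa>" "2 * Re w * Im w = 2 * (snd y - snd c) / \<kappa>"
    by (simp_all only: Re_power2 Im_power2 complex.sel)
  then have "complex_square \<kappa> c (Re w, Im w) = y"
    using assms by (simp add: complex_square_def prod_eq_iff field_simps)
  then show ?thesis by blast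
qed

context constant_patch
begin

theorem local_model:
  assumes x0: "x0 \<in> U"
  shows "K = 0 \<and> \<epsilon> = 0"
    and "\<exists>N Z \<omega> \<Xi> W Z0. open N \<and> x0 \<in> N \<and> N \<subseteq> U \<and> open Z \<and> Z \<subseteq> punctured_plane \<and> homeomorphism N Z \<omega> \<Xi> \<and>
      smooth_on N \<omega> \<and> smooth_on Z \<Xi> \<and> unitary W \<and> (\<forall>x\<in>N. W *v f x + Z0 = F_map \<kappa> (\<omega> x))"
proof -
  obtain U' \<Psi> V' \<Theta> where U': "open U'" "x0 \<in> U'" "U' \<subseteq> U" "open V'" "homeomorphism U' V' \<Psi> \<Theta>"
    "smooth_on U' \<Psi>" and s\<Theta>': "smooth_on V' \<Theta>"
    and D1': "\<And>y. y \<in> V' \<Longrightarrow> d1 \<Theta> y = (a1 (\<Theta> y) / h2 (\<Theta> y), a2 (\<Theta> y) / h2 (\<Theta> y))"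
    and D2': "\<And>y. y \<in> V' \<Longrightarrow> d2 \<Theta> y = (- \<alpha>2 (\<Theta> y) / (sqrt (\<Delta> (\<Theta> y)) * h2 (\<Theta> y)), \<alpha>1 (\<Theta> y) / (sqrt (\<Delta> (\<Theta> y)) * h2 (\<Theta> y)))"
    using harmonic_coordinates[OF x0] by metis
  have y0: "\<Psi> x0 \<in> V'" and \<Theta>U': "\<And>y. y \<in> V' \<Longrightarrow> \<Theta> y \<in> U'" and \<Psi>\<Theta>: "\<And>y. y \<in> V' \<Longrightarrow> \<Psi> (\<Theta> y) = y"
    and \<Theta>\<Psi>: "\<And>x. x \<in> U' \<Longrightarrow> \<Theta> (\<Psi> x) = x" and \<Psi>V': "\<And>x. x \<in> U' \<Longrightarrow> \<Psi> x \<in> V'"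
    using U' by (auto simp: homeomorphism_def)
  obtain r where r: "r > 0" "ball (\<Psi> x0) r \<subseteq> V'" using U'(4) y0 open_contains_ball by blast
  \<comment> \<open>A ball, because the eikonal argument needs a convex domain.\<close>
  define V where "V = ball (\<Psi> x0) r"
  have V: "open V" "convex V" "\<Psi> x0 \<in> V" "V \<subseteq> V'" using r by (auto simp: V_def)
  have s\<Theta>: "smooth_on V \<Theta>" by (rule smooth_on_subset[OF s\<Theta>' V(1,4)])
  note D1 = D1'[OF subsetD[OF V(4)]] and D2 = D2'[OF subsetD[OF V(4)]]
  have \<Theta>U: "\<Theta> y \<in> U" if "y \<in> V" for y using \<Theta>U' V(4) U'(3) that by blast
  have pos: "sqrt (\<Delta> (\<Theta> y)) > 0" "h2 (\<Theta> y) > 0" "\<Delta> (\<Theta> y) > 0" if "y \<in> V" for y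
    using Delta_pos[OF \<Theta>U[OF that]] nonzero_H[OF \<Theta>U[OF that]] by simp_all
  have jac: "jacdet \<Theta> y = 1 / (sqrt (\<Delta> (\<Theta> y)) * h2 (\<Theta> y))" if "y \<in> V" for y
  proof -
    have "jacdet \<Theta> y = (a1 (\<Theta> y) * \<alpha>1 (\<Theta> y) + a2 (\<Theta> y) * \<alpha>2 (\<Theta> y)) / (h2 (\<Theta> y) * (sqrt (\<Delta> (\<Theta> y)) * h2 (\<Theta> y)))"
      by (simp add: jacdet_def D1[OF that] D2[OF that] add_divide_distrib)
    then show ?thesis using pos[OF that] unfolding h2_eq[symmetric] by simp
  qed
  interpret I: patch_change \<epsilon> U f V \<Theta>
    by unfold_locales (use s\<Theta> \<Theta>U jac pos in \<open>auto simp: less_imp_neq[symmetric]\<close>)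
  have gI: "I.Q.g11 y = 1 / h2 (\<Theta> y)" "I.Q.g22 y = 1 / h2 (\<Theta> y)" "I.Q.g12 y = 0" if y: "y \<in> V" for y
  proof -
    let ?x = "\<Theta> y"
    note x = \<Theta>U[OF y]
    note la = lower_a[OF x]
    have p: "h2 ?x \<noteq> 0" "\<Delta> ?x \<noteq> 0" "sqrt (\<Delta> ?x) \<noteq> 0" using pos[OF y] by simp_all
    have "I.Q.g11 y = (a1 ?x * (g11 ?x * a1 ?x + g12 ?x * a2 ?x) + a2 ?x * (g12 ?x * a1 ?x + g22 ?x * a2 ?x)) / (h2 ?x)\<^sup>2"
      unfolding I.g_change[OF y] I.p11_def I.p12_def I.p21_def I.p22_def D1[OF y] fst_conv snd_conv
      using p by (simp add: field_simps power2_eq_square)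
    also have "\<dots> = 1 / h2 ?x" unfolding la h2_eq[symmetric] using p by (simp add: power2_eq_square)
    finally show "I.Q.g11 y = 1 / h2 ?x" .
    have "I.Q.g12 y = (- \<alpha>2 ?x * (g11 ?x * a1 ?x + g12 ?x * a2 ?x) + \<alpha>1 ?x * (g12 ?x * a1 ?x + g22 ?x * a2 ?x)) / (h2 ?x * (sqrt (\<Delta> ?x) * h2 ?x))"
      unfolding I.g_change[OF y] I.p11_def I.p12_def I.p21_def I.p22_def D1[OF y] D2[OF y] fst_conv snd_conv
      using p by (simp add: field_simps)
    also have "\<dots> = 0" unfolding la by simp
    finally show "I.Q.g12 y = 0" .
    have "I.Q.g22 y = (h2 ?x * \<Delta> ?x) / (sqrt (\<Delta> ?x) * h2 ?x)\<^sup>2"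
    proof -
      have "h2 ?x * \<Delta> ?x = g22 ?x * (\<alpha>1 ?x)\<^sup>2 - 2 * g12 ?x * \<alpha>1 ?x * \<alpha>2 ?x + g11 ?x * (\<alpha>2 ?x)\<^sup>2"
        using p by (simp add: h2_def)
      then show ?thesis
        unfolding I.g_change[OF y] I.p11_def I.p12_def I.p21_def I.p22_def D2[OF y] fst_conv snd_conv
        using p by (simp add: power_divide) (simp add: field_simps power2_eq_square)
    qed
    also have "\<dots> = 1 / h2 ?x" using p pos[OF y] by (simp add: power_mult_distrib power2_eq_square[of "h2 ?x"])
    finally show "I.Q.g22 y = 1 / h2 ?x" .
  qed
  define k where "k y = h2 (\<Theta> y)" for y
  have sk: "smooth_on V k"
    unfolding k_def by (rule smooth_on_compose[OF smooth_alpha(4) s\<Theta>]) (use \<Theta>U in auto)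
  have kpos: "k y > 0" if "y \<in> V" for y using pos[OF that] by (simp add: k_def)
  have gradk: "(d1 k y)\<^sup>2 + (d2 k y)\<^sup>2 = 4 * \<kappa>\<^sup>2" if y: "y \<in> V" for y
  proof -
    have "(I.Q.g22 y * (d1 k y)\<^sup>2 - 2 * I.Q.g12 y * d1 k y * d2 k y + I.Q.g11 y * (d2 k y)\<^sup>2) / I.Q.\<Delta> y = 4 * \<kappa>\<^sup>2 * k y"
      unfolding k_def[abs_def] using I.cometric_change[OF y smooth_alpha(4)] constant_gradient[OF \<Theta>U[OF y]] by simp
    then have "k y * k y * ((d1 k y)\<^sup>2 + (d2 k y)\<^sup>2 - 4 * \<kappa>\<^sup>2) = 0"
      using kpos[OF y] unfolding I.Q.\<Delta>_def gI[OF y] k_def[symmetric]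
      by (simp add: field_simps power2_eq_square)
    then show ?thesis using kpos[OF y] by simp
  qed
  have lapk: "2 * K * k y = k y * (d1 (d1 k) y + d2 (d2 k) y) - ((d1 k y)\<^sup>2 + (d2 k y)\<^sup>2)" if y: "y \<in> V" for y
  proof -
    have "2 * gaussian_curvature I.Q.G y * k y = k y * (d1 (d1 k) y + d2 (d2 k) y) - ((d1 k y)\<^sup>2 + (d2 k y)\<^sup>2)"
      by (rule I.Q.conformal_curvature[OF _ _ _ sk _ y]) (simp_all add: gI kpos k_def[symmetric])
    then show ?thesis using I.gaussian_curvature_change[OF y] constant_curvature[OF \<Theta>U[OF y]] by simp
  qed
  define q where "q y = k y / (2 * \<kappa>)" for y
  have sq: "smooth_on V q" unfolding q_def using kappa_pos by (intro smooth_intros sk V(1)) simp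
  have Dq: "D q y v = D k y v / (2 * \<kappa>)" if "y \<in> V" for y v
    unfolding q_def using D_linear[OF bounded_linear_divide sk that] .
  have DDq: "D (\<lambda>y. D q y v) y w = D (\<lambda>y. D k y v) y w / (2 * \<kappa>)" if "y \<in> V" for y v w
  proof -
    have "D (\<lambda>y. D q y v) y w = D (\<lambda>y. D k y v / (2 * \<kappa>)) y w"
      by (rule D_cong_on[OF V(1) _ that]) (rule Dq)
    then show ?thesis using D_linear[OF bounded_linear_divide smooth_on_D[OF sk] that] by simp
  qed
  have "K / \<kappa> = 0 \<and> (\<exists>c. \<forall>y\<in>V. q y = norm (y - c))"
  proof (rule eikonal_distance[OF sq V(2)])
    show "V \<noteq> {}" using V(3) by blast
    fix y assume y: "y \<in> V"
    show "q y > 0" using kpos[OF y] kappa_pos by (simp add: q_def)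
    show "(d1 q y)\<^sup>2 + (d2 q y)\<^sup>2 = 1"
      using gradk[OF y] kappa_pos unfolding Dq[OF y] power_divide add_divide_distrib[symmetric]
      by (simp add: power2_eq_square)
    show "d1 (d1 q) y + d2 (d2 q) y = K / \<kappa> + 1 / q y"
      using lapk[OF y] kpos[OF y] kappa_pos unfolding DDq[OF y] gradk[OF y] q_def
      by (simp add: field_simps power2_eq_square)
  qed
  then obtain c where K0: "K = 0" and c: "\<And>y. y \<in> V \<Longrightarrow> q y = norm (y - c)" using kappa_pos by auto
  have h2c: "h2 (\<Theta> y) = 2 * \<kappa> * norm (y - c)" if "y \<in> V" for y
    using c[OF that] kappa_pos by (simp add: q_def k_def field_simps)
  define Sq where "Sq = complex_square \<kappa> c"
  obtain z0 where z0: "Sq z0 = \<Psi> x0" using complex_square_surj[OF kappa_pos] unfolding Sq_def by blast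
  define Z' where "Z' = Sq -` V"
  have "continuous_on UNIV Sq" unfolding Sq_def by (rule smooth_on_continuous_on[OF smooth_complex_square[OF open_UNIV]])
  then have oZ': "open Z'" unfolding Z'_def by (rule open_vimage[OF V(1)])
  have z0Z: "z0 \<in> Z'" using z0 V(3) by (simp add: Z'_def)
  \<comment> \<open>The point \<open>c\<close> lies outside \<open>V\<close>, as \<open>q\<close> is
    the distance to it and is positive on \<open>V\<close>; so the square root has no branch point
    over \<open>V\<close>.\<close>
  have nzZ: "(fst z)\<^sup>2 + (snd z)\<^sup>2 > 0" if "z \<in> Z'" for z
  proof -
    have "q (Sq z) > 0" using that kpos kappa_pos by (simp add: Z'_def q_def)
    then have "norm (Sq z - c) > 0" using c[of "Sq z"] that by (simp add: Z'_def)
    then show ?thesis unfolding Sq_def norm_complex_square using kappa_pos by (simp add: zero_less_mult_iff)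
  qed
  have sSq: "smooth_on S Sq" if "open S" for S unfolding Sq_def by (rule smooth_complex_square[OF that])
  have jSq: "jacdet Sq z = \<kappa>\<^sup>2 * ((fst z)\<^sup>2 + (snd z)\<^sup>2)" for z
    by (simp add: jacdet_def Sq_def D_complex_square power2_eq_square algebra_simps)
  have kz: "\<kappa>\<^sup>2 * ((fst z)\<^sup>2 + (snd z)\<^sup>2) \<noteq> 0" if "z \<in> Z'" for z
    using less_imp_neq[OF nzZ[OF that]] kappa_pos by auto
  then have jnz: "jacdet Sq z \<noteq> 0" if "z \<in> Z'" for z
    unfolding jSq using that .
  obtain Z1 V1 R where Z1: "open Z1" "z0 \<in> Z1" "Z1 \<subseteq> Z'" "open V1" "homeomorphism Z1 V1 Sq R" "smooth_on V1 R"
    using local_inverse[OF sSq[OF oZ'] _ z0Z] jnz by metis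
  have RS: "R (Sq z) = z" "Sq z \<in> V1" if "z \<in> Z1" for z using Z1(5) that by (auto simp: homeomorphism_def)
  have SR: "Sq (R y) = y" "R y \<in> Z1" if "y \<in> V1" for y using Z1(5) that by (auto simp: homeomorphism_def)
  obtain \<rho> where \<rho>: "\<rho> > 0" "ball z0 \<rho> \<subseteq> Z1" using Z1 open_contains_ball by blast
  define Z where "Z = ball z0 \<rho>"
  have Z: "open Z" "convex Z" "z0 \<in> Z" "Z \<subseteq> Z1" "Z \<subseteq> Z'" using \<rho> Z1(3) by (auto simp: Z_def)
  have SqV: "Sq z \<in> V" if "z \<in> Z" for z using Z(5) that by (auto simp: Z'_def)
  interpret L: patch_change \<epsilon> V "\<lambda>y. f (\<Theta> y)" Z Sq
    by unfold_locales (use sSq[OF Z(1)] SqV jnz Z(5) in auto)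
  have hz: "h2 (\<Theta> (Sq z)) = \<kappa>\<^sup>2 * ((fst z)\<^sup>2 + (snd z)\<^sup>2)" if "z \<in> Z" for z
    using h2c[OF SqV[OF that]] kappa_pos by (simp add: Sq_def norm_complex_square power2_eq_square)
  have pL: "L.p11 z = \<kappa> * fst z" "L.p12 z = \<kappa> * snd z" "L.p21 z = - \<kappa> * snd z" "L.p22 z = \<kappa> * fst z" for z
    by (simp_all add: L.p11_def L.p12_def L.p21_def L.p22_def D_complex_square[of \<kappa> c, folded Sq_def])
  have gL: "L.Q.g11 z = 1" "L.Q.g22 z = 1" "L.Q.g12 z = 0" if z: "z \<in> Z" for z
  proof -
    have p: "\<kappa>\<^sup>2 * ((fst z)\<^sup>2 + (snd z)\<^sup>2) \<noteq> 0" using kz Z(5) z by blast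
    define d where "d = \<kappa>\<^sup>2 * ((fst z)\<^sup>2 + (snd z)\<^sup>2)"
    have d: "d \<noteq> 0" using p by (simp add: d_def)
    have "(\<kappa> * fst z)\<^sup>2 + (\<kappa> * snd z)\<^sup>2 = d" by (simp add: d_def power_mult_distrib distrib_left)
    then have 1: "(\<kappa> * fst z)\<^sup>2 * (1 / d) + (\<kappa> * snd z)\<^sup>2 * (1 / d) = 1"
      using d by (simp add: add_divide_distrib[symmetric])
    show "L.Q.g11 z = 1"
      unfolding L.g_change[OF z] pL gI[OF SqV[OF z]] hz[OF z] d_def[symmetric] using 1 by simp
    show "L.Q.g22 z = 1"
      unfolding L.g_change[OF z] pL gI[OF SqV[OF z]] hz[OF z] d_def[symmetric] using 1 by (simp add: add.commute)
    show "L.Q.g12 z = 0"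
      unfolding L.g_change[OF z] pL gI[OF SqV[OF z]] hz[OF z] d_def[symmetric] by simp
  qed
  \<comment> \<open>In the isothermal coordinates \<alpha> is the differential of the first
    coordinate.\<close>
  have \<alpha>I: "I.Q.\<alpha>1 y = 1" "I.Q.\<alpha>2 y = 0" if y: "y \<in> V" for y
  proof -
    have "I.Q.\<alpha>1 y = (a1 (\<Theta> y) * \<alpha>1 (\<Theta> y) + a2 (\<Theta> y) * \<alpha>2 (\<Theta> y)) / h2 (\<Theta> y)"
      unfolding I.alpha_change[OF y] I.p11_def I.p12_def D1[OF y] by (simp add: add_divide_distrib)
    then show "I.Q.\<alpha>1 y = 1" unfolding h2_eq[symmetric] using pos[OF y] by simp
    show "I.Q.\<alpha>2 y = 0"
      unfolding I.alpha_change[OF y] I.p21_def I.p22_def D2[OF y] by simp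
  qed
  have \<alpha>L: "L.Q.\<alpha>1 z = \<kappa> * fst z" "L.Q.\<alpha>2 z = - \<kappa> * snd z" if z: "z \<in> Z" for z
    using L.alpha_change[OF z] \<alpha>I[OF SqV[OF z]] by (simp_all add: pL)
  have "\<epsilon> = 0 \<and> (\<exists>W Z0. unitary W \<and> (\<forall>z\<in>Z. W *v f (\<Theta> (Sq z)) + Z0 = F_map \<kappa> z))"
    by (rule L.Q.flat_model[OF Z(2) _ kappa_pos]) (use Z(3) in blast, simp_all add: gL \<alpha>L)
  then obtain W Z0 where \<epsilon>: "\<epsilon> = 0" and W: "unitary W" "\<And>z. z \<in> Z \<Longrightarrow> W *v f (\<Theta> (Sq z)) + Z0 = F_map \<kappa> z" by blast
  show "K = 0 \<and> \<epsilon> = 0" using K0 \<epsilon> by simp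
  define \<Xi> where "\<Xi> z = \<Theta> (Sq z)" for z
  define \<omega> where "\<omega> x = R (\<Psi> x)" for x
  have s\<Xi>: "smooth_on Z \<Xi>" unfolding \<Xi>_def
    by (rule smooth_on_compose[OF s\<Theta> sSq[OF Z(1)]]) (use SqV in auto)
  \<comment> \<open>Cut down to points that \<open>R\<close> sends into \<open>Z\<close>, so that
    \<omega> and \<Xi> are mutually inverse between \<open>N\<close> and \<open>Z\<close>.\<close>
  define W1 where "W1 = V \<inter> V1 \<inter> R -` Z"
  have oW1: "open (V1 \<inter> R -` Z)"
    by (rule continuous_open_preimage[OF smooth_on_continuous_on[OF Z1(6)] Z1(4) Z(1)])
  then have "open W1" unfolding W1_def using V(1) by (simp add: Int_assoc open_Int)
  define N where "N = U' \<inter> \<Psi> -` W1"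
  have oN: "open N" unfolding N_def
    by (rule continuous_open_preimage[OF smooth_on_continuous_on[OF U'(6)] U'(1) \<open>open W1\<close>])
  have s\<omega>: "smooth_on N \<omega>" unfolding \<omega>_def
    by (rule smooth_on_compose[OF Z1(6) smooth_on_subset[OF U'(6) oN]]) (auto simp: N_def W1_def)
  have \<Xi>N: "\<Xi> z \<in> N" "\<omega> (\<Xi> z) = z" if z: "z \<in> Z" for z
  proof -
    have 1: "\<Psi> (\<Theta> (Sq z)) = Sq z" using \<Psi>\<Theta> SqV[OF z] V(4) by blast
    have "z \<in> Z1" using Z(4) z by blast
    from RS[OF this] have 2: "R (Sq z) = z" "Sq z \<in> V1" by simp_all
    have 3: "\<Theta> (Sq z) \<in> U'" using \<Theta>U' SqV[OF z] V(4) by blast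
    show "\<omega> (\<Xi> z) = z" by (simp add: \<omega>_def \<Xi>_def 1 2)
    show "\<Xi> z \<in> N" using SqV[OF z] z by (simp add: N_def W1_def \<Xi>_def 1 2 3)
  qed
  have \<omega>Z: "\<omega> x \<in> Z" "\<Xi> (\<omega> x) = x" if x: "x \<in> N" for x
  proof -
    have *: "x \<in> U'" "\<Psi> x \<in> V1" "R (\<Psi> x) \<in> Z" using x by (simp_all add: N_def W1_def)
    show "\<omega> x \<in> Z" "\<Xi> (\<omega> x) = x"
      by (simp_all add: \<Xi>_def \<omega>_def * SR(1)[OF *(2)] \<Theta>\<Psi>[OF *(1)])
  qed
  have hom: "homeomorphism N Z \<omega> \<Xi>"
  proof (rule homeomorphismI)
    show "continuous_on N \<omega>" "continuous_on Z \<Xi>"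
      by (rule smooth_on_continuous_on[OF s\<omega>], rule smooth_on_continuous_on[OF s\<Xi>])
    show "\<omega> ` N \<subseteq> Z" "\<Xi> ` Z \<subseteq> N" using \<omega>Z(1) \<Xi>N(1) by blast+
  qed (rule \<omega>Z(2) \<Xi>N(2); assumption)+
  have x0N: "x0 \<in> N"
  proof -
    have "\<Theta> (\<Psi> x0) = x0" using \<Theta>\<Psi> U'(2) by blast
    then show ?thesis using \<Xi>N(1)[OF Z(3)] z0 by (simp add: \<Xi>_def)
  qed
  have "Z \<subseteq> punctured_plane" using nzZ Z(5) by force
  moreover have "W *v f x + Z0 = F_map \<kappa> (\<omega> x)" if "x \<in> N" for x
    using W(2)[OF \<omega>Z(1)[OF that]] \<omega>Z(2)[OF that] by (simp add: \<Xi>_def)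
  moreover have "N \<subseteq> U" using U'(3) by (auto simp: N_def)
  ultimately show "\<exists>N Z \<omega> \<Xi> W Z0. open N \<and> x0 \<in> N \<and> N \<subseteq> U \<and> open Z \<and> Z \<subseteq> punctured_plane \<and> homeomorphism N Z \<omega> \<Xi> \<and>
      smooth_on N \<omega> \<and> smooth_on Z \<Xi> \<and> unitary W \<and> (\<forall>x\<in>N. W *v f x + Z0 = F_map \<kappa> (\<omega> x))"
    using oN x0N Z(1) hom s\<omega> s\<Xi> W(1) by blast
qed

end

section \<open>Integrals depending on a parameter\<close>

lemma set_integrable_continuous_compact:
  fixes f :: "'e::euclidean_space \<Rightarrow> real"
  shows "compact C \<Longrightarrow> continuous_on C f \<Longrightarrow> set_integrable lborel C f"
  unfolding set_integrable_def by (rule borel_integrable_compact)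

text \<open>Dominated convergence along sequences: on a compact slab around
  \<open>{0} \<times> C\<close> the \<open>t\<close>-derivative is bounded by some \<open>M\<close>,
  and by the mean value theorem so are the difference quotients.\<close>

lemma has_derivative_set_integral:
  fixes g :: "real \<times> 'e::euclidean_space \<Rightarrow> real"
  assumes g: "smooth_on W g" and C: "compact C" and W: "{0} \<times> C \<subseteq> W"
  shows "((\<lambda>t. LINT x:C|lborel. g (t, x)) has_real_derivative (LINT x:C|lborel. D g (0, x) (1, 0))) (at 0)"
proof -
  have oW: "open W" using g by (rule smooth_on_open)
  have "compact ({0::real} \<times> C)" using C by (intro compact_Times) auto
  then obtain e where e: "e > 0" "(\<Union>z\<in>{0} \<times> C. cball z e) \<subseteq> W"
    using compact_subset_open_imp_cball_epsilon_subset[OF _ oW W] by blast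
  define K where "K = {-e..e} \<times> C"
  have KW: "K \<subseteq> W"
  proof
    fix z assume "z \<in> K"
    then obtain t x where z: "z = (t, x)" "\<bar>t\<bar> \<le> e" "x \<in> C" by (auto simp: K_def abs_le_iff)
    then have "z \<in> cball (0, x) e" by (simp add: dist_Pair_Pair)
    then show "z \<in> W" using e z by blast
  qed
  have cK: "compact K" unfolding K_def using C by (intro compact_Times) auto
  define dg where "dg z = D g z (1, 0)" for z
  have cdg: "continuous_on K dg" unfolding dg_def
    by (rule continuous_on_subset[OF smooth_on_continuous_on[OF smooth_on_D[OF g]] KW])
  have cg: "continuous_on K g"
    by (rule continuous_on_subset[OF smooth_on_continuous_on[OF g] KW])
  obtain M where M: "\<And>z. z \<in> K \<Longrightarrow> \<bar>dg z\<bar> \<le> M"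
    using compact_imp_bounded[OF compact_continuous_image[OF cdg cK]] by (force simp: bounded_iff)
  have der: "((\<lambda>t. g (t, x)) has_real_derivative dg (t, x)) (at t)" if "\<bar>t\<bar> \<le> e" "x \<in> C" for t x
  proof -
    have z: "(t, x) \<in> W" using that KW by (auto simp: K_def abs_le_iff)
    have "((\<lambda>t. (t, x)) has_derivative (\<lambda>h. (h, 0))) (at t)" by (auto intro!: derivative_eq_intros)
    from has_derivative_compose[OF this smooth_on_has_derivative[OF g z]]
    have 1: "((\<lambda>t. g (t, x)) has_derivative (\<lambda>h. D g (t, x) (h, 0))) (at t)" .
    have "(\<lambda>h. D g (t, x) (h, 0)) = (*) (dg (t, x))"
    proof
      fix h show "D g (t, x) (h, 0) = dg (t, x) * h"
        using linear_scale[OF linear_D[OF g z], of h "(1, 0)"] by (simp add: dg_def mult.commute)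
    qed
    with 1 show ?thesis by (simp only: has_field_derivative_def)
  qed
  have bd: "\<bar>g (t, x) - g (0, x)\<bar> \<le> M * \<bar>t\<bar>" if "\<bar>t\<bar> \<le> e" "x \<in> C" for t x
  proof -
    have "norm (g (t, x) - g (0, x)) \<le> M * norm (t - 0)"
    proof (rule field_differentiable_bound[of "{-e..e}" "\<lambda>t. g (t, x)" "\<lambda>t. dg (t, x)" M t 0])
      fix z assume "z \<in> {-e..e}"
      then have "\<bar>z\<bar> \<le> e" by (simp add: abs_le_iff)
      then show "((\<lambda>t. g (t, x)) has_real_derivative dg (z, x)) (at z within {-e..e})" "norm (dg (z, x)) \<le> M"
        using der[of z x] M[of "(z, x)"] that by (auto simp: K_def abs_le_iff intro: has_field_derivative_at_within)
    qed (use that e in \<open>auto simp: abs_le_iff\<close>)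
    then show ?thesis by simp
  qed
  have cgt: "continuous_on C (\<lambda>x. h (t, x))" if "continuous_on K h" "\<bar>t\<bar> \<le> e" for t and h :: "real \<times> 'e \<Rightarrow> real"
    by (rule continuous_on_compose2[OF that(1)]) (use that in \<open>auto simp: K_def abs_le_iff intro!: continuous_intros\<close>)
  have e0: "\<bar>0::real\<bar> \<le> e" "\<bar>e\<bar> \<le> e" using e by auto
  show ?thesis unfolding DERIV_def dg_def[symmetric] tendsto_at_iff_sequentially
  proof (intro allI impI)
    fix X :: "nat \<Rightarrow> real" assume X0: "\<forall>i. X i \<in> UNIV - {0}" and X: "X \<longlonglongrightarrow> 0"
    \<comment> \<open>Terms outside the slab are replaced by \<open>e\<close>, so that the bound
      holds for every index; only finitely many terms change.\<close>
    define Y where "Y i = (if \<bar>X i\<bar> \<le> e then X i else e)" for i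
    have Y: "\<bar>Y i\<bar> \<le> e" "Y i \<noteq> 0" for i using X0 e by (auto simp: Y_def)
    have ev: "eventually (\<lambda>i. \<bar>X i\<bar> \<le> e) sequentially"
      using tendstoD[OF X e(1)] by eventually_elim (simp add: dist_real_def)
    then have evY: "eventually (\<lambda>i. Y i = X i) sequentially"
      by eventually_elim (simp add: Y_def)
    then have Ylim: "Y \<longlonglongrightarrow> 0"
      using Lim_transform_eventually[OF X] by (simp add: eq_commute)
    have C_borel [measurable]: "C \<in> sets borel" using C by (simp add: compact_imp_closed)
    define s where "s i x = indicator C x *\<^sub>R ((g (Y i, x) - g (0, x)) / Y i)" for i x
    have cs: "continuous_on C (\<lambda>x. (g (Y i, x) - g (0, x)) / Y i)" for i
      by (intro continuous_intros cgt cg Y e0) (simp add: Y(2))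
    have "(\<lambda>i. integral\<^sup>L lborel (s i)) \<longlonglongrightarrow> integral\<^sup>L lborel (\<lambda>x. indicator C x *\<^sub>R dg (0, x))"
    proof (rule integral_dominated_convergence[where w = "\<lambda>x. indicator C x *\<^sub>R M"])
      show "(\<lambda>x. indicator C x *\<^sub>R dg (0, x)) \<in> borel_measurable lborel"
        using borel_integrable_compact[OF C cgt[OF cdg e0(1)]] by (rule borel_measurable_integrable)
      show "s i \<in> borel_measurable lborel" for i
        unfolding s_def using borel_integrable_compact[OF C cs] by (rule borel_measurable_integrable)
      show "integrable lborel (\<lambda>x. indicator C x *\<^sub>R M)"
        by (rule borel_integrable_compact[OF C]) simp
      show "AE x in lborel. (\<lambda>i. s i x) \<longlonglongrightarrow> indicator C x *\<^sub>R dg (0, x)"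
      proof (rule AE_I2)
        fix x :: 'e
        have "(\<lambda>i. (g (Y i, x) - g (0, x)) / Y i) \<longlonglongrightarrow> dg (0, x)" if "x \<in> C"
        proof -
          have "((\<lambda>h. (g (0 + h, x) - g (0, x)) / h) \<longlongrightarrow> dg (0, x)) (at 0)"
            using der[OF e0(1) that] unfolding DERIV_def .
          then have "((\<lambda>h. (g (h, x) - g (0, x)) / h) \<circ> Y) \<longlonglongrightarrow> dg (0, x)"
            using Y(2) Ylim unfolding tendsto_at_iff_sequentially by simp
          then show ?thesis by (simp add: o_def)
        qed
        then show "(\<lambda>i. s i x) \<longlonglongrightarrow> indicator C x *\<^sub>R dg (0, x)"
          unfolding s_def by (cases "x \<in> C") simp_all
      qed
      show "AE x in lborel. norm (s i x) \<le> indicator C x *\<^sub>R M" for i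
      proof (rule AE_I2)
        fix x show "norm (s i x) \<le> indicator C x *\<^sub>R M"
          using bd[OF Y(1), of x i] Y(2)[of i] by (cases "x \<in> C") (simp_all add: s_def divide_le_eq)
      qed
    qed
    moreover have "eventually (\<lambda>i. integral\<^sup>L lborel (s i)
        = ((LINT x:C|lborel. g (0 + X i, x)) - (LINT x:C|lborel. g (0, x))) / X i) sequentially"
      using evY
    proof eventually_elim
      case (elim i)
      have "set_integrable lborel C (\<lambda>x. g (Y i, x))" "set_integrable lborel C (\<lambda>x. g (0, x))"
        using Y e0 by (auto intro!: set_integrable_continuous_compact C cgt cg)
      then have "(LINT x:C|lborel. (g (Y i, x) - g (0, x)) / Y i) = ((LINT x:C|lborel. g (Y i, x)) - (LINT x:C|lborel. g (0, x))) / Y i"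
        by (simp add: set_integral_diff)
      then show ?case unfolding elim s_def set_lebesgue_integral_def by simp
    qed
    ultimately have "(\<lambda>i. ((LINT x:C|lborel. g (0 + X i, x)) - (LINT x:C|lborel. g (0, x))) / X i) \<longlonglongrightarrow> (LINT x:C|lborel. dg (0, x))"
      unfolding set_lebesgue_integral_def by (rule Lim_transform_eventually)
    then show "((\<lambda>h. ((LINT x:C|lborel. g (0 + h, x)) - (LINT x:C|lborel. g (0, x))) / h) \<circ> X)
        \<longlonglongrightarrow> (LINT x:C|lborel. dg (0, x))" by (simp add: o_def)
  qed
qed

text \<open>Differentiate the translation invariance of the integral.\<close>

lemma integral_derivative_compact_support:
  fixes w :: "'e::euclidean_space \<Rightarrow> real"
  assumes w: "smooth_on UNIV w" and C: "compact C" and supp: "\<And>x. x \<notin> C \<Longrightarrow> w x = 0"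
  shows "(LINT x:C|lborel. D w x v) = 0"
proof -
  \<comment> \<open>Contains the supports of all translates with \<open>|t| \<le> 1\<close>, so that
    the domain of integration does not depend on \<open>t\<close>.\<close>
  define C' where "C' = (\<lambda>(t, x). x - t *\<^sub>R v) ` ({-1..1} \<times> C)"
  have cC': "compact C'" unfolding C'_def
    by (intro compact_continuous_image compact_Times C compact_Icc) (auto simp: case_prod_beta' intro!: continuous_intros)
  have CC': "C \<subseteq> C'" unfolding C'_def by (force intro: image_eqI[of _ _ "(0, _)"])
  have sg: "smooth_on UNIV (\<lambda>(t, x). w (x + t *\<^sub>R v))"
    unfolding case_prod_beta'
    by (rule smooth_on_compose[OF w]) (auto intro!: smooth_intros smooth_on_fst smooth_on_snd smooth_on_id)
  have "(LINT x:C'|lborel. w (x + t *\<^sub>R v)) = (LINT x|lborel. w x)" if "\<bar>t\<bar> < 1" for t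
  proof -
    have "w (x + t *\<^sub>R v) = 0" if x: "x \<notin> C'" for x
    proof (rule supp, rule notI)
      assume "x + t *\<^sub>R v \<in> C"
      then have "(x + t *\<^sub>R v) - t *\<^sub>R v \<in> C'" unfolding C'_def using \<open>\<bar>t\<bar> < 1\<close>
        by (intro image_eqI[of _ _ "(t, x + t *\<^sub>R v)"]) auto
      then show False using x by simp
    qed
    then have "(LINT x:C'|lborel. w (x + t *\<^sub>R v)) = (LINT x|lborel. w (x + t *\<^sub>R v))"
      unfolding set_lebesgue_integral_def by (intro Bochner_Integration.integral_cong) (auto simp: indicator_def)
    also have "\<dots> = (LINT x|distr lborel borel ((+) (t *\<^sub>R v)). w x)"
    proof (subst integral_distr)
      show "w \<in> borel_measurable borel"
        using smooth_on_continuous_on[OF w] by (rule borel_measurable_continuous_onI)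
    qed (simp_all add: add.commute)
    also have "\<dots> = (LINT x|lborel. w x)" by (simp add: lborel_distr_plus)
    finally show ?thesis .
  qed
  then have "eventually (\<lambda>t. (LINT x:C'|lborel. w (x + t *\<^sub>R v)) = (LINT x|lborel. w x)) (nhds 0)"
    by (intro eventually_nhds_metric[THEN iffD2] exI[of _ 1]) (simp add: dist_real_def)
  moreover have "((\<lambda>t. LINT x:C'|lborel. (\<lambda>(t, x). w (x + t *\<^sub>R v)) (t, x)) has_real_derivative
     (LINT x:C'|lborel. D (\<lambda>(t, x). w (x + t *\<^sub>R v)) (0, x) (1, 0))) (at 0)"
    by (rule has_derivative_set_integral[OF sg cC']) simp
  ultimately have "((\<lambda>t. (LINT x|lborel. w x)) has_real_derivative
     (LINT x:C'|lborel. D (\<lambda>(t, x). w (x + t *\<^sub>R v)) (0, x) (1, 0))) (at 0)"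
    by (subst (asm) DERIV_cong_ev[OF refl _ refl]) simp_all
  then have 0: "(LINT x:C'|lborel. D (\<lambda>(t, x). w (x + t *\<^sub>R v)) (0, x) (1, 0)) = 0"
    by (rule DERIV_unique) (rule DERIV_const)
  have D: "D (\<lambda>(t, x). w (x + t *\<^sub>R v)) (0, x) (1, 0) = D w x v" for x
  proof -
    have "((\<lambda>z. snd z + fst z *\<^sub>R v) has_derivative (\<lambda>h. snd h + fst h *\<^sub>R v)) (at (0, x))"
      by (auto intro!: derivative_eq_intros)
    from has_derivative_compose[OF this, of w "D w x"] smooth_on_has_derivative[OF w, of x]
    have "((\<lambda>z. w (snd z + fst z *\<^sub>R v)) has_derivative (\<lambda>h. D w x (snd h + fst h *\<^sub>R v))) (at (0, x))" by simp
    then show ?thesis by (simp add: case_prod_beta' D_eqI)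
  qed
  have Dz: "D w x v = 0" if "x \<notin> C" for x
  proof -
    have "D w x v = D (\<lambda>x. 0) x v"
      using C that supp by (intro D_cong_on[of "- C"]) (auto simp: compact_imp_closed open_Compl)
    then show ?thesis by (simp add: D_const)
  qed
  have "(LINT x:C'|lborel. D w x v) = (LINT x:C|lborel. D w x v)"
    unfolding set_lebesgue_integral_def
    by (intro Bochner_Integration.integral_cong) (use Dz CC' in \<open>auto simp: indicator_def\<close>)
  then show ?thesis using 0 D by simp
qed

section \<open>Bump functions and the fundamental lemma\<close>

text \<open>The exponent \<open>n\<close> makes the family closed under differentiation up to linear
  combinations, so that smoothness follows by one induction for all \<open>n\<close>.\<close>

definition flat_exp :: "nat \<Rightarrow> real \<Rightarrow> real" where
  "flat_exp n s = (if s > 0 then (1 / s) ^ n * exp (- (1 / s)) else 0)"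

lemma flat_exp_has_derivative:
  "(flat_exp n has_real_derivative (flat_exp (n + 2) s - real n * flat_exp (n + 1) s)) (at s)"
proof (cases "s = 0")
  case False
  have ev: "eventually (\<lambda>x. (if s > 0 then (1 / x) ^ n * exp (- (1 / x)) else 0) = flat_exp n x) (nhds s)"
  proof (cases "s > 0")
    case True
    then show ?thesis
      using eventually_nhds_in_open[of "{0<..}" s] by (auto elim!: eventually_mono simp: flat_exp_def)
  next
    case F: False
    then show ?thesis
      using eventually_nhds_in_open[of "{..<0}" s] False by (auto elim!: eventually_mono simp: flat_exp_def)
  qed
  have "((\<lambda>x. if s > 0 then (1 / x) ^ n * exp (- (1 / x)) else 0) has_real_derivative
      (flat_exp (n + 2) s - real n * flat_exp (n + 1) s)) (at s)"
  proof (cases "s > 0")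
    case True
    have d: "((\<lambda>x. 1 / x) has_real_derivative - (1 / s)\<^sup>2) (at s)"
      using True by (auto intro!: derivative_eq_intros simp: power2_eq_square field_simps)
    have p: "((\<lambda>x. (1 / x) ^ n) has_real_derivative real n * (1 / s) ^ (n - 1) * - (1 / s)\<^sup>2) (at s)"
      using DERIV_power[OF d, of n] by (simp add: mult_ac)
    have e: "((\<lambda>x. exp (- (1 / x))) has_real_derivative exp (- (1 / s)) * (1 / s)\<^sup>2) (at s)"
      using DERIV_fun_exp[OF DERIV_minus[OF d]] by simp
    have q: "real n * (1 / s) ^ (n - 1) * (1 / s)\<^sup>2 = real n * (1 / s) ^ (n + 1)"
      by (cases n) (simp_all add: power2_eq_square)
    have "real n * (1 / s) ^ (n - 1) * - (1 / s)\<^sup>2 * exp (- (1 / s)) + exp (- (1 / s)) * (1 / s)\<^sup>2 * (1 / s) ^ n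
      = flat_exp (n + 2) s - real n * flat_exp (n + 1) s"
      unfolding flat_exp_def using True q by (simp add: power_add algebra_simps power2_eq_square)
    with DERIV_mult[OF p e] True show ?thesis by simp
  qed (simp add: flat_exp_def)
  then show ?thesis using DERIV_cong_ev[OF refl ev refl] by simp
next
  case True
  \<comment> \<open>Exponential decay beats every power. The difference quotient of index
    \<open>n\<close> at 0 is, on the right, the function of index \<open>n + 1\<close>.\<close>
  have lim: "((\<lambda>h. flat_exp m h) \<longlongrightarrow> 0) (at_right 0)" for m
  proof -
    have "((\<lambda>h::real. inverse h ^ m / exp (inverse h)) \<longlongrightarrow> 0) (at_right 0)"
      by (rule filterlim_compose[OF tendsto_power_div_exp_0 filterlim_inverse_at_top_right])
    moreover have "eventually (\<lambda>h::real. inverse h ^ m / exp (inverse h) = flat_exp m h) (at_right 0)"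
      unfolding eventually_at_right_field by (auto simp: flat_exp_def exp_minus field_simps intro!: exI[of _ 1])
    ultimately show ?thesis by (rule Lim_transform_eventually)
  qed
  have "((\<lambda>h. (flat_exp n (0 + h) - flat_exp n 0) / h) \<longlongrightarrow> 0) (at_right 0)"
  proof (rule Lim_transform_eventually[OF lim[of "n + 1"]])
    show "eventually (\<lambda>h. flat_exp (n + 1) h = (flat_exp n (0 + h) - flat_exp n 0) / h) (at_right 0)"
      unfolding eventually_at_right_field by (auto simp: flat_exp_def field_simps intro!: exI[of _ 1])
  qed
  moreover have "((\<lambda>h. (flat_exp n (0 + h) - flat_exp n 0) / h) \<longlongrightarrow> 0) (at_left 0)"
  proof (rule Lim_transform_eventually[OF tendsto_const[of 0]])
    show "eventually (\<lambda>h. 0 = (flat_exp n (0 + h) - flat_exp n 0) / h) (at_left 0)"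
      unfolding eventually_at_left_field by (auto simp: flat_exp_def intro!: exI[of _ "-1"])
  qed
  ultimately have "(flat_exp n has_real_derivative 0) (at 0)"
    unfolding DERIV_def by (simp add: filterlim_at_split)
  then show ?thesis using True by (simp add: flat_exp_def)
qed

lemma smooth_flat_exp: "smooth_on UNIV (flat_exp n)"
proof -
  have "Ck_on k (flat_exp n) UNIV" for k
  proof (induction k arbitrary: n)
    case 0
    have "isCont (flat_exp n) s" for s using flat_exp_has_derivative DERIV_isCont by blast
    then show ?case by (simp add: continuous_at_imp_continuous_on)
  next
    case (Suc k)
    have "(flat_exp n has_derivative (\<lambda>v. v *\<^sub>R (flat_exp (n + 2) s + (- real n) *\<^sub>R flat_exp (n + 1) s))) (at s)" for s
      using flat_exp_has_derivative[of n s] unfolding has_field_derivative_def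
      by (rule has_derivative_eq_rhs) (simp add: fun_eq_iff mult.commute)
    moreover have "Ck_on k (\<lambda>s. v *\<^sub>R (flat_exp (n + 2) s + (- real n) *\<^sub>R flat_exp (n + 1) s)) UNIV" for v
      by (intro Ck_on_bilinear[OF bounded_bilinear_scaleR] Ck_on_add Ck_on_const Suc open_UNIV)
    ultimately show ?case by (intro Ck_on_SucI[OF open_UNIV])
  qed
  then show ?thesis by (simp add: smooth_on_def)
qed

lemma bump_function:
  fixes x0 :: "'e::euclidean_space"
  assumes "r > 0"
  obtains u :: "'e \<Rightarrow> real" where "smooth_on UNIV u" "\<And>x. x \<in> ball x0 r \<Longrightarrow> u x > 0" "\<And>x. x \<notin> ball x0 r \<Longrightarrow> u x = 0"
proof
  let ?s = "\<lambda>x. r\<^sup>2 - (x - x0) \<bullet> (x - x0)"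
  show "smooth_on UNIV (\<lambda>x. flat_exp 0 (?s x))"
    by (rule smooth_on_compose[OF smooth_flat_exp]) (auto intro!: smooth_intros)
  have "dist x0 x < r \<longleftrightarrow> (dist x0 x)\<^sup>2 < r\<^sup>2" for x
    using assms by (meson power2_less_imp_less power_strict_mono zero_le_dist less_imp_le zero_less_numeral)
  then have "?s x > 0 \<longleftrightarrow> x \<in> ball x0 r" for x
    by (simp only: mem_ball dist_norm norm_minus_commute[of x0] power2_norm_eq_inner[symmetric] diff_gt_0_iff_gt)
  then show "\<And>x. x \<in> ball x0 r \<Longrightarrow> flat_exp 0 (?s x) > 0" "\<And>x. x \<notin> ball x0 r \<Longrightarrow> flat_exp 0 (?s x) = 0"
    by (simp_all add: flat_exp_def)
qed

lemma smooth_on_extend_zero: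
  assumes "smooth_on U w" "closed C" "C \<subseteq> U" "\<And>x. x \<in> U - C \<Longrightarrow> w x = 0"
  shows "smooth_on UNIV (\<lambda>x. if x \<in> C then w x else 0)" (is "smooth_on _ ?w")
proof (rule smooth_on_local)
  fix x
  show "\<exists>T. x \<in> T \<and> T \<subseteq> UNIV \<and> smooth_on T ?w"
  proof (cases "x \<in> U")
    case True
    have "smooth_on U ?w" by (subst smooth_on_cong[where g = w]) (use assms in auto)
    then show ?thesis using True by blast
  next
    case False
    have "smooth_on (- C) (\<lambda>x. 0)" using assms(2) by (intro smooth_on_const) auto
    then have "smooth_on (- C) ?w" by (subst smooth_on_cong[where g = "\<lambda>x. 0"]) auto
    then show ?thesis using False assms(3) by blast
  qed
qed

text \<open>The product of \<open>u\<close> and \<open>Y\<close>, extended by zero, is smooth with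
  compact support on the whole space, so the integral of its derivative vanishes and no boundary
  term appears.\<close>

lemma integration_by_parts_compact:
  fixes u Y :: "'e::euclidean_space \<Rightarrow> real"
  assumes u: "smooth_on U u" and Y: "smooth_on U Y" and C: "compact C" "C \<subseteq> U" and supp: "\<And>x. x \<in> U - C \<Longrightarrow> u x = 0"
  shows "(LINT x:C|lborel. Y x * D u x v) = - (LINT x:C|lborel. u x * D Y x v)"
proof -
  define w where "w x = (if x \<in> C then u x * Y x else 0)" for x
  have "smooth_on UNIV w" unfolding w_def
    by (rule smooth_on_extend_zero[OF smooth_on_mult[OF u Y] compact_imp_closed[OF C(1)] C(2)]) (simp add: supp)
  from integral_derivative_compact_support[OF this C(1), of v]
  have 0: "(LINT x:C|lborel. D w x v) = 0" by (simp add: w_def)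
  have oU: "open U" using u by (rule smooth_on_open)
  have D: "D w x v = u x * D Y x v + Y x * D u x v" if x: "x \<in> U" for x
  proof -
    have "D w x v = D (\<lambda>x. u x * Y x) x v"
      by (rule D_cong_on[OF oU _ x]) (use supp in \<open>auto simp: w_def\<close>)
    then show ?thesis using D_mult[OF u Y x, of v] by (simp add: mult.commute)
  qed
  have c: "continuous_on C (\<lambda>x. u x * D Y x v)" "continuous_on C (\<lambda>x. Y x * D u x v)"
    by (rule continuous_on_subset[OF _ C(2)], rule smooth_on_continuous_on, intro smooth_intros u Y)+
  have "(LINT x:C|lborel. D w x v) = (LINT x:C|lborel. u x * D Y x v + Y x * D u x v)"
    by (rule set_lebesgue_integral_cong) (use D C in \<open>auto simp: compact_imp_closed\<close>)
  also have "\<dots> = (LINT x:C|lborel. u x * D Y x v) + (LINT x:C|lborel. Y x * D u x v)"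
    by (intro set_integral_add set_integrable_continuous_compact C c)
  finally show ?thesis using 0 by simp
qed

lemma divergence_form:
  fixes u :: "real \<times> real \<Rightarrow> real"
  assumes u: "smooth_on U u" and Y: "smooth_on U Y1" "smooth_on U Y2" and C: "compact C" "C \<subseteq> U"
    and supp: "\<And>x. x \<in> U - C \<Longrightarrow> u x = 0"
  shows "(LINT x:C|lborel. Y1 x * d1 u x + Y2 x * d2 u x) = - (LINT x:C|lborel. u x * (d1 Y1 x + d2 Y2 x))"
proof -
  have c: "set_integrable lborel C h" if "smooth_on U h" for h :: "real \<times> real \<Rightarrow> real"
    by (intro set_integrable_continuous_compact C continuous_on_subset[OF smooth_on_continuous_on[OF that]])
  have "(LINT x:C|lborel. Y1 x * d1 u x + Y2 x * d2 u x) = (LINT x:C|lborel. Y1 x * d1 u x) + (LINT x:C|lborel. Y2 x * d2 u x)"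
    by (intro set_integral_add c smooth_intros u Y)
  also have "\<dots> = - ((LINT x:C|lborel. u x * d1 Y1 x) + (LINT x:C|lborel. u x * d2 Y2 x))"
    using integration_by_parts_compact[OF u Y(1) C supp] integration_by_parts_compact[OF u Y(2) C supp] by simp
  also have "(LINT x:C|lborel. u x * d1 Y1 x) + (LINT x:C|lborel. u x * d2 Y2 x) = (LINT x:C|lborel. u x * d1 Y1 x + u x * d2 Y2 x)"
    by (rule set_integral_add(2)[symmetric]) (intro c smooth_intros u Y)+
  finally show ?thesis by (simp add: distrib_left)
qed

text \<open>If \<open>F x0\<close> is nonzero, then \<open>F\<close> times its sign is positive on a
  small closed ball. Tested against a bump function it gives a nonnegative integrand with integral
  zero that is positive on the open ball, which would then be a null set.\<close>

lemma fundamental_lemma: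
  fixes F :: "'e::euclidean_space \<Rightarrow> real"
  assumes F: "continuous_on U F" "open U" and x0: "x0 \<in> U"
    and vanish: "\<And>u x r. r > 0 \<Longrightarrow> cball x r \<subseteq> U \<Longrightarrow> smooth_on UNIV u \<Longrightarrow> (\<And>y. y \<notin> ball x r \<Longrightarrow> u y = 0) \<Longrightarrow>
       (LINT y:cball x r|lborel. u y * F y) = 0"
  shows "F x0 = 0"
proof (rule ccontr)
  assume nz: "F x0 \<noteq> 0"
  define G where "G y = sgn (F x0) * F y" for y
  have "G x0 > 0" using nz by (simp add: G_def sgn_if)
  have cG: "continuous_on U G" unfolding G_def by (intro continuous_intros F)
  then have "open (U \<inter> G -` {0<..})" by (rule continuous_open_preimage[OF _ F(2)]) auto
  moreover have "x0 \<in> U \<inter> G -` {0<..}" using x0 \<open>G x0 > 0\<close> by simp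
  ultimately obtain r where r: "r > 0" "cball x0 r \<subseteq> U \<inter> G -` {0<..}" using open_contains_cball by blast
  obtain u :: "'e \<Rightarrow> real" where u: "smooth_on UNIV u" "\<And>x. x \<in> ball x0 r \<Longrightarrow> u x > 0" "\<And>x. x \<notin> ball x0 r \<Longrightarrow> u x = 0"
    using bump_function[OF r(1)] by metis
  have "(LINT y:cball x0 r|lborel. u y * F y) = 0" by (rule vanish[OF r(1) _ u(1,3)]) (use r in auto)
  then have "sgn (F x0) * (LINT y:cball x0 r|lborel. u y * F y) = 0" by simp
  then have 0: "(LINT y:cball x0 r|lborel. u y * G y) = 0"
    unfolding G_def by (simp add: mult.left_commute[of _ "sgn (F x0)"])
  have int: "integrable lborel (\<lambda>y. indicator (cball x0 r) y *\<^sub>R (u y * G y))"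
    by (rule borel_integrable_compact)
       (use r in \<open>auto intro!: continuous_intros continuous_on_subset[OF smooth_on_continuous_on[OF u(1)]] continuous_on_subset[OF cG]\<close>)
  have u0: "u y \<ge> 0" for y using u(2,3)[of y] by (cases "y \<in> ball x0 r") auto
  have Gp: "G y > 0" if "y \<in> cball x0 r" for y using r(2) that by auto
  have "AE y in lborel. indicator (cball x0 r) y *\<^sub>R (u y * G y) = 0"
    using 0 unfolding set_lebesgue_integral_def
    by (subst (asm) integral_nonneg_eq_0_iff_AE[OF int])
       (use u0 Gp in \<open>auto simp: indicator_def less_imp_le\<close>)
  then obtain N where N: "N \<in> null_sets lborel" "{y. indicator (cball x0 r) y *\<^sub>R (u y * G y) \<noteq> 0} \<subseteq> N"
    by (auto simp: eventually_ae_filter)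
  have "ball x0 r \<subseteq> N"
  proof
    fix y assume y: "y \<in> ball x0 r"
    then have "y \<in> cball x0 r" by auto
    then have "indicator (cball x0 r) y *\<^sub>R (u y * G y) \<noteq> 0" using u(2)[OF y] Gp[of y] by simp
    then show "y \<in> N" using N(2) by blast
  qed
  moreover have "negligible N" using N(1) negligible_iff_null_sets null_sets_completionI by blast
  ultimately have "negligible (ball x0 r)" using negligible_subset by blast
  then show False using open_not_negligible[of "ball x0 r"] r(1) by simp
qed

section \<open>First variation of the area\<close>

context lagrangian_patch
begin

text \<open>The area density is the root of the Gram determinant. Along \<open>J X\<close> with
  \<open>X = grad u\<close> its derivative is \<open>- 2 sqrt \<Delta> \<alpha>(X)\<close>, the
  trace of the second fundamental form against the variation field, and \<open>\<alpha>(X)\<close>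
  equals \<open>a1 d1 u + a2 d2 u\<close>.\<close>

lemma first_variation:
  fixes \<phi> :: "real \<times> real \<times> real \<Rightarrow> complex^2"
  assumes \<phi>: "smooth_on W \<phi>" "\<phi> ` W \<subseteq> csf_domain \<epsilon>" and C: "compact C" "C \<subseteq> U"
    and init: "\<And>x. x \<in> U \<Longrightarrow> (0, x) \<in> W" "\<And>x. x \<in> U \<Longrightarrow> \<phi> (0, x) = f x"
    and u: "smooth_on U u"
    and field: "\<And>x. x \<in> U \<Longrightarrow> D \<phi> (0, x) (1, 0) = J (D f x (gradient G u x))"
  shows "((\<lambda>t. LINT x:C|lborel. sqrt (gram (induced_metric (csf_metric \<epsilon>) (\<lambda>x. \<phi> (t, x))) x)) has_real_derivative
     - 2 * (LINT x:C|lborel. sqrt (\<Delta> x) * a1 x * d1 u x + sqrt (\<Delta> x) * a2 x * d2 u x)) (at 0)"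
proof -
  have oW: "open W" using \<phi>(1) by (rule smooth_on_open)
  define P where "P w z = D \<phi> z (0, w)" for w z
  define E where "E w w' z = Re (csf_herm \<epsilon> (\<phi> z) (P w z) (P w' z))" for w w' z
  define e1 e2 :: "real \<times> real" where "e1 = (1, 0)" and "e2 = (0, 1)"
  define \<gamma> where "\<gamma> z = E e1 e1 z * E e2 e2 z - (E e1 e2 z)\<^sup>2" for z
  have sP: "smooth_on W (P w)" for w unfolding P_def by (rule smooth_on_D[OF \<phi>(1)])
  have sE: "smooth_on W (E w w')" for w w' unfolding E_def by (intro smooth_intros \<phi> sP)
  have s\<gamma>: "smooth_on W \<gamma>" unfolding \<gamma>_def by (intro smooth_intros sE)
  have slice: "D (\<lambda>x. \<phi> (t, x)) x v = P v (t, x)" if "(t, x) \<in> W" for t x v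
  proof -
    have "((\<lambda>x. (t, x)) has_derivative (\<lambda>h. (0, h))) (at x)" by (auto intro!: derivative_eq_intros)
    from has_derivative_compose[OF this smooth_on_has_derivative[OF \<phi>(1) that]]
    show ?thesis by (simp add: D_eqI P_def)
  qed
  have gram: "gram (induced_metric (csf_metric \<epsilon>) (\<lambda>x. \<phi> (t, x))) x = \<gamma> (t, x)" if "(t, x) \<in> W" for t x
  proof -
    have "\<phi> (t, x) \<in> csf_domain \<epsilon>" using \<phi>(2) that by blast
    then show ?thesis
      unfolding gram_def induced_metric_def slice[OF that] \<gamma>_def E_def e1_def e2_def by (simp add: csf_metric_eq)
  qed
  have P0: "P v (0, x) = D f x v" if "x \<in> U" for x v
    using slice[OF init(1)[OF that], of v] D_cong_on[OF open_U init(2) that, of "\<lambda>x. x" v] by simp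
  have E0: "E e1 e1 (0, x) = g11 x" "E e1 e2 (0, x) = g12 x" "E e2 e2 (0, x) = g22 x" if "x \<in> U" for x
    by (simp_all add: E_def P0[OF that] init(2)[OF that] g11_def g12_def g22_def e1_def e2_def)
  \<comment> \<open>The root is smooth where the Gram determinant is positive, an open set that
    contains \<open>{0} \<times> C\<close>.\<close>
  define W' where "W' = {z \<in> W. \<gamma> z > 0}"
  have "W' = W \<inter> \<gamma> -` {0<..}" by (auto simp: W'_def)
  then have oW': "open W'" by (simp add: continuous_open_preimage[OF smooth_on_continuous_on[OF s\<gamma>] oW])
  have \<gamma>0: "\<gamma> (0, x) = \<Delta> x" if "x \<in> U" for x by (simp add: \<gamma>_def E0[OF that] \<Delta>_def)
  have CW': "{0} \<times> C \<subseteq> W'" using C(2) init(1) \<gamma>0 Delta_pos by (auto simp: W'_def)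
  have sroot: "smooth_on W' (\<lambda>z. sqrt (\<gamma> z))"
    by (intro smooth_intros smooth_on_subset[OF s\<gamma> oW']) (auto simp: W'_def)
  define X1 X2 where "X1 x = (g22 x * d1 u x - g12 x * d2 u x) / \<Delta> x" and "X2 x = (g11 x * d2 u x - g12 x * d1 u x) / \<Delta> x" for x
  have nz: "\<Delta> x \<noteq> 0" if "x \<in> U" for x using Delta_pos[OF that] by simp
  have sX: "smooth_on U X1" "smooth_on U X2"
    unfolding X1_def X2_def by (intro smooth_intros smooth_coeffs smooth_alpha u nz; assumption)+
  have V: "D \<phi> (0, x) (1, 0) = J (X1 x *\<^sub>R f1 x + X2 x *\<^sub>R f2 x)" if x: "x \<in> U" for x
    unfolding field[OF x] gradient_eq[OF x smooth_on_differentiable[OF u x]] D_pair[OF x, of "_ / _"] X1_def X2_def ..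
  \<comment> \<open>The covariant \<open>t\<close>-derivative of the image of \<open>w\<close>;
    since second derivatives commute, it is the covariant derivative of the variation field along
    \<open>w\<close>.\<close>
  define S where "S x w = D (P w) (0, x) (1, 0) + csf_gamma \<epsilon> (f x) (D \<phi> (0, x) (1, 0)) (D f x w)" for x w
  have S: "S x w = J (D X1 x w *\<^sub>R f1 x + D X2 x w *\<^sub>R f2 x + X1 x *\<^sub>R hess \<epsilon> f x w (1,0) + X2 x *\<^sub>R hess \<epsilon> f x w (0,1))"
    if x: "x \<in> U" for x w
  proof -
    have "D (P w) (0, x) (1, 0) = D (\<lambda>z. D \<phi> z (1, 0)) (0, x) (0, w)"
      unfolding P_def by (rule D_D_commute[OF \<phi>(1) init(1)[OF x]])
    also have "\<dots> = D (\<lambda>x. D \<phi> (0, x) (1, 0)) x w"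
    proof -
      have "((\<lambda>x. (0, x)) has_derivative (\<lambda>h. (0, h))) (at x)" by (auto intro!: derivative_eq_intros)
      note hd = has_derivative_compose[OF this smooth_on_has_derivative[OF smooth_on_D[OF \<phi>(1)] init(1)[OF x]]]
      show ?thesis by (subst D_eqI[OF hd]) (rule refl)
    qed
    also have "\<dots> = D (\<lambda>x. J (X1 x *\<^sub>R f1 x + X2 x *\<^sub>R f2 x)) x w"
      by (rule D_cong_on[OF open_U _ x]) (rule V)
    also have "\<dots> = J (D X1 x w *\<^sub>R f1 x + D X2 x w *\<^sub>R f2 x + X1 x *\<^sub>R D f1 x w + X2 x *\<^sub>R D f2 x w)"
    proof -
      have s: "smooth_on U (\<lambda>x. X1 x *\<^sub>R f1 x)" "smooth_on U (\<lambda>x. X2 x *\<^sub>R f2 x)"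
        by (intro smooth_intros sX smooth_coeffs)+
      show ?thesis
        unfolding D_vscale[OF smooth_on_const[OF open_U] smooth_on_add[OF s] x] D_const D_add[OF s x]
          D_scaleR[OF sX(1) smooth_coeffs(1) x] D_scaleR[OF sX(2) smooth_coeffs(2) x]
        by (simp add: algebra_simps)
    qed
    finally have 1: "D (P w) (0, x) (1, 0) = J (D X1 x w *\<^sub>R f1 x + D X2 x w *\<^sub>R f2 x + X1 x *\<^sub>R D f1 x w + X2 x *\<^sub>R D f2 x w)" .
    show ?thesis
      unfolding S_def 1 V[OF x] hess_def
      by (simp add: csf_gamma_commute[of _ _ _ "D f x w"] vec_eq_iff algebra_simps scaleR_conv_of_real[where 'a = complex])
  qed
  have DE: "D (E w w') (0, x) (1, 0) = Re (csf_herm \<epsilon> (f x) (S x w) (D f x w')) + Re (csf_herm \<epsilon> (f x) (D f x w) (S x w'))"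
    if x: "x \<in> U" for x w w'
  proof -
    have z: "(0, x) \<in> W" "\<phi> (0, x) \<in> csf_domain \<epsilon>" using init[OF x] in_domain[OF x] by simp_all
    have "D (E w w') (0, x) (1, 0) = Re (csf_herm \<epsilon> (\<phi> (0, x)) (D (P w) (0, x) (1, 0) + csf_gamma \<epsilon> (\<phi> (0, x)) (D \<phi> (0, x) (1, 0)) (P w (0, x))) (P w' (0, x))
        + csf_herm \<epsilon> (\<phi> (0, x)) (P w (0, x)) (D (P w') (0, x) (1, 0) + csf_gamma \<epsilon> (\<phi> (0, x)) (D \<phi> (0, x) (1, 0)) (P w' (0, x))))"
      unfolding E_def[abs_def]
      by (subst D_eqI[OF bounded_linear.has_derivative[OF bounded_linear_Re has_derivative_csf_herm[OF z(2)
            smooth_on_has_derivative[OF \<phi>(1) z(1)] smooth_on_has_derivative[OF sP z(1)] smooth_on_has_derivative[OF sP z(1)]]]]) simp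
    then show ?thesis unfolding P0[OF x] init(2)[OF x] S_def by simp
  qed
  \<comment> \<open>Terms with derivatives of \<open>X1\<close> and \<open>X2\<close> are
    \<open>J\<close> of tangent vectors and hence orthogonal to the frame; of the Hessian terms only
    the imaginary coefficients survive, and their trace is twice \<alpha>.\<close>
  have D\<gamma>: "D \<gamma> (0, x) (1, 0) = - 4 * (\<Delta> x * (X1 x * \<alpha>1 x + X2 x * \<alpha>2 x))" if x: "x \<in> U" for x
  proof -
    have z: "(0, x) \<in> W" by (rule init(1)[OF x])
    have 0: "D \<gamma> (0, x) (1, 0) = E e1 e1 (0, x) * D (E e2 e2) (0, x) (1, 0) + D (E e1 e1) (0, x) (1, 0) * E e2 e2 (0, x)
        - 2 * E e1 e2 (0, x) * D (E e1 e2) (0, x) (1, 0)"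
      unfolding \<gamma>_def[abs_def] D_diff[OF smooth_on_mult[OF sE sE] smooth_on_power[OF sE] z] D_mult[OF sE sE z] D_power2[OF sE z] ..
    note 1 = 0[unfolded DE[OF x] S[OF x] E0[OF x], unfolded e1_def e2_def hess_commute[OF x, of "(0,1)" "(1,0)"] hess_frame[OF x]]
    have 2: "Im (A1 x + B2 x) = 2 * \<alpha>1 x" "Im (B1 x + C2 x) = 2 * \<alpha>2 x" by (simp_all add: \<alpha>1_def \<alpha>2_def)
    have "D \<gamma> (0, x) (1, 0) = - 2 * (\<Delta> x * (X1 x * Im (A1 x + B2 x) + X2 x * Im (B1 x + C2 x)))"
      unfolding 1 by (simp add: herm_frame[OF x] \<Delta>_def power2_eq_square algebra_simps)
    then show ?thesis unfolding 2 by (simp add: algebra_simps)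
  qed
  have Droot: "D (\<lambda>z. sqrt (\<gamma> z)) (0, x) (1, 0) = - 2 * (sqrt (\<Delta> x) * a1 x * d1 u x + sqrt (\<Delta> x) * a2 x * d2 u x)" if x: "x \<in> U" for x
  proof -
    have z: "(0, x) \<in> W" by (rule init(1)[OF x])
    have p: "\<Delta> x > 0" by (rule Delta_pos[OF x])
    have "((\<lambda>z. sqrt (\<gamma> z)) has_derivative (\<lambda>v. inverse (sqrt (\<gamma> (0, x))) / 2 * D \<gamma> (0, x) v)) (at (0, x))"
      using has_derivative_compose[OF smooth_on_has_derivative[OF s\<gamma> z] DERIV_real_sqrt[unfolded has_field_derivative_def]] p \<gamma>0[OF x] by simp
    then have "D (\<lambda>z. sqrt (\<gamma> z)) (0, x) (1, 0) = inverse (sqrt (\<Delta> x)) / 2 * (- 4 * (\<Delta> x * (X1 x * \<alpha>1 x + X2 x * \<alpha>2 x)))"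
      by (simp add: D_eqI \<gamma>0[OF x] D\<gamma>[OF x])
    also have "\<dots> = - 2 * (sqrt (\<Delta> x) * (X1 x * \<alpha>1 x + X2 x * \<alpha>2 x))"
      using p real_sqrt_mult_self[of "\<Delta> x"] by (simp add: field_simps)
    also have "X1 x * \<alpha>1 x + X2 x * \<alpha>2 x = a1 x * d1 u x + a2 x * d2 u x"
      unfolding X1_def X2_def a1_def a2_def using p by (simp add: field_simps)
    finally show ?thesis by (simp add: algebra_simps)
  qed
  have der: "((\<lambda>t. LINT x:C|lborel. sqrt (\<gamma> (t, x))) has_real_derivative (LINT x:C|lborel. D (\<lambda>z. sqrt (\<gamma> z)) (0, x) (1, 0))) (at 0)"
    by (rule has_derivative_set_integral[OF sroot C(1) CW'])
  have "(LINT x:C|lborel. D (\<lambda>z. sqrt (\<gamma> z)) (0, x) (1, 0)) = (LINT x:C|lborel. - 2 * (sqrt (\<Delta> x) * a1 x * d1 u x + sqrt (\<Delta> x) * a2 x * d2 u x))"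
    by (rule set_lebesgue_integral_cong) (use C Droot in \<open>auto simp: compact_imp_closed\<close>)
  also have "\<dots> = - 2 * (LINT x:C|lborel. sqrt (\<Delta> x) * a1 x * d1 u x + sqrt (\<Delta> x) * a2 x * d2 u x)"
    by (rule set_integral_mult_right)
  finally have L: "(LINT x:C|lborel. D (\<lambda>z. sqrt (\<gamma> z)) (0, x) (1, 0)) = \<dots>" .
  \<comment> \<open>The formula for the Gram determinant holds inside \<open>W\<close>, which by
    compactness contains all \<open>(t, x)\<close> with \<open>x\<close> in \<open>C\<close> once
    \<open>t\<close> is small.\<close>
  have ev: "eventually (\<lambda>t. (LINT x:C|lborel. sqrt (gram (induced_metric (csf_metric \<epsilon>) (\<lambda>x. \<phi> (t, x))) x))
      = (LINT x:C|lborel. sqrt (\<gamma> (t, x)))) (nhds 0)"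
  proof -
    have "compact ({0::real} \<times> C)" using C by (intro compact_Times) auto
    then obtain e where e: "e > 0" "(\<Union>z\<in>{0} \<times> C. cball z e) \<subseteq> W"
      using compact_subset_open_imp_cball_epsilon_subset[OF _ oW] CW' unfolding W'_def by blast
    have "(LINT x:C|lborel. sqrt (gram (induced_metric (csf_metric \<epsilon>) (\<lambda>x. \<phi> (t, x))) x)) = (LINT x:C|lborel. sqrt (\<gamma> (t, x)))"
      if "\<bar>t\<bar> < e" for t
    proof (rule set_lebesgue_integral_cong)
      have "(t, x) \<in> W" if "x \<in> C" for x
      proof -
        have "(t, x) \<in> cball (0, x) e" using \<open>\<bar>t\<bar> < e\<close> by (simp add: dist_Pair_Pair)
        then show ?thesis using e that by blast
      qed
      then show "\<forall>x. x \<in> C \<longrightarrow> sqrt (gram (induced_metric (csf_metric \<epsilon>) (\<lambda>x. \<phi> (t, x))) x) = sqrt (\<gamma> (t, x))"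
        by (simp add: gram)
    qed (use C in \<open>simp add: compact_imp_closed\<close>)
    then show ?thesis using e(1) by (intro eventually_nhds_metric[THEN iffD2] exI[of _ e]) (simp add: dist_real_def)
  qed
  show ?thesis unfolding DERIV_cong_ev[OF refl ev refl] using der unfolding L .
qed

end

section \<open>Transition maps of the ambient atlas\<close>

text \<open>Homogeneous coordinates for the affine chart with index \<open>j\<close>:
  \<open>ins j 1 w\<close> represents the point with coordinate \<open>w\<close>, and
  \<open>ins j 0 a\<close> a tangent vector there.\<close>

definition ins :: "3 \<Rightarrow> complex \<Rightarrow> complex^2 \<Rightarrow> complex^3" where
  "ins j c w = (if j = 1 then vector [c, w $ 1, w $ 2] else if j = 2 then vector [w $ 1, c, w $ 2] else vector [w $ 1, w $ 2, c])"

definition del :: "3 \<Rightarrow> complex^3 \<Rightarrow> complex^2" where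
  "del j v = (if j = 1 then vector [v $ 2, v $ 3] else if j = 2 then vector [v $ 1, v $ 3] else vector [v $ 1, v $ 2])"

lemma ins_nth [simp]: "ins j c w $ j = c"
  using exhaust_3[of j] by (auto simp: ins_def)

lemma del_ins [simp]: "del j (ins j c w) = w"
  using exhaust_3[of j] by (auto simp: ins_def del_def vec_eq_iff forall_2)

lemma ins_del: "v $ j = c \<Longrightarrow> ins j c (del j v) = v"
  using exhaust_3[of j] by (auto simp: ins_def del_def vec_eq_iff forall_3)

lemma del_linear: "del j (v + v') = del j v + del j v'" "del j (c *s v) = c *s del j v"
  by (auto simp: del_def vec_eq_iff forall_2)

lemma bounded_linear_del: "bounded_linear (del j)"
proof -
  have "linear (del j)"
    by (rule linearI) (auto simp: del_def vec_eq_iff forall_2)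
  then show ?thesis by (rule linear_conv_bounded_linear[THEN iffD1])
qed

lemma ins_zero_linear: "ins j 0 (c *s a) = c *s ins j 0 a"
  using exhaust_3[of j] by (auto simp: ins_def vec_eq_iff forall_3)

lemma bounded_linear_ins_zero: "bounded_linear (ins j 0)"
proof -
  have "linear (ins j 0)"
    using exhaust_3[of j] by (intro linearI) (auto simp: ins_def vec_eq_iff forall_3)
  then show ?thesis by (rule linear_conv_bounded_linear[THEN iffD1])
qed

lemma ins_affine: "ins j 1 w = ins j 1 0 + ins j 0 w"
  using exhaust_3[of j] by (auto simp: ins_def vec_eq_iff forall_3)

lemma herm_ins: "herm (ins j c a) (ins j c' b) = c * cnj c' + herm a b"
  using exhaust_3[of j] by (auto simp: herm_def ins_def sum_2 sum_3)

definition fubini_study :: "complex^3 \<Rightarrow> complex^3 \<Rightarrow> complex^3 \<Rightarrow> complex" where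
  "fubini_study v A B = (herm v v * herm A B - herm A v * herm v B) / (herm v v)\<^sup>2"

lemma fubini_study_invariant:
  assumes "c \<noteq> 0"
  shows "fubini_study (c *s v) (c *s A + \<mu> *s v) (c *s B + \<nu> *s v) = fubini_study v A B"
proof -
  have n: "(c * cnj c)\<^sup>2 \<noteq> 0" using assms by simp
  have "herm (c *s v) (c *s v) * herm (c *s A + \<mu> *s v) (c *s B + \<nu> *s v) - herm (c *s A + \<mu> *s v) (c *s v) * herm (c *s v) (c *s B + \<nu> *s v)
    = (c * cnj c)\<^sup>2 * (herm v v * herm A B - herm A v * herm v B)"
    by (simp add: power2_eq_square algebra_simps)
  moreover have "(herm (c *s v) (c *s v))\<^sup>2 = (c * cnj c)\<^sup>2 * (herm v v)\<^sup>2"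
    by (simp add: power2_eq_square algebra_simps)
  ultimately show ?thesis unfolding fubini_study_def using n by simp
qed

lemma csf_metric_fubini_study:
  assumes "\<epsilon> > 0"
  shows "csf_metric \<epsilon> w a b = Re (fubini_study (ins j 1 w) (ins j 0 a) (ins j 0 b)) / \<epsilon>"
proof -
  have e: "1 + herm w w = of_real (1 + (norm w)\<^sup>2)" by (simp add: herm_self)
  show ?thesis
    using assms unfolding csf_metric_def fubini_study_def herm_ins
    by (simp add: e del: of_real_add)
qed

section \<open>Affine charts of the complex projective plane\<close>

lemma complex_line_scale: "c \<noteq> 0 \<Longrightarrow> complex_line (c *s v) = complex_line v"
proof -
  assume c: "c \<noteq> 0"
  show ?thesis unfolding complex_line_def
  proof (intro equalityI image_subsetI)
    show "x *s (c *s v) \<in> range (\<lambda>c. c *s v)" for x by (rule range_eqI[of _ _ "x * c"]) simp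
    show "x *s v \<in> range (\<lambda>x. x *s (c *s v))" for x by (rule range_eqI[of _ _ "x / c"]) (use c in simp)
  qed
qed

lemma cp2_representative_line:
  assumes "v $ j \<noteq> 0"
  shows "cp2_representative j (Projective (complex_line v)) = (1 / v $ j) *s v"
proof -
  have "(THE u. u \<in> complex_line v \<and> u $ j = 1) = (1 / v $ j) *s v"
  proof (rule the_equality)
    show "(1 / v $ j) *s v \<in> complex_line v \<and> ((1 / v $ j) *s v) $ j = 1"
      using assms rangeI[of "\<lambda>c. c *s v" "1 / v $ j"] by (simp add: complex_line_def)
    fix u assume u: "u \<in> complex_line v \<and> u $ j = 1"
    then obtain c where c: "u = c *s v" by (auto simp: complex_line_def)
    then have "c * v $ j = 1" using u by simp
    then show "u = (1 / v $ j) *s v" using assms c by (simp add: field_simps)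
  qed
  then show ?thesis by simp
qed

definition cp2_chart :: "3 \<Rightarrow> (csf_point, complex^2) chart" where
  "cp2_chart j = (cp2_domain j, \<lambda>q. del j (cp2_representative j q))"

lemma cp2_charts_eq: "cp2_charts = range cp2_chart"
proof -
  have "cp2_chart 1 = (cp2_domain 1, \<lambda>q. let v = cp2_representative 1 q in vector [v $ 2, v $ 3])"
    "cp2_chart 2 = (cp2_domain 2, \<lambda>q. let v = cp2_representative 2 q in vector [v $ 1, v $ 3])"
    "cp2_chart 3 = (cp2_domain 3, \<lambda>q. let v = cp2_representative 3 q in vector [v $ 1, v $ 2])"
    by (simp_all only: cp2_chart_def del_def Let_def) simp_all
  then show ?thesis unfolding cp2_charts_def UNIV_3 by (simp only: image_insert image_empty)
qed

lemma fst_cp2_chart: "fst (cp2_chart j) = {Projective (complex_line v) | v. v $ j \<noteq> 0}"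
  by (simp add: cp2_chart_def cp2_domain_def)

lemma snd_cp2_chart:
  assumes "v $ j \<noteq> 0"
  shows "snd (cp2_chart j) (Projective (complex_line v)) = del j ((1 / v $ j) *s v)"
  by (simp only: cp2_chart_def snd_conv cp2_representative_line[OF assms])

lemma cp2_point_of_coord:
  assumes "q \<in> fst (cp2_chart j)"
  shows "q = Projective (complex_line (ins j 1 (snd (cp2_chart j) q)))"
proof -
  obtain v where q: "q = Projective (complex_line v)" "v $ j \<noteq> 0"
    using assms by (auto simp: fst_cp2_chart)
  have "ins j 1 (del j ((1 / v $ j) *s v)) = (1 / v $ j) *s v" by (rule ins_del) (use q in simp)
  then show ?thesis using q complex_line_scale[of "1 / v $ j" v] by (simp add: snd_cp2_chart)
qed

lemma cp2_coord_of_point: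
  "Projective (complex_line (ins j 1 w)) \<in> fst (cp2_chart j)"
  "snd (cp2_chart j) (Projective (complex_line (ins j 1 w))) = w"
proof -
  show "Projective (complex_line (ins j 1 w)) \<in> fst (cp2_chart j)"
    unfolding fst_cp2_chart by (rule CollectI, rule exI[of _ "ins j 1 w"]) simp
  show "snd (cp2_chart j) (Projective (complex_line (ins j 1 w))) = w"
    using snd_cp2_chart[of "ins j 1 w" j] by simp
qed

lemma inj_on_cp2_chart: "inj_on (snd (cp2_chart j)) (fst (cp2_chart j))"
  by (rule inj_onI) (metis cp2_point_of_coord)

lemma chart_inv_cp2: "chart_inv (cp2_chart j) w = Projective (complex_line (ins j 1 w))"
  using inv_into_f_f[OF inj_on_cp2_chart cp2_coord_of_point(1)[of j w]] by (simp add: cp2_coord_of_point(2))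

lemma cp2_in_chart_iff: "Projective (complex_line (ins j 1 w)) \<in> fst (cp2_chart k) \<longleftrightarrow> ins j 1 w $ k \<noteq> 0"
proof
  assume "Projective (complex_line (ins j 1 w)) \<in> fst (cp2_chart k)"
  then obtain v where v: "complex_line (ins j 1 w) = complex_line v" "v $ k \<noteq> 0" by (auto simp: fst_cp2_chart)
  have "v \<in> complex_line v" unfolding complex_line_def by (rule image_eqI[of _ _ 1]) simp_all
  then obtain c where "v = c *s ins j 1 w" using v(1) by (auto simp: complex_line_def)
  then show "ins j 1 w $ k \<noteq> 0" using v(2) by auto
qed (auto simp: fst_cp2_chart)

text \<open>A transition map is \<open>w \<mapsto> v / v\<^sub>k\<close> for the homogeneous coordinates \<open>v\<close> of \<open>w\<close>; the
  Fubini--Study form depends only on the line through \<open>v\<close> and on tangent vectors modulo \<open>v\<close>.\<close>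

lemma cp2_transition:
  fixes j k :: 3
  defines "T \<equiv> snd (cp2_chart j) ` (fst (cp2_chart j) \<inter> fst (cp2_chart k))"
    and "\<tau> \<equiv> \<lambda>w. snd (cp2_chart k) (chart_inv (cp2_chart j) w)"
  assumes \<epsilon>: "\<epsilon> > 0"
  shows "open T" "smooth_on T \<tau>" "w \<in> T \<Longrightarrow> D \<tau> w (c *s a) = c *s D \<tau> w a"
    "w \<in> T \<Longrightarrow> csf_metric \<epsilon> (\<tau> w) (D \<tau> w a) (D \<tau> w b) = csf_metric \<epsilon> w a b"
proof -
  have T: "T = {w. ins j 1 w $ k \<noteq> 0}"
  proof (intro equalityI subsetI)
    fix w assume "w \<in> T"
    then obtain q where q: "q \<in> fst (cp2_chart j)" "q \<in> fst (cp2_chart k)" "w = snd (cp2_chart j) q"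
      by (auto simp: T_def)
    then have "q = Projective (complex_line (ins j 1 w))" using cp2_point_of_coord by blast
    then show "w \<in> {w. ins j 1 w $ k \<noteq> 0}" using q(2) cp2_in_chart_iff by simp
  next
    fix w assume "w \<in> {w. ins j 1 w $ k \<noteq> 0}"
    then have "Projective (complex_line (ins j 1 w)) \<in> fst (cp2_chart j) \<inter> fst (cp2_chart k)"
      using cp2_coord_of_point(1)[of j w] cp2_in_chart_iff[of j w k] by simp
    from imageI[OF this, of "snd (cp2_chart j)"] show "w \<in> T"
      unfolding T_def cp2_coord_of_point(2) .
  qed
  define v where "v w = ins j 1 w" for w
  have v_eq: "v = (\<lambda>w. ins j 1 0 + ins j 0 w)"
    by (rule ext) (unfold v_def, rule ins_affine)
  have dv: "(v has_derivative ins j 0) (at w)" for w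
    unfolding v_eq
    using has_derivative_add[OF has_derivative_const bounded_linear_imp_has_derivative[OF bounded_linear_ins_zero]] by simp
  have sv: "smooth_on S v" if "open S" for S
    unfolding v_eq
    by (intro smooth_on_add smooth_on_const smooth_on_linear[OF bounded_linear_ins_zero] smooth_on_id that)
  have \<tau>: "\<tau> w = del k ((1 / v w $ k) *s v w)" if "w \<in> T" for w
    using that snd_cp2_chart[of "ins j 1 w" k] unfolding \<tau>_def chart_inv_cp2 T v_def by simp
  have nz: "v w $ k \<noteq> 0" if "w \<in> T" for w using that by (simp add: T v_def)
  have "continuous_on UNIV (\<lambda>w. v w $ k)"
    by (rule smooth_on_continuous_on[OF smooth_on_vec_nth[OF sv[OF open_UNIV]]])
  then have "open ((\<lambda>w. v w $ k) -` (- {0}))" by (intro open_vimage) auto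
  then show oO: "open T" by (simp add: T v_def vimage_def)
  show s\<tau>: "smooth_on T \<tau>"
  proof -
    have "smooth_on T (\<lambda>w. del k ((1 / v w $ k) *s v w))"
      using nz by (intro smooth_on_linear[OF bounded_linear_del] smooth_intros sv oO)
    then show ?thesis using smooth_on_cong[of T \<tau> "\<lambda>w. del k ((1 / v w $ k) *s v w)"] \<tau> by simp
  qed
  have D\<tau>: "D \<tau> w a = del k ((1 / v w $ k) *s ins j 0 a + (- (ins j 0 a $ k) / (v w $ k)\<^sup>2) *s v w)" if w: "w \<in> T" for w a
  proof -
    have 1: "((\<lambda>w. 1 / v w $ k) has_derivative (\<lambda>a. - (ins j 0 a $ k) / (v w $ k)\<^sup>2)) (at w)"
      using nz[OF w]
      by (auto intro!: derivative_eq_intros bounded_linear.has_derivative[OF bounded_linear_vec_nth dv] simp: power2_eq_square divide_inverse)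
    have "((\<lambda>w. del k ((1 / v w $ k) *s v w)) has_derivative
        (\<lambda>a. del k ((1 / v w $ k) *s ins j 0 a + (- (ins j 0 a $ k) / (v w $ k)\<^sup>2) *s v w))) (at w)"
      by (rule bounded_linear.has_derivative[OF bounded_linear_del has_derivative_vscale[OF 1 dv]])
    then show ?thesis using D_cong_on[OF oO \<tau> w, of "\<lambda>w. w" a] by (simp add: D_eqI)
  qed
  show "D \<tau> w (c *s a) = c *s D \<tau> w a" if w: "w \<in> T"
    unfolding D\<tau>[OF w] ins_zero_linear del_linear by (simp add: vec_eq_iff algebra_simps)
  show "csf_metric \<epsilon> (\<tau> w) (D \<tau> w a) (D \<tau> w b) = csf_metric \<epsilon> w a b" if w: "w \<in> T"
  proof -
    define c where "c = 1 / v w $ k"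
    define \<mu> where "\<mu> a = - (ins j 0 a $ k) / (v w $ k)\<^sup>2" for a
    have c: "c \<noteq> 0" using nz[OF w] by (simp add: c_def)
    have 1: "ins k 1 (\<tau> w) = c *s v w"
      unfolding \<tau>[OF w] by (subst ins_del) (use nz[OF w] in \<open>simp_all add: c_def\<close>)
    have 2: "ins k 0 (D \<tau> w a) = c *s ins j 0 a + \<mu> a *s v w" for a
      unfolding D\<tau>[OF w] by (subst ins_del) (use nz[OF w] in \<open>simp_all add: c_def \<mu>_def power2_eq_square\<close>)
    show ?thesis
      unfolding csf_metric_fubini_study[OF \<epsilon>, of "\<tau> w" _ _ k] csf_metric_fubini_study[OF \<epsilon>, of w _ _ j]
        1 2 fubini_study_invariant[OF c] v_def ..
  qed
qed

text \<open>Holomorphic isometries in coordinates: complex linearity transports \<open>J\<close>,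
  and isometry transports gradients between ambient charts.\<close>

definition csf_transition_property :: "real \<Rightarrow> (complex^2) set \<Rightarrow> (complex^2 \<Rightarrow> complex^2) \<Rightarrow> bool" where
  "csf_transition_property \<epsilon> T \<tau> \<longleftrightarrow> smooth_on T \<tau> \<and>
     (\<forall>w\<in>T. \<forall>c a. D \<tau> w (c *s a) = c *s D \<tau> w a) \<and>
     (\<forall>w\<in>T. \<forall>a b. csf_metric \<epsilon> (\<tau> w) (D \<tau> w a) (D \<tau> w b) = csf_metric \<epsilon> w a b)"

lemma csf_chart:
  assumes "d \<in> csf_charts \<epsilon>"
  shows "inj_on (snd d) (fst d)" "open (snd d ` fst d)" "snd d ` fst d \<subseteq> csf_domain \<epsilon>"
proof -
  consider "\<epsilon> = 0" "d = (range Affine, affine_coord)" | "\<epsilon> < 0" "d = (Affine ` {w. norm w < 1}, affine_coord)"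
    | j where "\<epsilon> > 0" "d = cp2_chart j"
    using assms by (auto simp: csf_charts_def cp2_charts_eq split: if_splits)
  then have "inj_on (snd d) (fst d) \<and> open (snd d ` fst d) \<and> snd d ` fst d \<subseteq> csf_domain \<epsilon>"
  proof cases
    case 1
    then show ?thesis by (auto simp: inj_on_def csf_domain_def image_image)
  next
    case 2
    have "(norm w)\<^sup>2 < 1" if "norm w < 1" for w :: "complex^2"
      using power_strict_mono[OF that, of 2] by simp
    moreover have "{w::complex^2. norm w < 1} = ball 0 1" by auto
    ultimately show ?thesis using 2 by (auto simp: inj_on_def csf_domain_def image_image)
  next
    case 3
    have "snd d ` fst d = UNIV"
    proof (intro equalityI subsetI UNIV_I)
      fix w show "w \<in> snd d ` fst d"
        unfolding 3(2) using cp2_coord_of_point[of j w] by (metis image_eqI)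
    qed
    moreover have "csf_domain \<epsilon> = UNIV" using 3 by (auto simp: csf_domain_def add_pos_nonneg)
    ultimately show ?thesis using 3 inj_on_cp2_chart by simp
  qed
  then show "inj_on (snd d) (fst d)" "open (snd d ` fst d)" "snd d ` fst d \<subseteq> csf_domain \<epsilon>" by simp_all
qed

lemma csf_transition:
  assumes "d \<in> csf_charts \<epsilon>" "d' \<in> csf_charts \<epsilon>"
  shows "csf_transition_property \<epsilon> (snd d ` (fst d \<inter> fst d')) (\<lambda>w. snd d' (chart_inv d w))"
proof (cases "d' = d")
  case True
  let ?\<tau> = "\<lambda>w. snd d' (chart_inv d w)"
  have \<tau>: "?\<tau> w = w" if "w \<in> snd d ` fst d" for w
    using that True f_inv_into_f by simp
  have o: "open (snd d ` fst d)" by (rule csf_chart(2)[OF assms(1)])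
  have "smooth_on (snd d ` fst d) ?\<tau>"
    using smooth_on_cong[of "snd d ` fst d" ?\<tau> "\<lambda>w. w"] \<tau> smooth_on_id[OF o] by simp
  moreover have "D ?\<tau> w a = a" if "w \<in> snd d ` fst d" for w a
  proof -
    have "D ?\<tau> w a = D (\<lambda>w. w) w a" by (rule D_cong_on[OF o _ that]) (rule \<tau>)
    then show ?thesis by (simp add: D_eqI[OF has_derivative_ident])
  qed
  ultimately show ?thesis using True \<tau> by (auto simp: csf_transition_property_def)
next
  case False
  \<comment> \<open>Two different charts occur in the projective case only.\<close>
  then obtain j k where "\<epsilon> > 0" "d = cp2_chart j" "d' = cp2_chart k"
    using assms by (auto simp: csf_charts_def cp2_charts_eq split: if_splits)
  then show ?thesis
    using cp2_transition[where j = j and k = k and \<epsilon> = \<epsilon>] by (auto simp: csf_transition_property_def)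
qed

section \<open>Hamiltonian variations supported in a chart\<close>

context lagrangian_patch
begin

lemma gradient_property:
  assumes x: "x \<in> U" and u: "u differentiable (at x)"
  shows "G x (gradient G u x) w = D u x w"
proof -
  have d: "\<Delta> x \<noteq> 0" using Delta_pos[OF x] by simp
  define p q where "p = d1 u x" and "q = d2 u x"
  have a: "(g22 x * p - g12 x * q) / \<Delta> x * g11 x + (g11 x * q - g12 x * p) / \<Delta> x * g12 x = p"
    using d by (simp add: field_simps) (simp add: \<Delta>_def power2_eq_square algebra_simps)
  have b: "(g22 x * p - g12 x * q) / \<Delta> x * g12 x + (g11 x * q - g12 x * p) / \<Delta> x * g22 x = q"
    using d by (simp add: field_simps) (simp add: \<Delta>_def power2_eq_square algebra_simps)
  have e: "G x (r, s) w = fst w * (r * g11 x + s * g12 x) + snd w * (r * g12 x + s * g22 x)" for r s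
    by (simp add: induced_metric_eq[OF x] algebra_simps)
  have l: "linear (D u x)" using u by (rule linear_frechet_derivative)
  have "D u x (fst w *\<^sub>R (1, 0) + snd w *\<^sub>R (0, 1)) = fst w * p + snd w * q"
    by (simp only: linear_add[OF l] linear_scale[OF l] real_scaleR_def p_def q_def)
  then show ?thesis
    unfolding gradient_eq[OF x u] e p_def[symmetric] q_def[symmetric] a b by simp
qed

lemma induced_metric_cancel:
  assumes x: "x \<in> U" and "\<And>w. G x z w = G x z' w"
  shows "z = z'"
proof -
  have "G x (z - z') w = G x z w - G x z' w" for w
    by (simp add: induced_metric_eq[OF x] algebra_simps)
  then have "G x (z - z') (z - z') = 0" using assms(2) by simp
  then show ?thesis using induced_metric_definite[OF x] by fastforce
qed

lemma gradient_zero: "x \<in> U \<Longrightarrow> u differentiable (at x) \<Longrightarrow> (\<And>v. D u x v = 0) \<Longrightarrow> gradient G u x = 0"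
  by (simp add: gradient_eq zero_prod_def)

end

section \<open>Chart representations of a Lagrangian surface\<close>

locale lagrangian_surface =
  fixes \<epsilon> :: real and S :: "'m::{t2_space,second_countable_topology} set"
    and A :: "('m, real \<times> real) chart set" and F :: "'m \<Rightarrow> csf_point"
  assumes surface: "smooth_surface S A" and immersed: "lagrangian_immersion \<epsilon> S A F"
begin

definition "cdom c d = snd c ` (fst c \<inter> F -` fst d)"

lemma chart_facts:
  assumes "c \<in> A"
  shows "openin (top_of_set S) (fst c)" "open (snd c ` fst c)" "continuous_on (fst c) (snd c)"
    "continuous_on (snd c ` fst c) (chart_inv c)" "fst c \<subseteq> S" "inj_on (snd c) (fst c)"
proof -
  have *: "openin (top_of_set S) (fst c) \<and> open (snd c ` fst c) \<and> homeomorphism (fst c) (snd c ` fst c) (snd c) (chart_inv c)"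
    using surface assms unfolding smooth_surface_def by blast
  then show "openin (top_of_set S) (fst c)" "open (snd c ` fst c)" "continuous_on (fst c) (snd c)"
    "continuous_on (snd c ` fst c) (chart_inv c)"
    by (simp_all add: homeomorphism_def)
  then show "fst c \<subseteq> S" using openin_imp_subset by blast
  have "homeomorphism (fst c) (snd c ` fst c) (snd c) (chart_inv c)" using * by blast
  then show "inj_on (snd c) (fst c)"
    by (intro inj_on_inverseI[of _ "chart_inv c"]) (rule homeomorphism_apply1)
qed

lemma chart_inv_snd: "c \<in> A \<Longrightarrow> p \<in> fst c \<Longrightarrow> chart_inv c (snd c p) = p"
  by (simp add: inv_into_f_f chart_facts(6))

lemma snd_chart_inv: "x \<in> snd c ` fst c \<Longrightarrow> snd c (chart_inv c x) = x" "x \<in> snd c ` fst c \<Longrightarrow> chart_inv c x \<in> fst c"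
  by (simp_all add: f_inv_into_f inv_into_into)

lemma cdom_iff: "c \<in> A \<Longrightarrow> x \<in> cdom c d \<longleftrightarrow> x \<in> snd c ` fst c \<and> F (chart_inv c x) \<in> fst d"
  unfolding cdom_def using chart_inv_snd by (auto simp: image_iff)

lemma cdomD:
  assumes "c \<in> A" "x \<in> cdom c d"
  shows "x \<in> snd c ` fst c" "F (chart_inv c x) \<in> fst d" "chart_inv c x \<in> fst c" "snd c (chart_inv c x) = x"
  using cdom_iff[OF assms(1), of x d] assms(2) snd_chart_inv[of x c] by simp_all

lemma cdomI: "c \<in> A \<Longrightarrow> p \<in> fst c \<Longrightarrow> F p \<in> fst d \<Longrightarrow> snd c p \<in> cdom c d"
  unfolding cdom_def by blast

lemma smooth_local_rep: "c \<in> A \<Longrightarrow> d \<in> csf_charts \<epsilon> \<Longrightarrow> smooth_on (cdom c d) (local_rep c d F)"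
  using immersed unfolding lagrangian_immersion_def smooth_into_csf_def cdom_def by blast

lemma smooth_chart_change: "c \<in> A \<Longrightarrow> c' \<in> A \<Longrightarrow> smooth_on (snd c' ` (fst c' \<inter> fst c)) (\<lambda>x. snd c (chart_inv c' x))"
  using surface unfolding smooth_surface_def comp_def by blast

lemma F_covered: "p \<in> S \<Longrightarrow> \<exists>d\<in>csf_charts \<epsilon>. F p \<in> fst d"
  using immersed unfolding lagrangian_immersion_def smooth_into_csf_def by blast

lemma everywhere_at:
  assumes "everywhere \<epsilon> A F Q" "c \<in> A" "d \<in> csf_charts \<epsilon>" "x \<in> cdom c d"
  shows "Q (local_rep c d F) x"
  using assms unfolding everywhere_def cdom_def by blast

lemma patch: "c \<in> A \<Longrightarrow> d \<in> csf_charts \<epsilon> \<Longrightarrow> lagrangian_patch \<epsilon> (cdom c d) (local_rep c d F)"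
proof
  assume c: "c \<in> A" and d: "d \<in> csf_charts \<epsilon>"
  show "smooth_on (cdom c d) (local_rep c d F)" by (rule smooth_local_rep[OF c d])
  show "local_rep c d F ` cdom c d \<subseteq> csf_domain \<epsilon>"
  proof (rule image_subsetI)
    fix x assume "x \<in> cdom c d"
    then have "snd d (F (chart_inv c x)) \<in> snd d ` fst d" by (intro imageI cdomD(2)[OF c])
    then show "local_rep c d F x \<in> csf_domain \<epsilon>" using csf_chart(3)[OF d] by (auto simp: local_rep_def)
  qed
  have *: "everywhere \<epsilon> A F (\<lambda>f x. inj (D f x))"
    "everywhere \<epsilon> A F (\<lambda>f x. \<forall>u v. csf_metric \<epsilon> (f x) (D f x u) (J (D f x v)) = 0)"
    using immersed unfolding lagrangian_immersion_def by simp_all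
  show "inj (D (local_rep c d F) x)" if "x \<in> cdom c d" for x
    by (rule everywhere_at[OF *(1) c d that])
  show "csf_metric \<epsilon> (local_rep c d F x) (D (local_rep c d F) x u) (J (D (local_rep c d F) x v)) = 0"
    if "x \<in> cdom c d" for x u v
    using everywhere_at[OF *(2) c d that] by blast
qed

end

text \<open>A test function supported in one chart, to be turned into a Hamiltonian variation of the
  whole surface, as the definition of stationarity demands.\<close>

locale chart_variation = lagrangian_surface +
  fixes c :: "('a, real \<times> real) chart" and d :: "(csf_point, complex^2) chart" and C0 :: "(real \<times> real) set" and u :: "real \<times> real \<Rightarrow> real"
  assumes c: "c \<in> A" and d: "d \<in> csf_charts \<epsilon>" and C0: "compact C0" "C0 \<subseteq> cdom c d"
    and smooth_u: "smooth_on UNIV u" and u_support: "y \<notin> C0 \<Longrightarrow> u y = 0"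
begin

abbreviation "U \<equiv> cdom c d"
abbreviation "f \<equiv> local_rep c d F"

sublocale P: lagrangian_patch \<epsilon> U f by (rule patch[OF c d])

definition "X x = gradient P.G u x"
definition "V x = J (D f x (X x))"
text \<open>Straight lines in the ambient chart \<open>d\<close>: only the velocity at
  \<open>t = 0\<close> is prescribed, so no geodesics or flows enter. The two cases fit together
  because \<open>V\<close> vanishes off \<open>C0\<close>.\<close>

definition "\<Phi> t q = (if q \<in> fst c \<and> F q \<in> fst d then chart_inv d (f (snd c q) + t *\<^sub>R V (snd c q)) else F q)"
definition "u_lift q = (if q \<in> fst c \<and> F q \<in> fst d then u (snd c q) else 0)"
definition "CS = chart_inv c ` C0"
definition "\<Omega> = snd d ` fst d"

lemma u_differentiable: "u differentiable (at x)"
  using smooth_on_differentiable[OF smooth_u] by simp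

lemma f_in_Omega: "x \<in> U \<Longrightarrow> f x \<in> \<Omega>"
  unfolding local_rep_def \<Omega>_def by (intro imageI cdomD(2)[OF c])

lemma open_Omega: "open \<Omega>" unfolding \<Omega>_def by (rule csf_chart(2)[OF d])

lemma chart_inv_d: "q \<in> fst d \<Longrightarrow> chart_inv d (snd d q) = q"
  by (simp add: inv_into_f_f csf_chart(1)[OF d])

lemma snd_d: "w \<in> \<Omega> \<Longrightarrow> snd d (chart_inv d w) = w" "w \<in> \<Omega> \<Longrightarrow> chart_inv d w \<in> fst d"
  by (simp_all add: \<Omega>_def f_inv_into_f inv_into_into)

lemma chart_inv_f: "x \<in> U \<Longrightarrow> chart_inv d (f x) = F (chart_inv c x)"
  unfolding local_rep_def by (intro chart_inv_d cdomD(2)[OF c])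

lemma smooth_V: "smooth_on U V"
proof -
  have nz: "P.\<Delta> x \<noteq> 0" if "x \<in> U" for x using P.Delta_pos[OF that] by simp
  have su: "smooth_on U (\<lambda>x. D u x v)" for v by (rule smooth_on_subset[OF smooth_on_D[OF smooth_u] P.open_U]) simp
  define X1 X2 where "X1 x = (P.g22 x * d1 u x - P.g12 x * d2 u x) / P.\<Delta> x" and "X2 x = (P.g11 x * d2 u x - P.g12 x * d1 u x) / P.\<Delta> x" for x
  have s: "smooth_on U X1" "smooth_on U X2"
    unfolding X1_def X2_def by (intro smooth_intros P.smooth_coeffs P.smooth_alpha su nz; assumption)+
  have "V x = J (X1 x *\<^sub>R P.f1 x + X2 x *\<^sub>R P.f2 x)" if "x \<in> U" for x
    unfolding V_def X_def P.gradient_eq[OF that u_differentiable] P.D_pair[OF that, of "_ / _"] X1_def X2_def ..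
  then have "smooth_on U V \<longleftrightarrow> smooth_on U (\<lambda>x. J (X1 x *\<^sub>R P.f1 x + X2 x *\<^sub>R P.f2 x))" by (rule smooth_on_cong)
  then show ?thesis by (simp only:) (intro smooth_intros s P.smooth_coeffs P.open_U)
qed

lemma V_zero: "x \<in> U \<Longrightarrow> x \<notin> C0 \<Longrightarrow> V x = 0"
proof -
  assume x: "x \<in> U" "x \<notin> C0"
  have o: "open (- C0)" using C0(1) by (simp add: compact_imp_closed open_Compl)
  have "D u x v = 0" for v
  proof -
    have "D u x v = D (\<lambda>x. 0) x v" by (rule D_cong_on[OF o]) (use x u_support in auto)
    then show ?thesis by (simp add: D_const)
  qed
  then have "X x = 0" unfolding X_def by (rule P.gradient_zero[OF x(1) u_differentiable])
  then show "V x = 0" using linear_0[OF linear_D[OF P.smooth x(1)]]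
    by (simp add: V_def)
qed

lemma CS: "compact CS" "CS \<subseteq> S" "q \<in> CS \<longleftrightarrow> q \<in> fst c \<and> snd c q \<in> C0"
proof -
  have sub: "C0 \<subseteq> snd c ` fst c" using C0(2) cdomD(1)[OF c] by blast
  show "compact CS"
    unfolding CS_def by (rule compact_continuous_image[OF continuous_on_subset[OF chart_facts(4)[OF c] sub] C0(1)])
  show 3: "q \<in> CS \<longleftrightarrow> q \<in> fst c \<and> snd c q \<in> C0" for q
  proof
    assume "q \<in> CS"
    then obtain x where x: "x \<in> C0" "q = chart_inv c x" by (auto simp: CS_def)
    then show "q \<in> fst c \<and> snd c q \<in> C0" using snd_chart_inv[of x c] sub by auto
  next
    assume "q \<in> fst c \<and> snd c q \<in> C0"
    then show "q \<in> CS" using chart_inv_snd[OF c, of q] imageI[of "snd c q" C0 "chart_inv c"] by (simp add: CS_def)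
  qed
  show "CS \<subseteq> S" using 3 chart_facts(5)[OF c] by blast
qed

lemma CS_in_chart: "q \<in> CS \<Longrightarrow> q \<in> fst c \<and> F q \<in> fst d"
  using CS(3)[of q] C0(2) cdomD(2)[OF c, of "snd c q" d] chart_inv_snd[OF c, of q] by auto

lemma Phi_stationary:
  assumes "t *\<^sub>R V (snd c q) = 0"
  shows "\<Phi> t q = F q"
proof (cases "q \<in> fst c \<and> F q \<in> fst d")
  case True
  then have "chart_inv d (f (snd c q)) = F q"
    using chart_inv_f[OF cdomI[OF c, of q d]] chart_inv_snd[OF c, of q] by simp
  then show ?thesis using True by (simp add: \<Phi>_def assms)
qed (auto simp: \<Phi>_def)

lemma Phi_outside: "q \<notin> CS \<Longrightarrow> \<Phi> t q = F q"
proof (cases "q \<in> fst c \<and> F q \<in> fst d")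
  case True
  assume "q \<notin> CS"
  then have "V (snd c q) = 0" using True CS(3)[of q] by (intro V_zero cdomI[OF c]) auto
  then show ?thesis by (intro Phi_stationary) simp
qed (auto simp: \<Phi>_def)

lemma u_lift_outside: "q \<notin> CS \<Longrightarrow> u_lift q = 0"
  using CS(3)[of q] u_support[of "snd c q"] by (auto simp: u_lift_def)

text \<open>Over the compact set \<open>C0\<close> the lines stay in the open set \<Omega> for a
  uniform time; elsewhere in \<open>U\<close> they are constant.\<close>

lemma variation_domain:
  obtains \<delta> where "\<delta> > 0" "\<And>t x. \<bar>t\<bar> < \<delta> \<Longrightarrow> x \<in> U \<Longrightarrow> f x + t *\<^sub>R V x \<in> \<Omega>"
proof -
  define h where "h z = f (snd z) + fst z *\<^sub>R V (snd z)" for z :: "real \<times> real \<times> real"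
  have oW0: "open (UNIV \<times> U :: (real \<times> real \<times> real) set)" using P.open_U by (intro open_Times) auto
  have c1: "continuous_on (UNIV \<times> U :: (real \<times> real \<times> real) set) (\<lambda>z. f (snd z))"
    by (rule continuous_on_compose2[OF smooth_on_continuous_on[OF P.smooth] continuous_on_snd[OF continuous_on_id]]) auto
  have c2: "continuous_on (UNIV \<times> U :: (real \<times> real \<times> real) set) (\<lambda>z. V (snd z))"
    by (rule continuous_on_compose2[OF smooth_on_continuous_on[OF smooth_V] continuous_on_snd[OF continuous_on_id]]) auto
  have "continuous_on (UNIV \<times> U) h" unfolding h_def by (intro continuous_intros c1 c2)
  then have oW: "open ((UNIV \<times> U) \<inter> h -` \<Omega>)" by (rule continuous_open_preimage[OF _ oW0 open_Omega])
  have sub: "{0} \<times> C0 \<subseteq> (UNIV \<times> U) \<inter> h -` \<Omega>" using C0(2) f_in_Omega by (auto simp: h_def)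
  have "compact ({0::real} \<times> C0)" using C0 by (intro compact_Times) auto
  then obtain e where e: "e > 0" "(\<Union>z\<in>{0} \<times> C0. cball z e) \<subseteq> (UNIV \<times> U) \<inter> h -` \<Omega>"
    using compact_subset_open_imp_cball_epsilon_subset[OF _ oW sub] by blast
  show ?thesis
  proof (rule that[OF e(1)])
    fix t x assume t: "\<bar>t\<bar> < e" and x: "x \<in> U"
    show "f x + t *\<^sub>R V x \<in> \<Omega>"
    proof (cases "x \<in> C0")
      case True
      have "(t, x) \<in> cball (0, x) e" using t by (simp add: dist_Pair_Pair)
      then have "(t, x) \<in> h -` \<Omega>" using e(2) True by blast
      then show ?thesis by (simp add: h_def)
    next
      case False
      then show ?thesis using V_zero[OF x False] f_in_Omega[OF x] by simp
    qed
  qed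
qed

lemma Phi_in_chart:
  assumes "f (snd c q) + t *\<^sub>R V (snd c q) \<in> \<Omega>" "q \<in> fst c" "F q \<in> fst d"
  shows "snd d (\<Phi> t q) = f (snd c q) + t *\<^sub>R V (snd c q)" "\<Phi> t q \<in> fst d"
  using assms snd_d by (simp_all add: \<Phi>_def)

text \<open>For an arbitrary surface chart \<open>c'\<close>: \<theta> is the transition to
  \<open>c\<close>, \<open>near\<close> the part where the explicit formula applies, and
  \<open>away\<close> the part off the support. The two parts are open and cover the chart, so
  smoothness can be checked on each.\<close>

definition "\<theta> c' y = snd c (chart_inv c' y)"
definition "near c' = {y \<in> snd c' ` fst c'. chart_inv c' y \<in> fst c \<and> F (chart_inv c' y) \<in> fst d}"
definition "away c' = {y \<in> snd c' ` fst c'. chart_inv c' y \<notin> CS}"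

lemma near_facts:
  assumes "c' \<in> A"
  shows "open (near c')" "smooth_on (near c') (\<theta> c')" "y \<in> near c' \<Longrightarrow> \<theta> c' y \<in> U"
    "y \<in> near c' \<Longrightarrow> chart_inv c (\<theta> c' y) = chart_inv c' y"
proof -
  have s: "smooth_on (snd c' ` (fst c' \<inter> fst c)) (\<theta> c')"
    unfolding \<theta>_def[abs_def] by (rule smooth_chart_change[OF c assms])
  have "near c' = snd c' ` (fst c' \<inter> fst c) \<inter> \<theta> c' -` U"
  proof (intro equalityI subsetI)
    fix y assume y: "y \<in> near c'"
    then have p: "chart_inv c' y \<in> fst c" "F (chart_inv c' y) \<in> fst d" "y \<in> snd c' ` fst c'" by (simp_all add: near_def)
    have "snd c' (chart_inv c' y) \<in> snd c' ` (fst c' \<inter> fst c)" using p snd_chart_inv[OF p(3)] by blast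
    then show "y \<in> snd c' ` (fst c' \<inter> fst c) \<inter> \<theta> c' -` U"
      using cdomI[OF c p(1,2)] snd_chart_inv[OF p(3)] by (simp add: \<theta>_def)
  next
    fix y assume y: "y \<in> snd c' ` (fst c' \<inter> fst c) \<inter> \<theta> c' -` U"
    then obtain p where p: "p \<in> fst c'" "p \<in> fst c" "y = snd c' p" by blast
    have i: "chart_inv c' y = p" using chart_inv_snd[OF assms p(1)] p(3) by simp
    have "snd c p \<in> U" using y i by (simp add: \<theta>_def)
    then have "F p \<in> fst d" using cdomD(2)[OF c] chart_inv_snd[OF c p(2)] by metis
    then show "y \<in> near c'" using p i by (simp add: near_def)
  qed
  then show o: "open (near c')"
    using continuous_open_preimage[OF smooth_on_continuous_on[OF s] smooth_on_open[OF s] P.open_U] by simp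
  show "smooth_on (near c') (\<theta> c')"
    by (rule smooth_on_subset[OF s o]) (use \<open>near c' = _\<close> in blast)
  show "\<theta> c' y \<in> U" if "y \<in> near c'" using that \<open>near c' = _\<close> by blast
  show "chart_inv c (\<theta> c' y) = chart_inv c' y" if "y \<in> near c'"
    using that chart_inv_snd[OF c] by (simp add: near_def \<theta>_def)
qed

lemma open_away: "c' \<in> A \<Longrightarrow> open (away c')"
proof -
  assume c': "c' \<in> A"
  have "away c' = snd c' ` fst c' \<inter> chart_inv c' -` (- CS)" by (auto simp: away_def)
  moreover have "open (- CS)" using CS(1) by (simp add: compact_imp_closed open_Compl)
  ultimately show ?thesis
    using continuous_open_preimage[OF chart_facts(4)[OF c'] chart_facts(2)[OF c']] by simp
qed

lemma near_or_away: "y \<in> snd c' ` fst c' \<Longrightarrow> y \<in> near c' \<or> y \<in> away c'"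
  using CS_in_chart by (auto simp: near_def away_def)

lemma smooth_u_lift:
  assumes c': "c' \<in> A"
  shows "smooth_on (snd c' ` fst c') (u_lift \<circ> chart_inv c')"
proof (rule smooth_on_local)
  have 1: "smooth_on (near c') (u_lift \<circ> chart_inv c')"
  proof (subst smooth_on_cong[where g = "\<lambda>y. u (\<theta> c' y)"])
    show "smooth_on (near c') (\<lambda>y. u (\<theta> c' y))" by (rule smooth_on_compose[OF smooth_u near_facts(2)[OF c']]) simp
  qed (simp add: near_def u_lift_def \<theta>_def)
  have 2: "smooth_on (away c') (u_lift \<circ> chart_inv c')"
  proof (subst smooth_on_cong[where g = "\<lambda>y. 0"])
    show "smooth_on (away c') (\<lambda>y. 0)" by (rule smooth_on_const[OF open_away[OF c']])
  qed (simp add: away_def u_lift_outside)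
  fix y assume "y \<in> snd c' ` fst c'"
  then have "y \<in> near c' \<or> y \<in> away c'" by (rule near_or_away)
  then show "\<exists>T. y \<in> T \<and> T \<subseteq> snd c' ` fst c' \<and> smooth_on T (u_lift \<circ> chart_inv c')"
  proof
    assume "y \<in> near c'"
    then show ?thesis using 1 by (intro exI[of _ "near c'"]) (auto simp: near_def)
  next
    assume "y \<in> away c'"
    then show ?thesis using 2 by (intro exI[of _ "away c'"]) (auto simp: away_def)
  qed
qed

text \<open>On the near part the variation is a line followed by an ambient transition map, on the
  away part it does not depend on \<open>t\<close>. Restricted to the points mapped into
  \<open>d'\<close>, both domains are open and together they cover the set.\<close>

lemma smooth_variation:
  assumes c': "c' \<in> A" and d': "d' \<in> csf_charts \<epsilon>"
    and \<delta>: "\<And>t x. \<bar>t\<bar> < \<delta> \<Longrightarrow> x \<in> U \<Longrightarrow> f x + t *\<^sub>R V x \<in> \<Omega>"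
  shows "smooth_on {(t, x). \<bar>t\<bar> < \<delta> \<and> x \<in> snd c' ` fst c' \<and> \<Phi> t (chart_inv c' x) \<in> fst d'}
     (\<lambda>(t, x). local_rep c' d' (\<Phi> t) x)" (is "smooth_on ?Q ?m")
proof (rule smooth_on_local)
  define Td where "Td = snd d ` (fst d \<inter> fst d')"
  define \<tau> where "\<tau> w = snd d' (chart_inv d w)" for w
  have s\<tau>: "smooth_on Td \<tau>"
    using csf_transition[OF d d'] unfolding csf_transition_property_def Td_def \<tau>_def by blast
  define h where "h z = f (\<theta> c' (snd z)) + fst z *\<^sub>R V (\<theta> c' (snd z))" for z :: "real \<times> real \<times> real"
  define I where "I = {-\<delta><..<\<delta>}"
  have I: "t \<in> I \<longleftrightarrow> \<bar>t\<bar> < \<delta>" for t by (auto simp: I_def abs_less_iff)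
  have oIN: "open (I \<times> near c')" using near_facts(1)[OF c'] by (intro open_Times) (auto simp: I_def)
  have s\<theta>: "smooth_on (I \<times> near c') (\<lambda>z. \<theta> c' (snd z))"
    by (rule smooth_on_compose[OF near_facts(2)[OF c'] smooth_on_snd[OF smooth_on_id[OF oIN]]]) auto
  have sub: "(\<lambda>z. \<theta> c' (snd z)) ` (I \<times> near c') \<subseteq> U"
  proof (rule image_subsetI)
    fix z assume "z \<in> I \<times> near c'"
    then have "snd z \<in> near c'" by (simp add: mem_Times_iff)
    then show "\<theta> c' (snd z) \<in> U" by (rule near_facts(3)[OF c'])
  qed
  have sh: "smooth_on (I \<times> near c') h"
    unfolding h_def
    by (intro smooth_on_add smooth_on_scaleR smooth_on_fst smooth_on_id oIN
        smooth_on_compose[OF P.smooth s\<theta> sub] smooth_on_compose[OF smooth_V s\<theta> sub])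
  define T1 where "T1 = (I \<times> near c') \<inter> h -` Td"
  have oT1: "open T1"
    unfolding T1_def by (rule continuous_open_preimage[OF smooth_on_continuous_on[OF sh] oIN smooth_on_open[OF s\<tau>]])
  have m1: "snd d (\<Phi> t (chart_inv c' y)) = h (t, y)" "\<Phi> t (chart_inv c' y) \<in> fst d" if "t \<in> I" "y \<in> near c'" for t y
  proof -
    have *: "chart_inv c' y \<in> fst c" "F (chart_inv c' y) \<in> fst d" using that by (simp_all add: near_def)
    have **: "f (\<theta> c' y) + t *\<^sub>R V (\<theta> c' y) \<in> \<Omega>" using that near_facts(3)[OF c'] by (intro \<delta>) (simp_all add: I)
    show "snd d (\<Phi> t (chart_inv c' y)) = h (t, y)" "\<Phi> t (chart_inv c' y) \<in> fst d"
      using Phi_in_chart[of "chart_inv c' y" t] * ** by (simp_all add: h_def \<theta>_def)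
  qed
  have T1: "(t, y) \<in> T1 \<longleftrightarrow> t \<in> I \<and> y \<in> near c' \<and> \<Phi> t (chart_inv c' y) \<in> fst d'" for t y
  proof -
    have "h (t, y) \<in> Td \<longleftrightarrow> \<Phi> t (chart_inv c' y) \<in> fst d'" if "t \<in> I" "y \<in> near c'"
    proof
      assume "h (t, y) \<in> Td"
      then obtain q where q: "q \<in> fst d" "q \<in> fst d'" "h (t, y) = snd d q" by (auto simp: Td_def)
      then have "\<Phi> t (chart_inv c' y) = q" using m1[OF that] chart_inv_d by metis
      then show "\<Phi> t (chart_inv c' y) \<in> fst d'" using q by simp
    next
      assume "\<Phi> t (chart_inv c' y) \<in> fst d'"
      then show "h (t, y) \<in> Td" using m1[OF that] unfolding Td_def by (metis IntI image_eqI)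
    qed
    then show ?thesis by (auto simp: T1_def)
  qed
  have sm1: "smooth_on T1 ?m"
  proof (subst smooth_on_cong[where g = "\<lambda>z. \<tau> (h z)"])
    show "smooth_on T1 (\<lambda>z. \<tau> (h z))"
      by (rule smooth_on_compose[OF s\<tau> smooth_on_subset[OF sh oT1]]) (auto simp: T1_def)
    fix z assume z: "z \<in> T1"
    obtain t y where ty: "z = (t, y)" by (rule that[OF surjective_pairing])
    then have "t \<in> I" "y \<in> near c'" using z T1 by simp_all
    then show "?m z = \<tau> (h z)"
      using m1[of t y] chart_inv_d by (simp add: ty \<tau>_def local_rep_def) metis
  qed
  define T2 where "T2 = I \<times> (away c' \<inter> cdom c' d')"
  have oT2: "open T2"
    unfolding T2_def I_def by (intro open_Times open_Int open_away[OF c'] smooth_on_open[OF smooth_local_rep[OF c' d']] open_greaterThanLessThan)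
  have sm2: "smooth_on T2 ?m"
  proof (subst smooth_on_cong[where g = "\<lambda>z. local_rep c' d' F (snd z)"])
    show "smooth_on T2 (\<lambda>z. local_rep c' d' F (snd z))"
      by (rule smooth_on_compose[OF smooth_local_rep[OF c' d'] smooth_on_snd[OF smooth_on_id[OF oT2]]]) (auto simp: T2_def)
    fix z assume z: "z \<in> T2"
    obtain t y where ty: "z = (t, y)" by (rule that[OF surjective_pairing])
    then have "chart_inv c' y \<notin> CS" using z by (simp add: T2_def away_def)
    then show "?m z = local_rep c' d' F (snd z)" by (simp add: ty local_rep_def Phi_outside)
  qed
  fix z assume z: "z \<in> ?Q"
  obtain t y where ty: "z = (t, y)" by (rule that[OF surjective_pairing])
  have *: "t \<in> I" "y \<in> snd c' ` fst c'" "\<Phi> t (chart_inv c' y) \<in> fst d'" using z by (simp_all add: ty I)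
  from near_or_away[OF *(2)] show "\<exists>T. z \<in> T \<and> T \<subseteq> ?Q \<and> smooth_on T ?m"
  proof
    assume "y \<in> near c'"
    then have "z \<in> T1" using * T1 ty by simp
    moreover have "T1 \<subseteq> ?Q"
    proof
      fix z assume "z \<in> T1"
      then show "z \<in> ?Q" using T1[of "fst z" "snd z"] by (simp add: case_prod_beta' I near_def)
    qed
    ultimately show ?thesis using sm1 by blast
  next
    assume a: "y \<in> away c'"
    then have "F (chart_inv c' y) \<in> fst d'" using *(3) Phi_outside by (simp add: away_def)
    then have "z \<in> T2" using a * cdom_iff[OF c', of y d'] by (simp add: T2_def ty)
    moreover have "T2 \<subseteq> ?Q"
    proof
      fix z assume z: "z \<in> T2"
      then have "snd z \<in> away c'" "snd z \<in> cdom c' d'" "fst z \<in> I" by (simp_all add: T2_def mem_Times_iff)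
      then show "z \<in> ?Q"
        using cdom_iff[OF c', of "snd z" d'] Phi_outside[of "chart_inv c' (snd z)" "fst z"]
        by (simp add: case_prod_beta' I away_def)
    qed
    ultimately show ?thesis using sm2 by blast
  qed
qed

end

context chart_variation
begin

text \<open>Off the support both sides vanish. On it the ambient transition map, being a holomorphic
  isometry, carries \<open>J grad u\<close> computed in the charts \<open>c\<close>,
  \<open>d\<close> to \<open>J grad\<close> of the lifted function computed in \<open>c'\<close>,
  \<open>d'\<close>.\<close>

lemma hamiltonian_field:
  assumes c': "c' \<in> A" and d': "d' \<in> csf_charts \<epsilon>" and p: "p \<in> fst c'" "F p \<in> fst d'"
  shows "vector_derivative (\<lambda>t. snd d' (\<Phi> t p)) (at 0) =
     J (D (local_rep c' d' F) (snd c' p)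
       (gradient (induced_metric (csf_metric \<epsilon>) (local_rep c' d' F)) (u_lift \<circ> chart_inv c') (snd c' p)))"
proof -
  let ?f = "local_rep c' d' F"
  let ?y = "snd c' p"
  let ?u = "u_lift \<circ> chart_inv c'"
  interpret R: lagrangian_patch \<epsilon> "cdom c' d'" ?f by (rule patch[OF c' d'])
  have y: "?y \<in> cdom c' d'" by (rule cdomI[OF c' p])
  have iy: "chart_inv c' ?y = p" by (rule chart_inv_snd[OF c' p(1)])
  have du: "?u differentiable (at ?y)"
    by (rule smooth_on_differentiable[OF smooth_u_lift[OF c']]) (use p in blast)
  show ?thesis
  proof (cases "p \<in> CS")
    case False
    then have ya: "?y \<in> away c'" using p iy by (simp add: away_def)
    have "D ?u ?y v = 0" for v
    proof -
      have "D ?u ?y v = D (\<lambda>x. 0) ?y v"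
        by (rule D_cong_on[OF open_away[OF c'] _ ya]) (simp add: away_def u_lift_outside)
      then show ?thesis by (simp add: D_const)
    qed
    then have "gradient R.G ?u ?y = 0" by (rule R.gradient_zero[OF y du])
    moreover have "D ?f ?y 0 = 0" by (rule linear_0[OF linear_D[OF R.smooth y]])
    ultimately show ?thesis by (simp add: Phi_outside[OF False])
  next
    case True
    then have pc: "p \<in> fst c" "F p \<in> fst d" using CS_in_chart by simp_all
    define x where "x = snd c p"
    have x: "x \<in> U" unfolding x_def by (rule cdomI[OF c pc])
    have yn: "?y \<in> near c'" using p pc iy by (simp add: near_def)
    have \<theta>y: "\<theta> c' ?y = x" by (simp add: \<theta>_def iy x_def)
    define Td where "Td = snd d ` (fst d \<inter> fst d')"
    define \<tau> where "\<tau> w = snd d' (chart_inv d w)" for w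
    have tr: "csf_transition_property \<epsilon> Td \<tau>"
      unfolding Td_def \<tau>_def by (rule csf_transition[OF d d'])
    then have s\<tau>: "smooth_on Td \<tau>"
      and J\<tau>: "\<And>w c a. w \<in> Td \<Longrightarrow> D \<tau> w (c *s a) = c *s D \<tau> w a"
      and iso: "\<And>w a b. w \<in> Td \<Longrightarrow> csf_metric \<epsilon> (\<tau> w) (D \<tau> w a) (D \<tau> w b) = csf_metric \<epsilon> w a b"
      unfolding csf_transition_property_def by blast+
    have fx: "f x = snd d (F p)" by (simp add: local_rep_def x_def chart_inv_snd[OF c pc(1)])
    have fxT: "f x \<in> Td" unfolding fx Td_def using pc p by blast
    have "(\<lambda>t. snd d' (\<Phi> t p)) = (\<lambda>t. \<tau> (f x + t *\<^sub>R V x))"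
      using pc by (simp add: \<Phi>_def \<tau>_def x_def)
    moreover have "((\<lambda>t. \<tau> (f x + t *\<^sub>R V x)) has_vector_derivative D \<tau> (f x) (V x)) (at 0)"
    proof -
      have 1: "((\<lambda>t. f x + t *\<^sub>R V x) has_derivative (\<lambda>t. t *\<^sub>R V x)) (at 0)"
        by (auto intro!: derivative_eq_intros)
      have 2: "(\<tau> has_derivative D \<tau> (f x)) (at (f x + 0 *\<^sub>R V x))"
        using smooth_on_has_derivative[OF s\<tau> fxT] by simp
      from has_derivative_compose[OF 1 2]
      show ?thesis unfolding has_vector_derivative_def
        by (simp add: linear_scale[OF linear_D[OF s\<tau> fxT]])
    qed
    ultimately have L: "vector_derivative (\<lambda>t. snd d' (\<Phi> t p)) (at 0) = D \<tau> (f x) (V x)"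
      by (simp add: vector_derivative_at)
    define M where "M = near c' \<inter> cdom c' d'"
    have oM: "open M" unfolding M_def by (intro open_Int near_facts(1)[OF c'] R.open_U)
    have yM: "?y \<in> M" using yn y by (simp add: M_def)
    have f_eq: "?f y = \<tau> (f (\<theta> c' y))" if "y \<in> M" for y
    proof -
      have "F (chart_inv c' y) \<in> fst d" "chart_inv c (\<theta> c' y) = chart_inv c' y"
        using that near_facts(4)[OF c'] by (simp_all add: M_def near_def)
      then show ?thesis by (simp add: local_rep_def \<tau>_def chart_inv_d)
    qed
    have s\<theta>: "smooth_on (near c') (\<theta> c')" by (rule near_facts(2)[OF c'])
    have D\<theta>: "(\<theta> c' has_derivative D (\<theta> c') ?y) (at ?y)" by (rule smooth_on_has_derivative[OF s\<theta> yn])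
    have Df: "D ?f ?y v = D \<tau> (f x) (D f x (D (\<theta> c') ?y v))" for v
    proof -
      have "((\<lambda>y. f (\<theta> c' y)) has_derivative (\<lambda>v. D f x (D (\<theta> c') ?y v))) (at ?y)"
        using has_derivative_compose[OF D\<theta>, of f "D f x"] smooth_on_has_derivative[OF P.smooth x] \<theta>y by simp
      from has_derivative_compose[OF this, of \<tau> "D \<tau> (f x)"] smooth_on_has_derivative[OF s\<tau> fxT] \<theta>y
      have "((\<lambda>y. \<tau> (f (\<theta> c' y))) has_derivative (\<lambda>v. D \<tau> (f x) (D f x (D (\<theta> c') ?y v)))) (at ?y)" by simp
      then have "D (\<lambda>y. \<tau> (f (\<theta> c' y))) ?y v = D \<tau> (f x) (D f x (D (\<theta> c') ?y v))" by (simp add: D_eqI)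
      moreover have "D ?f ?y v = D (\<lambda>y. \<tau> (f (\<theta> c' y))) ?y v" by (rule D_cong_on[OF oM f_eq yM])
      ultimately show ?thesis by simp
    qed
    have fy: "?f ?y = \<tau> (f x)" using f_eq[OF yM] \<theta>y by simp
    have GR: "R.G ?y v w = P.G x (D (\<theta> c') ?y v) (D (\<theta> c') ?y w)" for v w
      unfolding induced_metric_def fy Df iso[OF fxT] ..
    have Du: "D ?u ?y v = D u x (D (\<theta> c') ?y v)" for v
    proof -
      have "D ?u ?y v = D (\<lambda>y. u (\<theta> c' y)) ?y v"
        by (rule D_cong_on[OF near_facts(1)[OF c'] _ yn]) (simp add: near_def u_lift_def \<theta>_def)
      moreover have "((\<lambda>y. u (\<theta> c' y)) has_derivative (\<lambda>v. D u x (D (\<theta> c') ?y v))) (at ?y)"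
        by (rule has_derivative_compose[OF D\<theta>]) (simp add: \<theta>y smooth_on_has_derivative[OF smooth_u])
      ultimately show ?thesis by (simp only: D_eqI)
    qed
    \<comment> \<open>The chart change has a right inverse, so the two gradients can be compared
      against every vector.\<close>
    have surj: "\<exists>v. D (\<theta> c') ?y v = w" for w
    proof -
      define N where "N = snd c ` (fst c \<inter> fst c')"
      define \<theta>' where "\<theta>' z = snd c' (chart_inv c z)" for z
      have s\<theta>': "smooth_on N \<theta>'" unfolding N_def \<theta>'_def by (rule smooth_chart_change[OF c' c])
      have xN: "x \<in> N" unfolding N_def x_def using p pc by blast
      have inv: "\<theta> c' (\<theta>' z) = z" if z: "z \<in> N" for z
      proof -
        obtain q where q: "q \<in> fst c" "q \<in> fst c'" "z = snd c q" using z by (auto simp: N_def)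
        then show ?thesis by (simp add: \<theta>_def \<theta>'_def chart_inv_snd[OF c] chart_inv_snd[OF c'])
      qed
      have 1: "(\<theta>' has_derivative D \<theta>' x) (at x)" by (rule smooth_on_has_derivative[OF s\<theta>' xN])
      have "\<theta>' x = ?y" by (simp add: \<theta>'_def x_def chart_inv_snd[OF c pc(1)])
      then have "((\<lambda>z. \<theta> c' (\<theta>' z)) has_derivative (\<lambda>w. D (\<theta> c') ?y (D \<theta>' x w))) (at x)"
        using has_derivative_compose[OF 1, of "\<theta> c'" "D (\<theta> c') ?y"] D\<theta> by simp
      then have "D (\<theta> c') ?y (D \<theta>' x w) = D (\<lambda>z. \<theta> c' (\<theta>' z)) x w" by (simp add: D_eqI)
      also have "\<dots> = D (\<lambda>z. z) x w"
        by (rule D_cong_on[OF smooth_on_open[OF s\<theta>'] _ xN]) (rule inv)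
      also have "\<dots> = w" by (simp add: D_eqI[OF has_derivative_ident])
      finally show ?thesis by blast
    qed
    let ?g = "gradient R.G ?u ?y"
    have "D (\<theta> c') ?y ?g = X x"
    proof (rule P.induced_metric_cancel[OF x])
      fix w
      obtain v where v: "D (\<theta> c') ?y v = w" using surj by blast
      have "P.G x (D (\<theta> c') ?y ?g) w = R.G ?y ?g v" by (simp add: GR v)
      also have "\<dots> = D ?u ?y v" by (rule R.gradient_property[OF y du])
      also have "\<dots> = D u x w" by (simp add: Du v)
      also have "\<dots> = P.G x (X x) w" unfolding X_def by (rule P.gradient_property[OF x u_differentiable, symmetric])
      finally show "P.G x (D (\<theta> c') ?y ?g) w = P.G x (X x) w" .
    qed
    then have "J (D ?f ?y ?g) = D \<tau> (f x) (V x)"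
      unfolding Df V_def J\<tau>[OF fxT] by simp
    then show ?thesis using L by simp
  qed
qed

lemma hamiltonian_variation_Phi:
  assumes \<delta>: "\<delta> > 0" "\<And>t x. \<bar>t\<bar> < \<delta> \<Longrightarrow> x \<in> U \<Longrightarrow> f x + t *\<^sub>R V x \<in> \<Omega>"
  shows "hamiltonian_variation \<epsilon> S A F CS \<delta> \<Phi>"
proof -
  have "variation \<epsilon> S A F CS \<delta> \<Phi>"
    unfolding variation_def
  proof (intro conjI ballI allI impI)
    show "\<Phi> t ` S \<subseteq> (\<Union>d\<in>csf_charts \<epsilon>. fst d)" if "\<bar>t\<bar> < \<delta>" for t
    proof (rule image_subsetI)
      fix q assume q: "q \<in> S"
      show "\<Phi> t q \<in> (\<Union>d\<in>csf_charts \<epsilon>. fst d)"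
      proof (cases "q \<in> fst c \<and> F q \<in> fst d")
        case True
        then have "\<Phi> t q \<in> fst d" using \<delta>(2)[OF that cdomI[OF c, of q d]] by (intro Phi_in_chart(2)) auto
        then show ?thesis using d by blast
      next
        case False
        then have "\<Phi> t q = F q" by (auto simp: \<Phi>_def)
        then show ?thesis using F_covered[OF q] by auto
      qed
    qed
    show "smooth_on {(t, x). \<bar>t\<bar> < \<delta> \<and> x \<in> snd c' ` fst c' \<and> \<Phi> t (chart_inv c' x) \<in> fst d'}
       (\<lambda>(t, x). local_rep c' d' (\<Phi> t) x)" if "c' \<in> A" "d' \<in> csf_charts \<epsilon>" for c' d'
      by (rule smooth_variation[OF that \<delta>(2)])
  qed (use \<delta>(1) CS Phi_outside Phi_stationary in auto)
  moreover have "compactly_supported_smooth S A u_lift"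
    unfolding compactly_supported_smooth_def
    using smooth_u_lift CS(1,2) u_lift_outside by (intro conjI ballI exI[of _ CS]) auto
  ultimately show ?thesis
    unfolding hamiltonian_variation_def Let_def using hamiltonian_field by blast
qed

end

section \<open>From stationarity to pointwise equations\<close>

lemma gram_induced_metric_cong:
  assumes "open U" "x \<in> U" "\<And>y. y \<in> U \<Longrightarrow> f y = g y"
  shows "gram (induced_metric M f) x = gram (induced_metric M g) x"
  unfolding gram_def induced_metric_def using D_cong_open[OF assms] assms(2,3) by simp

context lagrangian_surface
begin

text \<open>For a test function supported in a ball, stationarity makes the area derivative of the
  constructed variation zero, while the first variation formula expresses it as an integral.
  Integration by parts and the fundamental lemma then give the pointwise equation.\<close>

lemma stationary_coclosed:
  assumes stationary: "hamiltonian_stationary_lagrangian_surface \<epsilon> S A F"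
    and c: "c \<in> A" and d: "d \<in> csf_charts \<epsilon>" and x: "x \<in> cdom c d"
  shows "d1 (\<lambda>x. sqrt (lagrangian_patch.\<Delta> \<epsilon> (local_rep c d F) x) * lagrangian_patch.a1 \<epsilon> (local_rep c d F) x) x
    + d2 (\<lambda>x. sqrt (lagrangian_patch.\<Delta> \<epsilon> (local_rep c d F) x) * lagrangian_patch.a2 \<epsilon> (local_rep c d F) x) x = 0"
proof -
  interpret P: lagrangian_patch \<epsilon> "cdom c d" "local_rep c d F" by (rule patch[OF c d])
  let ?f = "local_rep c d F"
  define Y1 Y2 where "Y1 x = sqrt (P.\<Delta> x) * P.a1 x" and "Y2 x = sqrt (P.\<Delta> x) * P.a2 x" for x
  have sY: "smooth_on (cdom c d) Y1" "smooth_on (cdom c d) Y2"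
    unfolding Y1_def Y2_def by (intro smooth_intros P.smooth_a)+
  have "d1 Y1 x + d2 Y2 x = 0"
  proof (rule fundamental_lemma[where F = "\<lambda>x. d1 Y1 x + d2 Y2 x", OF _ P.open_U x])
    show "continuous_on (cdom c d) (\<lambda>x. d1 Y1 x + d2 Y2 x)"
      by (intro smooth_on_continuous_on smooth_intros sY)
    fix u :: "real \<times> real \<Rightarrow> real" and x r
    assume r: "r > 0" "cball x r \<subseteq> cdom c d" and u: "smooth_on UNIV u" "\<And>y. y \<notin> ball x r \<Longrightarrow> u y = 0"
    interpret V: chart_variation \<epsilon> S A F c d "cball x r" u
      by unfold_locales (use c d r u in auto)
    obtain \<delta> where \<delta>: "\<delta> > 0" "\<And>t x. \<bar>t\<bar> < \<delta> \<Longrightarrow> x \<in> cdom c d \<Longrightarrow> ?f x + t *\<^sub>R V.V x \<in> V.\<Omega>"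
      using V.variation_domain by metis
    define a where "a t = (LINT x:cball x r|lborel. sqrt (gram (induced_metric (csf_metric \<epsilon>) (local_rep c d (V.\<Phi> t))) x))" for t
    have sub: "cball x r \<subseteq> snd c ` fst c" using r(2) cdomD(1)[OF c] by blast
    have img: "snd c ` V.CS = cball x r"
    proof -
      have "(\<lambda>y. snd c (chart_inv c y)) ` cball x r = (\<lambda>y. y) ` cball x r"
        by (rule image_cong[OF refl]) (rule snd_chart_inv(1)[OF subsetD[OF sub]])
      then show ?thesis by (simp only: V.CS_def image_image image_ident)
    qed
    \<comment> \<open>One piece suffices, as the support and its moving image stay in a single pair
      of charts.\<close>
    have "has_area \<epsilon> A (V.\<Phi> t) V.CS (a t)" if t: "\<bar>t\<bar> < \<delta>" for t
      unfolding has_area_def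
    proof (intro exI[of _ "1::nat"] exI[of _ "\<lambda>i. V.CS"] exI[of _ "\<lambda>i. c"] exI[of _ "\<lambda>i. d"] conjI allI impI)
      show "V.CS \<subseteq> fst c \<inter> V.\<Phi> t -` fst d"
      proof
        fix q assume "q \<in> V.CS"
        then have q: "q \<in> fst c" "F q \<in> fst d" using V.CS_in_chart by simp_all
        then show "q \<in> fst c \<inter> V.\<Phi> t -` fst d"
          using V.Phi_in_chart(2)[OF \<delta>(2)[OF t cdomI[OF c q]] q] by simp
      qed
      show "snd c ` V.CS \<in> sets borel" unfolding img by simp
      show "a t = (\<Sum>i<1::nat. LINT x:snd c ` V.CS|lborel. sqrt (gram (induced_metric (csf_metric \<epsilon>) (local_rep c d (V.\<Phi> t))) x))"
        unfolding img a_def by simp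
    qed (auto simp: c d disjoint_family_on_def)
    then have a0: "(a has_real_derivative 0) (at 0)"
      using stationary V.hamiltonian_variation_Phi[OF \<delta>] unfolding hamiltonian_stationary_lagrangian_surface_def by blast
    define \<phi> where "\<phi> z = ?f (snd z) + fst z *\<^sub>R V.V (snd z)" for z :: "real \<times> real \<times> real"
    define W0 where "W0 = {-\<delta><..<\<delta>} \<times> cdom c d"
    have oW: "open W0" unfolding W0_def using P.open_U by (intro open_Times) auto
    have W0: "(t, y) \<in> W0 \<longleftrightarrow> \<bar>t\<bar> < \<delta> \<and> y \<in> cdom c d" for t y by (auto simp: W0_def abs_less_iff)
    have s\<phi>: "smooth_on W0 \<phi>"
      unfolding \<phi>_def
      by (intro smooth_on_add smooth_on_scaleR smooth_on_fst smooth_on_id oW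
          smooth_on_compose[OF P.smooth smooth_on_snd[OF smooth_on_id[OF oW]]]
          smooth_on_compose[OF V.smooth_V smooth_on_snd[OF smooth_on_id[OF oW]]]) (auto simp: W0_def)
    have dom\<phi>: "\<phi> ` W0 \<subseteq> csf_domain \<epsilon>"
    proof (rule image_subsetI)
      fix z assume "z \<in> W0"
      then have "\<bar>fst z\<bar> < \<delta>" "snd z \<in> cdom c d" using W0[of "fst z" "snd z"] by simp_all
      then have "\<phi> z \<in> V.\<Omega>" unfolding \<phi>_def by (rule \<delta>(2))
      then show "\<phi> z \<in> csf_domain \<epsilon>" using csf_chart(3)[OF d] unfolding V.\<Omega>_def by blast
    qed
    have field: "D \<phi> (0, y) (1, 0) = J (D ?f y (gradient P.G u y))" if y: "y \<in> cdom c d" for y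
    proof -
      have z: "(0, y) \<in> W0" using y \<delta>(1) by (simp add: W0)
      have 1: "((\<lambda>t. (t, y)) has_derivative (\<lambda>h. (h, 0))) (at 0)" by (auto intro!: derivative_eq_intros)
      have "((\<lambda>t. \<phi> (t, y)) has_derivative (\<lambda>h. D \<phi> (0, y) (h, 0))) (at 0)"
        by (rule has_derivative_compose[OF 1 smooth_on_has_derivative[OF s\<phi> z]])
      moreover have "((\<lambda>t. \<phi> (t, y)) has_derivative (\<lambda>h. h *\<^sub>R V.V y)) (at 0)"
        unfolding \<phi>_def by (auto intro!: derivative_eq_intros)
      ultimately have "(\<lambda>h. D \<phi> (0, y) (h, 0)) = (\<lambda>h. h *\<^sub>R V.V y)" by (rule has_derivative_unique)
      from fun_cong[OF this, of 1] show ?thesis by (simp add: zero_prod_def V.V_def V.X_def)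
    qed
    have su: "smooth_on (cdom c d) u" by (rule smooth_on_subset[OF u(1) P.open_U]) simp
    have fv: "((\<lambda>t. LINT x:cball x r|lborel. sqrt (gram (induced_metric (csf_metric \<epsilon>) (\<lambda>x. \<phi> (t, x))) x)) has_real_derivative
     - 2 * (LINT x:cball x r|lborel. sqrt (P.\<Delta> x) * P.a1 x * d1 u x + sqrt (P.\<Delta> x) * P.a2 x * d2 u x)) (at 0)"
      by (rule P.first_variation[OF s\<phi> dom\<phi> compact_cball r(2) _ _ su field]) (use \<delta>(1) in \<open>simp_all add: W0 \<phi>_def\<close>)
    have ev: "eventually (\<lambda>t. (LINT x:cball x r|lborel. sqrt (gram (induced_metric (csf_metric \<epsilon>) (\<lambda>x. \<phi> (t, x))) x)) = a t) (nhds 0)"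
    proof -
      have "(LINT x:cball x r|lborel. sqrt (gram (induced_metric (csf_metric \<epsilon>) (\<lambda>x. \<phi> (t, x))) x)) = a t" if t: "\<bar>t\<bar> < \<delta>" for t
        unfolding a_def
      proof (rule set_lebesgue_integral_cong)
        have eq: "\<phi> (t, y) = local_rep c d (V.\<Phi> t) y" if y: "y \<in> cdom c d" for y
          using V.Phi_in_chart(1)[of "chart_inv c y" t] \<delta>(2)[OF t y] cdomD(2-4)[OF c y] by (simp add: \<phi>_def local_rep_def)
        show "\<forall>y. y \<in> cball x r \<longrightarrow> sqrt (gram (induced_metric (csf_metric \<epsilon>) (\<lambda>x. \<phi> (t, x))) y)
            = sqrt (gram (induced_metric (csf_metric \<epsilon>) (local_rep c d (V.\<Phi> t))) y)"
        proof (intro allI impI)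
          fix y assume "y \<in> cball x r"
          then have "y \<in> cdom c d" using r(2) by blast
          from gram_induced_metric_cong[OF P.open_U this, of "\<lambda>x. \<phi> (t, x)" "local_rep c d (V.\<Phi> t)"] eq
          show "sqrt (gram (induced_metric (csf_metric \<epsilon>) (\<lambda>x. \<phi> (t, x))) y)
            = sqrt (gram (induced_metric (csf_metric \<epsilon>) (local_rep c d (V.\<Phi> t))) y)" by simp
        qed
      qed simp
      then show ?thesis using \<delta>(1) by (intro eventually_nhds_metric[THEN iffD2] exI[of _ \<delta>]) (simp add: dist_real_def)
    qed
    have "(a has_real_derivative - 2 * (LINT x:cball x r|lborel. sqrt (P.\<Delta> x) * P.a1 x * d1 u x + sqrt (P.\<Delta> x) * P.a2 x * d2 u x)) (at 0)"
      by (rule DERIV_cong_ev[OF refl ev refl, THEN iffD1, OF fv])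
    then have "- 2 * (LINT x:cball x r|lborel. Y1 x * d1 u x + Y2 x * d2 u x) = 0"
      unfolding Y1_def Y2_def by (rule DERIV_unique[OF _ a0])
    moreover have "(LINT x:cball x r|lborel. Y1 x * d1 u x + Y2 x * d2 u x) = - (LINT x:cball x r|lborel. u x * (d1 Y1 x + d2 Y2 x))"
      by (rule divergence_form[OF su sY compact_cball r(2)]) (use u(2) in auto)
    ultimately show "(LINT y:cball x r|lborel. u y * (d1 Y1 y + d2 Y2 y)) = 0" by simp
  qed
  then show ?thesis by (simp only: Y1_def[abs_def] Y2_def[abs_def])
qed

text \<open>The length of \<open>H\<close> is smooth because it is positive, and
  \<open>d |H| = d h2 / (2 |H|)\<close> converts the gradient condition into the one for
  \<open>h2\<close>.\<close>

lemma constant_patch: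
  assumes stationary: "hamiltonian_stationary_lagrangian_surface \<epsilon> S A F"
    and H: "everywhere \<epsilon> A F (\<lambda>f x. mean_curvature (csf_metric \<epsilon>) f x \<noteq> 0)"
    and K: "everywhere \<epsilon> A F (\<lambda>f x. gaussian_curvature (induced_metric (csf_metric \<epsilon>) f) x = K)"
    and \<kappa>: "\<kappa> > 0" "everywhere \<epsilon> A F (\<lambda>f x. grad_mean_curvature_length (csf_metric \<epsilon>) f x = \<kappa>)"
    and c: "c \<in> A" and d: "d \<in> csf_charts \<epsilon>"
  shows "constant_patch \<epsilon> (cdom c d) (local_rep c d F) K \<kappa>"
proof -
  let ?f = "local_rep c d F"
  interpret P: lagrangian_patch \<epsilon> "cdom c d" ?f by (rule patch[OF c d])
  have h2: "P.h2 x > 0" if "x \<in> cdom c d" for x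
    by (rule P.h2_pos[OF that everywhere_at[OF H c d that]])
  show ?thesis
  proof
    fix x assume x: "x \<in> cdom c d"
    show "P.h2 x > 0" by (rule h2[OF x])
    show "gaussian_curvature P.G x = K" by (rule everywhere_at[OF K c d x])
    show "d1 (\<lambda>x. sqrt (P.\<Delta> x) * P.a1 x) x + d2 (\<lambda>x. sqrt (P.\<Delta> x) * P.a2 x) x = 0"
      by (rule stationary_coclosed[OF stationary c d x])
    let ?l = "mean_curvature_length (csf_metric \<epsilon>) ?f"
    define s where "s x = sqrt (P.h2 x)" for x
    have ss: "smooth_on (cdom c d) s" unfolding s_def by (intro smooth_intros P.smooth_alpha h2)
    have sp: "s x > 0" using h2[OF x] by (simp add: s_def)
    have ls: "?l y = s y" if "y \<in> cdom c d" for y using P.mean_curvature_length_eq[OF that] by (simp add: s_def)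
    have dl: "?l differentiable (at x)"
      using smooth_on_differentiable[OF ss x] differentiable_cong_open[OF P.open_U x ls] by simp
    have Dl: "D ?l x v = D P.h2 x v / (2 * s x)" for v
    proof -
      have "(s has_derivative (\<lambda>v. D P.h2 x v / (2 * s x))) (at x)"
        unfolding s_def using h2[OF x]
        by (auto intro!: derivative_eq_intros smooth_on_has_derivative[OF P.smooth_alpha(4) x] simp: field_simps)
      moreover have "D ?l x v = D s x v" by (rule D_cong_on[OF P.open_U ls x])
      ultimately show ?thesis by (simp add: D_eqI)
    qed
    define Q where "Q = (P.g22 x * (d1 P.h2 x)\<^sup>2 - 2 * P.g12 x * d1 P.h2 x * d2 P.h2 x + P.g11 x * (d2 P.h2 x)\<^sup>2) / P.\<Delta> x"
    have "metric_norm P.G x (gradient P.G ?l x) = \<kappa>"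
      using everywhere_at[OF \<kappa>(2) c d x] by (simp add: grad_mean_curvature_length_def)
    then have "\<kappa>\<^sup>2 = (P.g22 x * (d1 ?l x)\<^sup>2 - 2 * P.g12 x * d1 ?l x * d2 ?l x + P.g11 x * (d2 ?l x)\<^sup>2) / P.\<Delta> x"
      using P.grad_norm_eq[OF x dl] by simp
    also have "\<dots> = Q / (4 * (s x)\<^sup>2)"
      unfolding Dl Q_def using sp P.Delta_pos[OF x] by (simp add: field_simps power2_eq_square)
    also have "(s x)\<^sup>2 = P.h2 x" using h2[OF x] by (simp add: s_def)
    finally have "Q = 4 * \<kappa>\<^sup>2 * P.h2 x"
      using h2[OF x] by simp
    then show "(P.g22 x * (d1 P.h2 x)\<^sup>2 - 2 * P.g12 x * d1 P.h2 x * d2 P.h2 x + P.g11 x * (d2 P.h2 x)\<^sup>2) / P.\<Delta> x = 4 * \<kappa>\<^sup>2 * P.h2 x"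
      unfolding Q_def .
  qed (rule \<kappa>(1))
qed

end

section \<open>Local congruence\<close>

context lagrangian_surface
begin

text \<open>Local congruence asks for a chart compatible with the whole atlas. Following
  \<open>c\<close> by a diffeomorphism preserves compatibility with every chart, by composition with
  \<omega> in one direction and \<Xi> in the other.\<close>

lemma smooth_surface_insert:
  assumes c: "c \<in> A" and N: "open N" "N \<subseteq> snd c ` fst c" and Z: "open Z" and h: "homeomorphism N Z \<omega> \<Xi>"
    and s\<omega>: "smooth_on N \<omega>" and s\<Xi>: "smooth_on Z \<Xi>"
  shows "smooth_surface S (insert ({q \<in> fst c. snd c q \<in> N}, \<lambda>q. \<omega> (snd c q)) A)"
proof -
  define N' where "N' = {q \<in> fst c. snd c q \<in> N}"
  define \<phi> where "\<phi> q = \<omega> (snd c q)" for q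
  define \<Psi> where "\<Psi> z = chart_inv c (\<Xi> z)" for z
  have \<omega>: "\<omega> x \<in> Z" "\<Xi> (\<omega> x) = x" if "x \<in> N" for x using h that by (auto simp: homeomorphism_def)
  have \<Xi>: "\<Xi> z \<in> N" "\<omega> (\<Xi> z) = z" if "z \<in> Z" for z using h that by (auto simp: homeomorphism_def)
  have \<Psi>: "\<Psi> z \<in> N'" "\<phi> (\<Psi> z) = z" "snd c (\<Psi> z) = \<Xi> z" if z: "z \<in> Z" for z
  proof -
    have "\<Xi> z \<in> snd c ` fst c" using \<Xi>(1)[OF z] N(2) by blast
    note * = snd_chart_inv[OF this]
    show "\<Psi> z \<in> N'" "\<phi> (\<Psi> z) = z" "snd c (\<Psi> z) = \<Xi> z"
      using * \<Xi>[OF z] by (simp_all add: \<Psi>_def N'_def \<phi>_def)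
  qed
  have \<phi>: "\<phi> q \<in> Z" "\<Psi> (\<phi> q) = q" if "q \<in> N'" for q
    using that \<omega> chart_inv_snd[OF c] by (simp_all add: N'_def \<phi>_def \<Psi>_def)
  have img: "\<phi> ` N' = Z"
  proof
    show "Z \<subseteq> \<phi> ` N'" using \<Psi>(1,2) by (metis image_eqI subsetI)
  qed (use \<phi>(1) in blast)
  have inj: "inj_on \<phi> N'" by (rule inj_on_inverseI[of _ \<Psi>]) (rule \<phi>(2))
  have inv: "inv_into N' \<phi> z = \<Psi> z" if "z \<in> Z" for z
    by (rule inv_into_f_eq[OF inj \<Psi>(1,2)[OF that]])
  have "N' = fst c \<inter> snd c -` N" by (auto simp: N'_def)
  then have "openin (top_of_set (fst c)) N'"
    using continuous_openin_preimage_gen[OF chart_facts(3)[OF c] N(1)] by simp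
  then have opN: "openin (top_of_set S) N'" by (rule openin_trans[OF _ chart_facts(1)[OF c]])
  have N'S: "N' \<subseteq> S" using chart_facts(5)[OF c] by (auto simp: N'_def)
  have hom: "homeomorphism N' Z \<phi> (inv_into N' \<phi>)"
  proof (rule homeomorphismI)
    show "continuous_on N' \<phi>"
      unfolding \<phi>_def
      by (rule continuous_on_compose2[OF smooth_on_continuous_on[OF s\<omega>] continuous_on_subset[OF chart_facts(3)[OF c]]])
        (auto simp: N'_def)
    have "continuous_on Z \<Psi>"
      unfolding \<Psi>_def
      by (rule continuous_on_compose2[OF chart_facts(4)[OF c] smooth_on_continuous_on[OF s\<Xi>]]) (use \<Xi>(1) N(2) in blast)
    then show "continuous_on Z (inv_into N' \<phi>)" by (subst continuous_on_cong[OF refl inv])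
    show "\<phi> ` N' \<subseteq> Z" using img by simp
    show "inv_into N' \<phi> ` Z \<subseteq> N'" by (intro image_subsetI) (simp only: inv \<Psi>(1))
  qed (simp_all add: inv \<phi> \<Psi>)
  have smooth_in: "smooth_on (snd c1 ` (fst c1 \<inter> N')) (\<lambda>x. \<phi> (chart_inv c1 x))" if c1: "c1 \<in> A" for c1
  proof -
    define \<theta> where "\<theta> x = snd c (chart_inv c1 x)" for x
    let ?T = "snd c1 ` (fst c1 \<inter> fst c)"
    have s\<theta>: "smooth_on ?T \<theta>" unfolding \<theta>_def by (rule smooth_chart_change[OF c c1])
    have eq: "snd c1 ` (fst c1 \<inter> N') = ?T \<inter> \<theta> -` N"
      using chart_inv_snd[OF c1] by (auto simp: N'_def \<theta>_def)
    have o: "open (?T \<inter> \<theta> -` N)"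
      by (rule continuous_open_preimage[OF smooth_on_continuous_on[OF s\<theta>] smooth_on_open[OF s\<theta>] N(1)])
    show ?thesis
      unfolding eq \<phi>_def \<theta>_def[symmetric]
      by (rule smooth_on_compose[OF s\<omega> smooth_on_subset[OF s\<theta> o]]) auto
  qed
  have smooth_out: "smooth_on (\<phi> ` (N' \<inter> fst c2)) (\<lambda>z. snd c2 (inv_into N' \<phi> z))" if c2: "c2 \<in> A" for c2
  proof -
    let ?T = "snd c ` (fst c \<inter> fst c2)"
    have s: "smooth_on ?T (\<lambda>x. snd c2 (chart_inv c x))" by (rule smooth_chart_change[OF c2 c])
    have eq: "\<phi> ` (N' \<inter> fst c2) = Z \<inter> \<Xi> -` ?T"
    proof (intro equalityI subsetI)
      fix z assume "z \<in> \<phi> ` (N' \<inter> fst c2)"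
      then obtain q where q: "q \<in> N'" "q \<in> fst c2" "z = \<phi> q" by blast
      have "\<Xi> z = snd c q" using q \<omega>(2) by (simp add: N'_def \<phi>_def)
      then show "z \<in> Z \<inter> \<Xi> -` ?T" using q \<phi>(1) by (auto simp: N'_def)
    next
      fix z assume z: "z \<in> Z \<inter> \<Xi> -` ?T"
      then obtain q where q: "q \<in> fst c" "q \<in> fst c2" "\<Xi> z = snd c q" by blast
      have "\<Psi> z = q" unfolding \<Psi>_def q(3) by (rule chart_inv_snd[OF c q(1)])
      then show "z \<in> \<phi> ` (N' \<inter> fst c2)" using \<Psi>(1,2)[of z] z q(2) by (metis IntD1 IntI image_eqI)
    qed
    have o: "open (Z \<inter> \<Xi> -` ?T)"
      by (rule continuous_open_preimage[OF smooth_on_continuous_on[OF s\<Xi>] Z smooth_on_open[OF s]])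
    have "smooth_on (Z \<inter> \<Xi> -` ?T) (\<lambda>z. snd c2 (chart_inv c (\<Xi> z)))"
      by (rule smooth_on_compose[OF s smooth_on_subset[OF s\<Xi> o]]) auto
    then show ?thesis
      unfolding eq by (subst smooth_on_cong[where g = "\<lambda>z. snd c2 (chart_inv c (\<Xi> z))"]) (simp_all add: inv \<Psi>_def)
  qed
  have self: "smooth_on (\<phi> ` (N' \<inter> N')) (\<lambda>z. \<phi> (inv_into N' \<phi> z))"
    unfolding Int_absorb img
    by (subst smooth_on_cong[where g = "\<lambda>z. z"]) (simp_all add: inv \<Psi> smooth_on_id[OF Z])
  have old: "smooth_on (snd c1 ` (fst c1 \<inter> fst c2)) (\<lambda>x. snd c2 (chart_inv c1 x))" if "c1 \<in> A" "c2 \<in> A" for c1 c2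
    by (rule smooth_chart_change[OF that(2,1)])
  have "smooth_surface S (insert (N', \<phi>) A)"
    unfolding smooth_surface_def
  proof (intro conjI)
    show "S \<noteq> {}" "(\<Union>c\<in>insert (N', \<phi>) A. fst c) = S"
      using surface N'S unfolding smooth_surface_def by auto
    have 1: "\<forall>c\<in>A. openin (top_of_set S) (fst c) \<and> open (snd c ` fst c) \<and> homeomorphism (fst c) (snd c ` fst c) (snd c) (chart_inv c)"
      using surface unfolding smooth_surface_def by blast
    show "\<forall>c\<in>insert (N', \<phi>) A. openin (top_of_set S) (fst c) \<and> open (snd c ` fst c) \<and> homeomorphism (fst c) (snd c ` fst c) (snd c) (chart_inv c)"
      using 1 opN Z hom by (simp add: img)
    show "\<forall>c\<in>insert (N', \<phi>) A. \<forall>d\<in>insert (N', \<phi>) A. smooth_on (snd c ` (fst c \<inter> fst d)) (snd d \<circ> chart_inv c)"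
      unfolding comp_def using smooth_in smooth_out self old by simp
  qed
  then show ?thesis by (simp only: N'_def \<phi>_def[abs_def])
qed

lemma constant_patches_congruent:
  assumes patches: "\<And>c d. c \<in> A \<Longrightarrow> d \<in> csf_charts \<epsilon> \<Longrightarrow> constant_patch \<epsilon> (cdom c d) (local_rep c d F) K \<kappa>"
  shows "K = 0 \<and> \<epsilon> = 0 \<and> locally_congruent_to_model S A F \<kappa>"
proof -
  have cover: "\<exists>c\<in>A. \<exists>d\<in>csf_charts \<epsilon>. p \<in> fst c \<and> F p \<in> fst d" if p: "p \<in> S" for p
  proof -
    have "p \<in> (\<Union>c\<in>A. fst c)" using surface p unfolding smooth_surface_def by blast
    then show ?thesis using F_covered[OF p] by blast
  qed
  \<comment> \<open>\<open>K\<close> and \<epsilon> are global constants, so one point of the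
    nonempty surface decides them.\<close>
  obtain p0 where "p0 \<in> S" using surface unfolding smooth_surface_def by blast
  then obtain c0 d0 where c0: "c0 \<in> A" "d0 \<in> csf_charts \<epsilon>" "p0 \<in> fst c0" "F p0 \<in> fst d0" using cover by blast
  have K\<epsilon>: "K = 0 \<and> \<epsilon> = 0" by (rule constant_patch.local_model(1)[OF patches[OF c0(1,2)] cdomI[OF c0(1,3,4)]])
  have "locally_congruent_to_model S A F \<kappa>"
    unfolding locally_congruent_to_model_def
  proof
    fix p assume "p \<in> S"
    then obtain c d where c: "c \<in> A" and d: "d \<in> csf_charts \<epsilon>" and p: "p \<in> fst c" "F p \<in> fst d" using cover by blast
    obtain N Z \<omega> \<Xi> W Z0 where N: "open N" "snd c p \<in> N" "N \<subseteq> cdom c d" and Z: "open Z" "Z \<subseteq> punctured_plane"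
      and h: "homeomorphism N Z \<omega> \<Xi>" "smooth_on N \<omega>" "smooth_on Z \<Xi>" and W: "unitary W"
      and m: "\<forall>x\<in>N. W *v local_rep c d F x + Z0 = F_map \<kappa> (\<omega> x)"
      using constant_patch.local_model(2)[OF patches[OF c d] cdomI[OF c p]] by blast
    let ?N = "{q \<in> fst c. snd c q \<in> N}"
    have Nc: "N \<subseteq> snd c ` fst c" using N(3) cdomD(1)[OF c] by blast
    have "\<exists>Z. F q = Affine Z \<and> W *v Z + Z0 = F_map \<kappa> (\<omega> (snd c q))" if q: "q \<in> ?N" for q
    proof -
      have i: "chart_inv c (snd c q) = q" using chart_inv_snd[OF c] q by simp
      have "snd c q \<in> cdom c d" using q N(3) by blast
      then have "F q \<in> fst d" using cdomD(2)[OF c] i by metis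
      \<comment> \<open>As \<epsilon> vanishes, the ambient atlas is the single affine
        chart.\<close>
      moreover have dd: "d = (range Affine, affine_coord)" using d K\<epsilon> by (simp add: csf_charts_def)
      ultimately obtain Y where Y: "F q = Affine Y" by auto
      then have "local_rep c d F (snd c q) = Y" by (simp add: local_rep_def i dd)
      then show ?thesis using m q Y by auto
    qed
    moreover have "(\<lambda>q. \<omega> (snd c q)) ` ?N \<subseteq> punctured_plane"
      using h(1) Z(2) unfolding homeomorphism_def by blast
    ultimately show "\<exists>N \<phi> W Z0. p \<in> N \<and> smooth_surface S (insert (N, \<phi>) A) \<and> \<phi> ` N \<subseteq> punctured_plane \<and> unitary W \<and>
        (\<forall>q\<in>N. \<exists>Z. F q = Affine Z \<and> W *v Z + Z0 = F_map \<kappa> (\<phi> q))"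
      using smooth_surface_insert[OF c N(1) Nc Z(1) h] p(1) N(2) W
      by (intro exI[of _ ?N] exI[of _ "\<lambda>q. \<omega> (snd c q)"] exI[of _ W] exI[of _ Z0]) blast
  qed
  then show ?thesis using K\<epsilon> by blast
qed

end

section \<open>The model surface\<close>

text \<open>Agreement with \<open>F_map\<close> is asked on the punctured plane only, since the
  coordinate representation goes through \<open>inv_into\<close>, whose values elsewhere are
  arbitrary.\<close>

locale model_patch =
  fixes \<kappa> :: real and f :: "real \<times> real \<Rightarrow> complex^2"
  assumes kappa_pos: "\<kappa> > 0" and f_eq: "x \<in> punctured_plane \<Longrightarrow> f x = F_map \<kappa> x"
begin

definition E1 :: "real \<times> real \<Rightarrow> complex" where "E1 x = exp (\<i> * complex_of_real (\<kappa> * (fst x)\<^sup>2))"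
definition E2 :: "real \<times> real \<Rightarrow> complex" where "E2 x = exp (- \<i> * complex_of_real (\<kappa> * (snd x)\<^sup>2))"

lemma E_unit: "E1 x * cnj (E1 x) = 1" "E2 x * cnj (E2 x) = 1"
  by (simp_all add: complex_norm_square[symmetric] E1_def E2_def norm_exp_eq_Re)

lemma E_nonzero: "E1 x \<noteq> 0" "E2 x \<noteq> 0"
  by (simp_all add: E1_def E2_def)

lemma open_plane: "open punctured_plane"
  by (rule open_delete[OF open_UNIV])

lemma D_f: "x \<in> punctured_plane \<Longrightarrow> D f x v = vector [fst v *\<^sub>R E1 x, snd v *\<^sub>R E2 x]"
  by (subst D_cong_on[OF open_plane f_eq]) (simp_all add: D_F_map E1_def E2_def)

sublocale lagrangian_patch 0 punctured_plane f
proof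
  show "smooth_on punctured_plane f"
    by (subst smooth_on_cong[OF f_eq]) (simp_all add: smooth_on_subset[OF smooth_F_map open_plane])
  show "f ` punctured_plane \<subseteq> csf_domain 0" by (simp add: csf_domain_def)
  fix x :: "real \<times> real" and u v assume x: "x \<in> punctured_plane"
  show "inj (D f x)"
    unfolding inj_def D_f[OF x] by (auto simp: vec_eq_iff forall_2 E_nonzero prod_eq_iff)
  have "herm (D f x u) (J (D f x v)) = - \<i> * (of_real (fst u * fst v) * (E1 x * cnj (E1 x)) + of_real (snd u * snd v) * (E2 x * cnj (E2 x)))"
    unfolding D_f[OF x] by (simp add: herm_def sum_2 scaleR_conv_of_real algebra_simps)
  then show "csf_metric 0 (f x) (D f x u) (J (D f x v)) = 0"
    unfolding E_unit by (simp add: csf_metric_def)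
qed

lemma frame: "x \<in> punctured_plane \<Longrightarrow> f1 x = E1 x *s vector [1, 0]" "x \<in> punctured_plane \<Longrightarrow> f2 x = E2 x *s vector [0, 1]"
  by (simp_all add: D_f vec_eq_iff forall_2)

lemma g: "x \<in> punctured_plane \<Longrightarrow> g11 x = 1" "x \<in> punctured_plane \<Longrightarrow> g12 x = 0" "x \<in> punctured_plane \<Longrightarrow> g22 x = 1"
  unfolding g11_def g12_def g22_def csf_herm_flat by (simp_all add: frame herm_def sum_2 E_unit)

lemma Delta: "x \<in> punctured_plane \<Longrightarrow> \<Delta> x = 1"
  by (simp add: \<Delta>_def g)

lemma smooth_E: "smooth_on UNIV E1" "smooth_on UNIV E2"
  unfolding E1_def E2_def by (intro smooth_intros open_UNIV)+

lemma D_E: "D E1 x v = (2 * \<i> * of_real (\<kappa> * fst x * fst v)) * E1 x" "D E2 x v = (- 2 * \<i> * of_real (\<kappa> * snd x * snd v)) * E2 x"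
proof -
  have e: "((\<lambda>x. exp (p x)) has_derivative (\<lambda>v. p' v * exp (p x))) (at x)"
    if "(p has_derivative p') (at x)" "z = p x" for p p' and x :: "real \<times> real" and z :: complex
    using has_derivative_compose[OF that(1), of exp "(*) (exp (p x))"] DERIV_exp[of z] that(2)
    by (simp add: has_field_derivative_def mult.commute)
  have "((\<lambda>x. \<i> * complex_of_real (\<kappa> * (fst x)\<^sup>2)) has_derivative (\<lambda>v. 2 * \<i> * of_real (\<kappa> * fst x * fst v))) (at x)"
    by (rule derivative_eq_intros refl)+ (simp add: fun_eq_iff algebra_simps)
  from e[OF this refl] have "(E1 has_derivative (\<lambda>v. (2 * \<i> * of_real (\<kappa> * fst x * fst v)) * E1 x)) (at x)"
    by (simp only: E1_def[abs_def])
  moreover have "((\<lambda>x. - \<i> * complex_of_real (\<kappa> * (snd x)\<^sup>2)) has_derivative (\<lambda>v. - 2 * \<i> * of_real (\<kappa> * snd x * snd v))) (at x)"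
    by (rule derivative_eq_intros refl)+ (simp add: fun_eq_iff algebra_simps)
  from e[OF this refl] have "(E2 has_derivative (\<lambda>v. (- 2 * \<i> * of_real (\<kappa> * snd x * snd v)) * E2 x)) (at x)"
    by (simp only: E2_def[abs_def])
  ultimately show "D E1 x v = (2 * \<i> * of_real (\<kappa> * fst x * fst v)) * E1 x" "D E2 x v = (- 2 * \<i> * of_real (\<kappa> * snd x * snd v)) * E2 x"
    by (simp_all only: D_eqI)
qed

lemma D_frame:
  assumes x: "x \<in> punctured_plane"
  shows "D f1 x v = D E1 x v *s vector [1, 0]" "D f2 x v = D E2 x v *s vector [0, 1]"
proof -
  have "D f1 x v = D (\<lambda>y. E1 y *s vector [1, 0]) x v" by (rule D_cong_on[OF open_plane frame(1) x])
  also have "\<dots> = D E1 x v *s vector [1, 0]"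
    by (simp add: D_vscale[OF smooth_E(1) smooth_on_const[OF open_UNIV] UNIV_I] D_const)
  finally show "D f1 x v = D E1 x v *s vector [1, 0]" .
  have "D f2 x v = D (\<lambda>y. E2 y *s vector [0, 1]) x v" by (rule D_cong_on[OF open_plane frame(2) x])
  also have "\<dots> = D E2 x v *s vector [0, 1]"
    by (simp add: D_vscale[OF smooth_E(2) smooth_on_const[OF open_UNIV] UNIV_I] D_const)
  finally show "D f2 x v = D E2 x v *s vector [0, 1]" .
qed

lemma coefficients:
  assumes x: "x \<in> punctured_plane"
  shows "A1 x = 2 * \<i> * of_real (\<kappa> * fst x)" "A2 x = 0" "B1 x = 0" "B2 x = 0" "C1 x = 0"
    "C2 x = - 2 * \<i> * of_real (\<kappa> * snd x)"
  unfolding A1_def A2_def B1_def B2_def C1_def C2_def coeff1_def coeff2_def hess_def D_frame[OF x] frame[OF x] D_E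
  by (simp_all add: csf_gamma_def det2_def E_nonzero)

lemma alpha: "x \<in> punctured_plane \<Longrightarrow> \<alpha>1 x = \<kappa> * fst x" "x \<in> punctured_plane \<Longrightarrow> \<alpha>2 x = - \<kappa> * snd x"
  unfolding \<alpha>1_def \<alpha>2_def by (simp_all add: coefficients)

lemma a: "x \<in> punctured_plane \<Longrightarrow> a1 x = \<kappa> * fst x" "x \<in> punctured_plane \<Longrightarrow> a2 x = - \<kappa> * snd x"
  unfolding a1_def a2_def by (simp_all add: g Delta alpha)

lemma h2: "x \<in> punctured_plane \<Longrightarrow> h2 x = \<kappa>\<^sup>2 * ((fst x)\<^sup>2 + (snd x)\<^sup>2)"
  unfolding h2_def by (simp add: g Delta alpha power_mult_distrib distrib_left)

lemma radius_pos: "x \<in> punctured_plane \<Longrightarrow> (fst x)\<^sup>2 + (snd x)\<^sup>2 > 0"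
  by (cases x) (simp add: sum_power2_gt_zero_iff)

text \<open>By \<open>h2\<close> the length of \<open>H\<close> is \<kappa> times the distance from
  the origin, which is why the origin is removed.\<close>

lemma mean_curvature_nonzero: "x \<in> punctured_plane \<Longrightarrow> H x \<noteq> 0"
proof
  assume x: "x \<in> punctured_plane" and "H x = 0"
  then have "h2 x = 0" using mean_curvature_norm[OF x] by (simp add: csf_herm_flat herm_def)
  then show False using radius_pos[OF x] kappa_pos by (simp add: h2[OF x])
qed

text \<open>The Gauss equation with \<open>\<epsilon> = 0\<close>: the mixed second fundamental form
  vanishes, and the two pure ones are multiples of the Hermitian orthogonal vectors
  \<open>J f1\<close> and \<open>J f2\<close>.\<close>

lemma flat: "x \<in> punctured_plane \<Longrightarrow> gaussian_curvature G x = 0"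
  using gauss_equation[of x]
  by (simp add: Delta second_fundamental_form_frame T1_def T2_def coefficients csf_herm_flat frame herm_def sum_2)

lemma mean_curvature_gradient:
  assumes x: "x \<in> punctured_plane"
  shows "grad_mean_curvature_length (csf_metric 0) f x = \<kappa>"
proof -
  define l where "l x = \<kappa> * sqrt ((fst x)\<^sup>2 + (snd x)\<^sup>2)" for x :: "real \<times> real"
  let ?l = "mean_curvature_length (csf_metric 0) f"
  define r where "r = sqrt ((fst x)\<^sup>2 + (snd x)\<^sup>2)"
  have r: "r > 0" "r\<^sup>2 = (fst x)\<^sup>2 + (snd x)\<^sup>2" using radius_pos[OF x] by (simp_all add: r_def)
  have l: "?l y = l y" if "y \<in> punctured_plane" for y
    using kappa_pos by (simp add: mean_curvature_length_eq[OF that] h2[OF that] l_def real_sqrt_mult)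
  have "(l has_derivative (\<lambda>v. \<kappa> * (fst x * fst v + snd x * snd v) / r)) (at x)"
    unfolding l_def using radius_pos[OF x]
    by (auto intro!: derivative_eq_intros simp: r_def fun_eq_iff) (simp add: field_simps)
  then have dl: "(?l has_derivative (\<lambda>v. \<kappa> * (fst x * fst v + snd x * snd v) / r)) (at x)"
    using has_derivative_cong_open[OF open_plane x l] by simp
  have "(metric_norm G x (gradient G ?l x))\<^sup>2 = (\<kappa> * fst x / r)\<^sup>2 + (\<kappa> * snd x / r)\<^sup>2"
    unfolding grad_norm_eq[OF x differentiableI[OF dl]] D_eqI[OF dl] by (simp add: g[OF x] Delta[OF x] add.commute)
  also have "\<dots> = \<kappa>\<^sup>2 * ((fst x)\<^sup>2 + (snd x)\<^sup>2) / r\<^sup>2"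
    by (simp add: power_divide power_mult_distrib add_divide_distrib distrib_left)
  also have "\<dots> = \<kappa>\<^sup>2" unfolding r(2)[symmetric] using r(1) by simp
  finally have "(metric_norm G x (gradient G ?l x))\<^sup>2 = \<kappa>\<^sup>2" .
  moreover have "metric_norm G x v \<ge> 0" for v
    by (simp add: metric_norm_def induced_metric_eq[OF x] g[OF x])
  ultimately show ?thesis
    unfolding grad_mean_curvature_length_def using kappa_pos by (metis less_imp_le power2_eq_imp_eq)
qed

text \<open>The field \<open>(\<kappa> x, - \<kappa> y)\<close> is the vector dual to \<alpha> for
  the model, and it is divergence free.\<close>

lemma coclosed_integral:
  assumes u: "smooth_on punctured_plane u" and C: "compact C" "C \<subseteq> punctured_plane" "\<And>x. x \<in> punctured_plane - C \<Longrightarrow> u x = 0"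
  shows "(LINT x:C|lborel. \<kappa> * fst x * d1 u x + (- \<kappa> * snd x) * d2 u x) = 0"
proof -
  let ?Y1 = "\<lambda>x::real \<times> real. \<kappa> * fst x" and ?Y2 = "\<lambda>x::real \<times> real. - \<kappa> * snd x"
  have s: "smooth_on punctured_plane ?Y1" "smooth_on punctured_plane ?Y2"
    by (intro smooth_intros open_plane)+
  have "(?Y1 has_derivative (\<lambda>v. \<kappa> * fst v)) (at x)" "(?Y2 has_derivative (\<lambda>v. - \<kappa> * snd v)) (at x)" for x
    by (auto intro!: derivative_eq_intros)
  from D_eqI[OF this(1)] D_eqI[OF this(2)] have "d1 ?Y1 x + d2 ?Y2 x = 0" for x by simp
  then show ?thesis using divergence_form[OF u s C] by simp
qed

end

section \<open>The model as a global surface with one chart\<close>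

abbreviation "plane_chart \<equiv> (punctured_plane, id :: real \<times> real \<Rightarrow> real \<times> real)"
abbreviation "affine_chart \<equiv> (range Affine, affine_coord)"

lemma csf_charts_flat: "csf_charts 0 = {affine_chart}"
  by (simp add: csf_charts_def)

lemma inv_into_id: "x \<in> S \<Longrightarrow> inv_into S id x = x"
  using inv_into_f_f[of id S x] by simp

lemma everywhere_model:
  assumes "\<And>x. x \<in> punctured_plane \<Longrightarrow> Q (local_rep plane_chart affine_chart F) x"
  shows "everywhere 0 {plane_chart} F Q"
  using assms unfolding everywhere_def csf_charts_flat by simp

lemma smooth_surface_plane: "smooth_surface punctured_plane {plane_chart}"
proof -
  have o: "open punctured_plane" by (rule open_delete[OF open_UNIV])
  have "homeomorphism punctured_plane punctured_plane id (inv_into punctured_plane id)"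
  proof (rule homeomorphismI)
    show "continuous_on punctured_plane (inv_into punctured_plane (id :: real \<times> real \<Rightarrow> real \<times> real))"
      by (subst continuous_on_cong[OF refl inv_into_id]) simp_all
  qed (auto simp: inv_into_id)
  moreover have "smooth_on punctured_plane (id \<circ> inv_into punctured_plane id)"
    by (subst smooth_on_cong[where g = "\<lambda>x. x"]) (simp_all add: inv_into_id smooth_on_id[OF o])
  moreover have "(1, 0) \<in> punctured_plane" by simp
  then have "punctured_plane \<noteq> {}" by blast
  ultimately show ?thesis using o unfolding smooth_surface_def by simp
qed

lemma model_patch_local_rep: "\<kappa> > 0 \<Longrightarrow> model_patch \<kappa> (local_rep plane_chart affine_chart (Affine \<circ> F_map \<kappa>))"
  by unfold_locales (simp_all add: local_rep_def inv_into_id)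

lemma lagrangian_immersion_model:
  assumes "\<kappa> > 0"
  shows "lagrangian_immersion 0 punctured_plane {plane_chart} (Affine \<circ> F_map \<kappa>)"
proof -
  interpret model_patch \<kappa> "local_rep plane_chart affine_chart (Affine \<circ> F_map \<kappa>)"
    by (rule model_patch_local_rep[OF assms])
  have v: "(Affine \<circ> F_map \<kappa>) -` range Affine = UNIV" by auto
  show ?thesis
    unfolding lagrangian_immersion_def smooth_into_csf_def csf_charts_flat
    by (intro conjI everywhere_model allI) (use smooth immersion lagrangian in \<open>auto simp: v\<close>)
qed

text \<open>\<open>has_area\<close> allows any cutting into Borel pieces. With one chart on either
  side all pieces are integrated against the same density, and additivity gives one integral;
  continuity on the compact set \<open>C\<close> provides integrability.\<close>

lemma area_plane:
  assumes a: "has_area 0 {plane_chart} \<Phi> C a" and C: "compact C" "C \<subseteq> punctured_plane"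
    and s: "smooth_on punctured_plane (local_rep plane_chart affine_chart \<Phi>)"
  shows "a = (LINT x:C|lborel. sqrt (gram (induced_metric (csf_metric 0) (local_rep plane_chart affine_chart \<Phi>)) x))"
proof -
  let ?I = "\<lambda>x. sqrt (gram (induced_metric (csf_metric 0) (local_rep plane_chart affine_chart \<Phi>)) x)"
  obtain N :: nat and B c d where *: "disjoint_family_on B {..<N} \<and> (\<Union>i<N. B i) = C \<and>
     (\<forall>i<N. c i \<in> {plane_chart} \<and> d i \<in> {affine_chart} \<and> B i \<subseteq> fst (c i) \<inter> \<Phi> -` fst (d i) \<and> snd (c i) ` B i \<in> sets borel) \<and>
     a = (\<Sum>i<N. LINT x:snd (c i) ` B i|lborel. sqrt (gram (induced_metric (csf_metric 0) (local_rep (c i) (d i) \<Phi>)) x))"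
    using a unfolding has_area_def csf_charts_flat by blast
  then have B: "disjoint_family_on B {..<N}" "(\<Union>i<N. B i) = C"
    and a': "a = (\<Sum>i<N. LINT x:snd (c i) ` B i|lborel. sqrt (gram (induced_metric (csf_metric 0) (local_rep (c i) (d i) \<Phi>)) x))"
    by simp_all
  have B': "c i = plane_chart \<and> d i = affine_chart \<and> snd (c i) ` B i \<in> sets borel" if "i < N" for i
    using * that by blast
  have "continuous_on punctured_plane ?I"
    unfolding gram_def induced_metric_def csf_metric_def
    by (simp del: split_paired_All) (intro continuous_intros smooth_on_continuous_on[OF smooth_on_herm] smooth_intros s)
  then have i: "set_integrable lborel C ?I"
    by (intro set_integrable_continuous_compact[OF C(1)] continuous_on_subset[OF _ C(2)])
  have Bs: "B i \<in> sets lborel" if "i < N" for i using B'[OF that] by auto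
  have "a = (\<Sum>i<N. LINT x:B i|lborel. ?I x)"
    unfolding a' by (rule sum.cong[OF refl]) (use B' in simp)
  also have "\<dots> = (LINT x:(\<Union>i<N. B i)|lborel. ?I x)"
    using B Bs by (intro set_integral_finite_Union[symmetric] set_integrable_subset[OF i]) auto
  finally show ?thesis unfolding B(2) .
qed

text \<open>The variation is arbitrary, and the set \<open>C\<close> outside of which it is trivial
  may fail to contain the support \<open>Cu\<close> of \<open>u\<close>. Off \<open>C\<close> the
  field \<open>J grad u\<close> is zero, hence so is \<open>du\<close>, and the integral can be
  taken over \<open>C \<union> Cu\<close>, where \<open>coclosed_integral\<close> applies.\<close>

lemma stationary_model:
  assumes \<kappa>: "\<kappa> > 0"
    and var: "hamiltonian_variation 0 punctured_plane {plane_chart} (Affine \<circ> F_map \<kappa>) C \<delta> \<Phi>"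
    and area: "\<And>t. \<bar>t\<bar> < \<delta> \<Longrightarrow> has_area 0 {plane_chart} (\<Phi> t) C (a t)"
  shows "(a has_real_derivative 0) (at 0)"
proof -
  let ?F = "Affine \<circ> F_map \<kappa>"
  let ?f = "local_rep plane_chart affine_chart ?F"
  interpret model_patch \<kappa> ?f by (rule model_patch_local_rep[OF \<kappa>])
  have "variation 0 punctured_plane {plane_chart} ?F C \<delta> \<Phi>"
    using var unfolding hamiltonian_variation_def by blast
  then have \<delta>: "\<delta> > 0" and C: "compact C" "C \<subseteq> punctured_plane"
    and init: "\<And>p. p \<in> punctured_plane \<Longrightarrow> \<Phi> 0 p = ?F p"
    and out: "\<And>t p. \<bar>t\<bar> < \<delta> \<Longrightarrow> p \<in> punctured_plane - C \<Longrightarrow> \<Phi> t p = ?F p"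
    and dom: "\<And>t p. \<bar>t\<bar> < \<delta> \<Longrightarrow> p \<in> punctured_plane \<Longrightarrow> \<Phi> t p \<in> range Affine"
    and sv: "smooth_on {(t, x). \<bar>t\<bar> < \<delta> \<and> x \<in> id ` punctured_plane \<and> \<Phi> t (inv_into punctured_plane id x) \<in> range Affine}
                  (\<lambda>(t, x). local_rep plane_chart affine_chart (\<Phi> t) x)"
    unfolding variation_def csf_charts_flat by (simp_all add: image_subset_iff)
  obtain u where u: "compactly_supported_smooth punctured_plane {plane_chart} u"
    and field: "\<forall>p\<in>punctured_plane. vector_derivative (\<lambda>t. affine_coord (\<Phi> t p)) (at 0) =
        J (D ?f p (gradient G (u \<circ> inv_into punctured_plane id) p))"
    using var unfolding hamiltonian_variation_def csf_charts_flat Let_def by auto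
  define w where "w = u \<circ> inv_into punctured_plane id"
  from u obtain Cu where Cu: "compact Cu" "Cu \<subseteq> punctured_plane" "\<And>p. p \<in> punctured_plane - Cu \<Longrightarrow> u p = 0"
    unfolding compactly_supported_smooth_def by blast
  have sw: "smooth_on punctured_plane w" using u unfolding compactly_supported_smooth_def w_def by simp
  have w0: "w p = 0" if "p \<in> punctured_plane - Cu" for p using Cu(3)[OF that] that by (simp add: w_def inv_into_id)
  define \<phi> where "\<phi> z = local_rep plane_chart affine_chart (\<Phi> (fst z)) (snd z)" for z :: "real \<times> real \<times> real"
  define W where "W = {z :: real \<times> real \<times> real. \<bar>fst z\<bar> < \<delta> \<and> snd z \<in> punctured_plane}"
  have We: "{(t, x). \<bar>t\<bar> < \<delta> \<and> x \<in> id ` punctured_plane \<and> \<Phi> t (inv_into punctured_plane id x) \<in> range Affine} = W"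
    using dom by (fastforce simp: W_def inv_into_id)
  have s\<phi>: "smooth_on W \<phi>" using sv[unfolded We] unfolding case_prod_beta' \<phi>_def[abs_def] .
  have \<phi>x: "\<phi> (t, x) = affine_coord (\<Phi> t x)" if "x \<in> punctured_plane" for t x
    using that by (simp add: \<phi>_def local_rep_def inv_into_id)
  have W0: "(t, x) \<in> W" if "\<bar>t\<bar> < \<delta>" "x \<in> punctured_plane" for t x using that by (simp add: W_def)
  have fld: "D \<phi> (0, x) (1, 0) = J (D ?f x (gradient G w x))" if x: "x \<in> punctured_plane" for x
  proof -
    have z: "(0, x) \<in> W" using W0 x \<delta> by simp
    have 1: "((\<lambda>t. (t, x)) has_derivative (\<lambda>h. (h, 0))) (at 0)" by (auto intro!: derivative_eq_intros)
    have pt: "D \<phi> (0, x) (h, 0) = h *\<^sub>R D \<phi> (0, x) (1, 0)" for h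
      using linear_scale[OF linear_D[OF s\<phi> z], of h "(1, 0)"] by simp
    have scale: "(\<lambda>h. h *\<^sub>R D \<phi> (0, x) (1, 0)) = (\<lambda>h. D \<phi> (0, x) (h, 0))" by (rule ext) (rule pt[symmetric])
    have "((\<lambda>t. \<phi> (t, x)) has_vector_derivative D \<phi> (0, x) (1, 0)) (at 0)"
      unfolding has_vector_derivative_def scale
      by (rule has_derivative_compose[OF 1 smooth_on_has_derivative[OF s\<phi> z]])
    then have "vector_derivative (\<lambda>t. affine_coord (\<Phi> t x)) (at 0) = D \<phi> (0, x) (1, 0)"
      unfolding \<phi>x[OF x] by (rule vector_derivative_at)
    then show ?thesis using field x by (simp add: w_def)
  qed
  have fv: "((\<lambda>t. LINT x:C|lborel. sqrt (gram (induced_metric (csf_metric 0) (\<lambda>x. \<phi> (t, x))) x)) has_real_derivative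
     - 2 * (LINT x:C|lborel. sqrt (\<Delta> x) * a1 x * d1 w x + sqrt (\<Delta> x) * a2 x * d2 w x)) (at 0)"
    by (rule first_variation[OF s\<phi> _ C _ _ sw fld])
      (use W0 \<delta> in \<open>simp_all add: csf_domain_def \<phi>x init local_rep_def inv_into_id\<close>)
  have ev: "eventually (\<lambda>t. (LINT x:C|lborel. sqrt (gram (induced_metric (csf_metric 0) (\<lambda>x. \<phi> (t, x))) x)) = a t) (nhds 0)"
  proof -
    have "(LINT x:C|lborel. sqrt (gram (induced_metric (csf_metric 0) (\<lambda>x. \<phi> (t, x))) x)) = a t" if t: "\<bar>t\<bar> < \<delta>" for t
    proof -
      have "smooth_on punctured_plane (\<lambda>x. \<phi> (t, x))"
        by (rule smooth_on_compose[OF s\<phi>]) (use W0[OF t] in \<open>auto intro!: smooth_intros open_plane\<close>)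
      then show ?thesis using area_plane[OF area[OF t] C] by (simp add: \<phi>_def)
    qed
    then show ?thesis using \<delta> by (intro eventually_nhds_metric[THEN iffD2] exI[of _ \<delta>]) (simp add: dist_real_def)
  qed
  have "(LINT x:C|lborel. sqrt (\<Delta> x) * a1 x * d1 w x + sqrt (\<Delta> x) * a2 x * d2 w x)
    = (LINT x:C \<union> Cu|lborel. \<kappa> * fst x * d1 w x + (- \<kappa> * snd x) * d2 w x)"
    unfolding set_lebesgue_integral_def
  proof (rule Bochner_Integration.integral_cong[OF refl])
    fix x :: "real \<times> real"
    have D0: "D w x v = 0" if x: "x \<in> punctured_plane - C" for v
    proof -
      have xp: "x \<in> punctured_plane" using x by blast
      have "((\<lambda>t. affine_coord (\<Phi> t x)) has_vector_derivative 0) (at 0)"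
      proof (rule has_vector_derivative_transform_within_open[where f = "\<lambda>t. F_map \<kappa> x" and S = "{-\<delta><..<\<delta>}"])
        show "F_map \<kappa> x = affine_coord (\<Phi> t x)" if "t \<in> {-\<delta><..<\<delta>}" for t
          using out[of t x] that x by (simp add: abs_less_iff)
      qed (use \<delta> in auto)
      from vector_derivative_at[OF this] have "J (D ?f x (gradient G w x)) = 0"
        using bspec[OF field xp] by (simp add: w_def)
      then have "D ?f x (gradient G w x) = 0" by simp
      then have "gradient G w x = 0"
        using immersion[OF xp] linear_0[OF linear_D[OF smooth xp]] by (metis injD)
      moreover have "G x 0 v = 0" by (simp add: induced_metric_eq[OF xp])
      ultimately show ?thesis using gradient_property[OF xp smooth_on_differentiable[OF sw xp], of v] by simp
    qed
    show "indicator C x *\<^sub>R (sqrt (\<Delta> x) * a1 x * d1 w x + sqrt (\<Delta> x) * a2 x * d2 w x)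
      = indicator (C \<union> Cu) x *\<^sub>R (\<kappa> * fst x * d1 w x + (- \<kappa> * snd x) * d2 w x)"
    proof (cases "x \<in> C")
      case True
      then have "x \<in> punctured_plane" using C(2) by blast
      then show ?thesis using True by (simp only: Delta a) simp
    next
      case False
      show ?thesis
      proof (cases "x \<in> Cu")
        case True
        then have "x \<in> punctured_plane - C" using False Cu(2) by blast
        from D0[OF this] show ?thesis using False by (simp only:) simp
      qed (use False in simp)
    qed
  qed
  also have "\<dots> = 0"
    by (rule coclosed_integral[OF sw compact_Un[OF C(1) Cu(1)]]) (use C Cu w0 in auto)
  finally have "((\<lambda>t. LINT x:C|lborel. sqrt (gram (induced_metric (csf_metric 0) (\<lambda>x. \<phi> (t, x))) x)) has_real_derivative 0) (at 0)"
    using fv by simp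
  then show ?thesis by (rule DERIV_cong_ev[OF refl ev refl, THEN iffD1])
qed

theorem theorem1p1:
  shows
    "(\<forall>(\<epsilon>::real) (S::'m::{t2_space,second_countable_topology} set) A F (K::real) (\<kappa>::real).
        hamiltonian_stationary_lagrangian_surface \<epsilon> S A F \<and>
        everywhere \<epsilon> A F (\<lambda>f x. mean_curvature (csf_metric \<epsilon>) f x \<noteq> 0) \<and>
        everywhere \<epsilon> A F (\<lambda>f x. gaussian_curvature (induced_metric (csf_metric \<epsilon>) f) x = K) \<and>
        \<kappa> > 0 \<and>
        everywhere \<epsilon> A F (\<lambda>f x. grad_mean_curvature_length (csf_metric \<epsilon>) f x = \<kappa>)
        \<longrightarrow> K = 0 \<and> \<epsilon> = 0 \<and> locally_congruent_to_model S A F \<kappa>)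
     \<and>
     (\<forall>\<kappa>::real. \<kappa> > 0 \<longrightarrow>
        (let A = {(punctured_plane, id)}; F = Affine \<circ> F_map \<kappa> in
         hamiltonian_stationary_lagrangian_surface 0 punctured_plane A F \<and>
         everywhere 0 A F (\<lambda>f x. mean_curvature (csf_metric 0) f x \<noteq> 0) \<and>
         (\<exists>K. everywhere 0 A F (\<lambda>f x. gaussian_curvature (induced_metric (csf_metric 0) f) x = K)) \<and>
         (\<exists>c>0. everywhere 0 A F (\<lambda>f x. grad_mean_curvature_length (csf_metric 0) f x = c))))"
proof (intro conjI allI impI)
  fix \<epsilon> :: real and S :: "'m set" and A F and K \<kappa> :: real
  assume *: "hamiltonian_stationary_lagrangian_surface \<epsilon> S A F \<and>
        everywhere \<epsilon> A F (\<lambda>f x. mean_curvature (csf_metric \<epsilon>) f x \<noteq> 0) \<and>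
        everywhere \<epsilon> A F (\<lambda>f x. gaussian_curvature (induced_metric (csf_metric \<epsilon>) f) x = K) \<and>
        \<kappa> > 0 \<and>
        everywhere \<epsilon> A F (\<lambda>f x. grad_mean_curvature_length (csf_metric \<epsilon>) f x = \<kappa>)"
  then interpret lagrangian_surface \<epsilon> S A F
    unfolding hamiltonian_stationary_lagrangian_surface_def by unfold_locales blast+
  have "K = 0 \<and> \<epsilon> = 0 \<and> locally_congruent_to_model S A F \<kappa>"
    by (rule constant_patches_congruent, rule constant_patch) (use * in blast)+
  then show "K = 0" "\<epsilon> = 0" "locally_congruent_to_model S A F \<kappa>" by blast+
next
  fix \<kappa> :: real assume \<kappa>: "\<kappa> > 0"
  interpret model_patch \<kappa> "local_rep plane_chart affine_chart (Affine \<circ> F_map \<kappa>)"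
    by (rule model_patch_local_rep[OF \<kappa>])
  have "hamiltonian_stationary_lagrangian_surface 0 punctured_plane {plane_chart} (Affine \<circ> F_map \<kappa>)"
    unfolding hamiltonian_stationary_lagrangian_surface_def
    using smooth_surface_plane lagrangian_immersion_model[OF \<kappa>] stationary_model[OF \<kappa>] by blast
  moreover have "everywhere 0 {plane_chart} (Affine \<circ> F_map \<kappa>) (\<lambda>f x. mean_curvature (csf_metric 0) f x \<noteq> 0)"
    by (rule everywhere_model) (rule mean_curvature_nonzero)
  moreover have "everywhere 0 {plane_chart} (Affine \<circ> F_map \<kappa>) (\<lambda>f x. gaussian_curvature (induced_metric (csf_metric 0) f) x = 0)"
    by (rule everywhere_model) (rule flat)
  moreover have "everywhere 0 {plane_chart} (Affine \<circ> F_map \<kappa>) (\<lambda>f x. grad_mean_curvature_length (csf_metric 0) f x = \<kappa>)"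
    by (rule everywhere_model) (rule mean_curvature_gradient)
  ultimately show "let A = {(punctured_plane, id)}; F = Affine \<circ> F_map \<kappa> in
         hamiltonian_stationary_lagrangian_surface 0 punctured_plane A F \<and>
         everywhere 0 A F (\<lambda>f x. mean_curvature (csf_metric 0) f x \<noteq> 0) \<and>
         (\<exists>K. everywhere 0 A F (\<lambda>f x. gaussian_curvature (induced_metric (csf_metric 0) f) x = K)) \<and>
         (\<exists>c>0. everywhere 0 A F (\<lambda>f x. grad_mean_curvature_length (csf_metric 0) f x = c))"
    unfolding Let_def using \<kappa> by blast
qed

end
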